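(* Let $\mathfrak g$ be a subalgebra of $\mathfrak{gl}(V,V_* )$. Then every Levi component of $\mathfrak g$ is a maximal locally semisimple subalgebra of $\mathfrak g$, and any two Levi components of $\mathfrak g$ are isomorphic.
   Context: $V,V_*$: countable-dimensional complex vector spaces with a nondegenerate pairing; $\mathfrak{gl}(V,V_* )$ is the Lie algebra of the associative algebra $V\otimes V_*$ with $(v\otimes w)(v'\otimes w')=\langle v',w\rangle v\otimes w'$. The locally solvable radical $\mathfrak r$ of $\mathfrak g$ is its largest locally solvable ideal. A subalgebra $\mathfrak l\subset\mathfrak g$ is a Levi component if $[\mathfrak g,\mathfrak g]$ is the vector space direct sum of the ideal $\mathfrak r\cap[\mathfrak g,\mathfrak g]$ and the subalgebra $\mathfrak l$. A Lie algebra is locally semisimple if it is a union of nested finite-dimensional semisimple subalgebras. *)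

theory Defs
  imports Complex_Main "HOL-Library.Countable_Set"
begin

text \<open>Complex vector spaces are modelled via the locale vector_space with an explicit
scalar multiplication sc :: complex => 'v => 'v.  Elements of gl(V,V_*) are realised as
the finite-rank operators x |-> sum_i <x,w_i> v_i on V (the faithful image of V (x) V_*
under v (x) w |-> (x |-> <x,w> v); the associative product becomes composition).\<close>

definition count_inf_dim :: "(complex \<Rightarrow> 'v::ab_group_add \<Rightarrow> 'v) \<Rightarrow> bool" where
  "count_inf_dim sc \<longleftrightarrow> (\<exists>B. countable B \<and> infinite B \<and> \<not> module.dependent sc B
      \<and> module.span sc B = UNIV)"

definition nondeg_pairing ::
  "(complex \<Rightarrow> 'v::ab_group_add \<Rightarrow> 'v) \<Rightarrow> (complex \<Rightarrow> 'w::ab_group_add \<Rightarrow> 'w)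
   \<Rightarrow> ('v \<Rightarrow> 'w \<Rightarrow> complex) \<Rightarrow> bool" where
  "nondeg_pairing scV scW p \<longleftrightarrow>
     (\<forall>v v' w. p (v + v') w = p v w + p v' w) \<and>
     (\<forall>c v w. p (scV c v) w = c * p v w) \<and>
     (\<forall>v w w'. p v (w + w') = p v w + p v w') \<and>
     (\<forall>c v w. p v (scW c w) = c * p v w) \<and>
     (\<forall>v. (\<forall>w. p v w = 0) \<longrightarrow> v = 0) \<and>
     (\<forall>w. (\<forall>v. p v w = 0) \<longrightarrow> w = 0)"

definition glVV :: "(complex \<Rightarrow> 'v::ab_group_add \<Rightarrow> 'v) \<Rightarrow> ('v \<Rightarrow> 'w \<Rightarrow> complex)
   \<Rightarrow> ('v \<Rightarrow> 'v) set" where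
  "glVV scV p = {f. \<exists>(n::nat) (vs::nat \<Rightarrow> 'v) (ws::nat \<Rightarrow> 'w).
      f = (\<lambda>x. \<Sum>i<n. scV (p x (ws i)) (vs i))}"

definition opzero :: "'v::ab_group_add \<Rightarrow> 'v" where "opzero = (\<lambda>x. 0)"
definition opadd :: "('v::ab_group_add \<Rightarrow> 'v) \<Rightarrow> ('v \<Rightarrow> 'v) \<Rightarrow> 'v \<Rightarrow> 'v" where
  "opadd f g = (\<lambda>x. f x + g x)"
definition opsc :: "(complex \<Rightarrow> 'v::ab_group_add \<Rightarrow> 'v) \<Rightarrow> complex \<Rightarrow> ('v \<Rightarrow> 'v) \<Rightarrow> 'v \<Rightarrow> 'v" where
  "opsc sc c f = (\<lambda>x. sc c (f x))"
definition lbr :: "('v::ab_group_add \<Rightarrow> 'v) \<Rightarrow> ('v \<Rightarrow> 'v) \<Rightarrow> 'v \<Rightarrow> 'v" where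
  "lbr f g = (\<lambda>x. f (g x) - g (f x))"

definition lsubspace :: "(complex \<Rightarrow> 'v::ab_group_add \<Rightarrow> 'v) \<Rightarrow> ('v \<Rightarrow> 'v) set \<Rightarrow> bool" where
  "lsubspace sc A \<longleftrightarrow> opzero \<in> A \<and> (\<forall>f\<in>A. \<forall>g\<in>A. opadd f g \<in> A)
      \<and> (\<forall>c. \<forall>f\<in>A. opsc sc c f \<in> A)"

definition lspan :: "(complex \<Rightarrow> 'v::ab_group_add \<Rightarrow> 'v) \<Rightarrow> ('v \<Rightarrow> 'v) set \<Rightarrow> ('v \<Rightarrow> 'v) set" where
  "lspan sc S = \<Inter>{A. lsubspace sc A \<and> S \<subseteq> A}"

definition lie_subalg :: "(complex \<Rightarrow> 'v::ab_group_add \<Rightarrow> 'v) \<Rightarrow> ('v \<Rightarrow> 'v) set \<Rightarrow> bool" where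
  "lie_subalg sc A \<longleftrightarrow> lsubspace sc A \<and> (\<forall>f\<in>A. \<forall>g\<in>A. lbr f g \<in> A)"

definition lie_ideal :: "(complex \<Rightarrow> 'v::ab_group_add \<Rightarrow> 'v) \<Rightarrow> ('v \<Rightarrow> 'v) set \<Rightarrow> ('v \<Rightarrow> 'v) set \<Rightarrow> bool" where
  "lie_ideal sc L I \<longleftrightarrow> lsubspace sc I \<and> I \<subseteq> L \<and> (\<forall>x\<in>L. \<forall>y\<in>I. lbr x y \<in> I)"

definition brk :: "(complex \<Rightarrow> 'v::ab_group_add \<Rightarrow> 'v) \<Rightarrow> ('v \<Rightarrow> 'v) set \<Rightarrow> ('v \<Rightarrow> 'v) set \<Rightarrow> ('v \<Rightarrow> 'v) set" where
  "brk sc A B = lspan sc {lbr a b | a b. a \<in> A \<and> b \<in> B}"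

primrec derived :: "(complex \<Rightarrow> 'v::ab_group_add \<Rightarrow> 'v) \<Rightarrow> ('v \<Rightarrow> 'v) set \<Rightarrow> nat \<Rightarrow> ('v \<Rightarrow> 'v) set" where
  "derived sc A 0 = A"
| "derived sc A (Suc n) = brk sc (derived sc A n) (derived sc A n)"

definition solvable :: "(complex \<Rightarrow> 'v::ab_group_add \<Rightarrow> 'v) \<Rightarrow> ('v \<Rightarrow> 'v) set \<Rightarrow> bool" where
  "solvable sc A \<longleftrightarrow> (\<exists>n. derived sc A n = {opzero})"

definition gen_subalg :: "(complex \<Rightarrow> 'v::ab_group_add \<Rightarrow> 'v) \<Rightarrow> ('v \<Rightarrow> 'v) set \<Rightarrow> ('v \<Rightarrow> 'v) set" where
  "gen_subalg sc S = \<Inter>{A. lie_subalg sc A \<and> S \<subseteq> A}"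

definition loc_solvable :: "(complex \<Rightarrow> 'v::ab_group_add \<Rightarrow> 'v) \<Rightarrow> ('v \<Rightarrow> 'v) set \<Rightarrow> bool" where
  "loc_solvable sc L \<longleftrightarrow> (\<forall>S. finite S \<and> S \<subseteq> L \<longrightarrow> solvable sc (gen_subalg sc S))"

definition fin_dim :: "(complex \<Rightarrow> 'v::ab_group_add \<Rightarrow> 'v) \<Rightarrow> ('v \<Rightarrow> 'v) set \<Rightarrow> bool" where
  "fin_dim sc A \<longleftrightarrow> (\<exists>S. finite S \<and> A = lspan sc S)"

definition fd_semisimple :: "(complex \<Rightarrow> 'v::ab_group_add \<Rightarrow> 'v) \<Rightarrow> ('v \<Rightarrow> 'v) set \<Rightarrow> bool" where
  "fd_semisimple sc A \<longleftrightarrow> lie_subalg sc A \<and> fin_dim sc A \<and>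
     (\<forall>I. lie_ideal sc A I \<and> solvable sc I \<longrightarrow> I = {opzero})"

definition loc_semisimple :: "(complex \<Rightarrow> 'v::ab_group_add \<Rightarrow> 'v) \<Rightarrow> ('v \<Rightarrow> 'v) set \<Rightarrow> bool" where
  "loc_semisimple sc L \<longleftrightarrow> (\<exists>F :: nat \<Rightarrow> ('v \<Rightarrow> 'v) set.
      (\<forall>n. F n \<subseteq> F (Suc n)) \<and> (\<forall>n. fd_semisimple sc (F n)) \<and> L = \<Union>(range F))"

definition loc_solv_radical :: "(complex \<Rightarrow> 'v::ab_group_add \<Rightarrow> 'v) \<Rightarrow> ('v \<Rightarrow> 'v) set \<Rightarrow> ('v \<Rightarrow> 'v) set \<Rightarrow> bool" where
  "loc_solv_radical sc L R \<longleftrightarrow> lie_ideal sc L R \<and> loc_solvable sc R \<and>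
     (\<forall>I. lie_ideal sc L I \<and> loc_solvable sc I \<longrightarrow> I \<subseteq> R)"

definition levi_component :: "(complex \<Rightarrow> 'v::ab_group_add \<Rightarrow> 'v) \<Rightarrow> ('v \<Rightarrow> 'v) set \<Rightarrow> ('v \<Rightarrow> 'v) set \<Rightarrow> bool" where
  "levi_component sc L M \<longleftrightarrow> lie_subalg sc M \<and> M \<subseteq> L \<and>
     (\<exists>R. loc_solv_radical sc L R \<and>
        {opadd r m | r m. r \<in> R \<inter> brk sc L L \<and> m \<in> M} = brk sc L L \<and>
        R \<inter> brk sc L L \<inter> M = {opzero})"

definition max_loc_semisimple :: "(complex \<Rightarrow> 'v::ab_group_add \<Rightarrow> 'v) \<Rightarrow> ('v \<Rightarrow> 'v) set \<Rightarrow> ('v \<Rightarrow> 'v) set \<Rightarrow> bool" where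
  "max_loc_semisimple sc L M \<longleftrightarrow> M \<subseteq> L \<and> lie_subalg sc M \<and> loc_semisimple sc M \<and>
     (\<forall>N. N \<subseteq> L \<and> lie_subalg sc N \<and> loc_semisimple sc N \<and> M \<subseteq> N \<longrightarrow> N = M)"

definition lie_isomorphic :: "(complex \<Rightarrow> 'v::ab_group_add \<Rightarrow> 'v) \<Rightarrow> ('v \<Rightarrow> 'v) set \<Rightarrow> ('v \<Rightarrow> 'v) set \<Rightarrow> bool" where
  "lie_isomorphic sc A B \<longleftrightarrow> (\<exists>\<phi>. bij_betw \<phi> A B \<and>
     (\<forall>x\<in>A. \<forall>y\<in>A. \<phi> (opadd x y) = opadd (\<phi> x) (\<phi> y) \<and> \<phi> (lbr x y) = lbr (\<phi> x) (\<phi> y)) \<and>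
     (\<forall>c. \<forall>x\<in>A. \<phi> (opsc sc c x) = opsc sc c (\<phi> x)))"

end

theory Submission
  imports Defs "HOL-Computational_Algebra.Polynomial" "HOL-Computational_Algebra.Fundamental_Theorem_Algebra"
    "HOL-Library.Product_Plus"
begin

text \<open>An element \<open>x\<close> of \<open>gl(V,V\<^sub>*)\<close> acts on \<open>V \<oplus> V\<^sub>*\<close> by \<open>x \<oplus> - x\<^sup>T\<close>, a finite-rank operator that is skew for
  the canonical symmetric form. Let \<open>A\<close> be the associative algebra of operators generated by \<open>g\<close> and
  \<open>N\<close> the radical of the trace form on \<open>A\<close>. Cartan's criterion, applied in finitely generated
  subalgebras, shows that the locally solvable radical and \<open>N\<close> meet \<open>[g,g]\<close> in the same ideal, so a
  Levi component embeds into \<open>A/N\<close> with image \<open>[m,m]\<close>, where \<open>m\<close> is the image of \<open>g\<close>. The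
  algebra \<open>A/N\<close> has a non-degenerate trace form and an involution for which \<open>m\<close> is skew, and it is
  generated by \<open>m\<close>. This forces \<open>m\<close> to contain almost all skew elements of each finitely generated
  one-sided ideal. Cutting down by self-adjoint idempotents that are units for given finite
  sets produces finite-dimensional subalgebras of \<open>m\<close> with semisimple derived algebras, hence an
  exhaustion of the Levi component. A locally semisimple algebra is perfect and meets the
  locally solvable radical trivially, which gives maximality; two Levi components project
  bijectively onto the same quotient of \<open>[g,g]\<close>.\<close>

section \<open>Linear algebra\<close>

text \<open>The radical of a finitely generated subalgebra of \<open>g\<close> can be much larger
  than its intersection with the radical of \<open>g\<close>, so an exhaustion cannot be collected
  from finite-dimensional Levi decompositions. Corners \<open>e B e\<close> of the quotient
  \<open>B\<close> = \<open>A/N\<close> replace them. The obstacle is that the compression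
  \<open>e z e\<close> of an element \<open>z\<close> of \<open>m\<close> need not lie in
  \<open>m\<close>. Away from the finite-dimensional blocks of \<open>B\<close> the error is a skew
  element that brackets of \<open>m\<close> produce, because \<open>m\<close> has finite codimension
  where it matters. On a finite-dimensional block \<open>m\<close> can be much smaller than the
  space of all skew elements (as G2 in so(7)), and nothing may be cut there. Hence \<open>e\<close>
  is arranged to act on these blocks as a central idempotent. Even then only the brackets of
  \<open>e z e\<close> with the corner of \<open>m\<close> are shown to return to \<open>m\<close>;
  this suffices, since the traces of \<open>z\<close> and of \<open>e z e\<close> against the corner
  agree. The finiteness that drives the arguments is two-sided: \<open>a F b\<close> is
  finite-dimensional, \<open>a F\<close> in general is not. The nilpotency criteria come from one
  positivity statement: a nonzero idempotent has positive trace, namely its rank.\<close>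

definition commutator :: "'a::ring \<Rightarrow> 'a \<Rightarrow> 'a" where
  "commutator a b = a * b - b * a"

lemma commutator_add_left: "commutator (a + b) c = commutator a c + commutator b c"
  by (simp add: commutator_def algebra_simps)

lemma commutator_add_right: "commutator a (b + c) = commutator a b + commutator a c"
  by (simp add: commutator_def algebra_simps)

lemma commutator_zero [simp]: "commutator 0 a = 0" "commutator a 0 = 0" "commutator a a = 0"
  by (simp_all add: commutator_def)

lemma commutator_minus: "- commutator a b = commutator b a"
  by (simp add: commutator_def)

lemma commutator_mult: "commutator a (b * c) = commutator a b * c + b * commutator a c"
  by (simp add: commutator_def algebra_simps)

lemma commutator_jacobi: "commutator a (commutator b c) = commutator (commutator a b) c + commutator b (commutator a c)"
  by (simp add: commutator_def algebra_simps)

locale cvs = vector_space scale for scale :: "complex \<Rightarrow> 'b::ab_group_add \<Rightarrow> 'b"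
begin

text \<open>Stated for arbitrary sets, so that it passes to subsets and applies to sets such as
  \<open>{a * x * b | x. x \<in> F}\<close> without a check that they are subspaces.\<close>

definition fdim :: "'b set \<Rightarrow> bool" where
  "fdim Z \<longleftrightarrow> (\<exists>X. finite X \<and> Z \<subseteq> span X)"

text \<open>Linearity is relative to a set because the involution and the quotient map are
  controlled only on a subalgebra of a larger type; \<open>form_on\<close> does the same for the
  trace.\<close>

definition lin_on :: "'b set \<Rightarrow> ('b \<Rightarrow> 'b) \<Rightarrow> bool" where
  "lin_on E f \<longleftrightarrow> (\<forall>x\<in>E. \<forall>y\<in>E. f (x + y) = f x + f y) \<and> (\<forall>c. \<forall>x\<in>E. f (scale c x) = scale c (f x))"

definition form_on :: "'b set \<Rightarrow> ('b \<Rightarrow> complex) \<Rightarrow> bool" where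
  "form_on E f \<longleftrightarrow> (\<forall>x\<in>E. \<forall>y\<in>E. f (x + y) = f x + f y) \<and> (\<forall>c. \<forall>x\<in>E. f (scale c x) = c * f x)"

lemma fdim_subset: "fdim Y \<Longrightarrow> X \<subseteq> Y \<Longrightarrow> fdim X"
  unfolding fdim_def by blast

lemma fdim_finite: "finite X \<Longrightarrow> fdim X"
  unfolding fdim_def using span_superset by blast

lemma fdim_span: "fdim X \<Longrightarrow> fdim (span X)"
  unfolding fdim_def by (meson span_minimal subspace_span)

lemma fdim_Un: assumes "fdim X" "fdim Y" shows "fdim (X \<union> Y)"
proof -
  obtain A B where "finite A" "X \<subseteq> span A" "finite B" "Y \<subseteq> span B"
    using assms unfolding fdim_def by blast
  then have "finite (A \<union> B)" "X \<union> Y \<subseteq> span (A \<union> B)"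
    by (auto intro: span_mono[THEN subsetD, rotated])
  then show ?thesis unfolding fdim_def by blast
qed

lemma fdim_UN: assumes "finite I" "\<And>i. i \<in> I \<Longrightarrow> fdim (A i)" shows "fdim (\<Union>i\<in>I. A i)"
  using assms by (induction I rule: finite_induct) (auto intro: fdim_Un simp: fdim_finite)

lemma fdim_basis:
  assumes "fdim Z"
  shows "\<exists>X. finite X \<and> X \<subseteq> Z \<and> independent X \<and> Z \<subseteq> span X \<and> card X = dim Z"
proof -
  obtain A where A: "finite A" "Z \<subseteq> span A" using assms unfolding fdim_def by blast
  obtain X where X: "X \<subseteq> Z" "independent X" "Z \<subseteq> span X" "card X = dim Z" using basis_exists by blast
  then have "finite X" using independent_span_bound[OF A(1) X(2)] A(2) by auto
  then show ?thesis using X by blast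
qed

lemma fdim_basis_subspace:
  assumes "fdim Z" "subspace Z"
  shows "\<exists>X. finite X \<and> X \<subseteq> Z \<and> independent X \<and> span X = Z \<and> card X = dim Z"
proof -
  obtain X where X: "finite X" "X \<subseteq> Z" "independent X" "Z \<subseteq> span X" "card X = dim Z"
    using fdim_basis[OF assms(1)] by blast
  then have "span X = Z" using span_minimal[OF X(2) assms(2)] by blast
  then show ?thesis using X by blast
qed

lemma fdim_dim_mono:
  assumes "fdim Z" "Y \<subseteq> Z" "subspace Y" shows "dim Y \<le> dim Z"
proof -
  obtain X where X: "finite X" "Z \<subseteq> span X" "card X = dim Z" using fdim_basis[OF assms(1)] by blast
  then show ?thesis using dim_le_card[of Y X] assms(2) by (metis subset_trans)
qed

lemma fdim_dim_eq:
  assumes "fdim Z" "Y \<subseteq> Z" "subspace Y" "dim Z \<le> dim Y" shows "Y = Z"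
proof (rule ccontr)
  assume "Y \<noteq> Z"
  then obtain z where z: "z \<in> Z" "z \<notin> Y" using assms(2) by blast
  obtain X where X: "finite X" "X \<subseteq> Y" "independent X" "span X = Y" "card X = dim Y"
    using fdim_basis_subspace[OF fdim_subset[OF assms(1,2)] assms(3)] by blast
  have ind: "independent (insert z X)" using X z by (intro independent_insertI) auto
  obtain W where W: "finite W" "Z \<subseteq> span W" "card W = dim Z" using fdim_basis[OF assms(1)] by blast
  have "card (insert z X) \<le> card W"
    using independent_span_bound[OF W(1) ind] W(2) X(2) assms(2) z(1) by (meson insert_subset subset_trans)
  moreover have "z \<notin> X" using z(2) X(2) by blast
  ultimately show False using X W assms(4) by simp
qed

lemma lin_on_zero: "subspace E \<Longrightarrow> lin_on E f \<Longrightarrow> f 0 = 0"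
  unfolding lin_on_def by (metis subspace_0 scale_zero_left)

lemma lin_on_subset: "lin_on E f \<Longrightarrow> E' \<subseteq> E \<Longrightarrow> lin_on E' f"
  unfolding lin_on_def by blast

lemma form_on_subset: "form_on E f \<Longrightarrow> E' \<subseteq> E \<Longrightarrow> form_on E' f"
  unfolding form_on_def by blast

lemma form_on_zero: "subspace E \<Longrightarrow> form_on E f \<Longrightarrow> f 0 = 0"
  unfolding form_on_def using subspace_0[of E] by (metis mult_zero_left scale_zero_left)

lemma form_on_diff_scale:
  assumes "subspace E" "form_on E f" "x \<in> E" "y \<in> E"
  shows "f (x - scale c y) = f x - c * f y"
proof -
  have "f (x + scale (- c) y) = f x + (- c) * f y"
    using assms subspace_scale[OF assms(1,4)] unfolding form_on_def by metis
  then show ?thesis by simp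
qed

lemma lin_on_diff_scale:
  assumes "subspace E" "lin_on E f" "x \<in> E" "y \<in> E"
  shows "f (x - scale c y) = f x - scale c (f y)"
proof -
  have "f (x + scale (- c) y) = f x + scale (- c) (f y)"
    using assms subspace_scale[OF assms(1,4)] unfolding lin_on_def by metis
  then show ?thesis by simp
qed

lemma lin_on_image_span:
  assumes "subspace E" "lin_on E f" "X \<subseteq> E" "x \<in> span X"
  shows "f x \<in> span (f ` X)"
proof -
  let ?A = "{x \<in> E. f x \<in> span (f ` X)}"
  have "subspace ?A"
    using assms(1,2) lin_on_zero[OF assms(1,2)] unfolding subspace_def lin_on_def
    by (auto intro: span_add span_scale simp: span_zero)
  moreover have "X \<subseteq> ?A" using assms(3) span_superset by blast
  ultimately show ?thesis using span_minimal assms(4) by blast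
qed

lemma lin_on_image_fdim:
  assumes "subspace E" "lin_on E f" "Z \<subseteq> E" "fdim Z" shows "fdim (f ` Z)"
proof -
  obtain X where X: "finite X" "X \<subseteq> Z" "Z \<subseteq> span X"
    using fdim_basis[OF assms(4)] by blast
  have "f ` Z \<subseteq> span (f ` X)"
    using lin_on_image_span[OF assms(1,2), of X] X assms(3) by blast
  then show ?thesis using X(1) unfolding fdim_def by blast
qed

lemma lin_on_image_subspace:
  assumes "subspace E" "lin_on E f" "subspace Z" "Z \<subseteq> E" shows "subspace (f ` Z)"
proof (rule subspaceI)
  show "0 \<in> f ` Z" using lin_on_zero[OF assms(1,2)] subspace_0[OF assms(3)] by (metis image_eqI)
next
  fix x y assume "x \<in> f ` Z" "y \<in> f ` Z"
  then obtain a b where ab: "a \<in> Z" "b \<in> Z" "x = f a" "y = f b" by blast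
  then have "x + y = f (a + b)" using assms(2,4) unfolding lin_on_def by (metis subsetD)
  then show "x + y \<in> f ` Z" using subspace_add[OF assms(3)] ab by blast
next
  fix c x assume "x \<in> f ` Z"
  then obtain a where ab: "a \<in> Z" "x = f a" by blast
  then have "scale c x = f (scale c a)" using assms(2,4) unfolding lin_on_def by (metis subsetD)
  then show "scale c x \<in> f ` Z" using subspace_scale[OF assms(3)] ab by blast
qed

section \<open>Subspaces of finite codimension and separation by forms\<close>

lemma finite_codim_form:
  assumes "subspace E" "finite I" "\<And>i. i \<in> I \<Longrightarrow> form_on E (f i)"
  shows "\<exists>X. finite X \<and> X \<subseteq> E \<and> E \<subseteq> span ({e \<in> E. \<forall>i\<in>I. f i e = 0} \<union> X)"
  using assms(2,3)
proof (induction I rule: finite_induct)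
  case empty then show ?case by (intro exI[of _ "{}"]) (auto intro: span_base)
next
  case (insert j I)
  let ?E = "\<lambda>I. {e \<in> E. \<forall>i\<in>I. f i e = 0}"
  obtain X where X: "finite X" "X \<subseteq> E" "E \<subseteq> span (?E I \<union> X)" using insert by auto
  show ?case
  proof (cases "\<forall>e\<in>?E I. f j e = 0")
    case True
    then have "?E (insert j I) = ?E I" by auto
    with X show ?thesis by (intro exI[of _ X]) simp
  next
    case False
    then obtain e0 where e0: "e0 \<in> ?E I" "f j e0 \<noteq> 0" by blast
    have "?E I \<subseteq> span (?E (insert j I) \<union> insert e0 X)"
    proof
      fix e assume e: "e \<in> ?E I"
      let ?c = "f j e / f j e0"
      have "f i (e - scale ?c e0) = 0" if i: "i \<in> insert j I" for i
        using form_on_diff_scale[OF assms(1) insert.prems[OF i], of e e0 ?c] i e e0 by auto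
      moreover have "e - scale ?c e0 \<in> E" using e e0 assms(1) subspace_diff subspace_scale by blast
      ultimately have "e - scale ?c e0 \<in> span (?E (insert j I) \<union> insert e0 X)"
        by (intro span_base) auto
      moreover have "scale ?c e0 \<in> span (?E (insert j I) \<union> insert e0 X)"
        by (intro span_scale span_base) auto
      ultimately show "e \<in> span (?E (insert j I) \<union> insert e0 X)"
        using span_add by fastforce
    qed
    moreover have "X \<subseteq> span (?E (insert j I) \<union> insert e0 X)" by (auto intro: span_base)
    ultimately have "span (?E I \<union> X) \<subseteq> span (?E (insert j I) \<union> insert e0 X)"
      by (intro span_minimal) auto
    then show ?thesis using X e0 by (intro exI[of _ "insert e0 X"]) auto
  qed
qed

text \<open>The generators in \<open>X\<close> are removed one at a time: a vector \<open>e0\<close>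
  whose image involves \<open>x\<close> modulo the rest corrects all other vectors, so a generator
  costs at most one dimension of \<open>E\<close>. With \<open>f\<close> = \<open>skew\<close> and
  \<open>M\<close> = \<open>m\<close>, an inclusion up to finite dimension becomes a subspace of
  finite codimension that is sent into \<open>m\<close>.\<close>

lemma finite_codim_lin:
  assumes "subspace E" "lin_on E f" "subspace M" "finite X" "f ` E \<subseteq> span (M \<union> X)"
  shows "\<exists>Y. finite Y \<and> Y \<subseteq> E \<and> E \<subseteq> span ({e \<in> E. f e \<in> M} \<union> Y)"
  using assms(4,5,1,2)
proof (induction X arbitrary: E rule: finite_induct)
  case empty
  have "span M = M" using assms(3) by (simp only: span_eq_iff)
  moreover have "M \<union> {} = M" by simp
  ultimately have "f ` E \<subseteq> M" using empty(1) by metis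
  then have "E \<subseteq> {e \<in> E. f e \<in> M}" by auto
  then show ?case using span_superset by (intro exI[of _ "{}"]) auto
next
  case (insert x X)
  let ?E1 = "{e \<in> E. f e \<in> span (M \<union> X)}"
  have sub: "subspace ?E1"
    using insert.prems lin_on_zero[of E f] unfolding subspace_def lin_on_def
    by (auto intro: span_add span_scale simp: span_zero)
  have "f ` ?E1 \<subseteq> span (M \<union> X)" by auto
  from insert.IH[OF this sub] obtain Y where Y: "finite Y" "Y \<subseteq> ?E1" "?E1 \<subseteq> span ({e \<in> ?E1. f e \<in> M} \<union> Y)"
    using lin_on_subset[OF insert.prems(3), of ?E1] by auto
  have Y': "?E1 \<subseteq> span ({e \<in> E. f e \<in> M} \<union> Y)"
    using Y(3) span_mono[of "{e \<in> ?E1. f e \<in> M} \<union> Y" "{e \<in> E. f e \<in> M} \<union> Y"] by blast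
  show ?case
  proof (cases "?E1 = E")
    case True with Y Y' show ?thesis by (intro exI[of _ Y]) simp
  next
    case False
    then obtain e0 where e0: "e0 \<in> E" "f e0 \<notin> span (M \<union> X)" by blast
    have mem: "\<exists>k. f e - scale k x \<in> span (M \<union> X)" if "e \<in> E" for e
      using that insert.prems(1) span_breakdown_eq[of "f e" x "M \<union> X"] by auto
    obtain k0 where k0: "f e0 - scale k0 x \<in> span (M \<union> X)" using mem e0 by blast
    then have "k0 \<noteq> 0" using e0 by auto
    have "E \<subseteq> span ({e \<in> E. f e \<in> M} \<union> insert e0 Y)"
    proof
      fix e assume e: "e \<in> E"
      obtain k where k: "f e - scale k x \<in> span (M \<union> X)" using mem e by blast
      have "f e - scale k x - scale (k/k0) (f e0 - scale k0 x) \<in> span (M \<union> X)"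
        by (rule span_diff[OF k span_scale[OF k0]])
      moreover have "f e - scale k x - scale (k/k0) (f e0 - scale k0 x) = f (e - scale (k/k0) e0)"
        using lin_on_diff_scale[OF insert.prems(2,3) e e0(1)] \<open>k0 \<noteq> 0\<close>
        by (simp add: scale_right_diff_distrib)
      ultimately have "e - scale (k/k0) e0 \<in> ?E1"
        using e e0 subspace_diff[OF insert.prems(2)] subspace_scale[OF insert.prems(2)] by auto
      then have "e - scale (k/k0) e0 \<in> span ({e \<in> E. f e \<in> M} \<union> insert e0 Y)"
        using Y' span_mono[of "{e \<in> E. f e \<in> M} \<union> Y" "{e \<in> E. f e \<in> M} \<union> insert e0 Y"] by blast
      moreover have "scale (k/k0) e0 \<in> span ({e \<in> E. f e \<in> M} \<union> insert e0 Y)"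
        by (intro span_scale span_base) auto
      ultimately show "e \<in> span ({e \<in> E. f e \<in> M} \<union> insert e0 Y)"
        using span_add by fastforce
    qed
    then show ?thesis using Y e0 by (intro exI[of _ "insert e0 Y"]) auto
  qed
qed

text \<open>Duality by elimination. If \<open>f1\<close> vanishes on \<open>Z\<close> and not at
  \<open>z\<close>, then \<open>y\<close> is corrected by a multiple of \<open>z\<close>, and the
  form found for the corrected vector is corrected by a multiple of \<open>f1\<close>. The only
  operation on \<open>\<Phi>\<close> is \<open>f - c g\<close>, so \<open>\<Phi>\<close> can consist
  of the forms represented by elements of an algebra.\<close>

lemma separating_form:
  assumes "subspace E" "finite Z" "Z \<subseteq> E" "y \<in> E" "y \<notin> span Z"
    and "\<And>f. f \<in> \<Phi> \<Longrightarrow> form_on E f"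
    and "\<And>f g c. f \<in> \<Phi> \<Longrightarrow> g \<in> \<Phi> \<Longrightarrow> (\<lambda>x. f x - c * g x) \<in> \<Phi>"
    and "\<And>u. u \<in> span (insert y Z) \<Longrightarrow> u \<noteq> 0 \<Longrightarrow> \<exists>f\<in>\<Phi>. f u \<noteq> 0"
  shows "\<exists>f\<in>\<Phi>. (\<forall>z\<in>Z. f z = 0) \<and> f y \<noteq> 0"
  using assms(2,3,4,5,8)
proof (induction Z arbitrary: y rule: finite_induct)
  case empty
  then show ?case using span_base[of y "{y}"] by auto
next
  case (insert z Z)
  have sub: "span (insert y' Z) \<subseteq> span (insert y (insert z Z))" if "y' \<in> span (insert y (insert z Z))" for y'
    using that by (intro span_minimal) (auto intro: span_base)
  have IH: "\<exists>f\<in>\<Phi>. (\<forall>z\<in>Z. f z = 0) \<and> f y' \<noteq> 0"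
    if "y' \<notin> span Z" "y' \<in> E" "y' \<in> span (insert y (insert z Z))" for y'
  proof (rule insert.IH)
    show "Z \<subseteq> E" using insert.prems(1) by simp
    show "\<exists>f\<in>\<Phi>. f u \<noteq> 0" if "u \<in> span (insert y' Z)" "u \<noteq> 0" for u
      using insert.prems(4)[of u] sub[OF \<open>y' \<in> span (insert y (insert z Z))\<close>] that by blast
  qed (use that in auto)
  show ?case
  proof (cases "z \<in> span Z")
    case True
    have "y \<notin> span Z" using insert.prems(3) span_mono[of Z "insert z Z"] by blast
    then obtain f where f: "f \<in> \<Phi>" "\<forall>z\<in>Z. f z = 0" "f y \<noteq> 0"
      using IH[of y] insert.prems(2) span_base[of y "insert y (insert z Z)"] by auto
    have "span Z \<subseteq> {e \<in> E. f e = 0}"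
      using f insert.prems(1) assms(1) form_on_zero[OF assms(1) assms(6)[OF f(1)]] assms(6)[OF f(1)]
      by (intro span_minimal) (auto simp: subspace_def form_on_def)
    then show ?thesis using f True by blast
  next
    case False
    obtain f1 where f1: "f1 \<in> \<Phi>" "\<forall>z\<in>Z. f1 z = 0" "f1 z \<noteq> 0"
      using IH[of z] insert.prems(1) False span_base[of z "insert y (insert z Z)"] by auto
    let ?c = "f1 y / f1 z"
    let ?y = "y - scale ?c z"
    have "?y \<notin> span Z"
    proof
      assume "?y \<in> span Z"
      then have "?y + scale ?c z \<in> span (insert z Z)"
        by (intro span_add span_scale) (auto intro: span_base span_mono[THEN subsetD, of Z])
      then show False using insert.prems(3) by simp
    qed
    moreover have "?y \<in> E" using insert.prems assms(1) subspace_diff subspace_scale by (meson insert_subset)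
    moreover have "?y \<in> span (insert y (insert z Z))"
      by (intro span_diff span_scale) (auto intro: span_base)
    ultimately obtain f2 where f2: "f2 \<in> \<Phi>" "\<forall>z\<in>Z. f2 z = 0" "f2 ?y \<noteq> 0"
      using IH[of ?y] by blast
    let ?f = "\<lambda>x. f2 x - (f2 z / f1 z) * f1 x"
    have "f2 ?y = f2 y - ?c * f2 z"
      using form_on_diff_scale[OF assms(1) assms(6)[OF f2(1)]] insert.prems(1,2) by blast
    then have "?f y \<noteq> 0" using f2(3) f1(3) by (auto simp: field_simps)
    moreover have "\<forall>z'\<in>insert z Z. ?f z' = 0" using f1 f2 by auto
    moreover have "?f \<in> \<Phi>" by (rule assms(7)[OF f2(1) f1(1)])
    ultimately show ?thesis by (intro bexI[of _ ?f]) simp_all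
  qed
qed

text \<open>A form is determined up to a scalar by its kernel: an \<open>x\<close> with
  \<open>\<beta> x\<close> zero on the kernel of \<open>\<phi>\<close> and nonzero at
  \<open>y0\<close> represents \<open>\<phi>\<close> after rescaling.\<close>

lemma riesz_form:
  assumes "subspace C" "fdim C" "form_on C \<phi>"
    and "\<And>x. x \<in> C \<Longrightarrow> form_on C (\<beta> x)"
    and "\<And>x y c z. x \<in> C \<Longrightarrow> y \<in> C \<Longrightarrow> z \<in> C \<Longrightarrow> \<beta> (x - scale c y) z = \<beta> x z - c * \<beta> y z"
    and "\<And>z. z \<in> C \<Longrightarrow> z \<noteq> 0 \<Longrightarrow> \<exists>x\<in>C. \<beta> x z \<noteq> 0"
  shows "\<exists>e\<in>C. \<forall>z\<in>C. \<beta> e z = \<phi> z"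
proof (cases "\<forall>z\<in>C. \<phi> z = 0")
  case True
  have "\<beta> 0 z = 0" if "z \<in> C" for z
    using assms(5)[of 0 0 z 1] subspace_0[OF assms(1)] that by simp
  then show ?thesis using True subspace_0[OF assms(1)] by metis
next
  case False
  then obtain y0 where y0: "y0 \<in> C" "\<phi> y0 \<noteq> 0" by blast
  define Z where "Z = {z \<in> C. \<phi> z = 0}"
  have sZ: "subspace Z" unfolding Z_def
    using assms(1,3) form_on_zero[OF assms(1,3)] unfolding subspace_def form_on_def by auto
  obtain X where X: "finite X" "X \<subseteq> Z" "span X = Z"
    using fdim_basis_subspace[OF fdim_subset[OF assms(2)] sZ] Z_def by blast
  let ?\<Phi> = "{f. \<exists>x\<in>C. \<forall>z\<in>C. f z = \<beta> x z}"
  have sep: "\<exists>f\<in>?\<Phi>. (\<forall>z\<in>X. f z = 0) \<and> f y0 \<noteq> 0"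
  proof (rule separating_form[OF assms(1) X(1)])
    show "X \<subseteq> C" "y0 \<in> C" "y0 \<notin> span X" using X y0 Z_def by auto
    show "form_on C f" if f: "f \<in> ?\<Phi>" for f
    proof -
      obtain x where x: "x \<in> C" "\<forall>z\<in>C. f z = \<beta> x z" using f by blast
      then show ?thesis
        using assms(4)[of x] subspace_add[OF assms(1)] subspace_scale[OF assms(1)] unfolding form_on_def by auto
    qed
    show "(\<lambda>x. f x - c * g x) \<in> ?\<Phi>" if fg: "f \<in> ?\<Phi>" "g \<in> ?\<Phi>" for f g c
    proof -
      obtain x y where x: "x \<in> C" "\<forall>z\<in>C. f z = \<beta> x z" "y \<in> C" "\<forall>z\<in>C. g z = \<beta> y z" using fg by blast
      then have "x - scale c y \<in> C" "\<forall>z\<in>C. f z - c * g z = \<beta> (x - scale c y) z"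
        using assms(5) subspace_diff[OF assms(1)] subspace_scale[OF assms(1)] by auto
      then show ?thesis by blast
    qed
    show "\<exists>f\<in>?\<Phi>. f u \<noteq> 0" if u: "u \<in> span (insert y0 X)" "u \<noteq> 0" for u
    proof -
      have "u \<in> C" using u(1) span_minimal[of "insert y0 X" C] y0 X Z_def assms(1) by blast
      then obtain x where "x \<in> C" "\<beta> x u \<noteq> 0" using assms(6) u by blast
      then show ?thesis by (intro bexI[of _ "\<beta> x"]) auto
    qed
  qed
  then obtain x where x: "x \<in> C" "\<forall>z\<in>X. \<beta> x z = 0" "\<beta> x y0 \<noteq> 0" 
  proof -
    from sep obtain f x where fx: "x \<in> C" "\<forall>z\<in>C. f z = \<beta> x z" "\<forall>z\<in>X. f z = 0" "f y0 \<noteq> 0" by blast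
    moreover have "X \<subseteq> C" using X(2) Z_def by blast
    ultimately have "\<forall>z\<in>X. \<beta> x z = 0" by (metis subsetD)
    then show ?thesis using that fx y0(1) by metis
  qed
  have Zx: "\<beta> x z = 0" if "z \<in> Z" for z
  proof -
    have "span X \<subseteq> {z \<in> C. \<beta> x z = 0}"
      using x X Z_def assms(1) form_on_zero[OF assms(1) assms(4)[OF x(1)]] assms(4)[OF x(1)]
      by (intro span_minimal) (auto simp: subspace_def form_on_def)
    then show ?thesis using that X by blast
  qed
  let ?k = "\<phi> y0 / \<beta> x y0"
  have "\<beta> (scale ?k x) z = \<phi> z" if z: "z \<in> C" for z
  proof -
    let ?z = "z + scale (- (\<phi> z / \<phi> y0)) y0"
    have "?z \<in> C" using z y0 assms(1) subspace_add subspace_scale by blast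
    moreover have "\<phi> ?z = 0" using form_on_diff_scale[OF assms(1,3) z y0(1), of "\<phi> z / \<phi> y0"] y0 by simp
    ultimately have "\<beta> x ?z = 0" using Zx Z_def by blast
    moreover have "\<beta> x ?z = \<beta> x z - (\<phi> z / \<phi> y0) * \<beta> x y0"
      using form_on_diff_scale[OF assms(1) assms(4)[OF x(1)] z y0(1), of "\<phi> z / \<phi> y0"] by simp
    moreover have "\<beta> (0 - scale (-?k) x) z = \<beta> 0 z - (-?k) * \<beta> x z"
      using assms(5) x z subspace_0[OF assms(1)] by blast
    moreover have "\<beta> 0 z = 0"
      using assms(5)[of 0 0 z 1] subspace_0[OF assms(1)] z by simp
    ultimately have "\<beta> (scale ?k x) z = \<phi> y0 * \<beta> x z / \<beta> x y0" "\<phi> y0 * \<beta> x z = \<phi> z * \<beta> x y0"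
      using y0 x by (simp_all add: field_simps)
    then show ?thesis using x(3) by simp
  qed
  then show ?thesis using x(1) subspace_scale[OF assms(1)] by blast
qed

end

section \<open>Trace radicals and solvable ideals\<close>

locale calg = cvs scale for scale :: "complex \<Rightarrow> 'b::{ring,monoid_mult} \<Rightarrow> 'b" +
  assumes scale_mult_left: "scale c a * b = scale c (a * b)"
begin

text \<open>The ring in view consists of additive endomorphisms, where scalars act on values and
  left multiplication need not be complex linear. \<open>homog\<close> collects the elements for
  which it is; among additive endomorphisms these are the complex linear maps.\<close>

definition homog :: "'b set" where
  "homog = {a. \<forall>c b. a * scale c b = scale c (a * b)}"

lemma homogD: "a \<in> homog \<Longrightarrow> a * scale c b = scale c (a * b)"
  unfolding homog_def by blast

lemma subspace_homog: "subspace homog"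
  unfolding subspace_def homog_def
  by (auto simp: algebra_simps scale_mult_left scale_right_distrib)

lemma homog_mult: "a \<in> homog \<Longrightarrow> b \<in> homog \<Longrightarrow> a * b \<in> homog"
  unfolding homog_def by (auto simp: mult.assoc)

lemma homog_one: "1 \<in> homog" unfolding homog_def by simp

lemma homog_power: "a \<in> homog \<Longrightarrow> a ^ n \<in> homog"
  by (induction n) (auto simp: homog_one homog_mult)

lemma lin_on_mult_right: "lin_on E (\<lambda>x. x * a)"
  unfolding lin_on_def by (simp add: algebra_simps scale_mult_left)

lemma lin_on_mult_left: "a \<in> homog \<Longrightarrow> lin_on E (\<lambda>x. a * x)"
  unfolding lin_on_def by (simp add: algebra_simps homogD)

lemma lin_on_commutator: "a \<in> homog \<Longrightarrow> lin_on E (commutator a)"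
  unfolding lin_on_def by (simp add: commutator_def algebra_simps homogD scale_mult_left scale_right_diff_distrib)

lemma commutator_scale_right: "a \<in> homog \<Longrightarrow> commutator a (scale c b) = scale c (commutator a b)"
  by (simp add: commutator_def homogD scale_mult_left scale_right_diff_distrib)

lemma commutator_scale_left: "b \<in> homog \<Longrightarrow> commutator (scale c a) b = scale c (commutator a b)"
  by (simp add: commutator_def homogD scale_mult_left scale_right_diff_distrib)

lemma span_mult_right: "x \<in> span X \<Longrightarrow> x * a \<in> span ((\<lambda>x. x * a) ` X)"
  using lin_on_image_span[OF subspace_UNIV lin_on_mult_right, of X x a] by simp

lemma span_mult_left: "a \<in> homog \<Longrightarrow> x \<in> span X \<Longrightarrow> a * x \<in> span ((\<lambda>x. a * x) ` X)"
  using lin_on_image_span[OF subspace_UNIV lin_on_mult_left, of a X x] by simp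

lemma span_mult:
  assumes "A \<subseteq> homog" "a \<in> span A" "b \<in> span B"
  shows "a * b \<in> span {x * y | x y. x \<in> A \<and> y \<in> B}"
proof -
  have "x * b \<in> span {x * y | x y. x \<in> A \<and> y \<in> B}" if "x \<in> A" for x
    using span_mult_left[of x b B] that assms(1,3) span_mono[of "(\<lambda>y. x * y) ` B" "{x * y | x y. x \<in> A \<and> y \<in> B}"]
    by blast
  then have "(\<lambda>x. x * b) ` A \<subseteq> span {x * y | x y. x \<in> A \<and> y \<in> B}" by blast
  then show ?thesis using span_mult_right[OF assms(2), of b] span_minimal[OF _ subspace_span] by blast
qed

text \<open>The generated algebra is non-unital. The only product rule is left multiplication by a
  generator, so inductions extend words by one letter; closure under all products is
  derived.\<close>

inductive_set alg :: "'b set \<Rightarrow> 'b set" for G where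
  base: "x \<in> G \<Longrightarrow> x \<in> alg G"
| zero: "0 \<in> alg G"
| add: "a \<in> alg G \<Longrightarrow> b \<in> alg G \<Longrightarrow> a + b \<in> alg G"
| scale: "a \<in> alg G \<Longrightarrow> scale c a \<in> alg G"
| mult: "x \<in> G \<Longrightarrow> a \<in> alg G \<Longrightarrow> x * a \<in> alg G"

lemma subspace_alg: "subspace (alg G)"
  unfolding subspace_def by (auto intro: alg.intros)

lemma alg_mult: "a \<in> alg G \<Longrightarrow> b \<in> alg G \<Longrightarrow> a * b \<in> alg G"
  by (induction rule: alg.induct) (auto intro: alg.intros simp: algebra_simps scale_mult_left)

lemma alg_least: "subspace A \<Longrightarrow> G \<subseteq> A \<Longrightarrow> (\<And>x a. x \<in> G \<Longrightarrow> a \<in> A \<Longrightarrow> x * a \<in> A) \<Longrightarrow> alg G \<subseteq> A"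
proof
  fix x assume *: "subspace A" "G \<subseteq> A" "\<And>x a. x \<in> G \<Longrightarrow> a \<in> A \<Longrightarrow> x * a \<in> A" "x \<in> alg G"
  from *(4) show "x \<in> A"
    by (induction rule: alg.induct) (use *(1-3) in \<open>auto intro: subspace_0 subspace_add subspace_scale\<close>)
qed

lemma alg_mono: "G \<subseteq> H \<Longrightarrow> alg G \<subseteq> alg H"
  by (rule alg_least[OF subspace_alg]) (auto intro: alg.intros)

lemma alg_subset_subalgebra: "subspace A \<Longrightarrow> G \<subseteq> A \<Longrightarrow> (\<And>a b. a \<in> A \<Longrightarrow> b \<in> A \<Longrightarrow> a * b \<in> A) \<Longrightarrow> alg G \<subseteq> A"
  by (rule alg_least) auto

lemma alg_power: "a \<in> alg G \<Longrightarrow> a ^ Suc n \<in> alg G"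
  by (induction n) (auto intro: alg_mult)

lemma alg_commutator: "a \<in> alg G \<Longrightarrow> b \<in> alg G \<Longrightarrow> commutator a b \<in> alg G"
  unfolding commutator_def by (intro subspace_diff subspace_alg alg_mult)

definition lder :: "'b set \<Rightarrow> 'b set" where
  "lder I = span {commutator x y | x y. x \<in> I \<and> y \<in> I}"

primrec ders :: "'b set \<Rightarrow> nat \<Rightarrow> 'b set" where
  "ders I 0 = I"
| "ders I (Suc n) = lder (ders I n)"

lemma ders_Suc': "ders I (Suc n) = ders (lder I) n"
  by (induction n) auto

definition lsub :: "'b set \<Rightarrow> bool" where
  "lsub h \<longleftrightarrow> subspace h \<and> (\<forall>x\<in>h. \<forall>y\<in>h. commutator x y \<in> h)"

definition lideal :: "'b set \<Rightarrow> 'b set \<Rightarrow> bool" where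
  "lideal h I \<longleftrightarrow> subspace I \<and> I \<subseteq> h \<and> (\<forall>x\<in>h. \<forall>y\<in>I. commutator x y \<in> I)"

lemma lideal_commutator': "lideal h I \<Longrightarrow> x \<in> I \<Longrightarrow> y \<in> h \<Longrightarrow> commutator x y \<in> I"
  unfolding lideal_def by (metis commutator_minus subspace_neg)

lemma lder_mono: "I \<subseteq> J \<Longrightarrow> lder I \<subseteq> lder J"
  unfolding lder_def by (intro span_mono) blast

lemma lder_subset: "lsub h \<Longrightarrow> lder h \<subseteq> h"
  unfolding lder_def lsub_def by (intro span_minimal) auto

lemma commutator_in_lder: "x \<in> h \<Longrightarrow> y \<in> h \<Longrightarrow> commutator x y \<in> lder h"
  unfolding lder_def by (intro span_base) blast

lemma lder_induct:
  assumes "x \<in> lder h" "subspace A" "\<And>a b. a \<in> h \<Longrightarrow> b \<in> h \<Longrightarrow> commutator a b \<in> A"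
  shows "x \<in> A"
  using assms span_minimal[of "{commutator x y | x y. x \<in> h \<and> y \<in> h}" A] unfolding lder_def by blast

lemma subspace_commutator_preimage: "a \<in> homog \<Longrightarrow> subspace A \<Longrightarrow> subspace {x. commutator a x \<in> A}"
  unfolding subspace_def by (auto simp: commutator_add_right commutator_scale_right)

lemma lideal_lder:
  assumes "h \<subseteq> homog" "lideal h I" shows "lideal h (lder I)"
proof -
  have "lder I \<subseteq> I" using lder_subset[of I] assms(2) unfolding lsub_def lideal_def by blast
  moreover have "commutator x y \<in> lder I" if x: "x \<in> h" and y: "y \<in> lder I" for x y
  proof -
    have "y \<in> {y. commutator x y \<in> lder I}"
    proof (rule lder_induct[OF y subspace_commutator_preimage])
      show "x \<in> homog" using x assms(1) by blast
      show "subspace (lder I)" unfolding lder_def by simp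
      fix a b assume ab: "a \<in> I" "b \<in> I"
      have "commutator (commutator x a) b \<in> lder I" "commutator a (commutator x b) \<in> lder I"
        using ab x assms(2) unfolding lideal_def by (auto intro: commutator_in_lder)
      then show "commutator a b \<in> {y. commutator x y \<in> lder I}"
        unfolding commutator_jacobi[of x] mem_Collect_eq by (metis \<open>subspace (lder I)\<close> subspace_add)
    qed
    then show ?thesis by simp
  qed
  ultimately show ?thesis using assms(2) unfolding lideal_def lder_def by auto
qed

end

text \<open>An abstraction of the finite-rank operators with their trace. \<open>F_fdim\<close>
  stands in for finite dimension. The axioms are chosen so that they survive the passage to the
  quotient by the trace radical.\<close>

locale trace_alg = calg scale for scale :: "complex \<Rightarrow> 'b::{ring,monoid_mult} \<Rightarrow> 'b" +
  fixes F :: "'b set" and \<tau> :: "'b \<Rightarrow> complex"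
  assumes subspace_F: "subspace F" and F_homog: "F \<subseteq> homog"
    and F_mult: "a \<in> F \<Longrightarrow> b \<in> F \<Longrightarrow> a * b \<in> F"
    and F_fdim: "a \<in> F \<Longrightarrow> b \<in> F \<Longrightarrow> fdim {a * x * b | x. x \<in> F}"
    and tr_form: "form_on F \<tau>"
    and tr_comm: "a \<in> F \<Longrightarrow> b \<in> F \<Longrightarrow> \<tau> (a * b) = \<tau> (b * a)"
    and tr_nil: "a \<in> F \<Longrightarrow> a ^ n = 0 \<Longrightarrow> \<tau> a = 0"
begin

lemma tr_add: "a \<in> F \<Longrightarrow> b \<in> F \<Longrightarrow> \<tau> (a + b) = \<tau> a + \<tau> b"
  using tr_form unfolding form_on_def by blast

lemma tr_scale: "a \<in> F \<Longrightarrow> \<tau> (scale c a) = c * \<tau> a"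
  using tr_form unfolding form_on_def by blast

lemma tr_zero: "\<tau> 0 = 0" by (rule form_on_zero[OF subspace_F tr_form])

lemma tr_diff: "a \<in> F \<Longrightarrow> b \<in> F \<Longrightarrow> \<tau> (a - b) = \<tau> a - \<tau> b"
  using form_on_diff_scale[OF subspace_F tr_form, of a b 1] by simp

lemma F_power: "a \<in> F \<Longrightarrow> a ^ Suc n \<in> F"
  by (induction n) (auto intro: F_mult)

lemma F_diff: "a \<in> F \<Longrightarrow> b \<in> F \<Longrightarrow> a - b \<in> F" by (rule subspace_diff[OF subspace_F])
lemma F_add: "a \<in> F \<Longrightarrow> b \<in> F \<Longrightarrow> a + b \<in> F" by (rule subspace_add[OF subspace_F])
lemma F_zero: "0 \<in> F" by (rule subspace_0[OF subspace_F])
lemma F_scale: "a \<in> F \<Longrightarrow> scale c a \<in> F" by (rule subspace_scale[OF subspace_F])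
lemma F_commutator: "a \<in> F \<Longrightarrow> b \<in> F \<Longrightarrow> commutator a b \<in> F"
  unfolding commutator_def by (intro F_diff F_mult)

lemma alg_F: "G \<subseteq> F \<Longrightarrow> alg G \<subseteq> F"
  by (rule alg_subset_subalgebra[OF subspace_F _ F_mult])

lemma tr_invariant:
  assumes "a \<in> F" "b \<in> F" "c \<in> F"
  shows "\<tau> (commutator a b * c) = \<tau> (a * commutator b c)"
proof -
  have "\<tau> (commutator a b * c) = \<tau> (a * (b * c)) - \<tau> (b * (a * c))"
    unfolding commutator_def using assms by (simp add: left_diff_distrib tr_diff F_mult mult.assoc)
  also have "\<tau> (b * (a * c)) = \<tau> (a * c * b)" using assms by (simp add: tr_comm F_mult)
  finally show ?thesis
    unfolding commutator_def using assms by (simp add: right_diff_distrib tr_diff F_mult mult.assoc)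
qed

lemma tr_invariant':
  assumes "a \<in> F" "b \<in> F" "c \<in> F"
  shows "\<tau> (commutator a b * c) = \<tau> (b * commutator c a)"
proof -
  have "\<tau> (commutator a b * c) = \<tau> (a * (b * c)) - \<tau> (b * (a * c))"
    unfolding commutator_def using assms by (simp add: left_diff_distrib tr_diff F_mult mult.assoc)
  also have "\<tau> (a * (b * c)) = \<tau> (b * c * a)" using assms by (simp add: tr_comm F_mult)
  finally show ?thesis
    unfolding commutator_def using assms by (simp add: right_diff_distrib tr_diff F_mult mult.assoc)
qed

lemma tr_zero_of_power_nilpotent: "a \<in> F \<Longrightarrow> (a ^ m) ^ n = 0 \<Longrightarrow> \<tau> a = 0"
  using tr_nil[of a "m * n"] by (simp add: power_mult)

text \<open>A word of length at least three in \<open>X\<close> lies in \<open>x F y\<close> for its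
  outer letters \<open>x\<close>, \<open>y\<close>; there are finitely many such corners, each
  finite-dimensional by \<open>F_fdim\<close>.\<close>

lemma fdim_alg:
  assumes "G \<subseteq> F" "fdim G" shows "fdim (alg G)"
proof -
  obtain X where X: "finite X" "X \<subseteq> G" "G \<subseteq> span X" using fdim_basis[OF assms(2)] by blast
  have XF: "X \<subseteq> F" using X(2) assms(1) by (rule subset_trans)
  let ?Y = "X \<union> {x * y | x y. x \<in> X \<and> y \<in> X} \<union> (\<Union>x\<in>X. \<Union>y\<in>X. {x * a * y | a. a \<in> F})"
  have "alg G \<subseteq> span ?Y"
  proof (rule alg_least)
    show "G \<subseteq> span ?Y" using X(3) span_mono[of X ?Y] by blast
    fix g w assume g: "g \<in> G" and w: "w \<in> span ?Y"
    have "x * w \<in> span ?Y" if x: "x \<in> X" for x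
    proof -
      have "x * w \<in> span ((\<lambda>w. x * w) ` ?Y)"
        using x XF F_homog w by (intro span_mult_left) auto
      also have "\<dots> \<subseteq> span ?Y"
      proof (rule span_mono, clarify)
        fix v assume "v \<in> ?Y" "x * v \<notin> (\<Union>x\<in>X. \<Union>y\<in>X. {x * a * y | a. a \<in> F})" "x * v \<notin> X"
        then consider "v \<in> X" | y z where "v = y * z" "y \<in> X" "z \<in> X"
          | y a z where "v = y * a * z" "y \<in> X" "a \<in> F" "z \<in> X" by blast
        then show "\<exists>xa y. x * v = xa * y \<and> xa \<in> X \<and> y \<in> X"
        proof cases
          case 1 then show ?thesis using x by blast
        next
          case 2
          then have "x * v = x * y * z" "y \<in> F" using XF by (auto simp: mult.assoc)
          then show ?thesis using 2 x \<open>x * v \<notin> (\<Union>x\<in>X. \<Union>y\<in>X. {x * a * y | a. a \<in> F})\<close> by blast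
        next
          case 3
          then have "x * v = x * (y * a) * z" "y * a \<in> F" using XF F_mult by (auto simp: mult.assoc)
          then show ?thesis using 3 x \<open>x * v \<notin> (\<Union>x\<in>X. \<Union>y\<in>X. {x * a * y | a. a \<in> F})\<close> by blast
        qed
      qed
      finally show ?thesis .
    qed
    then have "(\<lambda>x. x * w) ` X \<subseteq> span ?Y" by blast
    then show "g * w \<in> span ?Y"
      using span_mult_right[of g X w] g X(3) span_minimal[OF _ subspace_span] by blast
  qed simp
  moreover have "fdim ?Y"
  proof (intro fdim_Un fdim_UN X(1))
    show "fdim X" by (rule fdim_finite[OF X(1)])
    show "fdim {x * y | x y. x \<in> X \<and> y \<in> X}" using X(1) by (intro fdim_finite) (simp add: finite_image_set2)
    show "fdim {x * a * y | a. a \<in> F}" if "x \<in> X" "y \<in> X" for x y using F_fdim XF that by auto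
  qed
  ultimately show ?thesis using fdim_span fdim_subset by blast
qed

end

text \<open>The converse nilpotency criterion is assumed by itself and not through positive traces
  of idempotents, so that the quotient by the trace radical, where traces of idempotents are not
  computed, is an instance as well.\<close>

locale talg = trace_alg scale F \<tau> for scale :: "complex \<Rightarrow> 'b::{ring,monoid_mult} \<Rightarrow> 'b" and F \<tau> +
  assumes nil_tr: "a \<in> F \<Longrightarrow> (\<And>k. \<tau> (a ^ Suc k) = 0) \<Longrightarrow> \<exists>n. a ^ n = 0"
begin

text \<open>A trace of the shape \<open>\<tau> (a * b)\<close> with \<open>b\<close> in the
  non-unital algebra reaches the powers of \<open>a\<close> only from the second on;
  \<open>nil_tr\<close> for the square of \<open>a\<close> makes up for the missing first
  power.\<close>

lemma nilpotent_of_tr_powers: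
  assumes "a \<in> F" "\<And>k. \<tau> (a ^ Suc (Suc k)) = 0"
  shows "\<exists>n. a ^ n = 0"
proof -
  have "\<tau> ((a ^ 2) ^ Suc k) = 0" for k
    using assms(2)[of "2 * k"] by (simp only: power_mult[symmetric]) simp
  then obtain n where "(a ^ 2) ^ n = 0"
    using nil_tr[of "a ^ 2"] F_power[OF assms(1), of 1] by (auto simp: numeral_2_eq_2)
  then show ?thesis by (metis power_mult)
qed

text \<open>The radical is taken in the associative envelope and not in the Lie algebra: there it is
  a two-sided nil ideal, so calculations modulo it are calculations in an associative ring.\<close>

definition trad :: "'b set \<Rightarrow> 'b set" where
  "trad G = {a \<in> alg G. \<forall>b\<in>alg G. \<tau> (a * b) = 0}"

lemma subspace_trad: "G \<subseteq> F \<Longrightarrow> subspace (trad G)"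
  unfolding trad_def subspace_def using alg_F[of G]
  by (auto simp: algebra_simps tr_zero tr_add tr_scale F_mult scale_mult_left subsetD intro: alg.intros)

lemma trad_mult_right: "a \<in> trad G \<Longrightarrow> b \<in> alg G \<Longrightarrow> a * b \<in> trad G"
  unfolding trad_def by (auto intro: alg_mult simp: mult.assoc)

lemma trad_mult_left:
  assumes "G \<subseteq> F" "a \<in> trad G" "b \<in> alg G" shows "b * a \<in> trad G"
proof -
  have "\<tau> (b * a * c) = 0" if c: "c \<in> alg G" for c
  proof -
    have "\<tau> (b * (a * c)) = \<tau> (a * c * b)"
      using tr_comm[of b "a * c"] alg_F[OF assms(1)] assms(2,3) c alg_mult unfolding trad_def by blast
    also have "\<dots> = 0" using assms(2,3) c unfolding trad_def by (simp add: mult.assoc alg_mult)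
    finally show ?thesis by (simp add: mult.assoc)
  qed
  then show ?thesis using assms unfolding trad_def by (auto intro: alg_mult)
qed

lemma trad_tr: "G \<subseteq> F \<Longrightarrow> a \<in> trad G \<Longrightarrow> b \<in> alg G \<Longrightarrow> \<tau> (b * a) = 0"
  using tr_comm[of b a] alg_F[of G] unfolding trad_def by auto

lemma trad_nilpotent:
  assumes "G \<subseteq> F" "a \<in> trad G" shows "\<exists>n. a ^ n = 0"
proof (rule nilpotent_of_tr_powers)
  have a: "a \<in> alg G" using assms(2) unfolding trad_def by blast
  then show "a \<in> F" using alg_F[OF assms(1)] by blast
  show "\<tau> (a ^ Suc (Suc k)) = 0" for k
    using assms(2) alg_power[OF a, of k] unfolding trad_def by simp
qed

lemma trad_commutator_power:
  assumes "G \<subseteq> F" "c \<in> alg G" "x \<in> alg G" "commutator c x \<in> trad G"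
  shows "commutator (c ^ Suc k) x \<in> trad G"
proof (induction k)
  case 0 then show ?case using assms by simp
next
  case (Suc k)
  have "commutator (c * c ^ Suc k) x = commutator c x * c ^ Suc k + c * commutator (c ^ Suc k) x"
    by (simp only: commutator_def) (simp add: algebra_simps)
  also have "\<dots> \<in> trad G"
    by (intro subspace_add[OF subspace_trad[OF assms(1)]] trad_mult_right[OF assms(4)]
        trad_mult_left[OF assms(1) Suc assms(2)] alg_power[OF assms(2)])
  finally show ?case by simp
qed

lemma prod_list_alg: "set ys \<subseteq> alg G \<Longrightarrow> b \<in> alg G \<Longrightarrow> prod_list ys * b \<in> alg G"
  by (induction ys) (auto intro: alg_mult simp: mult.assoc)

text \<open>Modulo the radical all letters \<open>x\<close> move to the front. The trailing factor
  \<open>b\<close> keeps the products inside the non-unital \<open>alg G\<close> when the word is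
  empty.\<close>

lemma prod_list_reorder:
  assumes "G \<subseteq> F" "x \<in> alg G" "b \<in> alg G"
  shows "set ys \<subseteq> alg G \<Longrightarrow> (\<And>y. y \<in> set ys \<Longrightarrow> commutator x y \<in> trad G) \<Longrightarrow>
    prod_list ys * b - x ^ length (filter ((=) x) ys) * (prod_list (filter ((\<noteq>) x) ys) * b) \<in> trad G"
proof (induction ys)
  case Nil then show ?case using subspace_0[OF subspace_trad[OF assms(1)]] by simp
next
  case (Cons y ys)
  let ?i = "length (filter ((=) x) ys)"
  let ?w = "prod_list (filter ((\<noteq>) x) ys) * b"
  let ?d = "prod_list ys * b - x ^ ?i * ?w"
  have IH: "?d \<in> trad G" using Cons by auto
  have w: "?w \<in> alg G" using prod_list_alg[of "filter ((\<noteq>) x) ys" G b] Cons.prems(1) assms(3) by auto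
  have y: "y \<in> alg G" using Cons.prems by simp
  show ?case
  proof (cases "y = x")
    case True
    have "prod_list (y # ys) * b - x ^ length (filter ((=) x) (y # ys)) * (prod_list (filter ((\<noteq>) x) (y # ys)) * b) = x * ?d"
      using True by (simp add: algebra_simps)
    then show ?thesis using trad_mult_left[OF assms(1) IH assms(2)] by simp
  next
    case False
    have "commutator (x ^ ?i) y \<in> trad G"
    proof (cases ?i)
      case 0 then show ?thesis using subspace_0[OF subspace_trad[OF assms(1)]] by (simp add: commutator_def)
    next
      case (Suc k) then show ?thesis using trad_commutator_power[OF assms(1,2) y] Cons.prems(2)[of y] by simp
    qed
    then have "y * ?d - commutator (x ^ ?i) y * ?w \<in> trad G"
      by (intro subspace_diff[OF subspace_trad[OF assms(1)]] trad_mult_left[OF assms(1) IH y] trad_mult_right w)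
    moreover have "y * ?d - commutator (x ^ ?i) y * ?w =
      prod_list (y # ys) * b - x ^ length (filter ((=) x) (y # ys)) * (prod_list (filter ((\<noteq>) x) (y # ys)) * b)"
      using False by (simp add: commutator_def algebra_simps)
    ultimately show ?thesis by simp
  qed
qed

text \<open>A pigeonhole argument: in a word of length \<open>n + k\<close> either \<open>x\<close>
  occurs \<open>k\<close> times and, collected in front, gives zero, or at least \<open>n\<close>
  other letters remain and the induction hypothesis applies to them.\<close>

lemma nilpotent_words:
  assumes "G \<subseteq> F" "finite X" "X \<subseteq> alg G" "\<And>x y. x \<in> X \<Longrightarrow> y \<in> X \<Longrightarrow> commutator x y \<in> trad G"
    and "\<And>x. x \<in> X \<Longrightarrow> \<exists>k. x ^ k = 0"
  shows "\<exists>n. \<forall>ys b. set ys \<subseteq> X \<and> n \<le> length ys \<and> b \<in> alg G \<longrightarrow> prod_list ys * b \<in> trad G"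
  using assms(2-5)
proof (induction X rule: finite_induct)
  case empty then show ?case by (intro exI[of _ 1]) auto
next
  case (insert x X)
  then obtain n where n: "\<And>ys b. set ys \<subseteq> X \<Longrightarrow> n \<le> length ys \<Longrightarrow> b \<in> alg G \<Longrightarrow> prod_list ys * b \<in> trad G"
    by (metis insert_iff insert_subset)
  obtain k where k: "x ^ k = 0" using insert.prems by blast
  have sub: "subspace (trad G)" by (rule subspace_trad[OF assms(1)])
  have "prod_list ys * b \<in> trad G" if ys: "set ys \<subseteq> insert x X" "n + k \<le> length ys" "b \<in> alg G" for ys b
  proof -
    let ?i = "length (filter ((=) x) ys)"
    let ?zs = "filter ((\<noteq>) x) ys"
    have d: "prod_list ys * b - x ^ ?i * (prod_list ?zs * b) \<in> trad G"
      using ys insert.prems by (intro prod_list_reorder[OF assms(1)]) auto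
    have "x ^ ?i * (prod_list ?zs * b) \<in> trad G"
    proof (cases "k \<le> ?i")
      case True
      then have "x ^ ?i = 0" using k by (metis le_add_diff_inverse power_add mult_zero_left)
      then show ?thesis using sub subspace_0 by simp
    next
      case False
      have "?i + length ?zs = length ys" by (rule sum_length_filter_compl)
      then have "prod_list ?zs * b \<in> trad G" using False ys by (intro n) auto
      moreover have "?i = 0 \<or> x ^ ?i \<in> alg G" using alg_power[of x G "?i - 1"] insert.prems by (cases ?i) auto
      ultimately show ?thesis using trad_mult_left[OF assms(1)] by auto
    qed
    then have "(prod_list ys * b - x ^ ?i * (prod_list ?zs * b)) + x ^ ?i * (prod_list ?zs * b) \<in> trad G"
      using subspace_add[OF sub d] by blast
    then show ?thesis by simp
  qed
  then show ?case by blast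
qed

text \<open>In characteristic 0 the bracket of \<open>h\<close> with an ideal that is abelian modulo the trace radical
  consists of elements with vanishing power traces, hence of commuting nilpotent elements.\<close>
lemma commutator_ideal_trad:
  assumes h: "h \<subseteq> F" "lsub h" "fdim h" and I: "lideal h I"
    and ab: "\<And>x y. x \<in> I \<Longrightarrow> y \<in> I \<Longrightarrow> commutator x y \<in> trad h"
    and xy: "x \<in> I" "y \<in> h"
  shows "commutator x y \<in> trad h"
proof -
  let ?A = "alg h"
  note sub = subspace_trad[OF h(1)]
  have hA: "h \<subseteq> ?A" by (auto intro: alg.base)
  have AF: "?A \<subseteq> F" by (rule alg_F[OF h(1)])
  have hH: "h \<subseteq> homog" using h(1) F_homog by (rule subset_trans)
  have Ih: "I \<subseteq> h" using I unfolding lideal_def by blast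
  define C where "C = span {commutator x y | x y. x \<in> I \<and> y \<in> h}"
  have CI: "C \<subseteq> I" unfolding C_def
    using lideal_commutator'[OF I] I unfolding lideal_def by (intro span_minimal) auto
  have CA: "C \<subseteq> ?A" using CI Ih hA by blast
  have yC: "commutator y c \<in> C" if y: "y \<in> h" and c: "c \<in> C" for y c
  proof -
    have gen: "commutator a b \<in> C" if "a \<in> I" "b \<in> h" for a b
      unfolding C_def by (rule span_base) (use that in blast)
    have "commutator y (commutator a b) \<in> C" if ab: "a \<in> I" "b \<in> h" for a b
    proof -
      have "commutator (commutator y a) b \<in> C"
        using gen ab y I unfolding lideal_def by blast
      moreover have "commutator a (commutator y b) \<in> C"
        using gen ab y h(2) unfolding lsub_def by blast
      ultimately show ?thesis
        unfolding commutator_jacobi[of y] C_def by (rule span_add)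
    qed
    then have "{commutator x y | x y. x \<in> I \<and> y \<in> h} \<subseteq> {c. commutator y c \<in> C}" by blast
    moreover have "subspace {c. commutator y c \<in> C}"
      using y hH by (intro subspace_commutator_preimage) (auto simp: C_def)
    ultimately have "C \<subseteq> {c. commutator y c \<in> C}"
      by (subst C_def) (rule span_minimal)
    then show ?thesis using c by blast
  qed
  \<comment> \<open>For a generator \<open>commutator a b\<close> of \<open>C\<close> the trace
    becomes that of \<open>b * commutator (c ^ Suc k) a\<close>, and \<open>c\<close> commutes with
    \<open>a\<close> modulo the radical since both lie in \<open>I\<close>.\<close>
  have tr0: "\<tau> (c' * c ^ Suc k) = 0" if "c' \<in> C" "c \<in> C" for c c' k
  proof -
    have cA: "c ^ Suc k \<in> ?A" using alg_power that CA by blast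
    have "C \<subseteq> {c'. c' \<in> F \<and> \<tau> (c' * c ^ Suc k) = 0}" unfolding C_def
    proof (intro span_minimal)
      show "subspace {c'. c' \<in> F \<and> \<tau> (c' * c ^ Suc k) = 0}"
        using cA AF unfolding subspace_def
        by (auto simp: F_zero tr_zero F_add F_scale distrib_right tr_add tr_scale F_mult scale_mult_left subsetD)
      show "{commutator x y | x y. x \<in> I \<and> y \<in> h} \<subseteq> {c'. c' \<in> F \<and> \<tau> (c' * c ^ Suc k) = 0}"
      proof clarify
        fix a b assume ab': "a \<in> I" "b \<in> h"
        then have aF: "a \<in> F" "b \<in> F" "a \<in> ?A" "b \<in> ?A" using Ih h hA by auto
        have "commutator c a \<in> trad h" using ab ab' that CI by blast
        then have "commutator (c ^ Suc k) a \<in> trad h"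
          using trad_commutator_power[OF h(1)] that CA aF by blast
        then have "\<tau> (b * commutator (c ^ Suc k) a) = 0" using trad_tr[OF h(1)] aF by blast
        then show "commutator a b \<in> F \<and> \<tau> (commutator a b * c ^ Suc k) = 0"
          using tr_invariant'[of a b "c ^ Suc k"] aF cA AF F_commutator by auto
      qed
    qed
    then show ?thesis using that by blast
  qed
  have Cnil: "\<exists>n. c ^ n = 0" if "c \<in> C" for c
    using that tr0[OF that that] CA AF by (intro nilpotent_of_tr_powers) (auto simp: subset_iff)
  obtain X where X: "finite X" "X \<subseteq> C" "C \<subseteq> span X"
    using fdim_basis[OF fdim_subset[OF h(3)], of C] CI Ih by blast
  obtain n where n: "\<And>ys b. set ys \<subseteq> X \<Longrightarrow> n \<le> length ys \<Longrightarrow> b \<in> ?A \<Longrightarrow> prod_list ys * b \<in> trad h"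
  proof -
    have "\<exists>n. \<forall>ys b. set ys \<subseteq> X \<and> n \<le> length ys \<and> b \<in> ?A \<longrightarrow> prod_list ys * b \<in> trad h"
    proof (rule nilpotent_words[OF h(1) X(1)])
      show "X \<subseteq> ?A" using X(2) CA by (rule subset_trans)
      have "X \<subseteq> I" using X(2) CI by (rule subset_trans)
      then show "commutator x y \<in> trad h" if "x \<in> X" "y \<in> X" for x y using ab that by auto
      show "\<exists>k. x ^ k = 0" if "x \<in> X" for x using Cnil that X(2) by auto
    qed
    then show ?thesis using that by blast
  qed
  \<comment> \<open>\<open>Q m\<close> is \<open>C^m A\<close> plus the radical. It is a left ideal
    of \<open>?A\<close> because \<open>[h, C]\<close> lies in \<open>C\<close>. Hence positive
    powers \<open>(c * a) ^ m\<close> fall into \<open>Q m\<close>, and \<open>Q n\<close> is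
    already contained in the radical.\<close>
  define Q where "Q = rec_nat ?A (\<lambda>_ q. span ({c * a | c a. c \<in> X \<and> a \<in> q} \<union> trad h))"
  have Q0: "Q 0 = ?A" and QS: "Q (Suc m) = span ({c * a | c a. c \<in> X \<and> a \<in> Q m} \<union> trad h)" for m
    by (simp_all add: Q_def)
  have subQ: "subspace (Q m)" for m by (cases m) (simp_all add: Q0 QS subspace_alg)
  have NQ: "trad h \<subseteq> Q m" for m
    by (cases m) (auto simp: Q0 QS trad_def intro: span_base)
  have CQ: "c * a \<in> Q (Suc m)" if "c \<in> C" "a \<in> Q m" for c a m
  proof -
    have "c \<in> span X" using that X by blast
    then have "c * a \<in> span ((\<lambda>x. x * a) ` X)" by (rule span_mult_right)
    also have "\<dots> \<subseteq> Q (Suc m)" unfolding QS using that by (intro span_mono) blast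
    finally show ?thesis .
  qed
  have yQ: "y * q \<in> Q m" if "y \<in> h" "q \<in> Q m" for y q m
    using that
  proof (induction m arbitrary: q)
    case 0 then show ?case by (auto simp: Q0 intro: alg.mult)
  next
    case (Suc m)
    have "Q (Suc m) \<subseteq> {q. y * q \<in> Q (Suc m)}"
    proof (subst QS, rule span_minimal)
      show "subspace {q. y * q \<in> Q (Suc m)}"
        using subQ[of "Suc m"] homogD[of y] Suc.prems(1) hH unfolding subspace_def
        by (auto simp: distrib_left)
      show "{c * a | c a. c \<in> X \<and> a \<in> Q m} \<union> trad h \<subseteq> {q. y * q \<in> Q (Suc m)}"
      proof (intro Un_least subsetI; clarify)
        fix c a assume ca: "c \<in> X" "a \<in> Q m"
        have "y * (c * a) = commutator y c * a + c * (y * a)"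
          by (simp add: commutator_def algebra_simps)
        also have "\<dots> \<in> Q (Suc m)"
          using ca X yC[OF Suc.prems(1)] Suc.IH[OF Suc.prems(1) ca(2)]
          by (intro subspace_add[OF subQ] CQ) auto
        finally show "y * (c * a) \<in> Q (Suc m)" .
      next
        fix q assume "q \<in> trad h"
        then show "y * q \<in> Q (Suc m)" using trad_mult_left[OF h(1)] Suc.prems hA NQ by blast
      qed
    qed
    then show ?case using Suc by blast
  qed
  have AQ: "a * q \<in> Q m" if "a \<in> ?A" "q \<in> Q m" for a q m
    using that(1)
  proof (induction rule: alg.induct)
    case (mult x a) then show ?case using yQ by (simp add: mult.assoc)
  next
    case (base x) then show ?case using yQ that by blast
  qed (use subQ that in \<open>auto simp: distrib_right scale_mult_left intro: subspace_0 subspace_add subspace_scale\<close>)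
  have "Q n \<subseteq> trad h"
  proof -
    have "Q m \<subseteq> span ({prod_list ys * b | ys b. set ys \<subseteq> X \<and> length ys = m \<and> b \<in> ?A} \<union> trad h)" (is "_ \<subseteq> ?W m") for m
    proof (induction m)
      case 0 show ?case unfolding Q0 by (auto intro: span_base)
    next
      case (Suc m)
      have "c * a \<in> ?W (Suc m)" if ca: "c \<in> X" "a \<in> Q m" for c a
      proof -
        have cA: "c \<in> ?A" using ca X CA by blast
        have "a \<in> ?W m" using Suc ca by blast
        then have "c * a \<in> span ((\<lambda>x. c * x) ` ({prod_list ys * b | ys b. set ys \<subseteq> X \<and> length ys = m \<and> b \<in> ?A} \<union> trad h))"
          using cA AF F_homog by (intro span_mult_left) auto
        also have "\<dots> \<subseteq> ?W (Suc m)"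
        proof (intro span_minimal subspace_span; clarify)
          fix z assume "z \<in> {prod_list ys * b | ys b. set ys \<subseteq> X \<and> length ys = m \<and> b \<in> ?A} \<union> trad h"
          then consider ys b where "z = prod_list ys * b" "set ys \<subseteq> X" "length ys = m" "b \<in> ?A" | "z \<in> trad h" by blast
          then show "c * z \<in> ?W (Suc m)"
          proof cases
            case 1
            have "c * z = prod_list (c # ys) * b" using 1 by (simp add: mult.assoc)
            moreover have "prod_list (c # ys) * b \<in> {prod_list ys * b | ys b. set ys \<subseteq> X \<and> length ys = Suc m \<and> b \<in> ?A}"
              unfolding mem_Collect_eq by (rule exI[of _ "c # ys"], rule exI[of _ b]) (use 1 ca in auto)
            ultimately show ?thesis by (auto intro: span_base)
          next
            case 2
            then show ?thesis using trad_mult_left[OF h(1) 2 cA] by (auto intro: span_base)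
          qed
        qed
        finally show ?thesis .
      qed
      then show ?case unfolding QS by (intro span_minimal subspace_span) (auto intro: span_base)
    qed
    then have "Q n \<subseteq> ?W n" .
    also have "\<dots> \<subseteq> span (trad h)" using n by (intro span_mono) auto
    finally have "Q n \<subseteq> span (trad h)" .
    moreover have "span (trad h) = trad h" using sub by (simp only: span_eq_iff)
    ultimately show ?thesis by simp
  qed
  have "\<tau> (c * a) = 0" if ca: "c \<in> C" "a \<in> ?A" for c a
  proof -
    have caA: "c * a \<in> ?A" using ca CA by (auto intro: alg_mult)
    have "(c * a) ^ Suc m \<in> Q (Suc m)" for m
    proof (induction m)
      case 0 show ?case using CQ[OF ca(1), of a 0] ca by (simp add: Q0)
    next
      case (Suc m)
      have "c * (a * (c * a) ^ Suc m) \<in> Q (Suc (Suc m))" by (intro CQ ca AQ Suc)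
      then show ?case by (simp add: mult.assoc)
    qed
    moreover have "Q (Suc n) \<subseteq> Q n"
      unfolding QS[of n] using X CA AQ NQ by (intro span_minimal subQ) blast
    ultimately have "(c * a) ^ Suc n \<in> trad h" using \<open>Q n \<subseteq> trad h\<close> by blast
    then obtain k where "((c * a) ^ Suc n) ^ k = 0" using trad_nilpotent[OF h(1)] by blast
    then show ?thesis using tr_zero_of_power_nilpotent caA AF by blast
  qed
  moreover have "commutator x y \<in> C" unfolding C_def using xy by (intro span_base) blast
  ultimately show ?thesis unfolding trad_def using CA by blast
qed

text \<open>Pairing a power of \<open>x\<close> with \<open>[a, b]\<close> moves the bracket to
  \<open>[b, x^k]\<close>, which is zero modulo the radical. So \<open>x\<close> is nilpotent. As
  \<open>x\<close> commutes with the envelope modulo the radical, \<open>(x * a)^m\<close> agrees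
  there with \<open>x^m * a^m\<close>, and every \<open>x * a\<close> is nilpotent too.\<close>

lemma central_derived_trad:
  assumes h: "h \<subseteq> F" "lsub h" and x: "x \<in> lder h" "\<And>y. y \<in> h \<Longrightarrow> commutator x y \<in> trad h"
  shows "x \<in> trad h"
proof -
  let ?A = "alg h"
  note sub = subspace_trad[OF h(1)]
  have hA: "h \<subseteq> ?A" by (auto intro: alg.base)
  have AF: "?A \<subseteq> F" by (rule alg_F[OF h(1)])
  have xh: "x \<in> h" using x lder_subset[OF h(2)] by blast
  then have xA: "x \<in> ?A" and xF: "x \<in> F" using hA AF by auto
  have xa: "commutator x a \<in> trad h" if "a \<in> ?A" for a
    using that
  proof (induction rule: alg.induct)
    case (mult y a)
    then show ?case unfolding commutator_mult
      using x(2) hA by (intro subspace_add[OF sub] trad_mult_left[OF h(1)] trad_mult_right) auto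
  qed (use sub x(2) xF F_homog in \<open>auto simp: commutator_add_right commutator_scale_right subset_iff intro: subspace_0 subspace_add subspace_scale\<close>)
  have "\<tau> (x' * x ^ Suc k) = 0" if "x' \<in> lder h" for x' k
  proof -
    have "x' \<in> {x'. x' \<in> F \<and> \<tau> (x' * x ^ Suc k) = 0}"
    proof (rule lder_induct[OF that])
      have "x ^ Suc k \<in> F" using xF by (rule F_power)
      then show "subspace {x'. x' \<in> F \<and> \<tau> (x' * x ^ Suc k) = 0}" unfolding subspace_def
        by (auto simp: F_zero tr_zero F_add F_scale distrib_right tr_add tr_scale F_mult scale_mult_left)
      fix a b assume ab: "a \<in> h" "b \<in> h"
      have "commutator x b \<in> trad h" using x ab by blast
      then have "commutator (x ^ Suc k) b \<in> trad h"
        using trad_commutator_power[OF h(1) xA] ab hA by blast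
      then have "commutator b (x ^ Suc k) \<in> trad h"
        using subspace_neg[OF sub] commutator_minus by metis
      then have "\<tau> (a * commutator b (x ^ Suc k)) = 0" using trad_tr[OF h(1)] ab hA by blast
      then show "commutator a b \<in> {x'. x' \<in> F \<and> \<tau> (x' * x ^ Suc k) = 0}"
        using tr_invariant[of a b "x ^ Suc k"] ab h(1) \<open>x ^ Suc k \<in> F\<close> F_commutator by auto
    qed
    then show ?thesis by blast
  qed
  then have "\<exists>n. x ^ n = 0"
    using x(1) by (intro nilpotent_of_tr_powers[OF xF]) auto
  then obtain n where n: "x ^ Suc n = 0" by (metis power_Suc mult_zero_right)
  have "\<tau> (x * a) = 0" if a: "a \<in> ?A" for a
  proof -
    have xaA: "x * a \<in> ?A" using a xA by (auto intro: alg_mult)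
    have "(x * a) ^ Suc m - x ^ Suc m * a ^ Suc m \<in> trad h" for m
    proof (induction m)
      case 0 then show ?case using subspace_0[OF sub] by simp
    next
      case (Suc m)
      have "commutator (x ^ Suc m) a \<in> trad h" using trad_commutator_power[OF h(1) xA a xa[OF a]] .
      then have "x * a * ((x * a) ^ Suc m - x ^ Suc m * a ^ Suc m) - x * (commutator (x ^ Suc m) a * a ^ Suc m) \<in> trad h"
        by (intro subspace_diff[OF sub] trad_mult_left[OF h(1)] trad_mult_right Suc xaA xA alg_power a)
      moreover have "x * a * ((x * a) ^ Suc m - x ^ Suc m * a ^ Suc m) - x * (commutator (x ^ Suc m) a * a ^ Suc m)
        = (x * a) ^ Suc (Suc m) - x ^ Suc (Suc m) * a ^ Suc (Suc m)"
        unfolding commutator_def power_Suc[of _ "Suc m"] by (simp only: algebra_simps)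
      ultimately show ?case by simp
    qed
    from this[of n] have "(x * a) ^ Suc n \<in> trad h" using n by simp
    then obtain k where "((x * a) ^ Suc n) ^ k = 0" using trad_nilpotent[OF h(1)] by blast
    then show ?thesis using tr_zero_of_power_nilpotent xaA AF by blast
  qed
  then show ?thesis unfolding trad_def using xA by blast
qed

text \<open>Induction along the derived series: by the hypothesis for \<open>lder I\<close>, the
  brackets inside \<open>I\<close> lie in the radical. So \<open>I\<close> is abelian modulo the
  radical, then central modulo it, and central elements of \<open>lder h\<close> lie in it.\<close>

lemma solvable_ideal_trad:
  assumes h: "h \<subseteq> F" "lsub h" "fdim h" and "lideal h I" "ders I n = {0}"
  shows "I \<inter> lder h \<subseteq> trad h" "\<And>x y. x \<in> I \<Longrightarrow> y \<in> h \<Longrightarrow> commutator x y \<in> trad h"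
proof -
  have "I \<inter> lder h \<subseteq> trad h \<and> (\<forall>x\<in>I. \<forall>y\<in>h. commutator x y \<in> trad h)"
    using assms(4,5)
  proof (induction n arbitrary: I)
    case 0
    then show ?case using subspace_0[OF subspace_trad[OF h(1)]] by (auto simp: commutator_def)
  next
    case (Suc n)
    have Ih: "I \<subseteq> h" using Suc.prems unfolding lideal_def by blast
    have "lideal h (lder I)" using lideal_lder Suc.prems h(1) F_homog by blast
    then have "lder I \<inter> lder h \<subseteq> trad h" using Suc unfolding ders_Suc' by blast
    then have "commutator x y \<in> trad h" if "x \<in> I" "y \<in> I" for x y
      using that commutator_in_lder lder_mono[OF Ih] by blast
    then have *: "commutator x y \<in> trad h" if "x \<in> I" "y \<in> h" for x y
      using commutator_ideal_trad[OF h Suc.prems(1)] that by blast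
    then show ?case using central_derived_trad[OF h(1,2)] by blast
  qed
  then show "I \<inter> lder h \<subseteq> trad h" "\<And>x y. x \<in> I \<Longrightarrow> y \<in> h \<Longrightarrow> commutator x y \<in> trad h" by blast+
qed

end

section \<open>Spectral idempotents\<close>

lemma linear_poly_bezout:
  fixes q :: "complex poly"
  assumes "poly q \<kappa> \<noteq> 0"
  shows "\<exists>u v. u * [:-\<kappa>, 1:] ^ m + v * q = 1"
proof (induction m)
  case 0 then show ?case by (intro exI[of _ 1] exI[of _ 0]) simp
next
  case (Suc m)
  define X where "X = [:-\<kappa>, 1:]"
  obtain u v where uv: "u * X ^ m + v * q = 1" using Suc unfolding X_def by blast
  have "X dvd q - [:poly q \<kappa>:]" by (simp add: poly_eq_0_iff_dvd[symmetric] X_def)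
  then obtain s where s: "q - [:poly q \<kappa>:] = X * s" by (elim dvdE)
  define k where "k = [:inverse (poly q \<kappa>):]"
  have k1: "k * [:poly q \<kappa>:] = 1" using assms by (simp add: k_def one_pCons)
  have "q - X * s = [:poly q \<kappa>:]" using s by (simp only: algebra_simps)
  then have "k * (q - X * s) = k * [:poly q \<kappa>:]" by (simp only:)
  \<comment> \<open>The inserted factor is 1, written as \<open>k * (q - X * s)\<close>; it raises
    the power of \<open>X\<close> by one at the cost of a multiple of \<open>q\<close>.\<close>
  then have "u * X ^ m * (k * (q - X * s)) + v * q = 1" using uv k1 by simp
  then have "(- u * k * s) * X ^ Suc m + (u * X ^ m * k + v) * q = 1"
    by (simp add: algebra_simps)
  then show ?case unfolding X_def by blast
qed

lemma linear_power_poly_neq_0: "\<kappa> \<noteq> \<mu> \<Longrightarrow> poly ([:-\<mu>, 1:] ^ m) \<kappa> \<noteq> (0::complex)"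
  by (simp add: poly_power)

lemma bezout_mult_dvd:
  fixes a b g :: "complex poly"
  assumes "u * a + v * b = 1" "a dvd g" "b dvd g" shows "a * b dvd g"
proof -
  have "g = u * a * g + v * b * g" using assms(1) by (metis distrib_right mult_1)
  moreover have "a * b dvd u * a * g" "a * b dvd v * b * g"
    using assms(2,3) by (auto elim!: dvdE)
  ultimately show ?thesis by (metis dvd_add)
qed

lemma prod_linear_powers_dvd:
  fixes g :: "complex poly"
  assumes "finite \<Lambda>" "\<And>\<kappa>. \<kappa> \<in> \<Lambda> \<Longrightarrow> [:-\<kappa>, 1:] ^ m dvd g"
  shows "(\<Prod>\<kappa>\<in>\<Lambda>. [:-\<kappa>, 1:] ^ m) dvd g"
  using assms
proof (induction \<Lambda> rule: finite_induct)
  case (insert \<kappa> \<Lambda>)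
  have "poly (\<Prod>\<mu>\<in>\<Lambda>. [:-\<mu>, 1:] ^ m) \<kappa> \<noteq> 0"
    using insert.hyps by (auto simp: poly_prod poly_power)
  then obtain u v where "u * [:-\<kappa>, 1:] ^ m + v * (\<Prod>\<mu>\<in>\<Lambda>. [:-\<mu>, 1:] ^ m) = 1"
    using linear_poly_bezout by blast
  then show ?case using bezout_mult_dvd insert by simp
qed simp

text \<open>\<open>E \<kappa>\<close> represents the idempotent of the Chinese remainder theorem
  modulo \<open>P\<close> that is 1 at the factor for \<open>\<kappa>\<close> and 0 at the others.
  It is a Bezout multiple of the product \<open>q \<kappa>\<close> of the other factors.\<close>

lemma crt_idempotents:
  fixes \<Lambda> :: "complex set" and m :: nat
  assumes "finite \<Lambda>"
  defines "P \<equiv> \<Prod>\<kappa>\<in>\<Lambda>. [:-\<kappa>, 1:] ^ m"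
  obtains E where "\<And>\<kappa>. \<kappa> \<in> \<Lambda> \<Longrightarrow> P dvd [:-\<kappa>, 1:] ^ m * E \<kappa>"
    "\<And>\<kappa>. \<kappa> \<in> \<Lambda> \<Longrightarrow> P dvd E \<kappa> * (E \<kappa> - 1)"
    "\<And>\<kappa> \<mu>. \<kappa> \<in> \<Lambda> \<Longrightarrow> \<mu> \<in> \<Lambda> \<Longrightarrow> \<mu> \<noteq> \<kappa> \<Longrightarrow> [:-\<mu>, 1:] ^ m dvd E \<kappa>"
    "P dvd (\<Sum>\<kappa>\<in>\<Lambda>. E \<kappa>) - 1"
proof -
  define q where "q \<kappa> = (\<Prod>\<mu>\<in>\<Lambda> - {\<kappa>}. [:-\<mu>, 1:] ^ m)" for \<kappa> :: complex
  have Pq: "P = [:-\<kappa>, 1:] ^ m * q \<kappa>" if "\<kappa> \<in> \<Lambda>" for \<kappa>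
    unfolding P_def q_def using prod.remove[OF assms(1) that] by blast
  have "poly (q \<kappa>) \<kappa> \<noteq> 0" for \<kappa>
    using assms(1) by (auto simp: q_def poly_prod poly_power)
  then have "\<forall>\<kappa>. \<exists>u v. u * [:-\<kappa>, 1:] ^ m + v * q \<kappa> = 1" using linear_poly_bezout by blast
  then obtain u v where uv: "\<And>\<kappa>. u \<kappa> * [:-\<kappa>, 1:] ^ m + v \<kappa> * q \<kappa> = 1" by metis
  define E where "E \<kappa> = v \<kappa> * q \<kappa>" for \<kappa>
  have E1: "E \<kappa> - 1 = - u \<kappa> * [:-\<kappa>, 1:] ^ m" for \<kappa> using uv[of \<kappa>] by (simp add: E_def algebra_simps)
  have Eo: "[:-\<mu>, 1:] ^ m dvd E \<kappa>" if "\<mu> \<in> \<Lambda>" "\<mu> \<noteq> \<kappa>" for \<kappa> \<mu>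
    unfolding E_def q_def using assms(1) that by (intro dvd_mult dvd_prodI) auto
  show ?thesis
  proof (rule that[of E])
    show "P dvd [:-\<kappa>, 1:] ^ m * E \<kappa>" if "\<kappa> \<in> \<Lambda>" for \<kappa>
      unfolding Pq[OF that] E_def by (intro mult_dvd_mono) auto
    show "P dvd E \<kappa> * (E \<kappa> - 1)" if "\<kappa> \<in> \<Lambda>" for \<kappa>
      unfolding E1 Pq[OF that] unfolding E_def mult.commute[of "[:-\<kappa>, 1:] ^ m"] by (intro mult_dvd_mono) auto
    show "[:-\<mu>, 1:] ^ m dvd E \<kappa>" if "\<kappa> \<in> \<Lambda>" "\<mu> \<in> \<Lambda>" "\<mu> \<noteq> \<kappa>" for \<kappa> \<mu> using Eo that by blast
    show "P dvd (\<Sum>\<kappa>\<in>\<Lambda>. E \<kappa>) - 1" unfolding P_def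
    proof (rule prod_linear_powers_dvd[OF assms(1)])
      fix \<mu> assume \<mu>: "\<mu> \<in> \<Lambda>"
      have "(\<Sum>\<kappa>\<in>\<Lambda>. E \<kappa>) - 1 = (E \<mu> - 1) + (\<Sum>\<kappa>\<in>\<Lambda> - {\<mu>}. E \<kappa>)"
        by (subst sum.remove[OF assms(1) \<mu>]) simp
      moreover have "[:-\<mu>, 1:] ^ m dvd E \<mu> - 1" unfolding E1 by simp
      moreover have "[:-\<mu>, 1:] ^ m dvd (\<Sum>\<kappa>\<in>\<Lambda> - {\<mu>}. E \<kappa>)" using Eo \<mu> by (intro dvd_sum) auto
      ultimately show "[:-\<mu>, 1:] ^ m dvd (\<Sum>\<kappa>\<in>\<Lambda>. E \<kappa>) - 1" by (simp only: dvd_add)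
    qed
  qed
qed

text \<open>One exponent serves all roots: a further root is absorbed by adding it to the set and
  raising the common exponent by one.\<close>

lemma complex_poly_dvd_linear_powers:
  fixes p :: "complex poly"
  assumes "p \<noteq> 0"
  shows "\<exists>\<Lambda> m. finite \<Lambda> \<and> p dvd (\<Prod>\<kappa>\<in>\<Lambda>. [:-\<kappa>, 1:] ^ m)"
  using assms
proof (induction "degree p" arbitrary: p)
  case 0
  then obtain c where "p = [:c:]" "c \<noteq> 0" by (metis degree_eq_zeroE pCons_0_0)
  then have "1 = p * [:inverse c:]" by (simp add: one_pCons)
  then show ?case by (intro exI[of _ "{}"]) (metis dvdI finite.emptyI prod.empty)
next
  case (Suc n)
  then have "\<not> constant (poly p)" by (simp add: constant_degree)
  then obtain \<kappa> where "poly p \<kappa> = 0" using fundamental_theorem_of_algebra by blast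
  then obtain q where q: "p = [:-\<kappa>, 1:] * q" by (auto simp: poly_eq_0_iff_dvd elim: dvdE)
  then have "q \<noteq> 0" using Suc.prems by auto
  then have "degree p = Suc (degree q)" unfolding q by (subst degree_mult_eq) auto
  then obtain \<Lambda> m where L: "finite \<Lambda>" "q dvd (\<Prod>\<kappa>\<in>\<Lambda>. [:-\<kappa>, 1:] ^ m)"
    using Suc.hyps(1)[of q] Suc.hyps(2) \<open>q \<noteq> 0\<close> by auto
  have "(\<Prod>\<kappa>\<in>\<Lambda>. [:-\<kappa>, 1:] ^ m) dvd (\<Prod>\<mu>\<in>insert \<kappa> \<Lambda>. [:-\<mu>, 1:] ^ m)"
    using L(1) by (intro prod_dvd_prod_subset) auto
  moreover have "[:-\<kappa>, 1:] dvd (\<Prod>\<mu>\<in>insert \<kappa> \<Lambda>. [:-\<mu>, 1:])"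
    using L(1) by (intro dvd_prodI) auto
  ultimately have "p dvd (\<Prod>\<mu>\<in>insert \<kappa> \<Lambda>. [:-\<mu>, 1:]) * (\<Prod>\<mu>\<in>insert \<kappa> \<Lambda>. [:-\<mu>, 1:] ^ m)"
    unfolding q using L(2) dvd_trans by (intro mult_dvd_mono) blast+
  also have "\<dots> = (\<Prod>\<mu>\<in>insert \<kappa> \<Lambda>. [:-\<mu>, 1:] ^ Suc m)" by (simp only: prod.distrib[symmetric] power_Suc)
  finally show ?case using L(1) by blast
qed

section \<open>Polynomials acting through a linear operator\<close>

context cvs
begin

definition lin :: "('b \<Rightarrow> 'b) \<Rightarrow> bool" where "lin f \<longleftrightarrow> lin_on UNIV f"

text \<open>The vector \<open>p(f) z\<close>, by Horner's scheme. The operator stays a parameter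
  because both left multiplications and inner derivations are inserted for it.\<close>

definition pact :: "('b \<Rightarrow> 'b) \<Rightarrow> complex poly \<Rightarrow> 'b \<Rightarrow> 'b" where
  "pact f p z = fold_coeffs (\<lambda>c r. scale c z + f r) p 0"

lemma lin_add: "lin f \<Longrightarrow> f (x + y) = f x + f y" and lin_scale: "lin f \<Longrightarrow> f (scale c x) = scale c (f x)"
  unfolding lin_def lin_on_def by auto

lemma lin_0: "lin f \<Longrightarrow> f 0 = 0" using lin_scale[of f 0 0] by simp

lemma pact_0 [simp]: "pact f 0 z = 0" by (simp add: pact_def)

lemma pact_pCons: "lin f \<Longrightarrow> pact f (pCons c p) z = scale c z + f (pact f p z)"
  by (cases "p = 0 \<and> c = 0") (auto simp: pact_def lin_0)

lemma pact_const: "lin f \<Longrightarrow> pact f [:c:] z = scale c z" by (simp add: pact_pCons lin_0)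

lemma pact_1: "lin f \<Longrightarrow> pact f 1 z = z" by (simp add: one_pCons pact_const)

lemma pact_add: "lin f \<Longrightarrow> pact f (p + q) z = pact f p z + pact f q z"
  by (induction p q rule: poly_induct2) (simp_all add: pact_pCons lin_add scale_left_distrib algebra_simps)

lemma pact_smult: "lin f \<Longrightarrow> pact f (smult c p) z = scale c (pact f p z)"
  by (induction p) (simp_all add: pact_pCons lin_scale scale_right_distrib)

lemma pact_diff: "lin f \<Longrightarrow> pact f (p - q) z = pact f p z - pact f q z"
  using pact_add[of f p "- q" z] pact_smult[of f "-1" q z] by simp

lemma pact_mult: "lin f \<Longrightarrow> pact f (p * q) z = pact f p (pact f q z)"
  by (induction p) (simp_all add: pact_pCons pact_add pact_smult)

lemma pact_lin: "lin f \<Longrightarrow> lin (pact f p)"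
proof (induction p)
  case 0 then show ?case by (simp add: lin_def lin_on_def)
next
  case (pCons c p)
  then show ?case unfolding lin_def[of "pact f (pCons c p)"] lin_on_def
    by (simp add: pact_pCons lin_add lin_scale scale_right_distrib algebra_simps)
qed

lemma pact_zero: "lin f \<Longrightarrow> pact f p 0 = 0" using pact_lin lin_0 by blast

lemma pact_dvd: "lin f \<Longrightarrow> p dvd q \<Longrightarrow> pact f p z = 0 \<Longrightarrow> pact f q z = 0"
  by (elim dvdE) (simp add: mult.commute[of p] pact_mult pact_zero)

lemma pact_sum: "lin f \<Longrightarrow> pact f (\<Sum>i\<in>I. p i) z = (\<Sum>i\<in>I. pact f (p i) z)"
  by (induction I rule: infinite_finite_induct) (simp_all add: pact_add)

lemma pact_closed:
  assumes "lin f" "subspace Q" "\<And>y. y \<in> Q \<Longrightarrow> f y \<in> Q" "z \<in> Q" shows "pact f p z \<in> Q"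
proof (induction p)
  case (pCons c p)
  have "scale c z + f (pact f p z) \<in> Q"
    by (intro subspace_add subspace_scale assms pCons)
  then show ?case using assms(1) by (simp add: pact_pCons)
qed (simp add: subspace_0[OF assms(2)])

lemma annihilating_poly:
  assumes "lin f" "subspace Q" "fdim Q" "\<And>y. y \<in> Q \<Longrightarrow> f y \<in> Q" "z \<in> Q"
  shows "\<exists>p. p \<noteq> 0 \<and> pact f p z = 0"
proof (rule ccontr)
  assume neg: "\<not> ?thesis"
  \<comment> \<open>Values at \<open>z\<close> of polynomials of degree below \<open>n\<close>;
    bounding the coefficients instead of \<open>degree\<close> makes \<open>W 0\<close> the zero
    space. Without an annihilating polynomial each \<open>W n\<close> would be strictly larger than
    the one before, inside the finite-dimensional \<open>Q\<close>.\<close>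
  define W where "W n = {pact f q z | q. \<forall>i\<ge>n. coeff q i = 0}" for n
  have sub: "subspace (W n)" for n
  proof (rule subspaceI)
    show "0 \<in> W n" unfolding W_def by (intro CollectI exI[of _ 0]) simp
  next
    fix x y assume "x \<in> W n" "y \<in> W n"
    then obtain q r where "x = pact f q z" "y = pact f r z" "\<forall>i\<ge>n. coeff q i = 0" "\<forall>i\<ge>n. coeff r i = 0"
      unfolding W_def by blast
    then show "x + y \<in> W n" unfolding W_def
      by (intro CollectI exI[of _ "q + r"]) (simp add: pact_add assms(1))
  next
    fix c x assume "x \<in> W n"
    then obtain q where "x = pact f q z" "\<forall>i\<ge>n. coeff q i = 0" unfolding W_def by blast
    then show "scale c x \<in> W n" unfolding W_def
      by (intro CollectI exI[of _ "smult c q"]) (simp add: pact_smult assms(1))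
  qed
  have WQ: "W n \<subseteq> Q" for n unfolding W_def using pact_closed[OF assms(1,2,4,5)] by blast
  have mono: "W n \<subseteq> W (Suc n)" for n unfolding W_def by fastforce
  have "W n \<noteq> W (Suc n)" for n
  proof
    assume eq: "W n = W (Suc n)"
    have "pact f (monom 1 n) z \<in> W (Suc n)" unfolding W_def by (intro CollectI exI[of _ "monom 1 n"]) simp
    then have "pact f (monom 1 n) z \<in> W n" by (simp only: eq)
    then obtain q where q: "pact f (monom 1 n) z = pact f q z" "\<forall>i\<ge>n. coeff q i = 0"
      unfolding W_def by blast
    then have "pact f (monom 1 n - q) z = 0" using assms(1) by (simp add: pact_diff)
    moreover have "coeff (monom 1 n - q) n = 1" using q by simp
    then have "monom 1 n - q \<noteq> 0" by (metis coeff_0 zero_neq_one)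
    ultimately show False using neg by blast
  qed
  then have lt: "dim (W n) < dim (W (Suc n))" for n
    using fdim_dim_eq[OF fdim_subset[OF assms(3) WQ] mono sub] by (metis not_le)
  have "n \<le> dim (W n)" for n
  proof (induction n)
    case (Suc n) then show ?case using lt[of n] by linarith
  qed simp
  moreover have "dim (W n) \<le> dim Q" for n using fdim_dim_mono[OF assms(3) WQ sub] .
  ultimately show False by (metis not_less_eq_eq order_trans)
qed

text \<open>An annihilating polynomial of \<open>z\<close> divides a product of powers of linear
  factors, and the idempotents of the Chinese remainder theorem split \<open>z\<close> into
  generalized eigenvectors that stay in \<open>Q\<close>.\<close>

lemma generalized_eigenspaces_span:
  assumes "lin f" "subspace Q" "fdim Q" "\<And>y. y \<in> Q \<Longrightarrow> f y \<in> Q" "z \<in> Q"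
  shows "z \<in> span {w \<in> Q. \<exists>\<alpha> n. pact f ([:-\<alpha>, 1:] ^ n) w = 0}"
proof -
  obtain p where p: "p \<noteq> 0" "pact f p z = 0" using annihilating_poly[OF assms] by blast
  obtain \<Lambda> m where L: "finite \<Lambda>" "p dvd (\<Prod>\<kappa>\<in>\<Lambda>. [:-\<kappa>, 1:] ^ m)"
    using complex_poly_dvd_linear_powers[OF p(1)] by blast
  let ?P = "\<Prod>\<kappa>\<in>\<Lambda>. [:-\<kappa>, 1:] ^ m"
  have P: "pact f ?P z = 0" using pact_dvd[OF assms(1) L(2) p(2)] .
  obtain E where E: "\<And>\<kappa>. \<kappa> \<in> \<Lambda> \<Longrightarrow> ?P dvd [:-\<kappa>, 1:] ^ m * E \<kappa>" "?P dvd (\<Sum>\<kappa>\<in>\<Lambda>. E \<kappa>) - 1"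
    using crt_idempotents[OF L(1)] by metis
  have "pact f ((\<Sum>\<kappa>\<in>\<Lambda>. E \<kappa>) - 1) z = 0" using pact_dvd[OF assms(1) E(2) P] .
  then have "z = (\<Sum>\<kappa>\<in>\<Lambda>. pact f (E \<kappa>) z)" using assms(1) by (simp add: pact_diff pact_sum pact_1)
  also have "\<dots> \<in> span {w \<in> Q. \<exists>\<alpha> n. pact f ([:-\<alpha>, 1:] ^ n) w = 0}"
  proof (intro span_sum span_base CollectI conjI)
    fix \<kappa> assume l: "\<kappa> \<in> \<Lambda>"
    show "pact f (E \<kappa>) z \<in> Q" by (rule pact_closed[OF assms(1,2,4,5)])
    have "pact f ([:-\<kappa>, 1:] ^ m) (pact f (E \<kappa>) z) = 0"
      using pact_dvd[OF assms(1) E(1)[OF l] P] assms(1) by (simp only: pact_mult)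
    then show "\<exists>\<alpha> n. pact f ([:-\<alpha>, 1:] ^ n) (pact f (E \<kappa>) z) = 0" by blast
  qed
  finally show ?thesis .
qed

end

context calg
begin

text \<open>The unit of the surrounding ring carries the constant term, so values may leave a
  non-unital \<open>F\<close>; polynomials divisible by \<open>[:0, 1:]\<close> keep them
  inside.\<close>

definition peval :: "'b \<Rightarrow> complex poly \<Rightarrow> 'b" where
  "peval a p = pact (\<lambda>r. a * r) p 1"

lemma lin_mult: "a \<in> homog \<Longrightarrow> lin (\<lambda>r. a * r)"
  unfolding lin_def by (rule lin_on_mult_left)

lemma lin_commutator: "a \<in> homog \<Longrightarrow> lin (commutator a)"
  unfolding lin_def by (rule lin_on_commutator)

lemma pact_mult_eq: "a \<in> homog \<Longrightarrow> pact (\<lambda>r. a * r) p b = peval a p * b"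
  unfolding peval_def
  by (induction p) (simp_all add: pact_pCons lin_mult distrib_right scale_mult_left mult.assoc)

lemma peval_add: "a \<in> homog \<Longrightarrow> peval a (p + q) = peval a p + peval a q"
  and peval_diff: "a \<in> homog \<Longrightarrow> peval a (p - q) = peval a p - peval a q"
  and peval_sum: "a \<in> homog \<Longrightarrow> peval a (\<Sum>i\<in>I. P i) = (\<Sum>i\<in>I. peval a (P i))"
  and peval_1: "a \<in> homog \<Longrightarrow> peval a 1 = 1"
  and peval_0: "peval a 0 = 0"
  and peval_pCons: "a \<in> homog \<Longrightarrow> peval a (pCons c p) = scale c 1 + a * peval a p"
  unfolding peval_def by (simp_all add: pact_add pact_diff pact_sum pact_1 pact_pCons lin_mult)

lemma peval_mult: "a \<in> homog \<Longrightarrow> peval a (p * q) = peval a p * peval a q"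
  using pact_mult[OF lin_mult, of a p q 1] pact_mult_eq[of a p "peval a q"] by (simp add: peval_def)

lemma peval_linear: "a \<in> homog \<Longrightarrow> peval a [:-\<kappa>, 1:] = a - scale \<kappa> 1"
  by (simp add: peval_pCons peval_0 homogD[symmetric])

lemma peval_power: "a \<in> homog \<Longrightarrow> peval a (p ^ n) = peval a p ^ n"
  by (induction n) (simp_all add: peval_1 peval_mult)

lemma peval_homog: "a \<in> homog \<Longrightarrow> peval a p \<in> homog"
  unfolding peval_def
  by (intro pact_closed[OF lin_mult subspace_homog]) (auto intro: homog_mult homog_one)

lemma peval_commute: "a \<in> homog \<Longrightarrow> peval a p * peval a q = peval a q * peval a p"
  by (simp add: peval_mult[symmetric] mult.commute)

lemma peval_dvd_0: "a \<in> homog \<Longrightarrow> p dvd q \<Longrightarrow> peval a p = 0 \<Longrightarrow> peval a q = 0"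
  by (elim dvdE) (simp add: peval_mult)

end

context trace_alg
begin

text \<open>Left multiplication by \<open>x\<close> preserves the finite-dimensional corner
  \<open>x F x\<close>, so some polynomial kills the vector \<open>x * x * x\<close> in it. Three
  further factors \<open>[:0, 1:]\<close> turn this into an annihilating polynomial of
  \<open>x\<close>.\<close>

lemma algebraic:
  assumes "x \<in> F" obtains p where "p \<noteq> 0" "peval x p = 0"
proof -
  have xh: "x \<in> homog" using assms F_homog by blast
  let ?Q = "{x * a * x | a. a \<in> F}"
  have Q: "?Q = (\<lambda>a. x * a * x) ` F" by blast
  have lin: "lin_on F (\<lambda>a. x * a * x)" unfolding lin_on_def
    using xh by (simp add: algebra_simps homogD scale_mult_left)
  have sub: "subspace ?Q" unfolding Q by (rule lin_on_image_subspace[OF subspace_F lin subspace_F]) simp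
  have "\<exists>p. p \<noteq> 0 \<and> pact (\<lambda>r. x * r) p (x * x * x) = 0"
  proof (rule annihilating_poly[OF lin_mult[OF xh] sub F_fdim[OF assms assms]])
    show "x * y \<in> ?Q" if "y \<in> ?Q" for y
    proof -
      obtain a where "a \<in> F" "y = x * a * x" using \<open>y \<in> ?Q\<close> by blast
      then show ?thesis using assms F_mult[of x a] by (intro CollectI exI[of _ "x * a"]) (auto simp: mult.assoc)
    qed
    show "x * x * x \<in> ?Q" using assms by blast
  qed
  then obtain p where p: "p \<noteq> 0" "peval x p * (x * x * x) = 0"
    using pact_mult_eq[OF xh] by auto
  have "peval x [:0, 1:] = x" using peval_linear[OF xh, of 0] by simp
  then have "peval x (p * [:0, 1:] * [:0, 1:] * [:0, 1:]) = peval x p * (x * x * x)"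
    by (simp only: peval_mult[OF xh] mult.assoc)
  then have ann: "peval x (p * [:0, 1:] * [:0, 1:] * [:0, 1:]) = 0" using p(2) by (simp only:)
  have "[:0, 1:] \<noteq> (0 :: complex poly)" by simp
  then have "p * [:0, 1:] * [:0, 1:] * [:0, 1:] \<noteq> 0" using p(1) mult_eq_0_iff by blast
  then show ?thesis using that ann by blast
qed

lemma peval_F:
  assumes "x \<in> F" "[:0, 1:] dvd p" shows "peval x p \<in> F"
proof -
  have xh: "x \<in> homog" using assms F_homog by blast
  obtain r where r: "p = [:0, 1:] * r" using assms(2) by (elim dvdE)
  have "x * peval x r \<in> F"
  proof (induction r)
    case 0 then show ?case by (simp add: peval_0 F_zero)
  next
    case (pCons c r)
    have "x * peval x (pCons c r) = scale c x + x * (x * peval x r)"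
      using xh by (simp add: peval_pCons distrib_left homogD)
    then show ?case using pCons F_add F_scale F_mult assms(1) by auto
  qed
  moreover have "peval x [:0, 1:] = x" using peval_linear[OF xh, of 0] by simp
  ultimately show ?thesis by (simp only: r peval_mult[OF xh])
qed

text \<open>The point 0 is added to the spectrum on purpose: the idempotents of the other points
  then have no constant term and lie in \<open>F\<close>. The exponent \<open>Suc m\<close> is
  positive for the same reason.\<close>

lemma spectral_idempotents:
  assumes "x \<in> F"
  obtains \<Lambda> m E where "finite \<Lambda>" "0 \<in> \<Lambda>"
    "\<And>\<kappa>. \<kappa> \<in> \<Lambda> \<Longrightarrow> peval x ([:-\<kappa>, 1:] ^ Suc m * E \<kappa>) = 0"
    "\<And>\<kappa>. \<kappa> \<in> \<Lambda> \<Longrightarrow> peval x (E \<kappa>) * peval x (E \<kappa>) = peval x (E \<kappa>)"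
    "\<And>\<kappa>. \<kappa> \<in> \<Lambda> \<Longrightarrow> \<kappa> \<noteq> 0 \<Longrightarrow> [:0, 1:] dvd E \<kappa>"
    "(\<Sum>\<kappa>\<in>\<Lambda>. peval x (E \<kappa>)) = 1"
proof -
  have xh: "x \<in> homog" using assms F_homog by blast
  obtain p where p: "p \<noteq> 0" "peval x p = 0" using algebraic[OF assms] by blast
  obtain \<Lambda> m where L: "finite \<Lambda>" "p dvd (\<Prod>\<kappa>\<in>\<Lambda>. [:-\<kappa>, 1:] ^ m)"
    using complex_poly_dvd_linear_powers[OF p(1)] by blast
  let ?\<Lambda> = "insert 0 \<Lambda>"
  let ?P = "\<Prod>\<kappa>\<in>?\<Lambda>. [:-\<kappa>, 1:] ^ Suc m"
  have fin: "finite ?\<Lambda>" using L(1) by simp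
  have d1: "(\<Prod>\<kappa>\<in>\<Lambda>. [:-\<kappa>, 1:] ^ m) dvd (\<Prod>\<kappa>\<in>?\<Lambda>. [:-\<kappa>, 1:] ^ m)"
    using fin by (intro prod_dvd_prod_subset) auto
  have d2: "(\<Prod>\<kappa>\<in>?\<Lambda>. [:-\<kappa>, 1:] ^ m) dvd ?P"
    by (intro prod_dvd_prod le_imp_power_dvd) simp
  have P: "peval x ?P = 0"
    by (rule peval_dvd_0[OF xh dvd_trans[OF L(2) dvd_trans[OF d1 d2]] p(2)])
  obtain E where E: "\<And>\<kappa>. \<kappa> \<in> ?\<Lambda> \<Longrightarrow> ?P dvd [:-\<kappa>, 1:] ^ Suc m * E \<kappa>"
    "\<And>\<kappa>. \<kappa> \<in> ?\<Lambda> \<Longrightarrow> ?P dvd E \<kappa> * (E \<kappa> - 1)"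
    "\<And>\<kappa> \<mu>. \<kappa> \<in> ?\<Lambda> \<Longrightarrow> \<mu> \<in> ?\<Lambda> \<Longrightarrow> \<mu> \<noteq> \<kappa> \<Longrightarrow> [:-\<mu>, 1:] ^ Suc m dvd E \<kappa>"
    "?P dvd (\<Sum>\<kappa>\<in>?\<Lambda>. E \<kappa>) - 1"
    using crt_idempotents[OF fin, of "Suc m"] by blast
  show ?thesis
  proof (rule that[of ?\<Lambda> m E])
    show "peval x ([:-\<kappa>, 1:] ^ Suc m * E \<kappa>) = 0" if "\<kappa> \<in> ?\<Lambda>" for \<kappa>
      using peval_dvd_0[OF xh E(1)[OF that] P] .
    show "peval x (E \<kappa>) * peval x (E \<kappa>) = peval x (E \<kappa>)" if "\<kappa> \<in> ?\<Lambda>" for \<kappa>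
      using peval_dvd_0[OF xh E(2)[OF that] P] xh by (simp add: peval_mult peval_diff peval_1 right_diff_distrib)
    show "[:0, 1:] dvd E \<kappa>" if "\<kappa> \<in> ?\<Lambda>" "\<kappa> \<noteq> 0" for \<kappa>
    proof (rule dvd_trans)
      show "[:-0, 1:] ^ Suc m dvd E \<kappa>" using E(3)[OF that(1), of 0] that(2) by blast
      show "[:0, 1:] dvd ([:-0, 1:] :: complex poly) ^ Suc m" unfolding power_Suc minus_zero by (rule dvd_triv_left)
    qed
    show "(\<Sum>\<kappa>\<in>?\<Lambda>. peval x (E \<kappa>)) = 1"
      using peval_dvd_0[OF xh E(4) P] xh by (simp only: peval_diff peval_sum peval_1) simp
  qed (use fin in auto)
qed

end

section \<open>Cartan's criterion\<close>

context trace_alg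
begin

text \<open>The idempotent at 0 is then the whole unit, and the power of \<open>x\<close> that kills
  it is zero.\<close>

lemma idempotents_zero_nilpotent:
  assumes "x \<in> F" and L: "finite \<Lambda>" "0 \<in> \<Lambda>"
    "\<And>\<kappa>. \<kappa> \<in> \<Lambda> \<Longrightarrow> peval x ([:-\<kappa>, 1:] ^ Suc m * E \<kappa>) = 0"
    "(\<Sum>\<kappa>\<in>\<Lambda>. peval x (E \<kappa>)) = 1"
    and z: "\<And>\<kappa>. \<kappa> \<in> \<Lambda> \<Longrightarrow> \<kappa> \<noteq> 0 \<Longrightarrow> peval x (E \<kappa>) = 0"
  shows "x ^ Suc m = 0"
proof -
  have xh: "x \<in> homog" using assms F_homog by blast
  have "(\<Sum>\<kappa>\<in>\<Lambda>. peval x (E \<kappa>)) = peval x (E 0)"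
    using z L(1,2) by (subst sum.remove[OF L(1,2)]) (simp add: sum.neutral)
  then have "peval x (E 0) = 1" using L(4) by simp
  moreover have "peval x ([:-0, 1:] ^ Suc m) = x ^ Suc m"
    using peval_power[OF xh, of "[:-0,1:]" "Suc m"] peval_linear[OF xh, of 0] by (simp only: scale_zero_left diff_zero)
  ultimately show ?thesis using L(3)[OF L(2)] peval_mult[OF xh, of "[:-0, 1:] ^ Suc m" "E 0"] by (simp only: mult_1_right)
qed

end

text \<open>For operators the trace of an idempotent is its rank. This positivity is the point where
  characteristic 0 enters.\<close>

locale pos_trace_alg = trace_alg scale F \<tau> for scale :: "complex \<Rightarrow> 'b::{ring,monoid_mult} \<Rightarrow> 'b" and F \<tau> +
  assumes idem_pos: "e \<in> F \<Longrightarrow> e * e = e \<Longrightarrow> e \<noteq> 0 \<Longrightarrow> \<exists>r>0. \<tau> e = complex_of_real r"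
begin

lemma tr_sum: "(\<And>i. i \<in> I \<Longrightarrow> f i \<in> F) \<Longrightarrow> \<tau> (\<Sum>i\<in>I. f i) = (\<Sum>i\<in>I. \<tau> (f i))"
proof (induction I rule: infinite_finite_induct)
  case (insert i I)
  then have "(\<Sum>i\<in>I. f i) \<in> F" by (intro subspace_sum[OF subspace_F]) auto
  then show ?case using insert by (simp add: tr_add)
qed (simp_all add: tr_zero)

text \<open>A spectral idempotent at a nonzero point is a polynomial in \<open>x\<close> without
  constant term, so its trace is a combination of traces of powers and vanishes; positivity makes
  the idempotent zero.\<close>

lemma nilpotent_of_tr_zero:
  assumes "x \<in> F" "\<And>k. \<tau> (x ^ Suc k) = 0" shows "\<exists>n. x ^ n = 0"
proof -
  have xh: "x \<in> homog" using assms F_homog by blast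
  obtain \<Lambda> m E where L: "finite \<Lambda>" "0 \<in> \<Lambda>"
    "\<And>\<kappa>. \<kappa> \<in> \<Lambda> \<Longrightarrow> peval x ([:-\<kappa>, 1:] ^ Suc m * E \<kappa>) = 0"
    "\<And>\<kappa>. \<kappa> \<in> \<Lambda> \<Longrightarrow> peval x (E \<kappa>) * peval x (E \<kappa>) = peval x (E \<kappa>)"
    "\<And>\<kappa>. \<kappa> \<in> \<Lambda> \<Longrightarrow> \<kappa> \<noteq> 0 \<Longrightarrow> [:0, 1:] dvd E \<kappa>"
    "(\<Sum>\<kappa>\<in>\<Lambda>. peval x (E \<kappa>)) = 1" using spectral_idempotents[OF assms(1)] by metis
  have tr: "\<tau> (x ^ Suc k * peval x r) = 0 \<and> x ^ Suc k * peval x r \<in> F" for r k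
  proof (induction r arbitrary: k)
    case 0 then show ?case by (simp add: peval_0 tr_zero F_zero)
  next
    case (pCons c r)
    have "x ^ Suc k * peval x (pCons c r) = scale c (x ^ Suc k) + x ^ Suc (Suc k) * peval x r"
      using homogD[OF homog_power[OF xh, of "Suc k"], of c 1]
      by (simp only: peval_pCons[OF xh] distrib_left power_Suc2[of x "Suc k"] mult.assoc mult_1_right)
    then show ?case using pCons.IH[of "Suc k"] F_power[OF assms(1), of k] assms(2)[of k]
      by (simp only: tr_add tr_scale F_scale F_add) simp
  qed
  have z: "peval x (E \<kappa>) = 0" if k: "\<kappa> \<in> \<Lambda>" "\<kappa> \<noteq> 0" for \<kappa>
  proof (rule ccontr)
    assume nz: "peval x (E \<kappa>) \<noteq> 0"
    obtain r where r: "E \<kappa> = [:0, 1:] * r" using L(5)[OF k] by (elim dvdE)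
    have "peval x [:0, 1:] = x" using peval_linear[OF xh, of 0] by simp
    then have "peval x (E \<kappa>) = x ^ Suc 0 * peval x r" unfolding r peval_mult[OF xh] by simp
    then have "\<tau> (peval x (E \<kappa>)) = 0" "peval x (E \<kappa>) \<in> F" using tr[of 0 r] by simp_all
    then show False using idem_pos[OF _ L(4)[OF k(1)] nz] by auto
  qed
  show ?thesis using idempotents_zero_nilpotent[OF assms(1) L(1-3,6) z] by blast
qed

end

sublocale pos_trace_alg \<subseteq> talg
  by unfold_locales (rule nilpotent_of_tr_zero)

context pos_trace_alg
begin

text \<open>A generalized eigenvector of \<open>ad x\<close> shifts generalized eigenvalues by
  \<open>\<alpha>\<close>. The operator \<open>x - \<kappa> - \<alpha>\<close> maps
  \<open>w * y\<close> to \<open>([x, w] - \<alpha> w) * y + w * ((x - \<kappa>) * y)\<close>, and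
  either summand lowers one of the two exponents.\<close>

lemma eigenspace_shift:
  assumes x: "x \<in> homog"
  shows "w \<in> homog \<Longrightarrow> pact (commutator x) ([:-\<alpha>, 1:] ^ n) w = 0 \<Longrightarrow> (x - scale \<kappa> 1) ^ i * y = 0 \<Longrightarrow>
    (x - scale (\<kappa> + \<alpha>) 1) ^ (n + i) * (w * y) = 0"
proof (induction "n + i" arbitrary: n i w y)
  case 0
  then show ?case using lin_commutator[OF x] by (simp add: pact_1)
next
  case (Suc k)
  note lc = lin_commutator[OF x]
  show ?case
  proof (cases "n = 0 \<or> i = 0")
    case True then show ?thesis using Suc.prems lc by (auto simp: pact_1)
  next
    case False
    then obtain n' i' where ni: "n = Suc n'" "i = Suc i'" by (metis not0_implies_Suc)
    let ?B = "x - scale (\<kappa> + \<alpha>) 1"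
    let ?w = "commutator x w - scale \<alpha> w" and ?y = "(x - scale \<kappa> 1) * y"
    have w: "?w \<in> homog" using x Suc.prems(1) unfolding commutator_def
      by (intro subspace_diff[OF subspace_homog] subspace_scale[OF subspace_homog] homog_mult)
    have "pact (commutator x) [:-\<alpha>, 1:] w = ?w" by (simp add: pact_pCons lc lin_0[OF lc])
    then have "pact (commutator x) ([:-\<alpha>, 1:] ^ n') ?w = 0"
      using Suc.prems(2) pact_mult[OF lc, of "[:-\<alpha>, 1:] ^ n'" "[:-\<alpha>, 1:]" w] unfolding ni power_Suc2 by simp
    then have 1: "?B ^ (n' + i) * (?w * y) = 0" using Suc.hyps(1)[of n' i ?w y] Suc.hyps(2) Suc.prems(3) ni w by simp
    have "(x - scale \<kappa> 1) ^ i' * ?y = 0" using Suc.prems(3) unfolding ni power_Suc2 by (simp add: mult.assoc)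
    then have 2: "?B ^ (n + i') * (w * ?y) = 0" using Suc.hyps(1)[of n i' w ?y] Suc.hyps(2) Suc.prems(1,2) ni by simp
    have "?B * (w * y) = ?w * y + w * ?y"
      using homogD[OF Suc.prems(1)]
      by (simp add: commutator_def algebra_simps scale_mult_left scale_left_distrib)
    then have "?B ^ (n' + i) * (?B * (w * y)) = ?B ^ (n' + i) * (?w * y) + ?B ^ (n + i') * (w * ?y)"
      using ni by (simp add: distrib_left)
    moreover have "n + i = Suc (n' + i)" using ni by simp
    ultimately show ?thesis using 1 2 by (simp only: power_Suc2 mult.assoc) simp
  qed
qed

lemma peval_bezout_zero:
  assumes x: "x \<in> homog" and "\<mu> \<noteq> \<nu>"
    and "(x - scale \<mu> 1) ^ m * v = 0" "(x - scale \<nu> 1) ^ n * v = 0"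
  shows "v = 0"
proof -
  obtain a b where ab: "a * [:-\<mu>, 1:] ^ m + b * [:-\<nu>, 1:] ^ n = 1"
    using linear_poly_bezout[OF linear_power_poly_neq_0[OF assms(2)]] by blast
  have "peval x (a * [:-\<mu>, 1:] ^ m + b * [:-\<nu>, 1:] ^ n) * v
    = peval x a * ((x - scale \<mu> 1) ^ m * v) + peval x b * ((x - scale \<nu> 1) ^ n * v)"
    by (simp only: peval_add[OF x] peval_mult[OF x] peval_power[OF x] peval_linear[OF x] distrib_right mult.assoc)
  then show ?thesis unfolding ab using assms(3,4) x by (simp add: peval_1)
qed

text \<open>If \<open>x = s + n\<close> is the Jordan decomposition and \<open>s'\<close> has the complex
  conjugate eigenvalues of \<open>s\<close> on the same eigenspaces, then \<open>ad s'\<close> preserves \<open>Q\<close>, so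
  \<open>\<tau> (x * s')\<close>, which is the weighted sum of the squared moduli of the eigenvalues, vanishes.\<close>
lemma cartan_nilpotent:
  assumes Q: "Q \<subseteq> F" "lsub Q" "fdim Q" and iso: "\<And>a b. a \<in> Q \<Longrightarrow> b \<in> Q \<Longrightarrow> \<tau> (a * b) = 0"
    and xQ: "x \<in> lder Q"
  shows "\<exists>n. x ^ n = 0"
proof -
  have subQ: "subspace Q" using Q(2) unfolding lsub_def by blast
  have xq: "x \<in> Q" using xQ lder_subset[OF Q(2)] by blast
  have xF: "x \<in> F" using xq Q(1) by blast
  have xh: "x \<in> homog" using xF F_homog by blast
  obtain \<Lambda> m E where L: "finite \<Lambda>" "0 \<in> \<Lambda>"
    "\<And>\<kappa>. \<kappa> \<in> \<Lambda> \<Longrightarrow> peval x ([:-\<kappa>, 1:] ^ Suc m * E \<kappa>) = 0"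
    "\<And>\<kappa>. \<kappa> \<in> \<Lambda> \<Longrightarrow> peval x (E \<kappa>) * peval x (E \<kappa>) = peval x (E \<kappa>)"
    "\<And>\<kappa>. \<kappa> \<in> \<Lambda> \<Longrightarrow> \<kappa> \<noteq> 0 \<Longrightarrow> [:0, 1:] dvd E \<kappa>"
    "(\<Sum>\<kappa>\<in>\<Lambda>. peval x (E \<kappa>)) = 1" using spectral_idempotents[OF xF] by metis
  define e where "e \<kappa> = peval x (E \<kappa>)" for \<kappa>
  have eh: "e \<kappa> \<in> homog" for \<kappa> unfolding e_def using peval_homog[OF xh] .
  have killl: "(x - scale \<kappa> 1) ^ Suc m * e \<kappa> = 0" if "\<kappa> \<in> \<Lambda>" for \<kappa>
    using L(3)[OF that] unfolding e_def peval_mult[OF xh] peval_power[OF xh] peval_linear[OF xh] .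
  have eF: "e \<kappa> \<in> F" if "\<kappa> \<in> \<Lambda>" "\<kappa> \<noteq> 0" for \<kappa> unfolding e_def using peval_F[OF xF L(5)[OF that]] .
  have ecomm: "(x - scale \<kappa> 1) ^ k * (e \<mu> * v) = e \<mu> * ((x - scale \<kappa> 1) ^ k * v)" for \<kappa> \<mu> k v
  proof -
    have "(x - scale \<kappa> 1) ^ k * e \<mu> = e \<mu> * (x - scale \<kappa> 1) ^ k"
      using peval_commute[OF xh, of "[:-\<kappa>, 1:] ^ k" "E \<mu>"]
      unfolding e_def peval_power[OF xh] peval_linear[OF xh] .
    then show ?thesis by (metis mult.assoc)
  qed
  \<comment> \<open>The point 0 is left out because \<open>e 0\<close> need not lie in
    \<open>F\<close>; its coefficient would be \<open>cnj 0\<close>, so the full sum has the same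
    value.\<close>
  define s where "s = (\<Sum>\<kappa>\<in>\<Lambda> - {0}. scale (cnj \<kappa>) (e \<kappa>))"
  have s': "s = (\<Sum>\<kappa>\<in>\<Lambda>. scale (cnj \<kappa>) (e \<kappa>))"
    unfolding s_def using sum.remove[OF L(1,2), of "\<lambda>\<kappa>. scale (cnj \<kappa>) (e \<kappa>)"] by simp
  have sF: "s \<in> F" unfolding s_def by (intro subspace_sum[OF subspace_F] F_scale eF) auto
  have sh: "s \<in> homog" using sF F_homog by blast
  have eig: "commutator s w = scale (cnj \<alpha>) w"
    if w: "w \<in> Q" "pact (commutator x) ([:-\<alpha>, 1:] ^ n) w = 0" for w \<alpha> n
  proof -
    have wh: "w \<in> homog" using w(1) Q(1) F_homog by blast
    \<comment> \<open>The product is killed by a power of \<open>x - \<mu>\<close> because of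
      \<open>e \<mu>\<close>, and by a power of \<open>x - \<kappa> - \<alpha>\<close> because of
      \<open>eigenspace_shift\<close>. Hence \<open>w\<close> has only blocks from
      \<open>\<kappa>\<close> to \<open>\<kappa> + \<alpha>\<close>, and on these
      \<open>ad s\<close> is multiplication by \<open>cnj \<alpha>\<close>.\<close>
    have z: "e \<mu> * (w * e \<kappa>) = 0" if k: "\<kappa> \<in> \<Lambda>" "\<mu> \<in> \<Lambda>" "\<mu> \<noteq> \<kappa> + \<alpha>" for \<kappa> \<mu>
    proof (rule peval_bezout_zero[OF xh k(3)])
      show "(x - scale \<mu> 1) ^ Suc m * (e \<mu> * (w * e \<kappa>)) = 0"
        using killl[OF k(2)] by (simp only: mult.assoc[symmetric]) simp
      have "(x - scale (\<kappa> + \<alpha>) 1) ^ (n + Suc m) * (w * e \<kappa>) = 0"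
        by (rule eigenspace_shift[OF xh wh w(2) killl[OF k(1)]])
      then show "(x - scale (\<kappa> + \<alpha>) 1) ^ (n + Suc m) * (e \<mu> * (w * e \<kappa>)) = 0"
        unfolding ecomm by simp
    qed
    have one: "(\<Sum>\<kappa>\<in>\<Lambda>. e \<kappa>) = 1" using L(6) unfolding e_def .
    have "s * w = s * (w * (\<Sum>\<kappa>\<in>\<Lambda>. e \<kappa>))" by (simp only: one mult_1_right)
    also have "\<dots> = (\<Sum>\<kappa>\<in>\<Lambda>. \<Sum>\<mu>\<in>\<Lambda>. scale (cnj \<mu>) (e \<mu> * (w * e \<kappa>)))"
      unfolding s' by (simp add: sum_distrib_left sum_distrib_right scale_mult_left)
    finally have sw: "s * w = (\<Sum>\<kappa>\<in>\<Lambda>. \<Sum>\<mu>\<in>\<Lambda>. scale (cnj \<mu>) (e \<mu> * (w * e \<kappa>)))" .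
    have "w * s = (\<Sum>\<mu>\<in>\<Lambda>. e \<mu>) * (w * s)" by (simp only: one mult_1_left)
    also have "\<dots> = (\<Sum>\<kappa>\<in>\<Lambda>. \<Sum>\<mu>\<in>\<Lambda>. scale (cnj \<kappa>) (e \<mu> * (w * e \<kappa>)))"
      unfolding s' using wh eh by (simp add: sum_distrib_left sum_distrib_right homogD)
    finally have ws: "w * s = (\<Sum>\<kappa>\<in>\<Lambda>. \<Sum>\<mu>\<in>\<Lambda>. scale (cnj \<kappa>) (e \<mu> * (w * e \<kappa>)))" .
    have "w = (\<Sum>\<mu>\<in>\<Lambda>. e \<mu>) * (w * (\<Sum>\<kappa>\<in>\<Lambda>. e \<kappa>))" by (simp only: one mult_1_left mult_1_right)
    also have "\<dots> = (\<Sum>\<kappa>\<in>\<Lambda>. \<Sum>\<mu>\<in>\<Lambda>. e \<mu> * (w * e \<kappa>))"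
      by (simp add: sum_distrib_left sum_distrib_right)
    finally have ww: "w = (\<Sum>\<kappa>\<in>\<Lambda>. \<Sum>\<mu>\<in>\<Lambda>. e \<mu> * (w * e \<kappa>))" .
    have "commutator s w = (\<Sum>\<kappa>\<in>\<Lambda>. \<Sum>\<mu>\<in>\<Lambda>. scale (cnj \<mu>) (e \<mu> * (w * e \<kappa>)) - scale (cnj \<kappa>) (e \<mu> * (w * e \<kappa>)))"
      unfolding commutator_def sw ws by (simp add: sum_subtractf)
    also have "\<dots> = (\<Sum>\<kappa>\<in>\<Lambda>. \<Sum>\<mu>\<in>\<Lambda>. scale (cnj \<alpha>) (e \<mu> * (w * e \<kappa>)))"
    proof (intro sum.cong refl)
      fix \<kappa> \<mu> assume "\<kappa> \<in> \<Lambda>" "\<mu> \<in> \<Lambda>"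
      then show "scale (cnj \<mu>) (e \<mu> * (w * e \<kappa>)) - scale (cnj \<kappa>) (e \<mu> * (w * e \<kappa>)) = scale (cnj \<alpha>) (e \<mu> * (w * e \<kappa>))"
        using z[of \<kappa> \<mu>] by (cases "\<mu> = \<kappa> + \<alpha>") (simp_all add: scale_left_distrib)
    qed
    also have "\<dots> = scale (cnj \<alpha>) (\<Sum>\<kappa>\<in>\<Lambda>. \<Sum>\<mu>\<in>\<Lambda>. e \<mu> * (w * e \<kappa>))" by (simp only: scale_sum_right)
    finally show ?thesis using ww by simp
  qed
  have sQ: "commutator s z \<in> Q" if "z \<in> Q" for z
  proof -
    have "z \<in> span {w \<in> Q. \<exists>\<alpha> n. pact (commutator x) ([:-\<alpha>, 1:] ^ n) w = 0}"
      using Q(2) xq that unfolding lsub_def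
      by (intro generalized_eigenspaces_span[OF lin_commutator[OF xh] subQ Q(3)]) auto
    also have "\<dots> \<subseteq> {z. commutator s z \<in> Q}"
      using eig subspace_scale[OF subQ]
      by (intro span_minimal subspace_commutator_preimage[OF sh subQ]) auto
    finally show ?thesis by blast
  qed
  have "x \<in> {y. y \<in> F \<and> \<tau> (y * s) = 0}"
  proof (rule lder_induct[OF xQ])
    show "subspace {y. y \<in> F \<and> \<tau> (y * s) = 0}" using sF unfolding subspace_def
      by (auto simp: F_zero tr_zero F_add F_scale distrib_right tr_add tr_scale F_mult scale_mult_left)
    fix a b assume ab: "a \<in> Q" "b \<in> Q"
    have "commutator b s \<in> Q" using sQ[OF ab(2)] subspace_neg[OF subQ] commutator_minus by metis
    then have "\<tau> (a * commutator b s) = 0" using iso ab by blast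
    then show "commutator a b \<in> {y. y \<in> F \<and> \<tau> (y * s) = 0}"
      using tr_invariant[of a b s] ab Q(1) sF F_commutator by auto
  qed
  then have "\<tau> (x * s) = 0" by blast
  moreover have "\<tau> (x * s) = (\<Sum>\<kappa>\<in>\<Lambda> - {0}. cnj \<kappa> * (\<kappa> * \<tau> (e \<kappa>)))"
  proof -
    have "x * s = (\<Sum>\<kappa>\<in>\<Lambda> - {0}. scale (cnj \<kappa>) (x * e \<kappa>))"
      unfolding s_def using xh by (simp add: sum_distrib_left homogD)
    then have "\<tau> (x * s) = (\<Sum>\<kappa>\<in>\<Lambda> - {0}. \<tau> (scale (cnj \<kappa>) (x * e \<kappa>)))"
      using tr_sum[of "\<Lambda> - {0}" "\<lambda>\<kappa>. scale (cnj \<kappa>) (x * e \<kappa>)"] eF xF F_mult F_scale by auto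
    also have "\<dots> = (\<Sum>\<kappa>\<in>\<Lambda> - {0}. cnj \<kappa> * (\<kappa> * \<tau> (e \<kappa>)))"
    proof (intro sum.cong refl)
      fix \<kappa> assume k: "\<kappa> \<in> \<Lambda> - {0}"
      \<comment> \<open>On the block of \<open>\<kappa>\<close> the difference \<open>?d\<close> is
        the nilpotent part of \<open>x\<close> and has trace zero, so only \<open>\<kappa>\<close>
        times the trace of the idempotent remains.\<close>
      let ?d = "x * e \<kappa> - scale \<kappa> (e \<kappa>)"
      have e: "e \<kappa> \<in> F" using eF k by blast
      have "?d = (x - scale \<kappa> 1) * e \<kappa>" by (simp add: left_diff_distrib scale_mult_left)
      also have "\<dots> = peval x ([:-\<kappa>, 1:] * E \<kappa>)" unfolding e_def by (simp only: peval_mult[OF xh] peval_linear[OF xh])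
      finally have "?d ^ Suc m = peval x (([:-\<kappa>, 1:] * E \<kappa>) ^ Suc m)" by (simp only: peval_power[OF xh])
      also have "\<dots> = 0"
      proof (rule peval_dvd_0[OF xh _ L(3)])
        show "[:-\<kappa>, 1:] ^ Suc m * E \<kappa> dvd ([:-\<kappa>, 1:] * E \<kappa>) ^ Suc m"
          unfolding power_mult_distrib by (intro mult_dvd_mono dvd_refl) (simp add: dvd_power)
      qed (use k in blast)
      finally have "\<tau> ?d = 0" using e xF by (intro tr_nil[of _ "Suc m"] F_diff F_mult F_scale)
      then have "\<tau> (x * e \<kappa>) = \<kappa> * \<tau> (e \<kappa>)" using e xF by (simp add: tr_diff tr_scale F_mult F_scale)
      then show "\<tau> (scale (cnj \<kappa>) (x * e \<kappa>)) = cnj \<kappa> * (\<kappa> * \<tau> (e \<kappa>))" using e xF by (simp add: tr_scale F_mult)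
    qed
    finally show ?thesis .
  qed
  ultimately have "(\<Sum>\<kappa>\<in>\<Lambda> - {0}. cnj \<kappa> * (\<kappa> * \<tau> (e \<kappa>))) = 0" by simp
  then have sum0: "(\<Sum>\<kappa>\<in>\<Lambda> - {0}. Re (cnj \<kappa> * (\<kappa> * \<tau> (e \<kappa>)))) = 0" by (metis Re_sum zero_complex.simps(1))
  have pos: "e \<kappa> = 0 \<or> Re (cnj \<kappa> * (\<kappa> * \<tau> (e \<kappa>))) > 0" if k: "\<kappa> \<in> \<Lambda> - {0}" for \<kappa>
  proof (cases "e \<kappa> = 0")
    case False
    have "e \<kappa> * e \<kappa> = e \<kappa>" using L(4) k unfolding e_def by blast
    then obtain r where r: "r > 0" "\<tau> (e \<kappa>) = complex_of_real r" using idem_pos[OF eF] False k by blast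
    have "cnj \<kappa> * (\<kappa> * \<tau> (e \<kappa>)) = complex_of_real ((cmod \<kappa>)\<^sup>2 * r)"
      unfolding r(2) of_real_mult complex_norm_square by (simp add: mult.assoc mult.left_commute)
    then have "Re (cnj \<kappa> * (\<kappa> * \<tau> (e \<kappa>))) = (cmod \<kappa>)\<^sup>2 * r" by (simp only: Re_complex_of_real)
    moreover have "(cmod \<kappa>)\<^sup>2 * r > 0" using r(1) k by simp
    ultimately show ?thesis by simp
  qed simp
  have "e \<kappa> = 0" if k: "\<kappa> \<in> \<Lambda>" "\<kappa> \<noteq> 0" for \<kappa>
  proof -
    have "\<forall>\<kappa>\<in>\<Lambda> - {0}. Re (cnj \<kappa> * (\<kappa> * \<tau> (e \<kappa>))) \<ge> 0"
      using pos by (metis less_imp_le mult_zero_right order_refl tr_zero zero_complex.simps(1))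
    then have "Re (cnj \<kappa> * (\<kappa> * \<tau> (e \<kappa>))) = 0"
      using sum0 sum_nonneg_eq_0_iff[of "\<Lambda> - {0}" "\<lambda>\<kappa>. Re (cnj \<kappa> * (\<kappa> * \<tau> (e \<kappa>)))"] L(1) k by auto
    then show ?thesis using pos[of \<kappa>] k by auto
  qed
  then show ?thesis using idempotents_zero_nilpotent[OF xF L(1-3,6)] unfolding e_def by blast
qed

end

section \<open>Traces of words in a Lie algebra of nilpotent elements\<close>

context talg
begin

text \<open>The multipliers of \<open>F\<close> contain 1, so that the outer factors of a word may
  be empty while the word itself stays in \<open>F\<close>.\<close>

definition idealizer :: "'b set" where
  "idealizer = {a \<in> homog. \<forall>f\<in>F. f * a \<in> F \<and> a * f \<in> F}"

lemma idealizer: "1 \<in> idealizer" "F \<subseteq> idealizer"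
  "a \<in> idealizer \<Longrightarrow> f \<in> F \<Longrightarrow> f * a \<in> F" "a \<in> idealizer \<Longrightarrow> f \<in> F \<Longrightarrow> a * f \<in> F"
  "a \<in> idealizer \<Longrightarrow> b \<in> idealizer \<Longrightarrow> a * b \<in> idealizer" "a \<in> idealizer \<Longrightarrow> a \<in> homog"
  "a \<in> idealizer \<Longrightarrow> a ^ n \<in> idealizer"
proof -
  show 5: "a \<in> idealizer \<Longrightarrow> b \<in> idealizer \<Longrightarrow> a * b \<in> idealizer" for a b
    unfolding idealizer_def using homog_mult by (auto simp: mult.assoc) (metis mult.assoc)
  show 1: "1 \<in> idealizer" unfolding idealizer_def by (simp add: homog_one)
  show "a \<in> idealizer \<Longrightarrow> a ^ n \<in> idealizer" by (induction n) (auto intro: 1 5)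
qed (use F_homog F_mult in \<open>auto simp: idealizer_def\<close>)

text \<open>Expansion of \<open>(x + c y)^n\<close> from the left. The linear coefficient, needed
  for polarisation, collects the words with one letter \<open>y\<close>; the constant coefficient is
  carried along because it supplies the new linear term when a \<open>y\<close> is split
  off.\<close>

lemma tr_power_expansion:
  assumes x: "x \<in> F" "y \<in> F" and w: "w \<in> idealizer"
  shows "u \<in> idealizer \<Longrightarrow> \<exists>p. (\<forall>c. \<tau> (u * (x + scale c y) ^ n * w) = poly p c)
     \<and> coeff p 1 = (\<Sum>i<n. \<tau> (u * x ^ i * y * x ^ (n - 1 - i) * w)) \<and> coeff p 0 = \<tau> (u * x ^ n * w)"
proof (induction n arbitrary: u)
  case 0
  then show ?case by (intro exI[of _ "[:\<tau> (u * w):]"]) (simp add: coeff_pCons)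
next
  case (Suc n)
  have ux: "u * x \<in> F" "u * y \<in> F" using Suc.prems x idealizer(4) by auto
  then have ux': "u * x \<in> idealizer" "u * y \<in> idealizer" using idealizer(2) by auto
  obtain p where p: "\<And>c. \<tau> (u * x * (x + scale c y) ^ n * w) = poly p c"
    "coeff p 1 = (\<Sum>i<n. \<tau> (u * x * x ^ i * y * x ^ (n - 1 - i) * w))" "coeff p 0 = \<tau> (u * x * x ^ n * w)"
    using Suc.IH[OF ux'(1)] by blast
  obtain q where q: "\<And>c. \<tau> (u * y * (x + scale c y) ^ n * w) = poly q c" "coeff q 0 = \<tau> (u * y * x ^ n * w)"
    using Suc.IH[OF ux'(2)] by blast
  have "\<tau> (u * (x + scale c y) ^ Suc n * w) = poly (p + pCons 0 q) c" for c
  proof -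
    have R: "(x + scale c y) ^ n * w \<in> idealizer"
      using x w idealizer(2) by (intro idealizer(5,7)) (auto intro: F_add F_scale)
    have uh: "u \<in> homog" using idealizer(6)[OF Suc.prems] .
    have "u * (x + scale c y) ^ Suc n * w = u * x * ((x + scale c y) ^ n * w) + scale c (u * y * ((x + scale c y) ^ n * w))"
      by (simp add: algebra_simps homogD[OF uh] scale_mult_left)
    also have "\<tau> \<dots> = \<tau> (u * x * ((x + scale c y) ^ n * w)) + c * \<tau> (u * y * ((x + scale c y) ^ n * w))"
      using idealizer(3)[OF R] ux by (simp add: tr_add tr_scale F_scale)
    finally show ?thesis using p(1)[of c] q(1)[of c] by (simp add: mult.assoc)
  qed
  moreover have "coeff (p + pCons 0 q) 1 = (\<Sum>i<Suc n. \<tau> (u * x ^ i * y * x ^ (Suc n - 1 - i) * w))"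
    unfolding sum.lessThan_Suc_shift using p(2) q(2) by (simp add: mult.assoc add.commute)
  moreover have "coeff (p + pCons 0 q) 0 = \<tau> (u * x ^ Suc n * w)" using p(3) by (simp add: mult.assoc)
  ultimately show ?case by blast
qed

text \<open>Polarisation: modulo shorter words the trace of a word is symmetric in its letters.\<close>
lemma nil_lsub_tr_word:
  assumes P: "P \<subseteq> F" "lsub P" and nil: "\<And>x. x \<in> P \<Longrightarrow> \<exists>n. x ^ n = 0"
  shows "set xs \<subseteq> P \<Longrightarrow> xs \<noteq> [] \<Longrightarrow> \<tau> (prod_list xs) = 0"
proof (induction "length xs" arbitrary: xs rule: less_induct)
  case less
  define k where "k = length xs"
  have shorter: "\<tau> (prod_list ys) = 0" if "length ys < k" "set ys \<subseteq> P" "ys \<noteq> []" for ys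
    using less.hyps that unfolding k_def by blast
  have pF: "prod_list ys \<in> F" if "set ys \<subseteq> P" "ys \<noteq> []" for ys
    using that
  proof (induction ys)
    case (Cons y ys) then show ?case using P(1) F_mult by (cases "ys = []") auto
  qed simp
  have rep: "prod_list (replicate n x) = x ^ n" for n and x :: 'b by (induction n) auto
  \<comment> \<open>Exchanging two neighbours changes the word by a word with one letter less, in
    which their commutator, again in \<open>P\<close>, replaces them.\<close>
  have swap: "\<tau> (prod_list (us @ y # x # vs)) = \<tau> (prod_list (us @ x # y # vs))"
    if "length us + length vs + 2 = k" "set us \<subseteq> P" "set vs \<subseteq> P" "x \<in> P" "y \<in> P" for us vs x y
  proof -
    have c: "commutator y x \<in> P" using P(2) that unfolding lsub_def by blast
    have "\<tau> (prod_list (us @ y # x # vs) - prod_list (us @ x # y # vs)) = 0"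
      using shorter[of "us @ commutator y x # vs"] that c by (simp add: commutator_def algebra_simps)
    then show ?thesis using that pF[of "us @ y # x # vs"] pF[of "us @ x # y # vs"] by (simp add: tr_diff)
  qed
  have move: "\<tau> (prod_list (us @ replicate j x @ y # replicate i x @ vs)) = \<tau> (prod_list (us @ replicate (j + i) x @ y # vs))"
    if "length us + j + i + 1 + length vs = k" "set us \<subseteq> P" "set vs \<subseteq> P" "x \<in> P" "y \<in> P" for us vs x y i j
    using that
  proof (induction i arbitrary: j)
    case (Suc i)
    have r: "replicate j x @ x # zs = replicate (Suc j) x @ zs" for zs by (metis replicate_app_Cons_same append_Cons replicate_Suc)
    have "\<tau> (prod_list ((us @ replicate j x) @ y # x # (replicate i x @ vs))) = \<tau> (prod_list ((us @ replicate j x) @ x # y # (replicate i x @ vs)))"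
      using Suc.prems by (intro swap) auto
    then have "\<tau> (prod_list (us @ replicate j x @ y # replicate (Suc i) x @ vs)) = \<tau> (prod_list (us @ replicate (Suc j) x @ y # replicate i x @ vs))"
      by (simp only: append_assoc r replicate_Suc append_Cons)
    also have "\<dots> = \<tau> (prod_list (us @ replicate (Suc j + i) x @ y # vs))" using Suc.prems by (intro Suc.IH) auto
    finally show ?case by simp
  qed simp
  \<comment> \<open>Induction on the rest \<open>ws\<close> behind a block of equal letters. An
    empty rest leaves a power of a nilpotent element, which needs \<open>j\<close> to be
    positive.\<close>
  have "\<tau> (prod_list (replicate j x @ ws)) = 0"
    if "j + length ws = k" "j \<ge> 1" "x \<in> P" "set ws \<subseteq> P" for j x ws
    using that
  proof (induction "length ws" arbitrary: j x ws)
    case 0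
    obtain n where n: "x ^ n = 0" using nil 0 by blast
    have "(x ^ j) ^ n = (x ^ n) ^ j" by (simp only: power_mult[symmetric] mult.commute)
    then have "(x ^ j) ^ n = 0" using n 0(3) by (cases j) auto
    then have "\<tau> (x ^ j) = 0" using 0 P(1) F_power[of x "j - 1"] by (intro tr_nil[of _ n]) auto
    then show ?case using 0 rep by simp
  next
    case (Suc l)
    then obtain y vs where ws: "ws = y # vs" by (cases ws) auto
    have xy: "x \<in> P" "y \<in> P" "set vs \<subseteq> P" "x \<in> F" "y \<in> F" using Suc.prems ws P(1) by auto
    have vi: "prod_list vs \<in> idealizer" using pF[of vs] xy(3) idealizer(1,2) by (cases "vs = []") auto
    obtain p where p: "\<And>c. \<tau> ((x + scale c y) ^ Suc j * prod_list vs) = poly p c"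
      "coeff p 1 = (\<Sum>i<Suc j. \<tau> (x ^ i * y * x ^ (Suc j - 1 - i) * prod_list vs))"
      using tr_power_expansion[OF xy(4,5) vi idealizer(1), of "Suc j"] by auto
    \<comment> \<open>With \<open>x + c y\<close> as the repeated letter the rest is shorter, so the
      trace vanishes for every \<open>c\<close>. After reordering, the linear coefficient is
      \<open>Suc j\<close> times the wanted trace.\<close>
    have "poly p c = 0" for c
    proof -
      have "x + scale c y \<in> P" using P(2) xy subspace_add subspace_scale unfolding lsub_def by blast
      then have "\<tau> (prod_list (replicate (Suc j) (x + scale c y) @ vs)) = 0"
        using Suc.hyps(2) Suc.prems ws by (intro Suc.hyps(1)) auto
      then show ?thesis using p(1)[of c] by (simp only: prod_list.append rep)
    qed
    then have "p = 0" using poly_all_0_iff_0 by blast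
    then have "0 = (\<Sum>i<Suc j. \<tau> (x ^ i * y * x ^ (Suc j - 1 - i) * prod_list vs))" using p(2) by simp
    also have "\<dots> = (\<Sum>i<Suc j. \<tau> (prod_list (replicate j x @ y # vs)))"
    proof (intro sum.cong refl)
      fix i assume "i \<in> {..<Suc j}"
      then have i: "i + (j - i) = j" by simp
      have "\<tau> (prod_list ([] @ replicate i x @ y # replicate (j - i) x @ vs)) = \<tau> (prod_list ([] @ replicate (i + (j - i)) x @ y # vs))"
        using Suc.prems ws xy i by (intro move) auto
      then show "\<tau> (x ^ i * y * x ^ (Suc j - 1 - i) * prod_list vs) = \<tau> (prod_list (replicate j x @ y # vs))"
        unfolding i by (simp add: rep mult.assoc)
    qed
    finally have "of_nat (Suc j) * \<tau> (prod_list (replicate j x @ y # vs)) = 0" by (simp only: sum_constant card_lessThan)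
    then show ?case unfolding ws using of_nat_neq_0[where 'a = complex] by (metis mult_eq_0_iff)
  qed
  from this[of 1 "tl xs" "hd xs"] less.prems show ?case unfolding k_def by (cases xs) auto
qed

end

context calg
begin

text \<open>Let \<open>X\<close> be a right ideal of least dimension not annihilated by
  \<open>A\<close>. For a suitable \<open>x\<close> in \<open>X\<close> the right ideal
  \<open>x A\<close> is again of this kind, because \<open>A\<close> is spanned by its products; so
  \<open>x A = X\<close>, and \<open>x = x * a = x * a^n\<close> is zero for nilpotent
  \<open>a\<close>.\<close>

lemma nil_idempotent_algebra_zero:
  assumes A: "subspace A" "fdim A" "A \<subseteq> homog" "\<And>a b. a \<in> A \<Longrightarrow> b \<in> A \<Longrightarrow> a * b \<in> A"
    and nil: "\<And>a. a \<in> A \<Longrightarrow> \<exists>n. a ^ n = 0"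
    and idem: "A \<subseteq> span {a * b | a b. a \<in> A \<and> b \<in> A}"
  shows "A \<subseteq> {0}"
proof (rule ccontr)
  assume neg: "\<not> A \<subseteq> {0}"
  define good where "good X \<longleftrightarrow> subspace X \<and> X \<subseteq> A \<and> (\<forall>x\<in>X. \<forall>a\<in>A. x * a \<in> X) \<and> (\<exists>x\<in>X. \<exists>a\<in>A. x * a \<noteq> 0)" for X
  have zero: "\<forall>a\<in>A. x * a = 0" if x: "x \<in> A" "\<And>a b. a \<in> A \<Longrightarrow> b \<in> A \<Longrightarrow> x * a * b = 0" for x
  proof -
    have "{a * b | a b. a \<in> A \<and> b \<in> A} \<subseteq> {a. x * a = 0}" using x(2) by (auto simp: mult.assoc)
    moreover have "subspace {a. x * a = 0}" using x(1) A(3) unfolding subspace_def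
      by (auto simp: distrib_left homogD subset_iff)
    ultimately have "span {a * b | a b. a \<in> A \<and> b \<in> A} \<subseteq> {a. x * a = 0}" by (rule span_minimal)
    then show ?thesis using idem by blast
  qed
  have "good A"
  proof -
    have "\<exists>x\<in>A. \<exists>a\<in>A. x * a \<noteq> 0"
    proof (rule ccontr)
      assume "\<not> ?thesis"
      then have "{a * b | a b. a \<in> A \<and> b \<in> A} \<subseteq> {0}" by blast
      then have "span {a * b | a b. a \<in> A \<and> b \<in> A} \<subseteq> {0}" by (rule span_minimal) simp
      then show False using idem neg by blast
    qed
    then show ?thesis unfolding good_def using A by blast
  qed
  then obtain X where X: "good X" "\<And>Y. good Y \<Longrightarrow> dim X \<le> dim Y"
    using ex_has_least_nat[of good A dim] by blast
  obtain x a0 where x: "x \<in> X" "a0 \<in> A" "x * a0 \<noteq> 0" using X(1) unfolding good_def by blast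
  have xA: "x \<in> A" using x X(1) unfolding good_def by blast
  define Y where "Y = (\<lambda>a. x * a) ` A"
  have YX: "Y \<subseteq> X" using X(1) x(1) unfolding good_def Y_def by blast
  have sY: "subspace Y" unfolding Y_def
    using xA A(3) by (intro lin_on_image_subspace[OF A(1) lin_on_mult_left A(1)]) auto
  have "\<exists>y\<in>Y. \<exists>a\<in>A. y * a \<noteq> 0" using zero[OF xA] x(2,3) unfolding Y_def by blast
  moreover have "y * a \<in> Y" if "y \<in> Y" "a \<in> A" for y a
    using that A(4) unfolding Y_def by (auto simp: mult.assoc)
  ultimately have "good Y" using YX X(1) sY unfolding good_def by blast
  then have "dim X \<le> dim Y" by (rule X(2))
  moreover have "fdim X" using X(1) A(2) fdim_subset unfolding good_def by blast
  ultimately have "Y = X" using fdim_dim_eq YX sY by blast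
  then obtain a where a: "a \<in> A" "x = x * a" using x(1) unfolding Y_def by blast
  have "x = x * a ^ n" for n
  proof (induction n)
    case (Suc n) then show ?case using a(2) by (metis mult.assoc power_Suc)
  qed simp
  moreover obtain n where "a ^ n = 0" using nil a(1) by blast
  ultimately have "x = 0" by (metis mult_zero_right)
  then show False using x(3) by simp
qed

lemma lsub_lder: "lsub P \<Longrightarrow> lsub (lder P)"
  unfolding lsub_def[of "lder P"] using lder_subset[of P] commutator_in_lder[of _ P]
  by (auto simp: lder_def)

lemma ders_stable:
  assumes "lsub P" "fdim P"
  obtains n where "lsub (ders P n)" "ders P n \<subseteq> P" "lder (ders P n) = ders P n"
proof -
  have sub: "lsub (ders P n)" for n by (induction n) (auto simp: assms lsub_lder)
  have dec: "ders P (Suc n) \<subseteq> ders P n" for n using lder_subset[OF sub] by simp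
  have le: "ders P n \<subseteq> P" for n by (induction n) (use dec in auto)
  have fd: "fdim (ders P n)" for n using fdim_subset[OF assms(2) le] .
  have "\<exists>n. dim (ders P n) \<le> dim (ders P (Suc n))"
  proof (rule ccontr)
    assume "\<not> ?thesis"
    then have lt: "dim (ders P (Suc n)) < dim (ders P n)" for n by (meson not_le)
    have "dim (ders P n) + n \<le> dim P" for n
    proof (induction n)
      case (Suc n) then show ?case using lt[of n] by linarith
    qed simp
    from this[of "Suc (dim P)"] show False by simp
  qed
  then obtain n where "dim (ders P n) \<le> dim (ders P (Suc n))" by blast
  then have "ders P (Suc n) = ders P n"
    using fdim_dim_eq[OF fd dec] sub[of "Suc n"] unfolding lsub_def by blast
  then show ?thesis using that sub le by simp
qed

end

section \<open>From isotropic trace forms to solvability\<close>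

context pos_trace_alg
begin

text \<open>The derived series ends in a perfect subalgebra, whose elements are nilpotent by
  \<open>cartan_nilpotent\<close>. All words in it have trace zero, so its associative envelope is
  nil; perfectness makes the envelope equal to the span of its products, hence zero.\<close>

lemma cartan_solvable:
  assumes P: "P \<subseteq> F" "lsub P" "fdim P" and iso: "\<And>a b. a \<in> P \<Longrightarrow> b \<in> P \<Longrightarrow> \<tau> (a * b) = 0"
  shows "\<exists>n. ders P n = {0}"
proof -
  obtain n where Q: "lsub (ders P n)" "ders P n \<subseteq> P" "lder (ders P n) = ders P n"
    using ders_stable[OF P(2,3)] by blast
  let ?Q = "ders P n" and ?A = "alg (ders P n)"
  have QF: "?Q \<subseteq> F" using Q(2) P(1) by (rule subset_trans)
  have fd: "fdim ?Q" using fdim_subset[OF P(3) Q(2)] .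
  have nil: "\<exists>k. x ^ k = 0" if "x \<in> ?Q" for x
    using cartan_nilpotent[OF QF Q(1) fd] iso Q(2,3) that by (metis subsetD)
  note word = nil_lsub_tr_word[OF QF Q(1) nil]
  have AF: "?A \<subseteq> F" by (rule alg_F[OF QF])
  \<comment> \<open>Testing against all words on the left, the empty one included, makes the set
    stable under left multiplication by letters.\<close>
  have "?A \<subseteq> {a \<in> F. \<forall>xs. set xs \<subseteq> ?Q \<longrightarrow> \<tau> (prod_list xs * a) = 0}" (is "_ \<subseteq> ?W")
  proof (rule alg_least)
    have pl: "prod_list xs \<in> idealizer" if "set xs \<subseteq> ?Q" for xs
      using that QF idealizer(1,2,5) by (induction xs) auto
    show "subspace ?W" unfolding subspace_def
      using idealizer(4,6)[OF pl]
      by (auto simp: F_zero tr_zero F_add F_scale distrib_left tr_add tr_scale homogD)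
    show "?Q \<subseteq> ?W"
    proof (intro subsetI CollectI conjI allI impI)
      fix x assume x: "x \<in> ?Q"
      show "x \<in> F" using x QF by blast
      fix xs assume "set xs \<subseteq> ?Q"
      then show "\<tau> (prod_list xs * x) = 0" using word[of "xs @ [x]"] x by simp
    qed
    show "x * a \<in> ?W" if x: "x \<in> ?Q" and a: "a \<in> ?W" for x a
    proof (intro CollectI conjI allI impI)
      show "x * a \<in> F" using x a QF F_mult by blast
      fix xs assume "set xs \<subseteq> ?Q"
      then have "set (xs @ [x]) \<subseteq> ?Q" using x by simp
      then have "\<tau> (prod_list (xs @ [x]) * a) = 0" using a by blast
      then show "\<tau> (prod_list xs * (x * a)) = 0" by (simp add: mult.assoc)
    qed
  qed
  then have tr0: "\<tau> a = 0" if "a \<in> ?A" for a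
    using that by (auto dest!: subsetD spec[of _ "[]"])
  have "?A \<subseteq> {0}"
  proof (rule nil_idempotent_algebra_zero[OF subspace_alg fdim_alg[OF QF fd]])
    show "?A \<subseteq> homog" using AF F_homog by blast
    show "a * b \<in> ?A" if "a \<in> ?A" "b \<in> ?A" for a b using that by (rule alg_mult)
    show "\<exists>k. a ^ k = 0" if "a \<in> ?A" for a
      using nil_tr[of a] AF that tr0 alg_power by blast
    let ?S = "span {a * b | a b. a \<in> ?A \<and> b \<in> ?A}"
    have QA: "?Q \<subseteq> ?A" by (auto intro: alg.base)
    show "?A \<subseteq> ?S"
    proof (rule alg_least)
      have "commutator a b \<in> ?S" if "a \<in> ?Q" "b \<in> ?Q" for a b
        unfolding commutator_def using that QA by (intro span_diff span_base) auto
      then have "lder ?Q \<subseteq> ?S" unfolding lder_def by (intro span_minimal) auto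
      then show "?Q \<subseteq> ?S" using Q(3) by simp
      have SA: "?S \<subseteq> ?A" by (rule span_minimal[OF _ subspace_alg]) (auto intro: alg_mult)
      show "x * a \<in> ?S" if "x \<in> ?Q" "a \<in> ?S" for x a
        using that QA SA by (intro span_base) blast
    qed simp
  qed
  then have "?Q \<subseteq> {0}" using alg.base by blast
  moreover have "0 \<in> ?Q" using Q(1) subspace_0 unfolding lsub_def by blast
  ultimately show ?thesis by blast
qed

end

section \<open>Duality for the trace form\<close>

context trace_alg
begin

lemma tr_mult_form: "D \<subseteq> F \<Longrightarrow> x \<in> F \<Longrightarrow> form_on D (\<lambda>z. \<tau> (x * z))"
  unfolding form_on_def using F_homog
  by (auto simp: distrib_left tr_add tr_scale F_mult homogD subset_iff)

lemma tr_separation: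
  assumes D: "subspace D" "D \<subseteq> F" and Z: "finite Z" "Z \<subseteq> F" "y \<in> F" "y \<notin> span Z"
    and nd: "\<And>u. u \<in> span (insert y Z) \<Longrightarrow> u \<noteq> 0 \<Longrightarrow> \<exists>x\<in>D. \<tau> (x * u) \<noteq> 0"
  shows "\<exists>x\<in>D. (\<forall>z\<in>span Z. \<tau> (x * z) = 0) \<and> \<tau> (x * y) \<noteq> 0"
proof -
  let ?\<Phi> = "{f. \<exists>x\<in>D. \<forall>z\<in>F. f z = \<tau> (x * z)}"
  have "\<exists>f\<in>?\<Phi>. (\<forall>z\<in>Z. f z = 0) \<and> f y \<noteq> 0"
  proof (rule separating_form[OF subspace_F Z])
    fix f assume "f \<in> ?\<Phi>"
    then obtain x where "x \<in> D" "\<forall>z\<in>F. f z = \<tau> (x * z)" by blast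
    then show "form_on F f" using tr_mult_form[of F x] D(2) F_add F_scale unfolding form_on_def by auto
  next
    fix f g c assume "f \<in> ?\<Phi>" "g \<in> ?\<Phi>"
    then obtain x x' where xx: "x \<in> D" "\<forall>z\<in>F. f z = \<tau> (x * z)" "x' \<in> D" "\<forall>z\<in>F. g z = \<tau> (x' * z)" by blast
    have "\<tau> ((x - scale c x') * z) = \<tau> (x * z) - c * \<tau> (x' * z)" if "z \<in> F" for z
    proof -
      have "x \<in> F" "x' \<in> F" using xx D(2) by auto
      then show ?thesis using that by (simp add: left_diff_distrib scale_mult_left tr_diff tr_scale F_mult F_scale)
    qed
    then show "(\<lambda>x. f x - c * g x) \<in> ?\<Phi>"
      using xx subspace_diff[OF D(1) xx(1) subspace_scale[OF D(1) xx(3)]] by (intro CollectI bexI[of _ "x - scale c x'"]) auto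
  next
    fix u assume u: "u \<in> span (insert y Z)" "u \<noteq> 0"
    then obtain x where "x \<in> D" "\<tau> (x * u) \<noteq> 0" using nd by blast
    then show "\<exists>f\<in>?\<Phi>. f u \<noteq> 0" by (intro bexI[of _ "\<lambda>z. \<tau> (x * z)"]) auto
  qed
  then obtain f x where fx: "x \<in> D" "\<forall>z\<in>F. f z = \<tau> (x * z)" "\<forall>z\<in>Z. f z = 0" "f y \<noteq> 0" by blast
  have xF: "x \<in> F" using fx(1) D(2) by blast
  have "span Z \<subseteq> {z \<in> F. \<tau> (x * z) = 0}"
  proof (rule span_minimal)
    show "Z \<subseteq> {z \<in> F. \<tau> (x * z) = 0}"
    proof
      fix z assume "z \<in> Z"
      then have "z \<in> F" "f z = 0" using fx(3) Z(2) by auto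
      then show "z \<in> {z \<in> F. \<tau> (x * z) = 0}" using fx(2) by simp
    qed
    show "subspace {z \<in> F. \<tau> (x * z) = 0}"
      using tr_mult_form[OF subset_refl xF] unfolding subspace_def form_on_def
      by (auto simp: F_zero F_add F_scale tr_zero)
  qed
  then have "\<forall>z\<in>span Z. \<tau> (x * z) = 0" by blast
  moreover have "\<tau> (x * y) \<noteq> 0" using fx(2,4) Z(3) by simp
  ultimately show ?thesis using fx(1) by blast
qed

lemma tr_riesz:
  assumes C: "subspace C" "C \<subseteq> F" "fdim C" and \<phi>: "form_on C \<phi>"
    and nd: "\<And>u. u \<in> C \<Longrightarrow> u \<noteq> 0 \<Longrightarrow> \<exists>x\<in>C. \<tau> (x * u) \<noteq> 0"
  shows "\<exists>e\<in>C. \<forall>z\<in>C. \<tau> (e * z) = \<phi> z"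
proof (rule riesz_form[OF C(1,3) \<phi>])
  show "form_on C (\<lambda>z. \<tau> (x * z))" if "x \<in> C" for x using tr_mult_form[OF C(2)] C(2) that by blast
  show "\<tau> ((x - scale c y) * z) = \<tau> (x * z) - c * \<tau> (y * z)" if "x \<in> C" "y \<in> C" "z \<in> C" for x y c z
  proof -
    have "x \<in> F" "y \<in> F" "z \<in> F" using that C(2) by auto
    then show ?thesis by (simp add: left_diff_distrib scale_mult_left tr_diff tr_scale F_mult F_scale)
  qed
qed (rule nd)

end

context pos_trace_alg
begin

text \<open>The kernel of the trace form on \<open>Q\<close> is a solvable ideal by
  \<open>cartan_solvable\<close>, so the form is nondegenerate. If some \<open>y\<close> lay outside
  \<open>lder Q\<close>, a separating form represented by \<open>x\<close> would vanish on all
  brackets; invariance makes \<open>x\<close> central, and its span is an abelian ideal.\<close>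

lemma semisimple_perfect:
  assumes Q: "Q \<subseteq> F" "lsub Q" "fdim Q"
    and ss: "\<And>I n. lideal Q I \<Longrightarrow> ders I n = {0} \<Longrightarrow> I = {0}"
  shows "lder Q = Q"
proof (rule ccontr)
  assume "lder Q \<noteq> Q"
  then obtain y where y: "y \<in> Q" "y \<notin> lder Q" using lder_subset[OF Q(2)] by blast
  have subQ: "subspace Q" and cQ: "\<And>a b. a \<in> Q \<Longrightarrow> b \<in> Q \<Longrightarrow> commutator a b \<in> Q"
    using Q(2) unfolding lsub_def by blast+
  define T where "T = {x \<in> Q. \<forall>y\<in>Q. \<tau> (x * y) = 0}"
  have TQ: "T \<subseteq> Q" unfolding T_def by blast
  have inv: "\<tau> (commutator a x * b) = 0" if "a \<in> Q" "x \<in> T" "b \<in> Q" for a x b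
  proof -
    have "\<tau> (commutator a x * b) = \<tau> (x * commutator b a)"
      using tr_invariant'[of a x b] that TQ Q(1) by blast
    moreover have "commutator b a \<in> Q" using cQ that(1,3) by blast
    ultimately show ?thesis using that(2) by (simp add: T_def)
  qed
  have sT: "subspace T" unfolding T_def subspace_def using Q(1) subQ
    by (auto simp: subspace_0 subspace_add subspace_scale distrib_right scale_mult_left tr_zero tr_add tr_scale F_mult subset_iff)
  have "commutator a x \<in> T" if "a \<in> Q" "x \<in> T" for a x
    using inv[OF that] cQ[of a x] that TQ unfolding T_def by auto
  then have idT: "lideal Q T" unfolding lideal_def using sT TQ by auto
  have "lsub T" using idT TQ unfolding lsub_def lideal_def by blast
  then obtain n where "ders T n = {0}"
    using cartan_solvable[of T] TQ Q(1) fdim_subset[OF Q(3) TQ] unfolding T_def by blast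
  then have T0: "T = {0}" using ss idT by blast
  obtain Z where Z: "finite Z" "Z \<subseteq> lder Q" "span Z = lder Q"
    using fdim_basis_subspace[OF fdim_subset[OF Q(3) lder_subset[OF Q(2)]]] unfolding lder_def by auto
  have "\<exists>x\<in>Q. (\<forall>z\<in>span Z. \<tau> (x * z) = 0) \<and> \<tau> (x * y) \<noteq> 0"
  proof (rule tr_separation[OF subQ Q(1) Z(1)])
    show "Z \<subseteq> F" "y \<in> F" "y \<notin> span Z" using Z lder_subset[OF Q(2)] Q(1) y by auto
    fix u assume u: "u \<in> span (insert y Z)" "u \<noteq> 0"
    have uQ: "u \<in> Q" using u(1) span_minimal[of "insert y Z" Q] y Z lder_subset[OF Q(2)] subQ by blast
    then have "u \<notin> T" using T0 u(2) by blast
    then obtain x where "x \<in> Q" "\<tau> (u * x) \<noteq> 0" using uQ unfolding T_def by blast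
    moreover from this have "\<tau> (x * u) \<noteq> 0" using tr_comm[of u x] uQ Q(1) by (simp add: subset_iff)
    ultimately show "\<exists>x\<in>Q. \<tau> (x * u) \<noteq> 0" by blast
  qed
  then obtain x where x: "x \<in> Q" "\<forall>z\<in>lder Q. \<tau> (x * z) = 0" "\<tau> (x * y) \<noteq> 0" using Z(3) by blast
  have central: "commutator x a = 0" if a: "a \<in> Q" for a
  proof -
    have "\<tau> (commutator x a * b) = 0" if "b \<in> Q" for b
      using tr_invariant[of x a b] x(1,2) a that Q(1) commutator_in_lder[OF a that] by (simp add: subset_iff)
    then have "commutator x a \<in> T" unfolding T_def using cQ x(1) a by blast
    then show ?thesis using T0 by blast
  qed
  have xh: "x \<in> homog" using x(1) Q(1) F_homog by blast
  have central': "commutator a x' = 0" if ax: "a \<in> Q" "x' \<in> span {x}" for a x'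
  proof -
    have "a \<in> homog" using ax Q(1) F_homog by blast
    moreover obtain k where "x' = scale k x" using ax(2) by (auto simp: span_singleton)
    ultimately show ?thesis using central[OF ax(1)] commutator_minus[of x a] by (simp add: commutator_scale_right)
  qed
  have sx: "span {x} \<subseteq> Q" using x(1) subQ by (intro span_minimal) auto
  have "lideal Q (span {x})" unfolding lideal_def using sx central' by (simp add: span_zero)
  moreover have "ders (span {x}) 1 = {0}"
  proof -
    have "{commutator a b | a b. a \<in> span {x} \<and> b \<in> span {x}} \<subseteq> {0}" using central' sx by blast
    then have "lder (span {x}) \<subseteq> {0}" unfolding lder_def by (rule span_minimal) simp
    then show ?thesis using span_zero unfolding lder_def by (auto simp: lder_def)
  qed
  ultimately have "span {x} = {0}" by (rule ss)
  then have "x = 0" using span_base[of x "{x}"] by simp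
  then show False using x(3) by (simp add: tr_zero)
qed

end

section \<open>Semiprime algebras generated by skew elements\<close>

text \<open>The properties kept from the quotient of the envelope by its trace radical:
  \<open>nondeg\<close> is what dividing out achieves, and \<open>lder_m_nondeg\<close> is what
  remains of the locally solvable radical.\<close>

locale skew_generated = talg scale B \<tau> for scale :: "complex \<Rightarrow> 'b::{ring,monoid_mult} \<Rightarrow> 'b" and B \<tau> +
  fixes m :: "'b set" and star :: "'b \<Rightarrow> 'b"
  assumes nondeg: "a \<in> B \<Longrightarrow> (\<And>b. b \<in> B \<Longrightarrow> \<tau> (a * b) = 0) \<Longrightarrow> a = 0"
    and B_alg: "B = alg m"
    and lsub_m: "lsub m"
    and star_B: "a \<in> B \<Longrightarrow> star a \<in> B"
    and star_add: "a \<in> B \<Longrightarrow> b \<in> B \<Longrightarrow> star (a + b) = star a + star b"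
    and star_scale: "a \<in> B \<Longrightarrow> star (scale c a) = scale c (star a)"
    and star_mult: "a \<in> B \<Longrightarrow> b \<in> B \<Longrightarrow> star (a * b) = star b * star a"
    and star_star: "a \<in> B \<Longrightarrow> star (star a) = a"
    and star_tr: "a \<in> B \<Longrightarrow> \<tau> (star a) = \<tau> a"
    and star_m: "x \<in> m \<Longrightarrow> star x = - x"
    and lder_m_nondeg: "x \<in> lder m \<Longrightarrow> (\<And>y. y \<in> m \<Longrightarrow> \<tau> (x * y) = 0) \<Longrightarrow> x = 0"
begin

lemma m_B: "m \<subseteq> B" unfolding B_alg by (auto intro: alg.base)

lemma B_homog: "a \<in> B \<Longrightarrow> a \<in> homog" using F_homog by blast

lemma subspace_m: "subspace m" using lsub_m unfolding lsub_def by blast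

lemma m_commutator: "x \<in> m \<Longrightarrow> y \<in> m \<Longrightarrow> commutator x y \<in> m" using lsub_m unfolding lsub_def by blast

lemma nondeg': "a \<in> B \<Longrightarrow> (\<And>b. b \<in> B \<Longrightarrow> \<tau> (b * a) = 0) \<Longrightarrow> a = 0"
  using nondeg[of a] tr_comm[of a] by metis

lemma star_lin: "lin_on B star" unfolding lin_on_def using star_add star_scale by blast

lemma star_zero: "star 0 = 0" by (rule lin_on_zero[OF subspace_F star_lin])

lemma star_diff: "a \<in> B \<Longrightarrow> b \<in> B \<Longrightarrow> star (a - b) = star a - star b"
  using lin_on_diff_scale[OF subspace_F star_lin, of a b 1] by simp

definition skew :: "'b \<Rightarrow> 'b" where "skew a = a - star a"

lemma skew_lin: "lin_on B skew"
  unfolding lin_on_def skew_def by (simp add: star_add star_scale scale_right_diff_distrib)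

lemma skew_span: "X \<subseteq> B \<Longrightarrow> x \<in> span X \<Longrightarrow> skew x \<in> span (skew ` X)"
  by (rule lin_on_image_span[OF subspace_F skew_lin])

text \<open>Von Neumann regularity from the trace. If \<open>x\<close> were outside
  \<open>x B x\<close>, some \<open>c\<close> would have \<open>\<tau> (c * x)\<close> nonzero and
  be orthogonal to \<open>x B x\<close>. Cyclicity and nondegeneracy give
  \<open>x * c * x = 0\<close>, so \<open>c * x\<close> squares to zero and has trace zero.\<close>

lemma regular: assumes x: "x \<in> B" obtains b where "b \<in> B" "x = x * b * x"
proof -
  let ?Z = "{x * b * x | b. b \<in> B}"
  have Z: "?Z = (\<lambda>b. x * b * x) ` B" by blast
  have "lin_on B (\<lambda>b. x * b * x)" unfolding lin_on_def
    using B_homog[OF x] by (simp add: algebra_simps homogD scale_mult_left)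
  then have sZ: "subspace ?Z" unfolding Z by (intro lin_on_image_subspace[OF subspace_F _ subspace_F]) auto
  have ZB: "?Z \<subseteq> B" using x F_mult by blast
  have "x \<in> ?Z"
  proof (rule ccontr)
    assume nx: "x \<notin> ?Z"
    obtain Y where Y: "finite Y" "Y \<subseteq> ?Z" "span Y = ?Z" using fdim_basis_subspace[OF F_fdim[OF x x] sZ] by blast
    have "\<exists>c\<in>B. (\<forall>z\<in>span Y. \<tau> (c * z) = 0) \<and> \<tau> (c * x) \<noteq> 0"
    proof (rule tr_separation[OF subspace_F subset_refl Y(1)])
      show "Y \<subseteq> B" "x \<in> B" "x \<notin> span Y" using Y ZB x nx by auto
      fix u assume u: "u \<in> span (insert x Y)" "u \<noteq> 0"
      have "span (insert x Y) \<subseteq> B" using Y ZB x by (intro span_minimal subspace_F) auto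
      then show "\<exists>c\<in>B. \<tau> (c * u) \<noteq> 0" using u nondeg' by blast
    qed
    then obtain c where c: "c \<in> B" "\<forall>z\<in>?Z. \<tau> (c * z) = 0" "\<tau> (c * x) \<noteq> 0" using Y(3) by blast
    have "x * c * x = 0"
    proof (rule nondeg)
      show "x * c * x \<in> B" using x c F_mult by blast
      fix b assume b: "b \<in> B"
      have "\<tau> (x * c * x * b) = \<tau> (x * (c * x * b))" by (simp add: mult.assoc)
      also have "\<dots> = \<tau> (c * x * b * x)" using x b c(1) F_mult by (intro tr_comm) auto
      also have "\<dots> = \<tau> (c * (x * b * x))" by (simp add: mult.assoc)
      also have "\<dots> = 0" using c(2) b by blast
      finally show "\<tau> (x * c * x * b) = 0" .
    qed
    then have "(c * x) ^ 2 = 0" by (simp add: power2_eq_square mult.assoc)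
    then show False using tr_nil[of "c * x" 2] c x F_mult by blast
  qed
  then show ?thesis using that by blast
qed

text \<open>Containment in \<open>m\<close> up to finitely many dimensions. No bound on the error is
  kept, since later only the finiteness of a codimension matters.\<close>

definition almost_m :: "'b set \<Rightarrow> bool" where
  "almost_m Z \<longleftrightarrow> (\<exists>X. finite X \<and> Z \<subseteq> span (m \<union> X))"

lemma almost_m_subset: "almost_m Z \<Longrightarrow> Y \<subseteq> Z \<Longrightarrow> almost_m Y"
  unfolding almost_m_def by blast

lemma almost_m_span: "almost_m Z \<Longrightarrow> almost_m (span Z)"
  unfolding almost_m_def by (meson span_minimal subspace_span)

lemma almost_m_m: "Z \<subseteq> m \<Longrightarrow> almost_m Z"
  unfolding almost_m_def by (intro exI[of _ "{}"]) (auto intro: span_base)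

lemma almost_m_Un: assumes "almost_m Y" "almost_m Z" shows "almost_m (Y \<union> Z)"
proof -
  obtain A C where AC: "finite A" "Y \<subseteq> span (m \<union> A)" "finite C" "Z \<subseteq> span (m \<union> C)"
    using assms unfolding almost_m_def by blast
  have "span (m \<union> A) \<subseteq> span (m \<union> (A \<union> C))" "span (m \<union> C) \<subseteq> span (m \<union> (A \<union> C))"
    by (auto intro!: span_mono)
  then show ?thesis using AC unfolding almost_m_def by (intro exI[of _ "A \<union> C"]) blast
qed

lemma almost_m_fdim: "fdim Z \<Longrightarrow> almost_m Z"
  unfolding almost_m_def fdim_def using span_mono[of _ "m \<union> _"] by (metis Un_upper2 subset_trans)

lemma almost_m_UN: "finite I \<Longrightarrow> (\<And>i. i \<in> I \<Longrightarrow> almost_m (A i)) \<Longrightarrow> almost_m (\<Union>i\<in>I. A i)"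
  by (induction I rule: finite_induct) (auto intro: almost_m_Un almost_m_m)

text \<open>The product rule for \<open>ad\<close>: every \<open>a\<close> in the associative envelope acts by \<open>z \<mapsto> a z - (a z)*\<close> on
  \<open>m\<close>, up to operators of finite rank.\<close>
lemma almost_m_skew_mult:
  assumes "a \<in> B" shows "almost_m ((\<lambda>z. skew (a * z)) ` m)"
  using assms unfolding B_alg
proof (induction rule: alg.induct)
  case (base x)
  have "skew (x * z) = commutator x z" if "z \<in> m" for z
    using base that m_B star_mult[of x z] star_m[of x] star_m[of z] by (auto simp: skew_def commutator_def)
  then show ?case using base m_commutator by (intro almost_m_m) auto
next
  case zero
  then show ?case using subspace_0[OF subspace_m] by (intro almost_m_m) (auto simp: skew_def star_zero)
next
  case (add a b)
  have ab: "a \<in> B" "b \<in> B" using add B_alg by auto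
  let ?f = "\<lambda>a. (\<lambda>z. skew (a * z)) ` m"
  have "?f (a + b) \<subseteq> span (?f a \<union> ?f b)"
  proof clarify
    fix z assume z: "z \<in> m"
    have "skew ((a + b) * z) = skew (a * z) + skew (b * z)"
      using skew_lin z ab m_B F_mult unfolding lin_on_def by (auto simp: distrib_right subset_iff)
    then show "skew ((a + b) * z) \<in> span (?f a \<union> ?f b)"
      using z by (simp only:) (intro span_add span_base; blast)
  qed
  then show ?case using almost_m_span[OF almost_m_Un[OF add.IH]] almost_m_subset by blast
next
  case (scale a c)
  let ?f = "\<lambda>a. (\<lambda>z. skew (a * z)) ` m"
  have "?f (scale c a) \<subseteq> span (?f a)"
  proof clarify
    fix z assume z: "z \<in> m"
    have "a * z \<in> B" using z m_B scale(1) F_mult B_alg by auto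
    then have "skew (scale c a * z) = scale c (skew (a * z))"
      using skew_lin unfolding lin_on_def scale_mult_left by blast
    then show "skew (scale c a * z) \<in> span (?f a)"
      using z by (simp only:) (intro span_scale span_base; blast)
  qed
  then show ?case using almost_m_span[OF scale.IH] almost_m_subset by blast
next
  case (mult x a)
  have a: "a \<in> B" using mult B_alg by auto
  have x: "x \<in> B" using mult(1) m_B by blast
  let ?f = "\<lambda>a. (\<lambda>z. skew (a * z)) ` m"
  let ?Y = "commutator x ` ?f a" and ?U = "{x * b * star a | b. b \<in> B}" and ?V = "{a * b * x | b. b \<in> B}"
  have "?f (x * a) \<subseteq> span (?Y \<union> (?U \<union> ?V))"
  proof clarify
    fix z assume z: "z \<in> m"
    then have zB: "z \<in> B" using m_B by blast
    have sx: "star x = - x" "star z = - z" using star_m mult(1) z by auto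
    have 1: "star (x * a * z) = z * star a * x" using x a zB F_mult sx by (simp add: star_mult mult.assoc)
    have 2: "star (a * z) = - z * star a" using a zB sx by (simp add: star_mult)
    \<comment> \<open>The two correction terms lie in the corners \<open>x B (star a)\<close> and
      \<open>a B x\<close>, which are finite-dimensional although \<open>z\<close> runs through all
      of \<open>m\<close>.\<close>
    have "skew (x * a * z) = commutator x (skew (a * z)) - x * z * star a + a * z * x"
      unfolding skew_def 1 2 by (simp add: commutator_def algebra_simps)
    moreover have "commutator x (skew (a * z)) \<in> span (?Y \<union> (?U \<union> ?V))" using z by (intro span_base) blast
    moreover have "x * z * star a \<in> span (?Y \<union> (?U \<union> ?V))" using zB by (intro span_base) blast
    moreover have "a * z * x \<in> span (?Y \<union> (?U \<union> ?V))" using zB by (intro span_base) blast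
    ultimately show "skew (x * a * z) \<in> span (?Y \<union> (?U \<union> ?V))" by (simp add: span_add span_diff)
  qed
  moreover have "almost_m ?Y"
  proof -
    obtain X where X: "finite X" "?f a \<subseteq> span (m \<union> X)" using mult.IH unfolding almost_m_def by blast
    have "?Y \<subseteq> span (commutator x ` (m \<union> X))"
      using X(2) lin_on_image_span[OF subspace_UNIV lin_on_commutator[OF B_homog[OF x]]] by blast
    also have "\<dots> \<subseteq> span (m \<union> commutator x ` X)" using mult(1) m_commutator by (intro span_mono) auto
    finally show ?thesis using X(1) unfolding almost_m_def by blast
  qed
  moreover have "almost_m (?U \<union> ?V)" using a x star_B by (intro almost_m_fdim fdim_Un F_fdim) auto
  ultimately show ?case using almost_m_span[OF almost_m_Un] almost_m_subset by blast
qed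

lemma almost_m_skew_mult':
  assumes "a \<in> B" shows "almost_m ((\<lambda>z. skew (z * a)) ` m)"
proof -
  have "skew (z * a) = skew (star a * z)" if "z \<in> m" for z
    using that m_B assms star_B star_m[of z] by (auto simp: skew_def star_mult star_star)
  then show ?thesis using almost_m_skew_mult[OF star_B[OF assms]] by simp
qed

lemma prod_list_idealizer: "set ys \<subseteq> m \<Longrightarrow> prod_list ys \<in> idealizer"
  using m_B idealizer(1,2,5) by (induction ys) auto

text \<open>Since \<open>z B a\<close> is finite-dimensional, a finite set \<open>C\<close> in
  \<open>B a\<close> accounts for all \<open>z * c\<close>. A word \<open>ys\<close> in front of
  \<open>z * c\<close> becomes the iterated bracket \<open>ad ys\<close>, an element of
  \<open>m\<close>, times \<open>c\<close>, up to words with fewer letters before \<open>z\<close>.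
  So \<open>B z B a\<close> lies in the span of \<open>m C\<close> and \<open>z C\<close>, and
  \<open>almost_m_skew_mult'\<close> treats each of the finitely many \<open>c\<close>.\<close>

lemma almost_m_skew_BmBa:
  assumes z: "z \<in> m" and a: "a \<in> B"
  shows "almost_m {skew (w * z * b * a) | w b. w \<in> B \<and> b \<in> B}"
proof -
  have zB: "z \<in> B" using z m_B by blast
  let ?Ba = "{b * a | b. b \<in> B}"
  have Ba: "?Ba \<subseteq> B" using a F_mult by blast
  obtain X where X: "finite X" "X \<subseteq> {z * b * a | b. b \<in> B}" "{z * b * a | b. b \<in> B} \<subseteq> span X"
    using fdim_basis[OF F_fdim[OF zB a]] by blast
  have "\<forall>x\<in>X. \<exists>c. c \<in> ?Ba \<and> x = z * c"
  proof
    fix x assume "x \<in> X"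
    then obtain b where "b \<in> B" "x = z * b * a" using X(2) by blast
    then show "\<exists>c. c \<in> ?Ba \<and> x = z * c" by (intro exI[of _ "b * a"]) (auto simp: mult.assoc)
  qed
  from bchoice[OF this] obtain g where g: "\<And>x. x \<in> X \<Longrightarrow> g x \<in> ?Ba \<and> x = z * g x" by blast
  define C where "C = g ` X"
  have C: "finite C" "C \<subseteq> ?Ba" unfolding C_def using X(1) g by auto
  have zc: "z * c \<in> span ((\<lambda>c. z * c) ` C)" if "c \<in> ?Ba" for c
  proof -
    have "z * c \<in> span X" using that X(3) by (auto simp: mult.assoc)
    moreover have "X \<subseteq> (\<lambda>c. z * c) ` C" unfolding C_def using g by blast
    ultimately show ?thesis using span_mono by blast
  qed
  let ?S = "{y * c | y c. y \<in> m \<and> c \<in> C}"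
  have SB: "?S \<subseteq> B" using m_B C Ba F_mult by blast
  define ad where "ad ys = foldr commutator ys z" for ys
  have adm: "set ys \<subseteq> m \<Longrightarrow> ad ys \<in> m" for ys
    unfolding ad_def using z m_commutator by (induction ys) auto
  \<comment> \<open>Words with fewer than \<open>k\<close> letters in front of \<open>z\<close>;
    they form the error when letters become brackets.\<close>
  define P where "P k = span {prod_list ys * z * c | ys c. length ys < k \<and> set ys \<subseteq> m \<and> c \<in> ?Ba}" for k
  have Pmono: "P k \<subseteq> P (Suc k)" for k unfolding P_def by (intro span_mono) (blast intro: less_SucI)
  have Pm: "y * v \<in> P (Suc k)" if "y \<in> m" "v \<in> P k" for y v k
  proof -
    have "y * v \<in> span ((\<lambda>v. y * v) ` {prod_list ys * z * c | ys c. length ys < k \<and> set ys \<subseteq> m \<and> c \<in> ?Ba})"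
      using that m_B B_homog unfolding P_def by (intro span_mult_left) auto
    also have "\<dots> \<subseteq> P (Suc k)" unfolding P_def
    proof (rule span_mono, clarify)
      fix ys b assume "length ys < k" "set ys \<subseteq> m" "b \<in> B"
      then show "\<exists>ys' c. y * (prod_list ys * z * (b * a)) = prod_list ys' * z * c \<and> length ys' < Suc k \<and> set ys' \<subseteq> m \<and> c \<in> ?Ba"
        using that(1) by (intro exI[of _ "y # ys"] exI[of _ "b * a"]) (auto simp: mult.assoc)
    qed
    finally show ?thesis .
  qed
  have ad_prod: "ad ys * c - prod_list ys * z * c \<in> P (length ys)" if "set ys \<subseteq> m" "c \<in> ?Ba" for ys c
    using that
  proof (induction ys arbitrary: c)
    case Nil then show ?case unfolding ad_def P_def by (simp add: span_zero)
  next
    case (Cons y ys)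
    have yB: "y \<in> B" using Cons.prems(1) m_B by auto
    obtain b where "b \<in> B" "c = b * a" using Cons.prems(2) by blast
    then have yc: "y * c \<in> ?Ba" using F_mult[OF yB] by (intro CollectI exI[of _ "y * b"]) (auto simp: mult.assoc)
    have 1: "y * (ad ys * c - prod_list ys * z * c) \<in> P (Suc (length ys))" using Cons by (intro Pm) auto
    have 2: "ad ys * (y * c) - prod_list ys * z * (y * c) \<in> P (Suc (length ys))" using Cons yc Pmono by auto
    have 3: "prod_list ys * z * (y * c) \<in> P (Suc (length ys))"
      unfolding P_def using Cons.prems yc by (intro span_base) auto
    have "ad (y # ys) * c - prod_list (y # ys) * z * c
      = y * (ad ys * c - prod_list ys * z * c) - (ad ys * (y * c) - prod_list ys * z * (y * c)) - prod_list ys * z * (y * c)"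
      unfolding ad_def by (simp add: commutator_def algebra_simps)
    moreover have "subspace (P (Suc (length ys)))" unfolding P_def by (rule subspace_span)
    ultimately have "ad (y # ys) * c - prod_list (y # ys) * z * c \<in> P (Suc (length ys))"
      using 1 2 3 subspace_diff by (simp only:)
    then show ?case by simp
  qed
  define W where "W = span (?S \<union> (\<lambda>c. z * c) ` C)"
  have subW: "subspace W" unfolding W_def by simp
  have word: "prod_list ys * z * c \<in> W" if "set ys \<subseteq> m" "c \<in> ?Ba" for ys c
    using that
  proof (induction "length ys" arbitrary: ys c rule: less_induct)
    case less
    have h: "prod_list ys \<in> homog" using prod_list_idealizer less.prems idealizer(6) by blast
    have PW: "P (length ys) \<subseteq> W" unfolding P_def using less.hyps by (intro span_minimal subW) blast
    have *: "prod_list ys * (z * c') \<in> W" if "c' \<in> C" for c'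
    proof (cases "ys = []")
      case True then show ?thesis using that unfolding W_def by (auto intro: span_base)
    next
      case False
      have "c' \<in> ?Ba" using that C by blast
      then have "ad ys * c' - prod_list ys * z * c' \<in> W" using ad_prod less.prems(1) PW by blast
      moreover have "ad ys * c' \<in> W" unfolding W_def using adm[OF less.prems(1)] that by (intro span_base) blast
      ultimately have "ad ys * c' - (ad ys * c' - prod_list ys * z * c') \<in> W" by (rule subspace_diff[OF subW, rotated])
      then show ?thesis by (simp add: mult.assoc)
    qed
    have "prod_list ys * (z * c) \<in> span ((\<lambda>v. prod_list ys * v) ` ((\<lambda>c. z * c) ` C))"
      by (rule span_mult_left[OF h zc[OF less.prems(2)]])
    also have "\<dots> \<subseteq> W" using * by (intro span_minimal subW) auto
    finally show ?case by (simp add: mult.assoc)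
  qed
  \<comment> \<open>The arbitrary prefix \<open>ys\<close> lets the induction over
    \<open>alg m\<close> hand the letters of \<open>w\<close> over to the word; the empty prefix is
    the case of interest.\<close>
  have "alg m \<subseteq> {w. \<forall>ys c. set ys \<subseteq> m \<longrightarrow> c \<in> ?Ba \<longrightarrow> prod_list ys * w * z * c \<in> W}" (is "_ \<subseteq> ?G")
  proof (rule alg_least)
    show "subspace ?G" unfolding subspace_def
    proof (intro conjI ballI allI CollectI impI)
      fix v w ys c assume "v \<in> ?G" "w \<in> ?G" "set ys \<subseteq> m" "c \<in> ?Ba"
      then have "prod_list ys * v * z * c + prod_list ys * w * z * c \<in> W" using subspace_add[OF subW] by blast
      then show "prod_list ys * (v + w) * z * c \<in> W" by (simp add: algebra_simps)
    next
      fix k w ys c assume w: "w \<in> ?G" "set ys \<subseteq> m" "c \<in> ?Ba"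
      then have "scale k (prod_list ys * w * z * c) \<in> W" using subspace_scale[OF subW] by blast
      moreover have "prod_list ys \<in> homog" using prod_list_idealizer w(2) idealizer(6) by blast
      ultimately show "prod_list ys * scale k w * z * c \<in> W" by (simp add: homogD scale_mult_left)
    qed (simp add: subspace_0[OF subW])
    show "m \<subseteq> ?G"
    proof clarify
      fix x ys b assume x: "x \<in> m" "set ys \<subseteq> m" "b \<in> B"
      then have "prod_list (ys @ [x]) * z * (b * a) \<in> W" by (intro word) auto
      then show "prod_list ys * x * z * (b * a) \<in> W" by simp
    qed
    show "x * w \<in> ?G" if x: "x \<in> m" and w: "w \<in> ?G" for x w
    proof clarify
      fix ys b assume "set ys \<subseteq> m" "b \<in> B"
      then have "set (ys @ [x]) \<subseteq> m" "b * a \<in> ?Ba" using x by auto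
      then have "prod_list (ys @ [x]) * w * z * (b * a) \<in> W" using w by blast
      then show "prod_list ys * (x * w) * z * (b * a) \<in> W" by (simp add: mult.assoc)
    qed
  qed
  then have BW: "w * z * b * a \<in> W" if "w \<in> B" "b \<in> B" for w b
    using that B_alg by (auto simp: mult.assoc dest!: subsetD spec[of _ "[]"])
  have "almost_m (skew ` (?S \<union> (\<lambda>c. z * c) ` C))"
  proof -
    have "skew ` (?S \<union> (\<lambda>c. z * c) ` C) \<subseteq> (\<Union>c\<in>C. (\<lambda>y. skew (y * c)) ` m) \<union> (\<lambda>c. skew (z * c)) ` C" by auto
    moreover have "almost_m (\<dots>)"
      using C Ba by (intro almost_m_Un almost_m_UN almost_m_skew_mult' almost_m_fdim fdim_finite) auto
    ultimately show ?thesis using almost_m_subset by blast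
  qed
  moreover have "{skew (w * z * b * a) | w b. w \<in> B \<and> b \<in> B} \<subseteq> span (skew ` (?S \<union> (\<lambda>c. z * c) ` C))"
  proof -
    have "?S \<union> (\<lambda>c. z * c) ` C \<subseteq> B" using SB zB C Ba F_mult by blast
    then show ?thesis using skew_span BW unfolding W_def by blast
  qed
  ultimately show ?thesis using almost_m_span almost_m_subset by blast
qed

text \<open>Regularity \<open>a = a * b0 * a\<close> places an element \<open>b0\<close> of
  \<open>alg m\<close> in the middle of every \<open>b * a\<close>. Expanding \<open>b0\<close>
  exposes a letter of \<open>m\<close> between two factors from \<open>B\<close>, which is the shape
  treated in \<open>almost_m_skew_BmBa\<close>; a single letter needs regularity once more to supply
  the second factor.\<close>

lemma almost_m_skew_left_ideal:
  assumes a: "a \<in> B" shows "almost_m {skew (b * a) | b. b \<in> B}"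
proof -
  obtain b0 where b0: "b0 \<in> B" "a = a * b0 * a" using regular[OF a] by blast
  have "almost_m {skew (u * d * a) | u. u \<in> B}" if "d \<in> alg m" for d
    using that
  proof (induction rule: alg.induct)
    case (base x)
    have "u * x * a = u * x * (a * b0) * a" for u using b0(2) by (metis mult.assoc)
    then have "{skew (u * x * a) | u. u \<in> B} \<subseteq> {skew (w * x * b * a) | w b. w \<in> B \<and> b \<in> B}"
      using a b0(1) F_mult by auto (metis)
    then show ?case using almost_m_skew_BmBa[OF base a] almost_m_subset by blast
  next
    case zero
    then show ?case using subspace_0[OF subspace_m] by (intro almost_m_m) (auto simp: skew_def star_zero)
  next
    case (add d d')
    have "{skew (u * (d + d') * a) | u. u \<in> B} \<subseteq> span ({skew (u * d * a) | u. u \<in> B} \<union> {skew (u * d' * a) | u. u \<in> B})"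
    proof clarify
      fix u assume u: "u \<in> B"
      have "u * d * a \<in> B" "u * d' * a \<in> B" using u a add.hyps F_mult B_alg by auto
      then have "skew (u * (d + d') * a) = skew (u * d * a) + skew (u * d' * a)"
        using skew_lin unfolding lin_on_def by (simp add: algebra_simps)
      then show "skew (u * (d + d') * a) \<in> span ({skew (u * d * a) | u. u \<in> B} \<union> {skew (u * d' * a) | u. u \<in> B})"
        using u by (simp only:) (intro span_add span_base; blast)
    qed
    then show ?case using almost_m_span[OF almost_m_Un[OF add.IH]] almost_m_subset by blast
  next
    case (scale d c)
    have "{skew (u * scale c d * a) | u. u \<in> B} \<subseteq> span {skew (u * d * a) | u. u \<in> B}"
    proof clarify
      fix u assume u: "u \<in> B"
      have "u * d * a \<in> B" using u a scale.hyps F_mult B_alg by auto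
      then have "skew (u * scale c d * a) = scale c (skew (u * d * a))"
        using skew_lin B_homog[OF u] unfolding lin_on_def by (simp add: homogD scale_mult_left)
      then show "skew (u * scale c d * a) \<in> span {skew (u * d * a) | u. u \<in> B}"
        using u by (simp only:) (intro span_scale span_base; blast)
    qed
    then show ?case using almost_m_span[OF scale.IH] almost_m_subset by blast
  next
    case (mult x d)
    have "{skew (u * (x * d) * a) | u. u \<in> B} \<subseteq> {skew (w * x * b * a) | w b. w \<in> B \<and> b \<in> B}"
      using mult.hyps(2) unfolding B_alg[symmetric] by (auto simp: mult.assoc)
    then show ?case using almost_m_skew_BmBa[OF mult.hyps(1) a] almost_m_subset by blast
  qed
  then have "almost_m {skew (u * b0 * a) | u. u \<in> B}" using b0(1) B_alg by blast
  moreover have "{skew (b * a) | b. b \<in> B} \<subseteq> {skew (u * b0 * a) | u. u \<in> B}"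
  proof clarify
    fix b assume "b \<in> B"
    moreover have "b * a = b * a * b0 * a" using b0(2) by (metis mult.assoc)
    ultimately show "\<exists>u. skew (b * a) = skew (u * b0 * a) \<and> u \<in> B" using a F_mult by metis
  qed
  ultimately show ?thesis using almost_m_subset by blast
qed

lemma almost_m_skew_right_ideal:
  assumes a: "a \<in> B" shows "almost_m {skew (a * b) | b. b \<in> B}"
proof -
  have "{skew (a * b) | b. b \<in> B} \<subseteq> span {skew (b * star a) | b. b \<in> B}"
  proof clarify
    fix b assume b: "b \<in> B"
    have "skew (a * b) = - skew (star b * star a)"
      using a b star_B by (simp add: skew_def star_mult star_star)
    moreover have "skew (star b * star a) \<in> span {skew (b * star a) | b. b \<in> B}"
      using b star_B by (intro span_base) blast
    ultimately show "skew (a * b) \<in> span {skew (b * star a) | b. b \<in> B}" by (simp add: span_neg)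
  qed
  then show ?thesis using almost_m_span[OF almost_m_skew_left_ideal[OF star_B[OF a]]] almost_m_subset by blast
qed

end

section \<open>Corners of skew elements and the finite-dimensional blocks\<close>

context skew_generated
begin

text \<open>All mixed products in the bracket of \<open>skew p\<close> and \<open>skew q\<close>
  vanish except \<open>p * q\<close> and its adjoint, so the bracket is
  \<open>skew (p * q)\<close>.\<close>

lemma skew_bracket:
  assumes B: "a \<in> B" "c \<in> B" "p1 \<in> B" "q1 \<in> B" and pq: "p = a * p1" "q = q1 * c"
    and ca: "c * a = 0" and sm: "skew p \<in> m" "skew q \<in> m" and z: "p * star c = 0" "star a * q = 0"
  shows "skew (p * q) \<in> m"
proof -
  have pB: "p \<in> B" "q \<in> B" using B pq F_mult by auto
  have sp: "star p = star p1 * star a" "star q = star c * star q1" using B pq by (auto simp: star_mult)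
  have 1: "p * star q = 0" unfolding sp using z(1) by (simp add: mult.assoc[symmetric])
  have 2: "star p * q = 0" unfolding sp using z(2) by (simp add: mult.assoc)
  have 3: "q * p = 0" unfolding pq using ca by (metis mult.assoc mult_zero_left mult_zero_right)
  have 4: "star p * star q = 0" using star_mult[OF pB(2,1)] 3 star_zero by simp
  have 5: "q * star p = 0" using star_mult[of p "star q"] 1 pB star_B star_star star_zero by simp
  have 6: "star q * p = 0" using star_mult[of "star p" q] 2 pB star_B star_star star_zero by simp
  have "commutator (skew p) (skew q) = p * q - star q * star p"
    unfolding commutator_def skew_def using 1 2 3 4 5 6 by (simp add: algebra_simps)
  then have "commutator (skew p) (skew q) = skew (p * q)" unfolding skew_def using star_mult[OF pB] by simp
  then show ?thesis using m_commutator[OF sm] by simp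
qed

text \<open>The union of the finite-dimensional two-sided ideals of \<open>B\<close>, as
  \<open>central_unit\<close> will show. On these blocks finite codimension carries no information,
  and \<open>m\<close> may miss many skew elements.\<close>

definition Bf :: "'b set" where "Bf = {b \<in> B. fdim {b * u | u. u \<in> B}}"

lemma Bf_B: "b \<in> Bf \<Longrightarrow> b \<in> B" unfolding Bf_def by blast

lemma Bf_right: assumes "b \<in> Bf" "u \<in> B" shows "b * u \<in> Bf"
proof -
  have "{b * u * v | v. v \<in> B} \<subseteq> {b * v | v. v \<in> B}" using assms F_mult by (auto simp: mult.assoc)
  then show ?thesis using assms fdim_subset F_mult unfolding Bf_def by blast
qed

lemma Bf_left: assumes "b \<in> Bf" "u \<in> B" shows "u * b \<in> Bf"
proof -
  have "fdim ((\<lambda>x. u * x) ` {b * v | v. v \<in> B})"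
    using assms B_homog unfolding Bf_def by (intro lin_on_image_fdim[OF subspace_UNIV lin_on_mult_left]) auto
  moreover have "{u * b * v | v. v \<in> B} \<subseteq> (\<lambda>x. u * x) ` {b * v | v. v \<in> B}" by (auto simp: mult.assoc)
  ultimately show ?thesis using assms fdim_subset F_mult unfolding Bf_def by blast
qed

lemma right_ideal_subspace: "a \<in> B \<Longrightarrow> subspace {a * b | b. b \<in> B}"
  using lin_on_image_subspace[OF subspace_F lin_on_mult_left[OF B_homog] subspace_F, of a]
  by (simp add: Setcompr_eq_image)

lemma left_ideal_subspace: "subspace {b * a | b. b \<in> B}"
  using lin_on_image_subspace[OF subspace_F lin_on_mult_right subspace_F, of a]
  by (simp add: Setcompr_eq_image)

lemma subspace_skew_preimage:
  assumes "subspace E" "E \<subseteq> B" shows "subspace {e \<in> E. skew e \<in> m}"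
  using assms(1) subspace_m lin_on_subset[OF skew_lin assms(2)]
    lin_on_zero[OF assms(1) lin_on_subset[OF skew_lin assms(2)]]
  unfolding subspace_def lin_on_def by auto

lemma finite_codim_two_step:
  assumes E: "subspace E" "E \<subseteq> B" and al: "almost_m (skew ` E)" and fd: "fdim (f ` E)" and lin: "lin_on E f"
  shows "\<exists>X. finite X \<and> X \<subseteq> E \<and> E \<subseteq> span ({e \<in> E. skew e \<in> m \<and> f e = 0} \<union> X)"
proof -
  obtain X0 where X0: "finite X0" "skew ` E \<subseteq> span (m \<union> X0)" using al unfolding almost_m_def by blast
  let ?E1 = "{e \<in> E. skew e \<in> m}" and ?E2 = "{e \<in> E. skew e \<in> m \<and> f e = 0}"
  obtain X1 where X1: "finite X1" "X1 \<subseteq> E" "E \<subseteq> span (?E1 \<union> X1)"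
    using finite_codim_lin[OF E(1) lin_on_subset[OF skew_lin E(2)] subspace_m X0] by blast
  have sE1: "subspace ?E1" by (rule subspace_skew_preimage[OF E])
  obtain Y0 where Y0: "finite Y0" "f ` E \<subseteq> span Y0" using fd unfolding fdim_def by blast
  have "f ` ?E1 \<subseteq> span ({0} \<union> Y0)" using Y0(2) span_mono[of Y0 "{0} \<union> Y0"] by blast
  then obtain X2 where X2: "finite X2" "X2 \<subseteq> ?E1" "?E1 \<subseteq> span ({e \<in> ?E1. f e \<in> {0}} \<union> X2)"
    using finite_codim_lin[OF sE1 lin_on_subset[OF lin] subspace_single_0 Y0(1)] by blast
  have "{e \<in> ?E1. f e \<in> {0}} = ?E2" by auto
  then have "?E1 \<subseteq> span (?E2 \<union> X2)" using X2(3) by simp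
  also have "\<dots> \<subseteq> span (?E2 \<union> (X1 \<union> X2))" by (rule span_mono) blast
  finally have "?E1 \<union> X1 \<subseteq> span (?E2 \<union> (X1 \<union> X2))" by (auto intro: span_base)
  then have "E \<subseteq> span (?E2 \<union> (X1 \<union> X2))" using X1(3) span_minimal[OF _ subspace_span] by blast
  then show ?thesis using X1 X2 by (intro exI[of _ "X1 \<union> X2"]) auto
qed

text \<open>The subspaces \<open>P\<close> of \<open>a B\<close> and \<open>Q\<close> of
  \<open>B c\<close> have finite codimension, and \<open>skew_bracket\<close> puts
  \<open>skew (p * q)\<close> into \<open>m\<close>. If \<open>a * b * c\<close> were outside the
  span of \<open>P Q\<close>, a separating \<open>x\<close> would satisfy \<open>c x p = 0\<close>
  for \<open>p\<close> in a subspace of finite codimension of \<open>a B\<close>; then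
  \<open>c x a\<close> lies in \<open>Bf\<close>. The hypothesis on \<open>Bf\<close> forces the
  separating trace to vanish.\<close>

lemma skew_corner_mem:
  assumes a: "a \<in> B" and b: "b \<in> B" and c: "c \<in> B" and ca: "c * a = 0"
    and y0: "\<And>u. u \<in> Bf \<Longrightarrow> a * b * c * u = 0"
  shows "skew (a * b * c) \<in> m"
proof -
  let ?y = "a * b * c"
  let ?aB = "{a * u | u. u \<in> B}" and ?Bc = "{u * c | u. u \<in> B}"
  define P where "P = {p \<in> ?aB. skew p \<in> m \<and> p * star c = 0}"
  define Q where "Q = {q \<in> ?Bc. skew q \<in> m \<and> star a * q = 0}"
  have aBB: "?aB \<subseteq> B" "?Bc \<subseteq> B" using a c F_mult by auto
  have "\<exists>X. finite X \<and> X \<subseteq> ?aB \<and> ?aB \<subseteq> span (P \<union> X)" unfolding P_def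
  proof (rule finite_codim_two_step[OF right_ideal_subspace[OF a] aBB(1) _ _ lin_on_mult_right])
    have "skew ` ?aB = {skew (a * b) | b. b \<in> B}" by blast
    then show "almost_m (skew ` ?aB)" using almost_m_skew_right_ideal[OF a] by simp
    have "(\<lambda>p. p * star c) ` ?aB = {a * u * star c | u. u \<in> B}" by blast
    then show "fdim ((\<lambda>p. p * star c) ` ?aB)" using F_fdim[OF a star_B[OF c]] by simp
  qed
  then obtain XP where XP: "finite XP" "XP \<subseteq> ?aB" "?aB \<subseteq> span (P \<union> XP)" by blast
  have "\<exists>X. finite X \<and> X \<subseteq> ?Bc \<and> ?Bc \<subseteq> span (Q \<union> X)" unfolding Q_def
  proof (rule finite_codim_two_step[OF left_ideal_subspace aBB(2) _ _ lin_on_mult_left])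
    have "skew ` ?Bc = {skew (b * c) | b. b \<in> B}" by blast
    then show "almost_m (skew ` ?Bc)" using almost_m_skew_left_ideal[OF c] by simp
    have "(\<lambda>q. star a * q) ` ?Bc = {star a * u * c | u. u \<in> B}" by (auto simp: mult.assoc)
    then show "fdim ((\<lambda>q. star a * q) ` ?Bc)" using F_fdim[OF star_B[OF a] c] by simp
    show "star a \<in> homog" using B_homog[OF star_B[OF a]] .
  qed
  then obtain XQ where XQ: "finite XQ" "XQ \<subseteq> ?Bc" "?Bc \<subseteq> span (Q \<union> XQ)" by blast
  let ?PQ = "{p * q | p q. p \<in> P \<and> q \<in> Q}"
  have PB: "P \<subseteq> B" "Q \<subseteq> B" using aBB unfolding P_def Q_def by auto
  have PQc: "?PQ \<subseteq> {a * u * c | u. u \<in> B}"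
  proof clarify
    fix p q assume "p \<in> P" "q \<in> Q"
    then obtain u v where "u \<in> B" "p = a * u" "v \<in> B" "q = v * c" unfolding P_def Q_def by blast
    then show "\<exists>w. p * q = a * w * c \<and> w \<in> B" using F_mult by (intro exI[of _ "u * v"]) (auto simp: mult.assoc)
  qed
  have PQB: "?PQ \<subseteq> B" using PB F_mult by blast
  have PQm: "skew ` ?PQ \<subseteq> m"
  proof clarify
    fix p q assume pq: "p \<in> P" "q \<in> Q"
    then obtain u v where "u \<in> B" "p = a * u" "v \<in> B" "q = v * c" unfolding P_def Q_def by blast
    then show "skew (p * q) \<in> m" using pq skew_bracket[OF a c] ca unfolding P_def Q_def by blast
  qed
  have yB: "?y \<in> B" using a b c F_mult by blast
  have "?y \<in> span ?PQ"
  proof (rule ccontr)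
    assume ny: "?y \<notin> span ?PQ"
    obtain Z where Z: "finite Z" "Z \<subseteq> span ?PQ" "span Z = span ?PQ"
      using fdim_basis_subspace[OF fdim_span[OF fdim_subset[OF F_fdim[OF a c] PQc]] subspace_span] by blast
    have sB: "span ?PQ \<subseteq> B" using PQB by (rule span_minimal[OF _ subspace_F])
    have "\<exists>x\<in>B. (\<forall>z\<in>span Z. \<tau> (x * z) = 0) \<and> \<tau> (x * ?y) \<noteq> 0"
    proof (rule tr_separation[OF subspace_F subset_refl Z(1)])
      show "Z \<subseteq> B" "?y \<in> B" "?y \<notin> span Z" using Z sB yB ny by auto
      fix u assume u: "u \<in> span (insert ?y Z)" "u \<noteq> 0"
      have "span (insert ?y Z) \<subseteq> B" using Z sB yB by (intro span_minimal subspace_F) auto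
      then show "\<exists>x\<in>B. \<tau> (x * u) \<noteq> 0" using u nondeg' by blast
    qed
    then obtain x where x: "x \<in> B" "\<forall>z\<in>span ?PQ. \<tau> (x * z) = 0" "\<tau> (x * ?y) \<noteq> 0" using Z(3) by auto
    have xpq: "\<tau> (x * (p * q)) = 0" if "p \<in> P" "q \<in> Q" for p q
      using x(2) that span_base[of "p * q" ?PQ] by blast
    let ?h = "\<lambda>p. c * x * p"
    have cx: "c * x \<in> B" using c x F_mult by blast
    have sP: "subspace P"
    proof -
      have "P = {p \<in> ?aB. skew p \<in> m} \<inter> (?aB \<inter> {p. p * star c = 0})" unfolding P_def by blast
      moreover have "subspace {p \<in> ?aB. skew p \<in> m}"
        by (rule subspace_skew_preimage[OF right_ideal_subspace[OF a] aBB(1)])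
      moreover have "subspace {p. p * star c = 0}"
        unfolding subspace_def by (simp add: distrib_right scale_mult_left)
      then have "subspace (?aB \<inter> {p. p * star c = 0})"
        by (rule subspace_inter[OF right_ideal_subspace[OF a]])
      ultimately show ?thesis by (simp only: subspace_inter)
    qed
    \<comment> \<open>Orthogonality to the finitely many \<open>XQ\<close>, the complement of
      \<open>Q\<close> in \<open>B c\<close>, costs finitely many dimensions and extends
      orthogonality from \<open>Q\<close> to all of \<open>B c\<close>.\<close>
    have "\<exists>Y. finite Y \<and> Y \<subseteq> P \<and> P \<subseteq> span ({p \<in> P. \<forall>q\<in>XQ. \<tau> (x * p * q) = 0} \<union> Y)"
    proof (rule finite_codim_form[OF sP XQ(1)])
      fix q assume "q \<in> XQ"
      then have q: "q \<in> B" using XQ(2) aBB(2) by blast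
      have "form_on B (\<lambda>p. \<tau> (x * p * q))" unfolding form_on_def
        using x(1) q B_homog[OF x(1)]
        by (simp add: distrib_left distrib_right tr_add tr_scale F_mult homogD scale_mult_left)
      then show "form_on P (\<lambda>p. \<tau> (x * p * q))" using PB(1) form_on_subset by blast
    qed
    then obtain Y where Y: "finite Y" "Y \<subseteq> P" "P \<subseteq> span ({p \<in> P. \<forall>q\<in>XQ. \<tau> (x * p * q) = 0} \<union> Y)" by blast
    have kill: "?h p = 0" if p: "p \<in> P" "\<forall>q\<in>XQ. \<tau> (x * p * q) = 0" for p
    proof (rule nondeg)
      have pB: "p \<in> B" using p PB by blast
      show "?h p \<in> B" using cx pB F_mult by blast
      fix v assume v: "v \<in> B"
      have "Q \<union> XQ \<subseteq> {q \<in> B. \<tau> (x * p * q) = 0}"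
        using p xpq PB(2) XQ(2) aBB(2) by (auto simp: mult.assoc)
      moreover have "subspace {q \<in> B. \<tau> (x * p * q) = 0}"
        using tr_mult_form[OF subset_refl F_mult[OF x(1) pB]] unfolding subspace_def form_on_def
        by (auto simp: F_zero F_add F_scale tr_zero)
      ultimately have "span (Q \<union> XQ) \<subseteq> {q \<in> B. \<tau> (x * p * q) = 0}" by (rule span_minimal)
      moreover have "v * c \<in> span (Q \<union> XQ)" using XQ(3) v by blast
      ultimately have "\<tau> (x * p * (v * c)) = 0" by blast
      moreover have "\<tau> (c * x * p * v) = \<tau> (x * p * v * c)"
        using tr_comm[of c "x * p * v"] c x(1) pB v F_mult by (simp add: mult.assoc)
      ultimately show "\<tau> (?h p * v) = 0" by (simp add: mult.assoc)
    qed
    have "?h ` (P \<union> XP) \<subseteq> span (?h ` (Y \<union> XP))"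
    proof (rule image_subsetI)
      fix p assume "p \<in> P \<union> XP"
      then consider "p \<in> P" | "p \<in> XP" by blast
      then show "?h p \<in> span (?h ` (Y \<union> XP))"
      proof cases
        case 1
        then have "?h p \<in> span (?h ` ({p \<in> P. \<forall>q\<in>XQ. \<tau> (x * p * q) = 0} \<union> Y))"
          using Y(3) by (intro span_mult_left[OF B_homog[OF cx]]) blast
        also have "\<dots> \<subseteq> span (?h ` (Y \<union> XP))"
          using kill by (intro span_minimal subspace_span) (auto intro: span_base simp: span_zero)
        finally show ?thesis .
      next
        case 2 then show ?thesis by (intro span_base) blast
      qed
    qed
    then have hs: "span (?h ` (P \<union> XP)) \<subseteq> span (?h ` (Y \<union> XP))" by (rule span_minimal[OF _ subspace_span])
    have "?h p \<in> span (?h ` (Y \<union> XP))" if "p \<in> ?aB" for p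
      using subsetD[OF hs span_mult_left[OF B_homog[OF cx] subsetD[OF XP(3) that]]] .
    then have "?h ` ?aB \<subseteq> span (?h ` (Y \<union> XP))" by (rule image_subsetI)
    moreover have "finite (?h ` (Y \<union> XP))" using Y XP by blast
    ultimately have fd: "fdim (?h ` ?aB)" unfolding fdim_def by (intro exI[of _ "?h ` (Y \<union> XP)"] conjI)
    have "{c * x * a * u | u. u \<in> B} \<subseteq> ?h ` ?aB" by (auto simp: mult.assoc)
    then have "fdim {c * x * a * u | u. u \<in> B}" by (rule fdim_subset[OF fd])
    then have g: "c * x * a \<in> Bf" unfolding Bf_def using cx a F_mult by blast
    obtain a' where a': "a' \<in> B" "a = a * a' * a" using regular[OF a] by blast
    obtain c' where c': "c' \<in> B" "c = c * c' * c" using regular[OF c] by blast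
    \<comment> \<open>Regularity reproduces the factors \<open>a\<close> and \<open>c\<close> around
      \<open>?y\<close>, so that cycling the trace brings \<open>c * x * a\<close> together behind
      \<open>?y\<close>.\<close>
    have y: "?y = a * (a' * ?y * c') * c" using a'(2) c'(2) by (metis mult.assoc)
    have B2: "a' * ?y * c' \<in> B" using a' yB c' F_mult by blast
    have "\<tau> (x * ?y) = \<tau> (x * a * (a' * ?y * c') * c)" using y by (metis mult.assoc)
    also have "\<dots> = \<tau> (c * (x * a * (a' * ?y * c')))"
      using x(1) a c B2 F_mult by (intro tr_comm) auto
    also have "\<dots> = \<tau> ((c * x * a * a') * (?y * c'))" by (simp add: mult.assoc)
    also have "\<dots> = \<tau> (?y * c' * (c * x * a * a'))"
      using cx a a' yB c' F_mult by (intro tr_comm) auto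
    also have "\<dots> = \<tau> (?y * (c' * (c * x * a * a')))" by (simp add: mult.assoc)
    also have "\<dots> = 0" using y0[OF Bf_left[OF Bf_right[OF g a'(1)] c'(1)]] by (simp add: tr_zero)
    finally show False using x(3) by simp
  qed
  then have "skew ?y \<in> span (skew ` ?PQ)" by (rule skew_span[OF PQB])
  then show ?thesis using PQm span_minimal[OF _ subspace_m] by blast
qed

text \<open>A left unit \<open>f\<close> for \<open>X\<close> is extended to \<open>x\<close> by
  treating the remainder \<open>x - f * x\<close>: regularity yields an idempotent that fixes it,
  and \<open>f + ?g - ?g * f\<close> fixes both parts.\<close>

lemma left_unit:
  assumes "finite X" "X \<subseteq> B"
  shows "\<exists>f\<in>span {x * b | x b. x \<in> X \<and> b \<in> B}. \<forall>x\<in>X. f * x = x"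
  using assms
proof (induction X rule: finite_induct)
  case empty then show ?case by (intro bexI[of _ 0]) (auto simp: span_zero)
next
  case (insert x X)
  let ?W = "\<lambda>X. span {x * b | x b. x \<in> X \<and> b \<in> B}"
  have right: "w * b \<in> ?W Y" if "w \<in> ?W Y" "b \<in> B" for w b Y
  proof -
    have "w * b \<in> span ((\<lambda>x. x * b) ` {x * b | x b. x \<in> Y \<and> b \<in> B})" using that(1) by (rule span_mult_right)
    also have "\<dots> \<subseteq> ?W Y"
    proof (rule span_mono, clarify)
      fix x b' assume "x \<in> Y" "b' \<in> B"
      then show "\<exists>x' b''. x * b' * b = x' * b'' \<and> x' \<in> Y \<and> b'' \<in> B"
        using that(2) F_mult by (intro exI[of _ x] exI[of _ "b' * b"]) (auto simp: mult.assoc)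
    qed
    finally show ?thesis .
  qed
  have mono: "?W X \<subseteq> ?W (insert x X)" by (intro span_mono) blast
  obtain f where f: "f \<in> ?W X" "\<forall>x\<in>X. f * x = x" using insert by auto
  have "?W X \<subseteq> B" using insert.prems F_mult by (intro span_minimal subspace_F) blast
  then have fB: "f \<in> B" using f by blast
  have xB: "x \<in> B" using insert by blast
  define x' where "x' = x - f * x"
  have x'B: "x' \<in> B" unfolding x'_def using xB fB F_mult F_diff by blast
  obtain y where y: "y \<in> B" "x' = x' * y * x'" using regular[OF x'B] by blast
  let ?g = "x' * y"
  have "?g = x * y - f * (x * y)" unfolding x'_def by (simp add: algebra_simps)
  moreover have "x * y \<in> ?W (insert x X)" using y(1) by (intro span_base) blast
  moreover have "f * (x * y) \<in> ?W (insert x X)" using right[OF f(1)] mono xB y(1) F_mult by blast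
  ultimately have g: "?g \<in> ?W (insert x X)" by (simp add: span_diff)
  have "f + ?g - ?g * f \<in> ?W (insert x X)"
    using f(1) mono g right[OF g fB] by (intro span_diff span_add) auto
  moreover have "(f + ?g - ?g * f) * z = z" if "z \<in> insert x X" for z
  proof (cases "z \<in> X")
    case True then show ?thesis using f(2) by (simp add: algebra_simps)
  next
    case False
    then have "z = x" using that by blast
    then have "(f + ?g - ?g * f) * z = f * x + x' * y * x'" unfolding x'_def by (simp add: algebra_simps)
    then show ?thesis using y(2) \<open>z = x\<close> unfolding x'_def by simp
  qed
  ultimately show ?case by blast
qed

end

section \<open>Self-adjoint local units\<close>

context skew_generated
begin

lemma span_right_closed:
  assumes "w \<in> span {x * b | x b. x \<in> X \<and> b \<in> B}" "b \<in> B"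
  shows "w * b \<in> span {x * b | x b. x \<in> X \<and> b \<in> B}"
proof -
  have "w * b \<in> span ((\<lambda>x. x * b) ` {x * b | x b. x \<in> X \<and> b \<in> B})" using assms(1) by (rule span_mult_right)
  also have "\<dots> \<subseteq> span {x * b | x b. x \<in> X \<and> b \<in> B}"
  proof (rule span_mono, clarify)
    fix x b' assume "x \<in> X" "b' \<in> B"
    then show "\<exists>x' b''. x * b' * b = x' * b'' \<and> x' \<in> X \<and> b'' \<in> B"
      using assms(2) F_mult by (intro exI[of _ x] exI[of _ "b' * b"]) (auto simp: mult.assoc)
  qed
  finally show ?thesis .
qed

text \<open>The unit is the element representing \<open>\<tau>\<close> itself:
  \<open>\<tau> (e * z) = \<tau> z\<close> makes \<open>e * c - c\<close> orthogonal to
  \<open>C\<close>. Adjoints preserve traces, so \<open>star e\<close> represents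
  \<open>\<tau>\<close> as well and equals \<open>e\<close>; this turns the left unit into a right
  unit.\<close>

lemma nondeg_unit:
  assumes C: "subspace C" "C \<subseteq> B" "fdim C" "\<And>a b. a \<in> C \<Longrightarrow> b \<in> C \<Longrightarrow> a * b \<in> C" "star ` C \<subseteq> C"
    and nd: "\<And>x. x \<in> C \<Longrightarrow> (\<And>d. d \<in> C \<Longrightarrow> \<tau> (x * d) = 0) \<Longrightarrow> x = 0"
  obtains e where "e \<in> C" "star e = e" "\<And>c. c \<in> C \<Longrightarrow> e * c = c" "\<And>c. c \<in> C \<Longrightarrow> c * e = c"
proof -
  have CB: "c \<in> B" if "c \<in> C" for c using that C(2) by blast
  have "\<exists>e\<in>C. \<forall>z\<in>C. \<tau> (e * z) = \<tau> z"
  proof (rule tr_riesz[OF C(1-3) form_on_subset[OF tr_form C(2)]])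
    fix u assume u: "u \<in> C" "u \<noteq> 0"
    then obtain d where d: "d \<in> C" "\<tau> (u * d) \<noteq> 0" using nd by blast
    then have "\<tau> (d * u) \<noteq> 0" using tr_comm[of u d] CB u by simp
    then show "\<exists>x\<in>C. \<tau> (x * u) \<noteq> 0" using d by blast
  qed
  then obtain e where e: "e \<in> C" "\<And>z. z \<in> C \<Longrightarrow> \<tau> (e * z) = \<tau> z" by blast
  have left: "e * c = c" if c: "c \<in> C" for c
  proof -
    have "e * c - c = 0"
    proof (rule nd)
      show "e * c - c \<in> C" using C(4)[OF e(1) c] c subspace_diff[OF C(1)] by blast
      fix d assume d: "d \<in> C"
      have "\<tau> ((e * c - c) * d) = \<tau> (e * (c * d)) - \<tau> (c * d)"
        using CB e(1) c d F_mult by (simp add: left_diff_distrib tr_diff mult.assoc)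
      then show "\<tau> ((e * c - c) * d) = 0" using e(2) C(4)[OF c d] by simp
    qed
    then show ?thesis by simp
  qed
  have se: "star e \<in> C" using C(5) e(1) by blast
  have "star e - e = 0"
  proof (rule nd)
    show "star e - e \<in> C" using se e(1) subspace_diff[OF C(1)] by blast
    fix d assume d: "d \<in> C"
    have sd: "star d \<in> C" using C(5) d by blast
    have "\<tau> (star e * d) = \<tau> (star (star d * e))" using CB d e(1) star_B by (simp add: star_mult star_star)
    also have "\<dots> = \<tau> (star d * e)" using CB d e(1) star_B F_mult by (intro star_tr) auto
    also have "\<dots> = \<tau> (e * star d)" using CB sd e(1) by (intro tr_comm) auto
    also have "\<dots> = \<tau> d" using e(2)[OF sd] star_tr CB d by simp
    finally have "\<tau> (star e * d) = \<tau> (e * d)" using e(2)[OF d] by simp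
    then show "\<tau> ((star e - e) * d) = 0" using CB se e(1) d F_mult by (simp add: left_diff_distrib tr_diff)
  qed
  then have see: "star e = e" by simp
  have "c * e = c" if c: "c \<in> C" for c
  proof -
    have "star (c * e) = star c" using left[of "star c"] C(5) c CB e(1) see by (simp add: star_mult image_subset_iff)
    then show ?thesis using star_star CB c e(1) F_mult by metis
  qed
  then show ?thesis using that e(1) see left by blast
qed

text \<open>A self-adjoint form of Litoff's theorem. The radical of the form on the right ideal \<open>S B\<close> is
  generated by an idempotent \<open>f\<close>, and adding \<open>star f\<close> to \<open>S\<close> makes the form non-degenerate.\<close>
lemma local_unit_star_closed:
  assumes S: "finite S" "S \<subseteq> B" "star ` S \<subseteq> S"
  obtains e where "e \<in> B" "e * e = e" "star e = e" "\<And>s. s \<in> S \<Longrightarrow> e * s = s"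
proof -
  define SB where "SB = span {s * b | s b. s \<in> S \<and> b \<in> B}"
  have SBB: "SB \<subseteq> B" unfolding SB_def using S(2) F_mult by (intro span_minimal subspace_F) blast
  have SBr: "w * b \<in> SB" if "w \<in> SB" "b \<in> B" for w b using span_right_closed that unfolding SB_def by blast
  have SSB: "s \<in> SB" if s: "s \<in> S" for s
  proof -
    have sB: "s \<in> B" using s S(2) by blast
    obtain b where b: "b \<in> B" "s = s * b * s" using regular[OF sB] by blast
    have "s * (b * s) \<in> SB" unfolding SB_def using b(1) s sB F_mult by (intro span_base) blast
    then show ?thesis using b(2) by (simp add: mult.assoc)
  qed
  \<comment> \<open>The part of the right ideal \<open>S B\<close> killed by \<open>S\<close> from
    the left, which spoils nondegeneracy.\<close>
  define R where "R = {x \<in> SB. \<forall>s\<in>S. s * x = 0}"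
  have RB: "R \<subseteq> B" using SBB unfolding R_def by blast
  have Rr: "x * b \<in> R" if "x \<in> R" "b \<in> B" for x b
    using that SBr unfolding R_def by (auto simp: mult.assoc[symmetric])
  have sR: "subspace R" unfolding R_def subspace_def SB_def using S(2) B_homog
    by (auto simp: span_zero span_add span_scale distrib_left homogD subset_iff)
  \<comment> \<open>\<open>R B S\<close> lies in the span of \<open>S B S\<close> and is
    finite-dimensional. A left unit \<open>f\<close> for a spanning set lies in \<open>R\<close> and
    fixes all of \<open>R\<close>, since regularity writes \<open>r\<close> as
    \<open>r * b * r\<close> with the last factor in \<open>S B\<close>.\<close>
  define Z where "Z = {r * b * s | r b s. r \<in> R \<and> b \<in> B \<and> s \<in> S}"
  have ZR: "Z \<subseteq> R" unfolding Z_def using Rr S(2) by blast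
  have "fdim Z"
  proof -
    let ?T = "\<Union>s\<in>S. \<Union>s'\<in>S. {s * b * s' | b. b \<in> B}"
    have "fdim ?T" using S(1,2) by (intro fdim_UN F_fdim) auto
    moreover have "Z \<subseteq> span ?T"
    proof
      fix z assume "z \<in> Z"
      then obtain r b s where z: "z = r * (b * s)" "r \<in> SB" "b \<in> B" "s \<in> S" unfolding Z_def R_def by (auto simp: mult.assoc)
      have "r * (b * s) \<in> span ((\<lambda>x. x * (b * s)) ` {s * b | s b. s \<in> S \<and> b \<in> B})"
        using z(2) unfolding SB_def by (rule span_mult_right)
      also have "\<dots> \<subseteq> span ?T"
      proof (rule span_mono, clarify)
        fix s1 b1 assume 1: "s1 \<in> S" "b1 \<in> B"
        then have "s1 * b1 * (b * s) = s1 * (b1 * b) * s" "b1 * b \<in> B" using z F_mult by (auto simp: mult.assoc)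
        then show "s1 * b1 * (b * s) \<in> ?T" using 1 z by blast
      qed
      finally show "z \<in> span ?T" using z(1) by simp
    qed
    ultimately show ?thesis using fdim_span fdim_subset by blast
  qed
  then obtain Y where Y: "finite Y" "Y \<subseteq> Z" "Z \<subseteq> span Y" using fdim_basis by blast
  have YR: "Y \<subseteq> R" using Y(2) ZR by blast
  have YB: "Y \<subseteq> B" using YR RB by blast
  obtain f where f: "f \<in> span {x * b | x b. x \<in> Y \<and> b \<in> B}" "\<forall>y\<in>Y. f * y = y"
    using left_unit[OF Y(1) YB] by blast
  have fR: "f \<in> R"
    using f(1) YR Rr span_minimal[OF _ sR, of "{x * b | x b. x \<in> Y \<and> b \<in> B}"] by blast
  have fB: "f \<in> B" using fR RB by blast
  have fix1: "f * r = r" if r: "r \<in> R" for r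
  proof -
    have rB: "r \<in> B" "r \<in> SB" using r RB R_def by auto
    obtain b where b: "b \<in> B" "r = r * b * r" using regular[OF rB(1)] by blast
    have fz: "f * z = z" if "z \<in> Z" for z
    proof -
      have "span Y \<subseteq> {z. f * z = z}" using f(2) B_homog[OF fB]
        by (intro span_minimal) (auto simp: subspace_def distrib_left homogD)
      then show ?thesis using that Y(3) by blast
    qed
    have rbh: "r * b \<in> homog" using rB(1) b(1) F_mult B_homog by blast
    have "r * b * r \<in> span ((\<lambda>v. (r * b) * v) ` {s * b | s b. s \<in> S \<and> b \<in> B})"
      using rB(2) unfolding SB_def by (intro span_mult_left rbh)
    also have "\<dots> \<subseteq> {v. f * v = v}"
    proof (rule span_minimal)
      show "subspace {v. f * v = v}" using B_homog[OF fB] by (auto simp: subspace_def distrib_left homogD)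
      show "(\<lambda>v. r * b * v) ` {s * b | s b. s \<in> S \<and> b \<in> B} \<subseteq> {v. f * v = v}"
      proof clarify
        fix s b' assume "s \<in> S" "b' \<in> B"
        then have "f * (r * b * s) = r * b * s" using r b(1) fz unfolding Z_def by blast
        then show "f * (r * b * (s * b')) = r * b * (s * b')" by (metis mult.assoc)
      qed
    qed
    finally show ?thesis using b(2) by simp
  qed
  have ff: "f * f = f" using fix1[OF fR] .
  have sff: "star f * star f = star f" using star_mult[OF fB fB] ff by simp
  have sfB: "star f \<in> B" using star_B[OF fB] .
  have SBann: "star w * x = 0" if x: "x \<in> B" "\<forall>s\<in>S. s * x = 0" and w: "w \<in> SB" for x w
  proof -
    have "SB \<subseteq> {w \<in> B. star w * x = 0}" unfolding SB_def
    proof (rule span_minimal)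
      show "subspace {w \<in> B. star w * x = 0}" unfolding subspace_def
        by (auto simp: F_zero F_add F_scale star_zero star_add star_scale distrib_right scale_mult_left)
      show "{s * b | s b. s \<in> S \<and> b \<in> B} \<subseteq> {w \<in> B. star w * x = 0}"
      proof clarify
        fix s b assume sb: "s \<in> S" "b \<in> B"
        then have "star (s * b) = star b * star s" "star s * x = 0" "s \<in> B" using S(2,3) x(2) by (auto simp: star_mult subset_iff)
        then show "s * b \<in> B \<and> star (s * b) * x = 0" using sb F_mult by (simp add: mult.assoc)
      qed
    qed
    then show ?thesis using w by blast
  qed
  have fS: "\<forall>s\<in>S. s * f = 0" using fR unfolding R_def by blast
  have fSB: "f \<in> SB" using fR unfolding R_def by blast
  have sfw: "star f * w = 0" if w: "w \<in> SB" for w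
  proof -
    have "star w * f = 0" using SBann[OF fB fS w] .
    then have "star (star w * f) = 0" by (simp add: star_zero)
    then show ?thesis using w SBB fB star_B by (auto simp: star_mult star_star subset_iff)
  qed
  \<comment> \<open>\<open>star f\<close> supplies the partner for the degenerate part: it kills
    \<open>S B\<close> from the left, while its adjoint \<open>f\<close> fixes
    \<open>R\<close>.\<close>
  define U where "U = insert (star f) S"
  have UB: "U \<subseteq> B" unfolding U_def using S(2) sfB by blast
  define UUB where "UUB = span {u * b | u b. u \<in> U \<and> b \<in> B}"
  have UBr: "w * b \<in> UUB" if "w \<in> UUB" "b \<in> B" for w b using span_right_closed that unfolding UUB_def by blast
  have UUBB: "UUB \<subseteq> B" unfolding UUB_def using UB F_mult by (intro span_minimal subspace_F) blast
  have decomp: "\<exists>u\<in>SB. \<exists>b\<in>B. x = u + star f * b" if "x \<in> UUB" for x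
  proof -
    have "UUB \<subseteq> {u + star f * b | u b. u \<in> SB \<and> b \<in> B}" unfolding UUB_def
    proof (rule span_minimal)
      show "subspace {u + star f * b | u b. u \<in> SB \<and> b \<in> B}"
      proof (rule subspaceI)
        show "0 \<in> {u + star f * b | u b. u \<in> SB \<and> b \<in> B}"
          using F_zero span_zero unfolding SB_def by (intro CollectI exI[of _ 0]) auto
      next
        fix x y assume "x \<in> {u + star f * b | u b. u \<in> SB \<and> b \<in> B}" "y \<in> {u + star f * b | u b. u \<in> SB \<and> b \<in> B}"
        then obtain u b u' b' where "x = u + star f * b" "y = u' + star f * b'" "u \<in> SB" "u' \<in> SB" "b \<in> B" "b' \<in> B" by blast
        then show "x + y \<in> {u + star f * b | u b. u \<in> SB \<and> b \<in> B}"
          using F_add span_add unfolding SB_def by (intro CollectI exI[of _ "u + u'"] exI[of _ "b + b'"]) (auto simp: algebra_simps)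
      next
        fix c x assume "x \<in> {u + star f * b | u b. u \<in> SB \<and> b \<in> B}"
        then obtain u b where "x = u + star f * b" "u \<in> SB" "b \<in> B" by blast
        then show "scale c x \<in> {u + star f * b | u b. u \<in> SB \<and> b \<in> B}"
          using F_scale span_scale B_homog[OF sfB] unfolding SB_def
          by (intro CollectI exI[of _ "scale c u"] exI[of _ "scale c b"]) (auto simp: scale_right_distrib homogD)
      qed
      show "{u * b | u b. u \<in> U \<and> b \<in> B} \<subseteq> {u + star f * b | u b. u \<in> SB \<and> b \<in> B}"
      proof clarify
        fix u b assume ub: "u \<in> U" "b \<in> B"
        show "\<exists>u' b'. u * b = u' + star f * b' \<and> u' \<in> SB \<and> b' \<in> B"
        proof (cases "u \<in> S")
          case True
          then have "u * b \<in> SB" unfolding SB_def using ub by (intro span_base) blast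
          then show ?thesis using F_zero by (intro exI[of _ "u * b"] exI[of _ 0]) auto
        next
          case False
          then have "u = star f" using ub U_def by blast
          then show ?thesis using ub span_zero unfolding SB_def by (intro exI[of _ 0] exI[of _ b]) auto
        qed
      qed
    qed
    then show ?thesis using that by blast
  qed
  \<comment> \<open>In \<open>x = u + star f * b\<close> the second term vanishes because
    \<open>star f\<close> kills both \<open>x\<close> and \<open>S B\<close>. Then \<open>x\<close>
    lies in \<open>R\<close>, where \<open>f\<close> acts as the identity, but
    \<open>f * x = 0\<close>.\<close>
  have rad: "x = 0" if x: "x \<in> UUB" "\<forall>s\<in>S. s * x = 0" "f * x = 0" for x
  proof -
    obtain u b where ub: "u \<in> SB" "b \<in> B" "x = u + star f * b" using decomp x(1) by blast
    have "star f * x = 0" using SBann[OF _ x(2) fSB] x(1) UUBB by blast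
    then have "star f * b = 0" using sfw[OF ub(1)] sff ub(3) by (simp add: distrib_left mult.assoc[symmetric])
    then have "x = u" using ub(3) by simp
    then have "x \<in> R" using x(2) ub(1) unfolding R_def by blast
    then show ?thesis using fix1 x(3) by metis
  qed
  \<comment> \<open>The span \<open>U B (star U)\<close> is finite-dimensional, closed under
    products and adjoints, and contained in the right ideal generated by \<open>U\<close>, where
    \<open>rad\<close> applies.\<close>
  let ?G = "{u * b * v | u b v. u \<in> U \<and> b \<in> B \<and> v \<in> star ` U}"
  define C where "C = span ?G"
  have sUB: "star ` U \<subseteq> B" using UB star_B by blast
  have GB: "?G \<subseteq> B"
  proof
    fix x assume "x \<in> ?G"
    then obtain u b v where "x = u * b * v" "u \<in> U" "b \<in> B" "v \<in> star ` U" by blast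
    then show "x \<in> B" using F_mult[OF F_mult] subsetD[OF UB] subsetD[OF sUB] by simp
  qed
  have CB: "C \<subseteq> B" unfolding C_def by (rule span_minimal[OF GB subspace_F])
  have sU: "star v \<in> U" if "v \<in> star ` U" for v using that UB star_star by auto
  have GUU: "?G \<subseteq> UUB" unfolding UUB_def
  proof clarify
    fix u b v assume "u \<in> U" "b \<in> B" "v \<in> U"
    then have "u * (b * star v) \<in> span {u * b | u b. u \<in> U \<and> b \<in> B}" using UB star_B F_mult by (intro span_base) blast
    then show "u * b * star v \<in> span {u * b | u b. u \<in> U \<and> b \<in> B}" by (simp add: mult.assoc)
  qed
  have CUU: "C \<subseteq> UUB" unfolding C_def by (rule span_minimal[OF GUU]) (simp add: UUB_def)
  have Smem: "S \<subseteq> star ` U"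
  proof
    fix s assume "s \<in> S"
    then have "star s \<in> U" "star (star s) = s" using S(2,3) star_star unfolding U_def by auto
    then show "s \<in> star ` U" by (metis image_eqI)
  qed
  have fmem: "f \<in> star ` U" unfolding U_def using star_star[OF fB] by (metis image_eqI insertI1)
  obtain e where e: "e \<in> C" "star e = e" "\<And>c. c \<in> C \<Longrightarrow> e * c = c" "\<And>c. c \<in> C \<Longrightarrow> c * e = c"
  proof (rule nondeg_unit[of C])
    show "subspace C" unfolding C_def by simp
    show "C \<subseteq> B" by (rule CB)
    have "fdim ?G"
    proof -
      have "?G = (\<Union>u\<in>U. \<Union>v\<in>star ` U. {u * b * v | b. b \<in> B})" by blast
      moreover have "finite U" unfolding U_def using S(1) by simp
      moreover have "fdim (\<Union>u\<in>U. \<Union>v\<in>star ` U. {u * b * v | b. b \<in> B})"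
        using \<open>finite U\<close> UB sUB by (intro fdim_UN F_fdim finite_imageI) auto
      ultimately show ?thesis by (simp only:)
    qed
    then show "fdim C" unfolding C_def by (rule fdim_span)
    show "a * b \<in> C" if "a \<in> C" "b \<in> C" for a b
    proof -
      have "a * b \<in> span {x * y | x y. x \<in> ?G \<and> y \<in> ?G}"
        using that GB F_homog unfolding C_def by (intro span_mult) auto
      also have "\<dots> \<subseteq> C" unfolding C_def
      proof (rule span_mono, clarify)
        fix u b v u' b' v' assume "u \<in> U" "b \<in> B" "v \<in> U" "u' \<in> U" "b' \<in> B" "v' \<in> U"
        then show "\<exists>u'' b'' w. u * b * star v * (u' * b' * star v') = u'' * b'' * w \<and> u'' \<in> U \<and> b'' \<in> B \<and> w \<in> star ` U"
          using UB star_B F_mult by (intro exI[of _ u] exI[of _ "b * star v * u' * b'"] exI[of _ "star v'"]) (auto simp: mult.assoc subset_iff)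
      qed
      finally show ?thesis .
    qed
    show "star ` C \<subseteq> C"
    proof (rule image_subsetI)
      fix x assume "x \<in> C"
      then have "star x \<in> span (star ` ?G)" unfolding C_def
        by (rule lin_on_image_span[OF subspace_F star_lin GB])
      also have "\<dots> \<subseteq> C" unfolding C_def
      proof (rule span_mono, clarify)
        fix u b v assume "u \<in> U" "b \<in> B" "v \<in> U"
        then have "star (u * b * star v) = v * star b * star u" "star b \<in> B"
          using UB star_B F_mult by (auto simp: star_mult star_star mult.assoc subset_iff)
        then show "\<exists>u' b' w. star (u * b * star v) = u' * b' * w \<and> u' \<in> U \<and> b' \<in> B \<and> w \<in> star ` U"
          using \<open>u \<in> U\<close> \<open>v \<in> U\<close> by blast
      qed
      finally show "star x \<in> C" .
    qed
    \<comment> \<open>Orthogonality to \<open>C\<close> means that \<open>star U\<close> and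
      \<open>U\<close> kill \<open>x\<close> when placed on its two sides. Applying
      \<open>rad\<close> gives \<open>x * u = 0\<close> for \<open>u\<close> in \<open>U\<close>,
      and applying it to \<open>star x\<close> removes the other side.\<close>
    show "x = 0" if x: "x \<in> C" "\<And>d. d \<in> C \<Longrightarrow> \<tau> (x * d) = 0" for x
    proof -
      have xB: "x \<in> B" using x(1) CB by blast
      have vxu: "v * x * u = 0" if vu: "v \<in> star ` U" "u \<in> U" for v u
      proof (rule nondeg)
        have B: "v \<in> B" "u \<in> B" using vu UB sUB by auto
        show "v * x * u \<in> B" using B xB F_mult by blast
        fix b assume b: "b \<in> B"
        have "\<tau> (v * x * u * b) = \<tau> (v * (x * u * b))" by (simp add: mult.assoc)
        also have "\<dots> = \<tau> (x * u * b * v)" using B xB b F_mult by (intro tr_comm) auto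
        also have "\<dots> = \<tau> (x * (u * b * v))" by (simp add: mult.assoc)
        also have "\<dots> = 0" using vu b unfolding C_def by (intro x(2)[unfolded C_def] span_base) blast
        finally show "\<tau> (v * x * u * b) = 0" .
      qed
      have xu: "x * u = 0" if u: "u \<in> U" for u
      proof (rule rad)
        show "x * u \<in> UUB" using UBr x(1) CUU u UB by blast
        show "\<forall>s\<in>S. s * (x * u) = 0" "f * (x * u) = 0"
          using vxu u Smem fmem by (auto simp: mult.assoc[symmetric] subset_iff)
      qed
      have "star x = 0"
      proof (rule rad)
        show "star x \<in> UUB" using \<open>star ` C \<subseteq> C\<close> x(1) CUU by blast
        have "v * star x = 0" if v: "v \<in> star ` U" for v
        proof -
          have "v = star (star v)" "star v \<in> U" "star v \<in> B" using v sU sUB star_star star_B by auto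
          then show ?thesis using star_mult[OF xB, of "star v"] xu star_zero by metis
        qed
        then show "\<forall>s\<in>S. s * star x = 0" "f * star x = 0" using Smem fmem by blast+
      qed
      then show ?thesis using star_star[OF xB] star_zero by simp
    qed
  qed (use that in blast)
  have eB: "e \<in> B" using e(1) CB by blast
  \<comment> \<open>The elements of \<open>S\<close> need not lie in \<open>C\<close>. The defect
    \<open>x = e * s - s\<close> satisfies \<open>x B v = 0\<close> for \<open>v\<close> in
    \<open>star U\<close>; since \<open>x\<close> lies in the right ideal generated by
    \<open>U\<close>, regularity \<open>x = x * b0 * x\<close> makes it zero.\<close>
  have "e * s = s" if s: "s \<in> S" for s
  proof -
    have sB: "s \<in> B" and sU': "s \<in> U" using s S(2) U_def by auto
    define x where "x = e * s - s"
    have sUU: "s \<in> UUB"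
    proof -
      have "SB \<subseteq> UUB" unfolding SB_def UUB_def U_def by (rule span_mono) blast
      then show ?thesis using SSB[OF s] by blast
    qed
    have "e * s \<in> UUB" using UBr e(1) CUU sB by blast
    then have xU: "x \<in> UUB" unfolding x_def using sUU subspace_diff[of UUB] by (simp add: UUB_def span_diff)
    have xB: "x \<in> B" using xU UUBB by blast
    have xbv: "x * b * v = 0" if bv: "b \<in> B" "v \<in> star ` U" for b v
    proof -
      have "s * b * v \<in> C" unfolding C_def using bv sU' by (intro span_base) blast
      then have "e * (s * b * v) = s * b * v" by (rule e(3))
      then show ?thesis unfolding x_def by (simp add: algebra_simps)
    qed
    have xbS: "x * b * w = 0" if b: "b \<in> B" and w: "w \<in> SB" for b w
    proof -
      have "SB \<subseteq> {w. x * b * w = 0}" unfolding SB_def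
      proof (rule span_minimal)
        have "x * b \<in> homog" using xB b F_mult B_homog by blast
        then show "subspace {w. x * b * w = 0}" by (auto simp: subspace_def distrib_left homogD)
        show "{s * b | s b. s \<in> S \<and> b \<in> B} \<subseteq> {w. x * b * w = 0}"
        proof clarify
          fix s' b' assume "s' \<in> S" "b' \<in> B"
          then have "x * b * s' = 0" using xbv b Smem by blast
          then show "x * b * (s' * b') = 0" by (simp add: mult.assoc[symmetric])
        qed
      qed
      then show ?thesis using w by blast
    qed
    have xbf: "x * b * star f = 0" if b: "b \<in> B" for b
    proof -
      have "SB \<subseteq> {w \<in> B. x * b * star w = 0}" unfolding SB_def
      proof (rule span_minimal)
        have "x * b \<in> homog" using xB b F_mult B_homog by blast
        then show "subspace {w \<in> B. x * b * star w = 0}"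
          by (auto simp: subspace_def distrib_left homogD F_zero F_add F_scale star_zero star_add star_scale)
        show "{s * b | s b. s \<in> S \<and> b \<in> B} \<subseteq> {w \<in> B. x * b * star w = 0}"
        proof clarify
          fix s' b' assume s': "s' \<in> S" "b' \<in> B"
          then have "s' \<in> B" "star s' \<in> star ` U" using S(2) U_def by auto
          moreover have "x * (b * star b') * star s' = 0"
            using xbv[of "b * star b'" "star s'"] b s' star_B F_mult \<open>star s' \<in> star ` U\<close> by blast
          ultimately show "s' * b' \<in> B \<and> x * b * star (s' * b') = 0" using s' F_mult by (simp add: star_mult mult.assoc)
        qed
      qed
      then show ?thesis using fSB by blast
    qed
    obtain b0 where b0: "b0 \<in> B" "x = x * b0 * x" using regular[OF xB] by blast
    obtain u b where ub: "u \<in> SB" "b \<in> B" "x = u + star f * b" using decomp xU by blast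
    have "x * b0 * x = x * b0 * u + x * b0 * star f * b" by (subst (2) ub(3)) (simp add: distrib_left mult.assoc)
    then have "x = 0" using xbS[OF b0(1) ub(1)] xbf[OF b0(1)] b0(2) by simp
    then show ?thesis unfolding x_def by simp
  qed
  then show ?thesis using that eB e(2) e(3)[OF e(1)] by blast
qed

lemma local_unit:
  assumes S: "finite S" "S \<subseteq> B"
  obtains e where "e \<in> B" "e * e = e" "star e = e" "\<And>s. s \<in> S \<Longrightarrow> e * s = s" "\<And>s. s \<in> S \<Longrightarrow> s * e = s"
proof -
  have "star ` (S \<union> star ` S) \<subseteq> S \<union> star ` S" using S(2) star_star by auto
  moreover have "finite (S \<union> star ` S)" "S \<union> star ` S \<subseteq> B" using S star_B by auto
  ultimately obtain e where e: "e \<in> B" "e * e = e" "star e = e" "\<And>s. s \<in> S \<union> star ` S \<Longrightarrow> e * s = s"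
    using local_unit_star_closed[of "S \<union> star ` S"] by blast
  have "s * e = s" if s: "s \<in> S" for s
  proof -
    have "star (e * star s) = star (star s)" using e(4)[of "star s"] s by simp
    then show ?thesis using s S(2) e(1,3) star_B by (auto simp: star_mult star_star subset_iff)
  qed
  then show ?thesis using that e by blast
qed

end

section \<open>Central idempotents and corner subalgebras\<close>

context skew_generated
begin

lemma Bf_zero: "0 \<in> Bf"
  unfolding Bf_def using F_zero by (auto intro: fdim_finite fdim_subset[of "{0}"])

lemma Bf_lin: assumes "a \<in> Bf" "b \<in> Bf" shows "a + b \<in> Bf" "a - b \<in> Bf"
proof -
  have fd: "fdim (span ({a * u | u. u \<in> B} \<union> {b * u | u. u \<in> B}))"
    using assms unfolding Bf_def by (intro fdim_span fdim_Un) auto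
  have "a * u \<in> span ({a * u | u. u \<in> B} \<union> {b * u | u. u \<in> B})" "b * u \<in> span ({a * u | u. u \<in> B} \<union> {b * u | u. u \<in> B})"
    if "u \<in> B" for u using that by (auto intro: span_base)
  then have "{(a + b) * u | u. u \<in> B} \<subseteq> span ({a * u | u. u \<in> B} \<union> {b * u | u. u \<in> B})"
    "{(a - b) * u | u. u \<in> B} \<subseteq> span ({a * u | u. u \<in> B} \<union> {b * u | u. u \<in> B})"
    by (auto simp: distrib_right left_diff_distrib intro!: span_add span_diff)
  then show "a + b \<in> Bf" "a - b \<in> Bf"
    using assms fdim_subset[OF fd] F_add F_diff unfolding Bf_def by auto
qed

text \<open>The trace form transfers finiteness from \<open>b B\<close> to \<open>B b\<close>:
  \<open>u * b\<close> vanishes as soon as \<open>u\<close> is orthogonal to a finite spanning set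
  of \<open>b B\<close>, and such \<open>u\<close> have finite codimension.\<close>

lemma Bf_left_fdim:
  assumes b: "b \<in> Bf" shows "fdim {u * b | u. u \<in> B}"
proof -
  have bB: "b \<in> B" using b by (rule Bf_B)
  obtain Y where Y: "finite Y" "Y \<subseteq> {b * u | u. u \<in> B}" "{b * u | u. u \<in> B} \<subseteq> span Y"
    using b fdim_basis[of "{b * u | u. u \<in> B}"] unfolding Bf_def by blast
  have YB: "Y \<subseteq> B" using Y(2) bB F_mult by blast
  have "\<exists>X. finite X \<and> X \<subseteq> B \<and> B \<subseteq> span ({u \<in> B. \<forall>y\<in>Y. \<tau> (u * y) = 0} \<union> X)"
  proof (rule finite_codim_form[OF subspace_F Y(1)])
    fix y assume "y \<in> Y"
    then have "y \<in> B" using YB by blast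
    then show "form_on B (\<lambda>u. \<tau> (u * y))" unfolding form_on_def
      by (simp add: distrib_right tr_add tr_scale F_mult scale_mult_left)
  qed
  then obtain X where X: "finite X" "X \<subseteq> B" "B \<subseteq> span ({u \<in> B. \<forall>y\<in>Y. \<tau> (u * y) = 0} \<union> X)" by blast
  have kill: "u * b = 0" if u: "u \<in> B" "\<forall>y\<in>Y. \<tau> (u * y) = 0" for u
  proof (rule nondeg)
    show "u * b \<in> B" using u bB F_mult by blast
    fix v assume v: "v \<in> B"
    have "span Y \<subseteq> {z \<in> B. \<tau> (u * z) = 0}"
    proof (rule span_minimal)
      show "Y \<subseteq> {z \<in> B. \<tau> (u * z) = 0}" using u(2) YB by auto
      show "subspace {z \<in> B. \<tau> (u * z) = 0}"
        using tr_mult_form[OF subset_refl u(1)] unfolding subspace_def form_on_def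
        by (auto simp: F_zero F_add F_scale tr_zero)
    qed
    moreover have "b * v \<in> span Y" using Y(3) v by blast
    ultimately have "\<tau> (u * (b * v)) = 0" by blast
    then show "\<tau> (u * b * v) = 0" by (simp add: mult.assoc)
  qed
  have "{u * b | u. u \<in> B} \<subseteq> span ((\<lambda>u. u * b) ` X)"
  proof clarify
    fix u assume "u \<in> B"
    then have "u * b \<in> span ((\<lambda>u. u * b) ` ({u \<in> B. \<forall>y\<in>Y. \<tau> (u * y) = 0} \<union> X))"
      using X(3) by (intro span_mult_right) blast
    also have "\<dots> \<subseteq> span ((\<lambda>u. u * b) ` X)"
      using kill by (intro span_minimal subspace_span) (auto intro: span_base simp: span_zero)
    finally show "u * b \<in> span ((\<lambda>u. u * b) ` X)" .
  qed
  then show ?thesis using X(1) unfolding fdim_def by (intro exI[of _ "(\<lambda>u. u * b) ` X"]) auto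
qed

lemma Bf_star: assumes b: "b \<in> Bf" shows "star b \<in> Bf"
proof -
  have bB: "b \<in> B" using b by (rule Bf_B)
  have "fdim (star ` {u * b | u. u \<in> B})"
    using bB F_mult by (intro lin_on_image_fdim[OF subspace_F star_lin _ Bf_left_fdim[OF b]]) auto
  moreover have "{star b * u | u. u \<in> B} \<subseteq> star ` {u * b | u. u \<in> B}"
  proof clarify
    fix u assume u: "u \<in> B"
    then have "star b * u = star (star u * b)" using bB star_B by (simp add: star_mult star_star)
    then show "star b * u \<in> star ` {u * b | u. u \<in> B}" using u star_B by blast
  qed
  ultimately show ?thesis using bB star_B fdim_subset unfolding Bf_def by blast
qed

text \<open>Each of these is the unit of a finite-dimensional two-sided ideal that is stable under
  \<open>star\<close>.\<close>

definition cidem :: "'b \<Rightarrow> bool" where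
  "cidem f \<longleftrightarrow> f \<in> Bf \<and> f * f = f \<and> star f = f \<and> (\<forall>x\<in>B. f * x = x * f)"

text \<open>The two-sided ideal generated by \<open>b\<close> and \<open>star b\<close> is
  finite-dimensional, and regularity keeps the trace form on it nondegenerate, so it has a
  self-adjoint unit \<open>f\<close>. As \<open>f * x\<close> and \<open>x * f\<close> lie in the
  ideal, both equal \<open>f * x * f\<close>, and \<open>f\<close> is central.\<close>

lemma central_unit:
  assumes b: "b \<in> Bf" shows "\<exists>f. cidem f \<and> f * b = b"
proof -
  have bB: "b \<in> B" and sb: "star b \<in> Bf" "star b \<in> B" using b Bf_B Bf_star star_B by auto
  define G where "G = {u * c * v | u c v. u \<in> B \<and> c \<in> {b, star b} \<and> v \<in> B}"
  define J where "J = span G"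
  have GI: "u * c * v \<in> G" if "u \<in> B" "c \<in> {b, star b}" "v \<in> B" for u c v using that unfolding G_def by blast
  have GE: "\<exists>u c v. x = u * c * v \<and> u \<in> B \<and> c \<in> {b, star b} \<and> c \<in> B \<and> v \<in> B" if "x \<in> G" for x
    using that bB sb unfolding G_def by auto
  have GB: "G \<subseteq> B" using GE F_mult by blast
  have JB: "J \<subseteq> B" unfolding J_def by (rule span_minimal[OF GB subspace_F])
  have sJ: "subspace J" unfolding J_def by simp
  have Jl: "x * j \<in> J" if x: "x \<in> B" and j: "j \<in> J" for x j
  proof -
    have "x * j \<in> span ((\<lambda>j. x * j) ` G)" using j unfolding J_def by (intro span_mult_left B_homog x)
    also have "\<dots> \<subseteq> J" unfolding J_def
    proof (rule span_mono, rule image_subsetI)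
      fix g assume "g \<in> G"
      then obtain u c v where g: "g = u * c * v" "u \<in> B" "c \<in> {b, star b}" "v \<in> B" using GE by blast
      then have "x * g = (x * u) * c * v" by (simp add: mult.assoc)
      then show "x * g \<in> G" using GI[OF F_mult[OF x g(2)] g(3,4)] by simp
    qed
    finally show ?thesis .
  qed
  have Jr: "j * x \<in> J" if x: "x \<in> B" and j: "j \<in> J" for x j
  proof -
    have "j * x \<in> span ((\<lambda>j. j * x) ` G)" using j unfolding J_def by (rule span_mult_right)
    also have "\<dots> \<subseteq> J" unfolding J_def
    proof (rule span_mono, rule image_subsetI)
      fix g assume "g \<in> G"
      then obtain u c v where g: "g = u * c * v" "u \<in> B" "c \<in> {b, star b}" "v \<in> B" using GE by blast
      then have "g * x = u * c * (v * x)" by (simp add: mult.assoc)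
      then show "g * x \<in> G" using GI[OF g(2,3) F_mult[OF g(4) x]] by simp
    qed
    finally show ?thesis .
  qed
  have Js: "star ` J \<subseteq> J"
  proof (rule image_subsetI)
    fix x assume "x \<in> J"
    then have "star x \<in> span (star ` G)" unfolding J_def by (rule lin_on_image_span[OF subspace_F star_lin GB])
    also have "\<dots> \<subseteq> J" unfolding J_def
    proof (rule span_mono, rule image_subsetI)
      fix g assume "g \<in> G"
      then obtain u c v where g: "g = u * c * v" "u \<in> B" "c \<in> {b, star b}" "c \<in> B" "v \<in> B" using GE by blast
      have "star g = star v * star c * star u" unfolding g(1) using g F_mult by (simp add: star_mult mult.assoc)
      moreover have "star c \<in> {b, star b}" using g(3) star_star[OF bB] by auto
      ultimately show "star g \<in> G" using GI[of "star v" "star c" "star u"] g star_B by simp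
    qed
    finally show "star x \<in> J" .
  qed
  have fdc: "fdim {u * c * v | u v. u \<in> B \<and> v \<in> B}" if c: "c \<in> Bf" for c
  proof -
    obtain Y where Y: "finite Y" "Y \<subseteq> {c * u | u. u \<in> B}" "{c * u | u. u \<in> B} \<subseteq> span Y"
      using c fdim_basis[of "{c * u | u. u \<in> B}"] unfolding Bf_def by blast
    have "y \<in> Bf" if "y \<in> Y" for y using that Y(2) Bf_right[OF c] by blast
    then have "fdim (span (\<Union>y\<in>Y. {u * y | u. u \<in> B}))" using Y(1) by (intro fdim_span fdim_UN Bf_left_fdim)
    moreover have "{u * c * v | u v. u \<in> B \<and> v \<in> B} \<subseteq> span (\<Union>y\<in>Y. {u * y | u. u \<in> B})"
    proof clarify
      fix u v assume uv: "u \<in> B" "v \<in> B"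
      then have "c * v \<in> span Y" using Y(3) by blast
      then have "u * (c * v) \<in> span ((\<lambda>y. u * y) ` Y)" by (rule span_mult_left[OF B_homog[OF uv(1)]])
      also have "\<dots> \<subseteq> span (\<Union>y\<in>Y. {u * y | u. u \<in> B})" using uv by (intro span_mono) blast
      finally show "u * c * v \<in> span (\<Union>y\<in>Y. {u * y | u. u \<in> B})" by (simp add: mult.assoc)
    qed
    ultimately show ?thesis by (rule fdim_subset)
  qed
  have "G = {u * b * v | u v. u \<in> B \<and> v \<in> B} \<union> {u * star b * v | u v. u \<in> B \<and> v \<in> B}" unfolding G_def by blast
  then have fdJ: "fdim J" unfolding J_def using fdc[OF b] fdc[OF sb(1)] by (intro fdim_span) (simp add: fdim_Un)
  obtain f where f: "f \<in> J" "star f = f" "\<And>c. c \<in> J \<Longrightarrow> f * c = c" "\<And>c. c \<in> J \<Longrightarrow> c * f = c"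
  proof (rule nondeg_unit[OF sJ JB fdJ _ Js])
    show "a * c \<in> J" if "a \<in> J" "c \<in> J" for a c using Jl that JB by blast
    show "x = 0" if x: "x \<in> J" "\<And>d. d \<in> J \<Longrightarrow> \<tau> (x * d) = 0" for x
    proof (rule nondeg)
      show xB: "x \<in> B" using x JB by blast
      fix v assume v: "v \<in> B"
      obtain x' where x': "x' \<in> B" "x = x * x' * x" using regular[OF xB] by blast
      have "x' * x * v \<in> J" using Jr[OF v Jl[OF x'(1) x(1)]] .
      then have "\<tau> (x * (x' * x * v)) = 0" by (rule x(2))
      then show "\<tau> (x * v) = 0" using x'(2) by (metis mult.assoc)
    qed
  qed (use that in blast)
  have fB: "f \<in> B" using f(1) JB by blast
  have "f * x = x * f" if x: "x \<in> B" for x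
    using f(3)[OF Jl[OF x f(1)]] f(4)[OF Jr[OF x f(1)]] by (simp add: mult.assoc)
  moreover have "f \<in> Bf"
  proof -
    have "{f * u | u. u \<in> B} \<subseteq> J" using Jr f(1) by blast
    then show ?thesis unfolding Bf_def using fB fdim_subset[OF fdJ] by blast
  qed
  moreover have "b \<in> J"
  proof -
    obtain b' where b': "b' \<in> B" "b = b * b' * b" using regular[OF bB] by blast
    have "b * b' * b * (b' * b) \<in> J" unfolding J_def using bB b'(1) F_mult by (intro span_base GI) auto
    moreover have "b * b' * b * (b' * b) = b" using b'(2) by (metis mult.assoc)
    ultimately show ?thesis by simp
  qed
  ultimately have "cidem f" "f * b = b" unfolding cidem_def using f by auto
  then show ?thesis by blast
qed

text \<open>The corner \<open>e B e\<close> is finite-dimensional, so some central \<open>f\<close>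
  makes \<open>f e B e\<close> as large as possible. Joining the central unit of any
  \<open>b\<close> in \<open>Bf\<close> to \<open>f\<close> cannot enlarge it, hence the part of
  \<open>e * b\<close> outside \<open>f\<close> kills \<open>B e\<close> from the left; by
  regularity it is zero.\<close>

lemma central_cover:
  assumes e: "e \<in> B" "e * e = e"
  shows "\<exists>f. cidem f \<and> (\<forall>b\<in>Bf. e * b = e * b * f)"
proof -
  define D where "D f = (\<lambda>u. f * e * u * e) ` B" for f
  have B: "f \<in> B" if "cidem f" for f using that Bf_B unfolding cidem_def by blast
  have cen: "f * x = x * f" if "cidem f" "x \<in> B" for f x using that unfolding cidem_def by blast
  have fd: "fdim {e * u * e | u. u \<in> B}" using F_fdim[OF e(1) e(1)] .
  have De: "D f \<subseteq> {e * u * e | u. u \<in> B}" if f: "cidem f" for f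
  proof -
    have "f * e * u * e = e * (f * u) * e" if "u \<in> B" for u using cen[OF f e(1)] by (simp add: mult.assoc[symmetric])
    then show ?thesis unfolding D_def using F_mult[OF B[OF f]] by blast
  qed
  have sD: "subspace (D f)" if f: "cidem f" for f
  proof -
    have "f * e \<in> homog" using B[OF f] e F_mult B_homog by blast
    then have "lin_on B (\<lambda>u. f * e * u * e)" unfolding lin_on_def
      by (simp add: distrib_left distrib_right homogD scale_mult_left)
    then show ?thesis unfolding D_def by (intro lin_on_image_subspace[OF subspace_F _ subspace_F]) auto
  qed
  have "\<exists>f. cidem f \<and> (\<forall>g. cidem g \<longrightarrow> dim (D g) \<le> dim (D f))"
  proof (rule ex_has_greatest_nat[of cidem 0 "\<lambda>f. dim (D f)" "Suc (dim {e * u * e | u. u \<in> B})"])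
    show "cidem 0" unfolding cidem_def using Bf_zero star_zero by simp
    show "\<forall>f. cidem f \<longrightarrow> dim (D f) < Suc (dim {e * u * e | u. u \<in> B})"
      using fdim_dim_mono[OF fd De sD] by (simp add: less_Suc_eq_le)
  qed
  then obtain f where f: "cidem f" "\<And>g. cidem g \<Longrightarrow> dim (D g) \<le> dim (D f)" by blast
  have "e * b = e * b * f" if b: "b \<in> Bf" for b
  proof -
    have bB: "b \<in> B" using b by (rule Bf_B)
    obtain f' where f': "cidem f'" "f' * b = b" using central_unit[OF b] by blast
    have fB: "f \<in> B" "f' \<in> B" using B f f' by auto
    have ff: "f * f = f" "f' * f' = f'" "f' * f = f * f'" "star f = f" "star f' = f'"
      using f(1) f'(1) cen[OF f'(1) fB(1)] unfolding cidem_def by (simp_all only:)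
    \<comment> \<open>The join of two commuting central idempotents.\<close>
    define g where "g = f + f' - f * f'"
    have gf: "g * f = f" "g * f' = f'"
      unfolding g_def using ff by (simp_all add: algebra_simps) (metis mult.assoc)+
    have g: "cidem g" unfolding cidem_def
    proof (intro conjI ballI)
      show "g \<in> Bf" unfolding g_def using f(1) f'(1) Bf_lin Bf_right fB unfolding cidem_def by blast
      have "g * g = g * f + g * f' - g * f * f'" by (subst (2) g_def) (simp add: algebra_simps)
      then show "g * g = g" using gf by (simp add: g_def)
      show "star g = g" unfolding g_def using fB ff F_mult F_add by (simp add: star_diff star_add star_mult)
      fix x assume x: "x \<in> B"
      have "f * (f' * x) = x * (f * f')" using cen[OF f(1) x] cen[OF f'(1) x] by (metis mult.assoc)
      then show "g * x = x * g" unfolding g_def distrib_right left_diff_distrib distrib_left right_diff_distrib mult.assoc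
        using cen[OF f(1) x] cen[OF f'(1) x] by (simp only:)
    qed
    have gB: "g \<in> B" by (rule B[OF g])
    have "D f \<subseteq> D g"
    proof -
      have "f * e * u * e = g * e * (f * u) * e" for u using gf cen[OF f(1) e(1)] by (metis mult.assoc)
      then show ?thesis unfolding D_def using F_mult[OF fB(1)] by blast
    qed
    then have Dfg: "D f = D g"
      using fdim_dim_eq[OF fdim_subset[OF fd De[OF g]] _ sD[OF f(1)] f(2)[OF g]] by blast
    have gb: "g * b = b" using gf f'(2) by (metis mult.assoc)
    define d where "d = e * b - e * b * f"
    have dB: "d \<in> B" unfolding d_def by (intro F_diff F_mult e(1) bB fB(1))
    have "d * u * e = 0" if u: "u \<in> B" for u
    proof -
      have "g * (e * b) = e * b" using cen[OF g e(1)] gb by (metis mult.assoc)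
      then have "g * e * ((b - b * f) * u) * e = (e * b - e * b * f) * u * e"
        by (simp only: mult.assoc[symmetric] right_diff_distrib left_diff_distrib) 
      then have "d * u * e = g * e * ((b - b * f) * u) * e" unfolding d_def by simp
      moreover have "(b - b * f) * u \<in> B" by (intro F_diff F_mult bB fB(1) u)
      ultimately have "d * u * e \<in> D f" unfolding Dfg unfolding D_def by blast
      then obtain v where "v \<in> B" "d * u * e = f * e * v * e" unfolding D_def by blast
      then have "f * (d * u * e) = d * u * e" using ff by (metis mult.assoc)
      moreover have "f * d = 0"
        using cen[OF f(1) dB] ff unfolding d_def by (simp add: left_diff_distrib mult.assoc)
      then have "f * (d * u * e) = 0" by (simp add: mult.assoc[symmetric])
      ultimately show ?thesis by simp
    qed
    moreover obtain u where u: "u \<in> B" "d = d * u * d" using regular[OF dB] by blast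
    moreover have "d = e * (b - b * f)" unfolding d_def by (simp add: algebra_simps)
    ultimately have "d = 0" by (metis mult.assoc mult_zero_left)
    then show ?thesis unfolding d_def by simp
  qed
  then show ?thesis using f(1) by blast
qed

text \<open>The join of a local unit with its central cover. Cutting by it keeps or drops each
  finite-dimensional block as a whole, since on \<open>Bf\<close> it acts as the central
  \<open>f\<close>.\<close>

lemma good_unit:
  assumes S: "finite S" "S \<subseteq> B"
  obtains e f where "e \<in> B" "e * e = e" "star e = e" "\<And>s. s \<in> S \<Longrightarrow> e * s = s" "\<And>s. s \<in> S \<Longrightarrow> s * e = s"
    "cidem f" "\<And>b. b \<in> Bf \<Longrightarrow> e * b = f * b"
proof -
  obtain e0 where e0: "e0 \<in> B" "e0 * e0 = e0" "star e0 = e0" "\<And>s. s \<in> S \<Longrightarrow> e0 * s = s" "\<And>s. s \<in> S \<Longrightarrow> s * e0 = s"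
    using local_unit[OF S] by metis
  obtain f where f: "cidem f" "\<And>b. b \<in> Bf \<Longrightarrow> e0 * b = e0 * b * f" using central_cover[OF e0(1,2)] by blast
  have fB: "f \<in> B" and ff: "f * f = f" "star f = f" and cen: "\<And>x. x \<in> B \<Longrightarrow> f * x = x * f"
    using f(1) Bf_B unfolding cidem_def by auto
  define e where "e = e0 + f - e0 * f"
  have fe: "f * e0 = e0 * f" using cen e0(1) by blast
  show ?thesis
  proof (rule that[of e f])
    show "e \<in> B" unfolding e_def by (intro F_diff F_add F_mult e0(1) fB)
    have "e0 * f * e0 = e0 * f" "f * (e0 * f) = e0 * f" "e0 * f * (e0 * f) = e0 * f" "e0 * f * f = e0 * f" "e0 * (e0 * f) = e0 * f"
      using fe e0(2) ff(1) by (metis mult.assoc)+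
    then show "e * e = e" unfolding e_def using e0(2) ff(1) fe by (simp add: distrib_left distrib_right left_diff_distrib right_diff_distrib)
    show "star e = e" unfolding e_def using e0 fB ff fe F_mult F_add by (simp add: star_add star_diff star_mult)
    show "e * s = s" "s * e = s" if s: "s \<in> S" for s
    proof -
      have "s \<in> B" using s S(2) by blast
      then have "e0 * f * s = f * s" using fe e0(4)[OF s] by (metis mult.assoc)
      then show "e * s = s" unfolding e_def using e0(4)[OF s] by (simp add: algebra_simps)
      have "s * (e0 * f) = s * f" using e0(5)[OF s] by (metis mult.assoc)
      then show "s * e = s" unfolding e_def using e0(5)[OF s] by (simp add: algebra_simps)
    qed
    show "e * b = f * b" if b: "b \<in> Bf" for b
    proof -
      have "e0 * f * b = e0 * b" using f(2)[OF b] cen[OF Bf_B[OF b]] by (metis mult.assoc)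
      then show ?thesis unfolding e_def by (simp add: algebra_simps)
    qed
  qed (rule f(1))
qed

text \<open>Semisimplicity of \<open>lder K\<close> is tested against all of \<open>m\<close>, the
  only place where nondegeneracy is known. The link is the compression \<open>e z e\<close> of
  \<open>z\<close> in \<open>m\<close>: it normalises \<open>K\<close>, and it has the same trace as
  \<open>z\<close> against the corner. Therefore ideals of \<open>lder K\<close> that are stable
  under the normaliser \<open>Nm\<close> are treated before arbitrary ones.\<close>

theorem locally_semisimple_core:
  assumes S: "finite S" "S \<subseteq> m"
  shows "\<exists>K. lsub K \<and> fdim K \<and> K \<subseteq> m \<and> S \<subseteq> K \<and>
    (\<forall>I. lideal (lder K) I \<and> (\<forall>x\<in>I. \<forall>y\<in>I. commutator x y = 0) \<longrightarrow> I = {0})"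
proof -
  have SB: "S \<subseteq> B" using S(2) m_B by blast
  obtain e f where e: "e \<in> B" "e * e = e" "star e = e" "\<And>s. s \<in> S \<Longrightarrow> e * s = s" "\<And>s. s \<in> S \<Longrightarrow> s * e = s"
    "cidem f" "\<And>b. b \<in> Bf \<Longrightarrow> e * b = f * b" using good_unit[OF S(1) SB] by metis
  have ff: "f * f = f" "f \<in> B" and cen: "\<And>x. x \<in> B \<Longrightarrow> f * x = x * f"
    using e(6) Bf_B unfolding cidem_def by auto
  define K where "K = {x \<in> m. e * x = x \<and> x * e = x}"
  have Km: "K \<subseteq> m" unfolding K_def by blast
  have KB: "K \<subseteq> B" using Km m_B by blast
  have Ke: "e * x = x" "x * e = x" if "x \<in> K" for x using that unfolding K_def by auto
  have eh: "e \<in> homog" using B_homog[OF e(1)] .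
  have lK: "lsub K" unfolding lsub_def
  proof (intro conjI ballI)
    show "subspace K" unfolding K_def subspace_def using subspace_m eh
      by (auto simp: subspace_0 subspace_add subspace_scale distrib_left distrib_right homogD scale_mult_left)
    fix x y assume xy: "x \<in> K" "y \<in> K"
    have "e * commutator x y = commutator x y" "commutator x y * e = commutator x y"
      unfolding commutator_def using Ke[OF xy(1)] Ke[OF xy(2)]
      by (simp_all add: left_diff_distrib right_diff_distrib mult.assoc) (simp_all add: mult.assoc[symmetric])
    then show "commutator x y \<in> K" unfolding K_def using xy Km m_commutator by blast
  qed
  \<comment> \<open>The bracket with \<open>e z e\<close> differs from the bracket with
    \<open>z\<close> by \<open>skew (y * z * c)\<close>, where \<open>c\<close> is the difference of
    a larger local unit and \<open>e\<close>. Since \<open>c * y = 0\<close>, the corner lemma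
    places this error in \<open>m\<close> once it kills \<open>Bf\<close>.\<close>
  have eKm: "commutator y (e * z * e) \<in> K" if y: "y \<in> K" and z: "z \<in> m" for y z
  proof -
    have yB: "y \<in> B" and zB: "z \<in> B" and ym: "y \<in> m" using y z KB Km m_B by auto
    have fin: "finite {z, e}" and sub: "{z, e} \<subseteq> B" using zB e(1) by auto
    obtain e1 where e1B: "e1 \<in> B" and "e1 * e1 = e1" "star e1 = e1"
      and e1: "\<And>s. s \<in> {z, e} \<Longrightarrow> e1 * s = s" "\<And>s. s \<in> {z, e} \<Longrightarrow> s * e1 = s"
      by (rule local_unit[OF fin sub]) (rule that)
    define c where "c = e1 - e"
    have cB: "c \<in> B" unfolding c_def using e1B e(1) by (rule F_diff)
    have ca: "c * y = 0"
    proof -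
      have "e1 * e = e" using e1(1)[of e] by simp
      then have "e1 * y = y" using Ke(1)[OF y] by (metis mult.assoc)
      then show ?thesis unfolding c_def using Ke(1)[OF y] by (simp add: left_diff_distrib)
    qed
    have x0: "y * z * c = y * z - y * z * e"
      unfolding c_def using e1(2)[of z] by (simp add: right_diff_distrib mult.assoc)
    \<comment> \<open>On \<open>Bf\<close> the idempotent \<open>e\<close> acts as \<open>f\<close>,
      which commutes with \<open>z\<close>; writing \<open>y\<close> as \<open>y * e\<close> turns
      the remaining difference \<open>w - f * w\<close> into
      \<open>f * w - f * (f * w)\<close>.\<close>
    have kill: "y * z * c * u = 0" if u: "u \<in> Bf" for u
    proof -
      have uB: "u \<in> B" using u by (rule Bf_B)
      define w where "w = z * u"
      have w: "w \<in> Bf" unfolding w_def using Bf_left[OF u zB] .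
      have fw: "f * w \<in> Bf" using Bf_left[OF w ff(2)] .
      have "z * (e * u) = f * w" unfolding w_def e(7)[OF u] using cen[OF zB] by (metis mult.assoc)
      then have "y * z * c * u = y * (w - f * w)"
        unfolding x0 w_def by (simp add: left_diff_distrib right_diff_distrib mult.assoc)
      also have "\<dots> = y * (e * w - e * (f * w))" using Ke(2)[OF y] by (metis mult.assoc right_diff_distrib)
      also have "\<dots> = y * (f * w - f * (f * w))" using e(7) w fw by simp
      also have "\<dots> = 0" using ff(1) by (simp add: mult.assoc[symmetric])
      finally show ?thesis .
    qed
    have sk: "skew (y * z * c) \<in> m" by (rule skew_corner_mem[OF yB zB cB ca kill])
    have st: "star (y * z) = z * y" "star (y * z * e) = e * (z * y)"
      using yB zB e(1,3) F_mult star_m[OF ym] star_m[OF z] by (simp_all add: star_mult)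
    have "skew (y * z * c) = y * z - y * z * e - (z * y - e * (z * y))"
      unfolding skew_def x0 using st yB zB e(1) F_mult by (simp add: star_diff)
    moreover have cm: "commutator y (e * z * e) = y * z * e - e * (z * y)"
      unfolding commutator_def using Ke[OF y] by (metis mult.assoc)
    ultimately have "commutator y (e * z * e) = commutator y z - skew (y * z * c)"
      unfolding commutator_def by simp
    then have "commutator y (e * z * e) \<in> m" using sk m_commutator[OF ym z] subspace_diff[OF subspace_m] by simp
    moreover have "e * commutator y (e * z * e) = commutator y (e * z * e)" "commutator y (e * z * e) * e = commutator y (e * z * e)"
      unfolding cm using Ke[OF y] e(2) by (simp_all add: left_diff_distrib right_diff_distrib mult.assoc) (metis mult.assoc)+
    ultimately show ?thesis unfolding K_def by blast
  qed
  have fdE: "fdim {e * u * e | u. u \<in> B}" using F_fdim[OF e(1) e(1)] .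
  \<comment> \<open>The normaliser of \<open>K\<close> inside the corner. It contains
    \<open>K\<close> and all compressions \<open>e z e\<close>, and it is a finite-dimensional Lie
    algebra, so the results on solvable ideals apply to it.\<close>
  define Nm where "Nm = {n \<in> B. e * n = n \<and> n * e = n \<and> (\<forall>y\<in>K. commutator n y \<in> K)}"
  have NB: "Nm \<subseteq> B" unfolding Nm_def by blast
  have Ne: "e * n = n" "n * e = n" if "n \<in> Nm" for n using that unfolding Nm_def by auto
  have NK: "commutator n y \<in> K" if "n \<in> Nm" "y \<in> K" for n y using that unfolding Nm_def by blast
  have fdN: "fdim Nm"
  proof (rule fdim_subset[OF fdE], rule subsetI)
    fix n assume n: "n \<in> Nm"
    then have "n = e * n * e" "n \<in> B" using Ne NB by auto
    then show "n \<in> {e * u * e | u. u \<in> B}" by blast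
  qed
  have sK: "subspace K" and cK: "\<And>x y. x \<in> K \<Longrightarrow> y \<in> K \<Longrightarrow> commutator x y \<in> K"
    using lK unfolding lsub_def by blast+
  have lN: "lsub Nm" unfolding lsub_def
  proof (intro conjI ballI)
    show "subspace Nm" unfolding Nm_def subspace_def using eh sK KB B_homog
      by (auto simp: F_zero F_add F_scale distrib_left distrib_right homogD scale_mult_left
          commutator_add_left commutator_scale_left subspace_0 subspace_add subspace_scale subset_iff)
    fix a b assume ab: "a \<in> Nm" "b \<in> Nm"
    have "e * commutator a b = commutator a b" "commutator a b * e = commutator a b"
      unfolding commutator_def using Ne[OF ab(1)] Ne[OF ab(2)]
      by (simp_all add: left_diff_distrib right_diff_distrib mult.assoc) (simp_all add: mult.assoc[symmetric])
    moreover have "commutator (commutator a b) y \<in> K" if "y \<in> K" for y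
    proof -
      have "commutator a (commutator b y) - commutator b (commutator a y) \<in> K"
        by (intro subspace_diff[OF sK] NK ab that)
      then show ?thesis using commutator_jacobi[of a b y] by simp
    qed
    moreover have "commutator a b \<in> B" using F_commutator ab NB by auto
    ultimately show "commutator a b \<in> Nm" unfolding Nm_def by simp
  qed
  have KN: "K \<subseteq> Nm" unfolding Nm_def using KB Ke cK by blast
  have zN: "e * z * e \<in> Nm" if z: "z \<in> m" for z
  proof -
    have "z \<in> B" using z m_B by blast
    then have "e * z * e \<in> B" using e(1) F_mult by blast
    moreover have "e * (e * z * e) = e * z * e" "e * z * e * e = e * z * e" using e(2) by (metis mult.assoc)+
    moreover have "commutator (e * z * e) y \<in> K" if "y \<in> K" for y
      using eKm[OF that z] subspace_neg[OF sK] commutator_minus by metis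
    ultimately show ?thesis unfolding Nm_def by blast
  qed
  have trz: "\<tau> (x * (e * z * e)) = \<tau> (x * z)" if x: "x \<in> Nm" and z: "z \<in> m" for x z
  proof -
    have B: "x \<in> B" "z \<in> B" using x z NB m_B by auto
    have "\<tau> (x * (e * z * e)) = \<tau> (x * e * z * e)" by (simp add: mult.assoc)
    also have "\<dots> = \<tau> (e * (x * e * z))" using B e(1) F_mult by (intro tr_comm) auto
    also have "\<dots> = \<tau> (x * z)" using Ne[OF x] by (simp add: mult.assoc[symmetric])
    finally show ?thesis .
  qed
  let ?K' = "lder K"
  have K'K: "?K' \<subseteq> K" by (rule lder_subset[OF lK])
  have K'm: "?K' \<subseteq> lder m" by (rule lder_mono[OF Km])
  have NH: "Nm \<subseteq> homog" using NB B_homog by blast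
  have "lideal Nm K" unfolding lideal_def using sK KN NK by blast
  then have iK': "lideal Nm ?K'" by (rule lideal_lder[OF NH])
  have NK': "commutator n x \<in> ?K'" if "n \<in> Nm" "x \<in> ?K'" for n x using that iK' unfolding lideal_def by blast
  have sK': "subspace ?K'" unfolding lder_def by simp
  \<comment> \<open>An abelian ideal of \<open>Nm\<close> inside \<open>lder K\<close> lies in
    \<open>trad Nm\<close>, hence is orthogonal to every \<open>e z e\<close>, hence to
    \<open>m\<close>, and vanishes by \<open>lder_m_nondeg\<close>.\<close>
  have claim: "x = 0" if I: "subspace I" "I \<subseteq> ?K'" "\<And>n x. n \<in> Nm \<Longrightarrow> x \<in> I \<Longrightarrow> commutator n x \<in> I"
    "\<And>x y. x \<in> I \<Longrightarrow> y \<in> I \<Longrightarrow> commutator x y = 0" and x: "x \<in> I" for I x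
  proof -
    have id: "lideal Nm I" unfolding lideal_def using I K'K KN by blast
    have "{commutator x y | x y. x \<in> I \<and> y \<in> I} \<subseteq> {0}" using I(4) by blast
    then have "lder I \<subseteq> {0}" unfolding lder_def by (rule span_minimal) simp
    then have "ders I 1 = {0}" using span_zero unfolding lder_def by (auto simp: lder_def)
    then have "I \<inter> lder Nm \<subseteq> trad Nm" by (rule solvable_ideal_trad(1)[OF NB lN fdN id])
    moreover have "x \<in> lder Nm" using x I(2) lder_mono[OF KN] by blast
    ultimately have xt: "x \<in> trad Nm" using x by blast
    have xK': "x \<in> ?K'" using x I(2) by blast
    show "x = 0"
    proof (rule lder_m_nondeg)
      show "x \<in> lder m" using xK' K'm by blast
      fix z assume z: "z \<in> m"
      have "\<tau> (x * (e * z * e)) = 0" using xt zN[OF z] unfolding trad_def by (auto intro: alg.base)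
      then show "\<tau> (x * z) = 0" using trz[of x z] xK' K'K KN z by (simp add: subset_iff)
    qed
  qed
  have center: "x = 0" if x: "x \<in> ?K'" "\<And>y. y \<in> ?K' \<Longrightarrow> commutator x y = 0" for x
  proof (rule claim[of "{x \<in> ?K'. \<forall>y\<in>?K'. commutator x y = 0}"])
    show "subspace {x \<in> ?K'. \<forall>y\<in>?K'. commutator x y = 0}"
      unfolding subspace_def using sK' K'K KB B_homog
      by (auto simp: subspace_0 subspace_add subspace_scale commutator_add_left commutator_scale_left subset_iff)
    show "commutator n x \<in> {x \<in> ?K'. \<forall>y\<in>?K'. commutator x y = 0}"
      if n: "n \<in> Nm" and x: "x \<in> {x \<in> ?K'. \<forall>y\<in>?K'. commutator x y = 0}" for n x
    proof -
      have "commutator (commutator n x) y = 0" if y: "y \<in> ?K'" for y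
        using commutator_jacobi[of n x y] x y NK'[OF n y] by simp
      then show ?thesis using NK' n x by blast
    qed
  qed (use x in auto)
  \<comment> \<open>Testing against \<open>K\<close> instead of \<open>lder K\<close> lets
    \<open>\<tau> ([t, y] * z)\<close> be rewritten as the trace of \<open>t\<close> times
    \<open>[y, e z e]\<close>, which lies in \<open>K\<close>. So \<open>T\<close> commutes with
    \<open>K\<close> and \<open>claim\<close> applies.\<close>
  define T where "T = {x \<in> ?K'. \<forall>w\<in>K. \<tau> (x * w) = 0}"
  have T0: "t = 0" if t: "t \<in> T" for t
  proof (rule claim[of T])
    have TK: "T \<subseteq> ?K'" unfolding T_def by blast
    then have TB: "T \<subseteq> B" using K'K KB by blast
    have Ty: "commutator t y = 0" if t: "t \<in> T" and y: "y \<in> K" for t y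
    proof (rule lder_m_nondeg)
      have tK: "t \<in> K" using t TK K'K by blast
      show "commutator t y \<in> lder m" using tK y Km by (intro commutator_in_lder) auto
      fix z assume z: "z \<in> m"
      have B: "t \<in> B" "y \<in> B" "z \<in> B" using t TB y KB z m_B by auto
      have eze: "e * z * e \<in> B" using B e(1) F_mult by blast
      have "\<tau> (t * commutator y (e * z * e)) = 0" using t eKm[OF y z] unfolding T_def by blast
      then have "\<tau> (commutator t y * (e * z * e)) = 0" using tr_invariant[OF B(1,2) eze] by simp
      then show "\<tau> (commutator t y * z) = 0" using trz[of "commutator t y" z] cK[OF tK y] KN z by (simp add: subset_iff)
    qed
    show "subspace T" unfolding T_def subspace_def using sK' K'K KB
      by (auto simp: subspace_0 subspace_add subspace_scale distrib_right scale_mult_left tr_zero tr_add tr_scale F_mult subset_iff)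
    show "T \<subseteq> ?K'" by (rule TK)
    show "commutator x y = 0" if "x \<in> T" "y \<in> T" for x y using Ty that TK K'K by blast
    show "commutator n x \<in> T" if n: "n \<in> Nm" and x: "x \<in> T" for n x
    proof -
      have "\<tau> (commutator n x * w) = 0" if w: "w \<in> K" for w
      proof -
        have "\<tau> (commutator n x * w) = \<tau> (x * commutator w n)"
          using n x w NB TB KB by (intro tr_invariant') auto
        moreover have "commutator w n \<in> K" using NK[OF n w] subspace_neg[OF sK] commutator_minus by metis
        ultimately show ?thesis using x unfolding T_def by simp
      qed
      moreover have "commutator n x \<in> ?K'" using NK' n x TK by blast
      ultimately show ?thesis unfolding T_def by blast
    qed
  qed (rule t)
  \<comment> \<open>An element orthogonal to \<open>lder K\<close> has all its brackets with
    \<open>lder K\<close> in \<open>T\<close>, so it is central and vanishes by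
    \<open>center\<close>.\<close>
  have nd: "x = 0" if x: "x \<in> ?K'" "\<And>y. y \<in> ?K' \<Longrightarrow> \<tau> (x * y) = 0" for x
  proof (rule center[OF x(1)])
    fix y assume y: "y \<in> ?K'"
    have yK: "y \<in> K" using y K'K by blast
    have xK: "x \<in> K" using x(1) K'K by blast
    have "commutator x y \<in> T" unfolding T_def
    proof (intro CollectI conjI ballI)
      show "commutator x y \<in> ?K'" using xK yK by (rule commutator_in_lder)
      fix w assume w: "w \<in> K"
      have "\<tau> (commutator x y * w) = \<tau> (x * commutator y w)"
        using xK yK w KB by (intro tr_invariant) auto
      then show "\<tau> (commutator x y * w) = 0" using x(2) commutator_in_lder[OF yK w] by simp
    qed
    then show "commutator x y = 0" by (rule T0)
  qed
  \<comment> \<open>Brackets of an abelian ideal with \<open>lder K\<close> lie in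
    \<open>trad ?K'\<close>, so they vanish by \<open>nd\<close>; the ideal is central and
    \<open>center\<close> finishes.\<close>
  have "I = {0}" if I: "lideal ?K' I" "\<forall>x\<in>I. \<forall>y\<in>I. commutator x y = 0" for I
  proof -
    have K'B: "?K' \<subseteq> B" using K'K KB by blast
    have IK: "I \<subseteq> ?K'" using I(1) unfolding lideal_def by blast
    have "{commutator x y | x y. x \<in> I \<and> y \<in> I} \<subseteq> {0}" using I(2) by blast
    then have "lder I \<subseteq> {0}" unfolding lder_def by (rule span_minimal) simp
    then have d: "ders I 1 = {0}" using span_zero unfolding lder_def by (auto simp: lder_def)
    have fd: "fdim ?K'" using fdim_subset[OF fdN] K'K KN by blast
    have "x = 0" if x: "x \<in> I" for x
    proof (rule center)
      show xK: "x \<in> ?K'" using x IK by blast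
      fix y assume y: "y \<in> ?K'"
      have "commutator x y \<in> trad ?K'" by (rule solvable_ideal_trad(2)[OF K'B lsub_lder[OF lK] fd I(1) d x y])
      then show "commutator x y = 0"
        using commutator_in_lder[of x K y] xK y K'K unfolding trad_def by (intro nd) (auto intro: alg.base)
    qed
    then show ?thesis using I(1) subspace_0 unfolding lideal_def by blast
  qed
  moreover have "fdim K" by (rule fdim_subset[OF fdN KN])
  moreover have "S \<subseteq> K" unfolding K_def using S(2) e(4,5) by blast
  ultimately show ?thesis using lK Km by blast
qed

end

section \<open>Operators of finite rank\<close>

text \<open>The scalar multiplication is a term and cannot enter a type, so the type contains all
  additive maps; complex linearity returns as membership in \<open>homog\<close>.\<close>

typedef (overloaded) 'v aend = "{f :: 'v::ab_group_add \<Rightarrow> 'v. \<forall>x y. f (x + y) = f x + f y}"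
  morphisms app Aend
  by (intro exI[of _ "\<lambda>x. x"]) simp

lemma app_add: "app a (x + y) = app a x + app a y"
  using app[of a] by simp

lemma app_Aend: "(\<And>x y. f (x + y) = f x + f y) \<Longrightarrow> app (Aend f) = f"
  by (intro Aend_inverse) simp

lemma aend_eqI: "(\<And>x. app a x = app b x) \<Longrightarrow> a = b"
  by (metis app_inject ext)

lemma app_zero_arg [simp]: "app a 0 = 0"
  using app_add[of a 0 0] by simp

instantiation aend :: (ab_group_add) "{ring, monoid_mult}"
begin

definition "0 = Aend (\<lambda>x. 0)"
definition "1 = Aend (\<lambda>x. x)"
definition "a + b = Aend (\<lambda>x. app a x + app b x)"
definition "a - b = Aend (\<lambda>x. app a x - app b x)"
definition "- a = Aend (\<lambda>x. - app a x)"
definition "a * b = Aend (\<lambda>x. app a (app b x))"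

lemma app_ring [simp]:
  "app 0 x = 0" "app 1 x = x" "app (a + b) x = app a x + app b x" "app (a - b) x = app a x - app b x"
  "app (- a) x = - app a x" "app (a * b) x = app a (app b x)"
  unfolding zero_aend_def one_aend_def plus_aend_def minus_aend_def uminus_aend_def times_aend_def
  by (subst app_Aend; simp add: app_add)+

instance
  by standard (rule aend_eqI; simp add: app_add algebra_simps)+

end

definition smul :: "(complex \<Rightarrow> 'v::ab_group_add \<Rightarrow> 'v) \<Rightarrow> complex \<Rightarrow> 'v aend \<Rightarrow> 'v aend" where
  "smul sc c a = Aend (\<lambda>x. sc c (app a x))"

context cvs
begin

lemma app_smul: "app (smul scale c a) x = scale c (app a x)"
  unfolding smul_def by (subst app_Aend) (simp_all add: app_add scale_right_distrib)

lemma calg_smul: "calg (smul scale)"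
  by unfold_locales
    (rule aend_eqI; simp add: app_smul scale_right_distrib scale_left_distrib app_add)+

interpretation E: calg "smul scale" by (rule calg_smul)

lemma homog_iff: "a \<in> E.homog \<longleftrightarrow> (\<forall>c x. app a (scale c x) = scale c (app a x))"
proof
  assume "a \<in> E.homog"
  then have "a * smul scale c 1 = smul scale c (a * 1)" for c by (rule E.homogD)
  then have "app (a * smul scale c 1) x = app (smul scale c (a * 1)) x" for c x by simp
  then show "\<forall>c x. app a (scale c x) = scale c (app a x)" by (simp add: app_smul)
next
  assume "\<forall>c x. app a (scale c x) = scale c (app a x)"
  then show "a \<in> E.homog" unfolding E.homog_def by (auto intro!: aend_eqI simp: app_smul)
qed

definition rank1 :: "('b \<Rightarrow> complex) \<Rightarrow> 'b \<Rightarrow> 'b aend" where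
  "rank1 \<phi> u = Aend (\<lambda>x. scale (\<phi> x) u)"

abbreviation lform :: "('b \<Rightarrow> complex) \<Rightarrow> bool" where "lform \<equiv> form_on UNIV"

lemma lform_simps: "lform \<phi> \<Longrightarrow> \<phi> (x + y) = \<phi> x + \<phi> y" "lform \<phi> \<Longrightarrow> \<phi> (scale c x) = c * \<phi> x"
  unfolding form_on_def by auto

lemma app_rank1: "lform \<phi> \<Longrightarrow> app (rank1 \<phi> u) x = scale (\<phi> x) u"
  unfolding rank1_def by (subst app_Aend) (simp_all add: lform_simps scale_left_distrib)

definition frank :: "'b aend set" where
  "frank = E.span {rank1 \<phi> u | \<phi> u. lform \<phi>}"

lemma subspace_frank: "E.subspace frank" unfolding frank_def by simp

lemma rank1_frank: "lform \<phi> \<Longrightarrow> rank1 \<phi> u \<in> frank"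
  unfolding frank_def by (intro E.span_base) blast

lemma rank1_homog: "lform \<phi> \<Longrightarrow> rank1 \<phi> u \<in> E.homog"
  by (simp add: homog_iff app_rank1 lform_simps)

lemma frank_homog: "frank \<subseteq> E.homog"
  unfolding frank_def using rank1_homog by (intro E.span_minimal E.subspace_homog) auto

lemma rank1_mult_right: "lform \<phi> \<Longrightarrow> b \<in> E.homog \<Longrightarrow> rank1 \<phi> u * b = rank1 (\<lambda>x. \<phi> (app b x)) u \<and> lform (\<lambda>x. \<phi> (app b x))"
proof
  assume a: "lform \<phi>" "b \<in> E.homog"
  show "lform (\<lambda>x. \<phi> (app b x))" using a unfolding form_on_def homog_iff by (simp add: app_add)
  then show "rank1 \<phi> u * b = rank1 (\<lambda>x. \<phi> (app b x)) u" by (intro aend_eqI) (simp add: app_rank1 a)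
qed

lemma rank1_mult_left: "lform \<phi> \<Longrightarrow> b \<in> E.homog \<Longrightarrow> b * rank1 \<phi> u = rank1 \<phi> (app b u)"
  by (intro aend_eqI) (simp add: app_rank1 homog_iff)

lemma rank1_mult: "lform \<phi> \<Longrightarrow> lform \<psi> \<Longrightarrow> rank1 \<phi> u * rank1 \<psi> v = smul scale (\<phi> v) (rank1 \<psi> u)"
  by (intro aend_eqI) (simp add: app_rank1 app_smul lform_simps mult.commute)

lemma frank_ideal:
  assumes "a \<in> frank" "b \<in> E.homog" shows "a * b \<in> frank" "b * a \<in> frank"
proof -
  have "a * b \<in> E.span ((\<lambda>x. x * b) ` {rank1 \<phi> u | \<phi> u. lform \<phi>})"
    using assms(1) unfolding frank_def by (rule E.span_mult_right)
  also have "\<dots> \<subseteq> frank"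
    using rank1_mult_right[OF _ assms(2)] rank1_frank by (intro E.span_minimal subspace_frank) auto
  finally show "a * b \<in> frank" .
  have "b * a \<in> E.span ((\<lambda>x. b * x) ` {rank1 \<phi> u | \<phi> u. lform \<phi>})"
    using assms unfolding frank_def by (intro E.span_mult_left)
  also have "\<dots> \<subseteq> frank"
    using rank1_mult_left[OF _ assms(2)] rank1_frank by (intro E.span_minimal subspace_frank) auto
  finally show "b * a \<in> frank" .
qed

lemma frank_finite:
  assumes "a \<in> frank"
  obtains T where "finite T" "\<And>\<phi> u. (\<phi>, u) \<in> T \<Longrightarrow> lform \<phi>" "a \<in> E.span ((\<lambda>(\<phi>, u). rank1 \<phi> u) ` T)"
proof -
  obtain A where A: "finite A" "A \<subseteq> {rank1 \<phi> u | \<phi> u. lform \<phi>}" "a \<in> E.span A"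
    using assms unfolding frank_def E.span_explicit by (auto intro: E.span_sum E.span_scale E.span_base)
  have "\<forall>x\<in>A. \<exists>p. lform (fst p) \<and> x = rank1 (fst p) (snd p)"
  proof
    fix x assume "x \<in> A"
    then obtain \<phi> u where "lform \<phi>" "x = rank1 \<phi> u" using A(2) by blast
    then show "\<exists>p. lform (fst p) \<and> x = rank1 (fst p) (snd p)" by (intro exI[of _ "(\<phi>, u)"]) simp
  qed
  from bchoice[OF this] obtain g where g: "\<And>x. x \<in> A \<Longrightarrow> lform (fst (g x)) \<and> x = rank1 (fst (g x)) (snd (g x))" by blast
  have "A \<subseteq> (\<lambda>(\<phi>, u). rank1 \<phi> u) ` g ` A"
  proof
    fix x assume x: "x \<in> A"
    then have "x = (\<lambda>(\<phi>, u). rank1 \<phi> u) (g x)" using g by (simp add: case_prod_beta)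
    then show "x \<in> (\<lambda>(\<phi>, u). rank1 \<phi> u) ` g ` A" using x by blast
  qed
  then have "a \<in> E.span ((\<lambda>(\<phi>, u). rank1 \<phi> u) ` g ` A)" using A(3) E.span_mono by blast
  moreover have "lform \<phi>" if pu: "(\<phi>, u) \<in> g ` A" for \<phi> u
  proof -
    obtain x where "x \<in> A" "g x = (\<phi>, u)" using pu by auto
    then show ?thesis using g[of x] by simp
  qed
  ultimately show ?thesis using A(1) by (intro that[of "g ` A"]) auto
qed

text \<open>Sandwiching a linear \<open>x\<close> between rank-one operators leaves only the scalar
  \<open>\<phi> (app x v)\<close>; the operators that remain combine the vectors of \<open>a\<close>
  with the forms of \<open>b\<close>, finitely many in all.\<close>

lemma frank_fdim:
  assumes "a \<in> frank" "b \<in> frank" shows "E.fdim {a * x * b | x. x \<in> frank}"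
proof -
  obtain S where S: "finite S" "\<And>\<phi> u. (\<phi>, u) \<in> S \<Longrightarrow> lform \<phi>" "a \<in> E.span ((\<lambda>(\<phi>, u). rank1 \<phi> u) ` S)"
    using frank_finite[OF assms(1)] by blast
  obtain T where T: "finite T" "\<And>\<phi> u. (\<phi>, u) \<in> T \<Longrightarrow> lform \<phi>" "b \<in> E.span ((\<lambda>(\<phi>, u). rank1 \<phi> u) ` T)"
    using frank_finite[OF assms(2)] by blast
  let ?W = "(\<lambda>(s, t). rank1 (fst t) (snd s)) ` (S \<times> T)"
  have "{a * x * b | x. x \<in> frank} \<subseteq> E.span ?W"
  proof clarify
    fix x assume "x \<in> frank"
    then have x: "x \<in> E.homog" using frank_homog by blast
    have SH: "(\<lambda>(\<phi>, u). rank1 \<phi> u) ` S \<subseteq> E.homog" using S(2) rank1_homog by auto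
    have "x * b \<in> E.span ((\<lambda>y. x * y) ` (\<lambda>(\<phi>, u). rank1 \<phi> u) ` T)" using T(3) by (rule E.span_mult_left[OF x])
    then have "a * (x * b) \<in> E.span {y * z | y z. y \<in> (\<lambda>(\<phi>, u). rank1 \<phi> u) ` S \<and> z \<in> (\<lambda>y. x * y) ` (\<lambda>(\<phi>, u). rank1 \<phi> u) ` T}"
      by (rule E.span_mult[OF SH S(3)])
    also have "\<dots> \<subseteq> E.span ?W"
    proof (rule E.span_minimal[OF _ E.subspace_span], clarify)
      fix \<phi> u \<psi> v assume st: "(\<phi>, u) \<in> S" "(\<psi>, v) \<in> T"
      have "rank1 \<phi> u * (x * rank1 \<psi> v) = smul scale (\<phi> (app x v)) (rank1 \<psi> u)"
        using S(2)[OF st(1)] T(2)[OF st(2)] x by (simp add: rank1_mult_left rank1_mult)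
      moreover have "rank1 \<psi> u \<in> ?W" using st by (force simp: image_iff)
      ultimately show "rank1 \<phi> u * (x * rank1 \<psi> v) \<in> E.span ?W" by (simp add: E.span_scale E.span_base)
    qed
    finally show "a * x * b \<in> E.span ?W" by (simp add: mult.assoc)
  qed
  then show ?thesis unfolding E.fdim_def using S(1) T(1) by (intro exI[of _ ?W]) auto
qed

lemma frank_range: assumes "a \<in> frank" shows "fdim (range (app a))"
proof -
  obtain S where S: "finite S" "\<And>\<phi> u. (\<phi>, u) \<in> S \<Longrightarrow> lform \<phi>" "a \<in> E.span ((\<lambda>(\<phi>, u). rank1 \<phi> u) ` S)"
    using frank_finite[OF assms] by blast
  have "E.span ((\<lambda>(\<phi>, u). rank1 \<phi> u) ` S) \<subseteq> {a. range (app a) \<subseteq> span (snd ` S)}"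
  proof (rule E.span_minimal)
    show "E.subspace {a. range (app a) \<subseteq> span (snd ` S)}"
      unfolding E.subspace_def by (auto simp: image_subset_iff app_smul span_zero span_add span_scale)
    show "(\<lambda>(\<phi>, u). rank1 \<phi> u) ` S \<subseteq> {a. range (app a) \<subseteq> span (snd ` S)}"
    proof clarify
      fix \<phi> u x assume "(\<phi>, u) \<in> S"
      then have "app (rank1 \<phi> u) x = scale (\<phi> x) u" "u \<in> snd ` S" using S(2) app_rank1 by (blast, force)
      then show "app (rank1 \<phi> u) x \<in> span (snd ` S)" by (simp add: span_scale span_base)
    qed
  qed
  then show ?thesis using S unfolding fdim_def by (intro exI[of _ "snd ` S"]) auto
qed

section \<open>The trace of a finite-rank operator\<close>

definition tbasis :: "'b set" where
  "tbasis = (SOME X. independent X \<and> span X = UNIV)"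

lemma tbasis: "independent tbasis" "span tbasis = UNIV"
proof -
  obtain X where "independent X" "UNIV \<subseteq> span X" by (rule basis_exists[of UNIV]) (rule that)
  then have "\<exists>X. independent X \<and> span X = UNIV" by auto
  then show "independent tbasis" "span tbasis = UNIV" unfolding tbasis_def by (metis (mono_tags, lifting) someI_ex)+
qed

definition tsupp :: "'b aend \<Rightarrow> 'b set" where
  "tsupp a = {b \<in> tbasis. representation tbasis (app a b) b \<noteq> 0}"

text \<open>The sum of diagonal entries in a fixed but arbitrary basis. On \<open>frank\<close> the
  support is finite, because the diagonal of a rank-one operator is supported where its vector has
  coordinates.\<close>

definition tr :: "'b aend \<Rightarrow> complex" where
  "tr a = (\<Sum>b\<in>tsupp a. representation tbasis (app a b) b)"

lemma rep_add: "representation tbasis (x + y) b = representation tbasis x b + representation tbasis y b"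
  using representation_add[OF tbasis(1)] tbasis(2) by simp

lemma rep_scale: "representation tbasis (scale c x) b = c * representation tbasis x b"
  using representation_scale[OF tbasis(1)] tbasis(2) by simp

lemma tr_superset: "finite S \<Longrightarrow> tsupp a \<subseteq> S \<Longrightarrow> S \<subseteq> tbasis \<Longrightarrow> tr a = (\<Sum>b\<in>S. representation tbasis (app a b) b)"
  unfolding tr_def by (rule sum.mono_neutral_left) (auto simp: tsupp_def)

lemma tsupp_sub: "tsupp (a + b) \<subseteq> tsupp a \<union> tsupp b" "tsupp (smul scale c a) \<subseteq> tsupp a" "tsupp 0 = {}"
proof -
  have "representation tbasis 0 b = 0" for b using rep_scale[of 0 0 b] by simp
  then show "tsupp 0 = {}" unfolding tsupp_def by simp
qed (auto simp: tsupp_def rep_add rep_scale app_smul)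

text \<open>The value \<open>\<phi> u\<close> no longer refers to the basis; linearity and cyclicity
  on \<open>frank\<close> reduce to it.\<close>

lemma rank1_trace: assumes "lform \<phi>" shows "finite (tsupp (rank1 \<phi> u))" "tr (rank1 \<phi> u) = \<phi> u"
proof -
  let ?S = "{b. representation tbasis u b \<noteq> 0}"
  have fin: "finite ?S" by (rule finite_representation)
  have sub: "?S \<subseteq> tbasis" using representation_ne_zero by blast
  have ts: "tsupp (rank1 \<phi> u) \<subseteq> ?S" unfolding tsupp_def using assms by (auto simp: app_rank1 rep_scale)
  then show "finite (tsupp (rank1 \<phi> u))" using fin by (rule finite_subset)
  have "tr (rank1 \<phi> u) = (\<Sum>b\<in>?S. representation tbasis u b * \<phi> b)"
    using tr_superset[OF fin ts sub] assms by (simp add: app_rank1 rep_scale mult.commute)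
  also have "\<dots> = \<phi> (\<Sum>b\<in>?S. scale (representation tbasis u b) b)"
  proof -
    have "\<phi> 0 = 0" using lform_simps(2)[OF assms, of 0 0] by simp
    then have "\<phi> (\<Sum>b\<in>X. scale (g b) b) = (\<Sum>b\<in>X. g b * \<phi> b)" for g X
      by (induction X rule: infinite_finite_induct) (simp_all add: lform_simps assms)
    then show ?thesis by simp
  qed
  also have "(\<Sum>b\<in>?S. scale (representation tbasis u b) b) = u"
    using sum_nonzero_representation_eq[OF tbasis(1)] tbasis(2) by simp
  finally show "tr (rank1 \<phi> u) = \<phi> u" .
qed

lemma finite_tsupp: assumes "a \<in> frank" shows "finite (tsupp a)"
proof -
  have "frank \<subseteq> {a. finite (tsupp a)}" unfolding frank_def
  proof (rule E.span_minimal)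
    show "E.subspace {a. finite (tsupp a)}" unfolding E.subspace_def
      using finite_subset[OF tsupp_sub(1)] finite_subset[OF tsupp_sub(2)] tsupp_sub(3) by auto
  qed (use rank1_trace in auto)
  then show ?thesis using assms by blast
qed

lemma tr_lin: "E.form_on frank tr"
  unfolding E.form_on_def
proof (intro conjI ballI allI)
  fix a b assume ab: "a \<in> frank" "b \<in> frank"
  have S: "finite (tsupp a \<union> tsupp b)" "tsupp a \<union> tsupp b \<subseteq> tbasis" using finite_tsupp ab by (auto simp: tsupp_def)
  show "tr (a + b) = tr a + tr b"
    using tr_superset[OF S(1) _ S(2), of a] tr_superset[OF S(1) _ S(2), of b] tr_superset[OF S(1) tsupp_sub(1) S(2)]
    by (simp add: rep_add sum.distrib)
next
  fix c a assume a: "a \<in> frank"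
  have S: "finite (tsupp a)" "tsupp a \<subseteq> tbasis" using finite_tsupp a by (auto simp: tsupp_def)
  show "tr (smul scale c a) = c * tr a"
    using tr_superset[OF S(1) tsupp_sub(2) S(2)] by (simp add: tr_def app_smul rep_scale sum_distrib_left)
qed

lemma tr_cyclic: assumes "a \<in> frank" "b \<in> E.homog" shows "tr (a * b) = tr (b * a)"
proof -
  have "frank \<subseteq> {a \<in> frank. tr (a * b) = tr (b * a)}" (is "_ \<subseteq> ?A")
  proof (subst frank_def, rule E.span_minimal)
    have t: "tr (x + y) = tr x + tr y" "tr (smul scale c x) = c * tr x" if "x \<in> frank" "y \<in> frank" for x y c
      using tr_lin that unfolding E.form_on_def by auto
    have z: "tr 0 = 0" by (rule E.form_on_zero[OF subspace_frank tr_lin])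
    show "E.subspace ?A"
      using frank_ideal[OF _ assms(2)] subspace_frank assms(2) unfolding E.subspace_def
      by (auto simp: distrib_left distrib_right t z E.scale_mult_left E.homogD)
    show "{rank1 \<phi> u | \<phi> u. lform \<phi>} \<subseteq> ?A"
    proof clarify
      fix \<phi> u assume p: "lform \<phi>"
      have "tr (rank1 \<phi> u * b) = \<phi> (app b u)" using rank1_mult_right[OF p assms(2)] rank1_trace(2) by simp
      moreover have "tr (b * rank1 \<phi> u) = \<phi> (app b u)" using rank1_mult_left[OF p assms(2)] rank1_trace(2)[OF p] by simp
      ultimately show "rank1 \<phi> u \<in> frank \<and> tr (rank1 \<phi> u * b) = tr (b * rank1 \<phi> u)" using rank1_frank[OF p] by simp
    qed
  qed
  then show ?thesis using assms(1) by blast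
qed

lemma homog_regular: assumes "a \<in> E.homog" shows "\<exists>g\<in>E.homog. a * g * a = a"
proof -
  interpret P: vector_space_pair scale scale by unfold_locales
  have "Vector_Spaces.linear scale scale (app a)"
    using assms unfolding homog_iff by unfold_locales (auto simp: app_add)
  then obtain g where g: "Vector_Spaces.linear scale scale g" "\<forall>v\<in>range (app a). app a (g v) = v"
    using P.linear_exists_right_inverse_on[of "app a" UNIV] by auto
  have gadd: "g (x + y) = g x + g y" and gs: "g (scale c x) = scale c (g x)" for x y c
    using g(1) by (simp_all add: Vector_Spaces.linear_iff)
  have "app (Aend g) = g" using gadd by (rule app_Aend)
  then show ?thesis using g(2) gs by (intro bexI[of _ "Aend g"] aend_eqI) (auto simp: homog_iff)
qed

text \<open>Induction on the exponent. With \<open>a * g * a = a\<close> the operator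
  \<open>f = a * (a * g)\<close> has the trace of \<open>a\<close> by cyclicity, and
  \<open>f ^ Suc j = a ^ Suc (Suc j) * g\<close>, so \<open>f\<close> vanishes one power
  earlier.\<close>

lemma tr_nilpotent_zero: "a \<in> frank \<Longrightarrow> a ^ n = 0 \<Longrightarrow> tr a = 0"
proof (induction n arbitrary: a)
  case 0
  \<comment> \<open>A vanishing zeroth power means that the endomorphism ring is trivial.\<close>
  then have "(1 :: 'b aend) = 0" by simp
  then have "a = 0" by (metis mult_1_left mult_zero_left)
  then show ?case using E.form_on_zero[OF subspace_frank tr_lin] by simp
next
  case (Suc n)
  have ah: "a \<in> E.homog" using Suc.prems frank_homog by blast
  obtain g where g: "g \<in> E.homog" "a * g * a = a" using homog_regular[OF ah] by blast
  have ag: "a * g \<in> E.homog" using E.homog_mult ah g by blast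
  define f where "f = a * (a * g)"
  have fF: "f \<in> frank" unfolding f_def by (rule frank_ideal(1)[OF Suc.prems(1) ag])
  have "tr a = tr (a * g * a)" using g by simp
  also have "\<dots> = tr f" unfolding f_def using tr_cyclic[OF Suc.prems(1) ag] by simp
  finally have tra: "tr a = tr f" .
  show ?case
  proof (cases n)
    case 0 then show ?thesis using Suc.prems(2) E.form_on_zero[OF subspace_frank tr_lin] by simp
  next
    case (Suc k)
    have "f ^ Suc j = a ^ Suc (Suc j) * g" for j
    proof (induction j)
      case 0 show ?case by (simp add: f_def mult.assoc)
    next
      case (Suc j)
      have "f ^ Suc (Suc j) = f * (a ^ Suc (Suc j) * g)" by (simp only: power_Suc[of f "Suc j"] Suc)
      also have "\<dots> = a * (a * g * a) * a ^ Suc j * g"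
        unfolding f_def power_Suc[of a "Suc j"] by (simp only: mult.assoc)
      also have "\<dots> = a ^ Suc (Suc (Suc j)) * g" unfolding g(2) by (simp only: power_Suc mult.assoc)
      finally show ?case .
    qed
    then have "f ^ n = 0" using Suc.prems(2) Suc by simp
    then show ?thesis using Suc.IH[OF fF] tra by simp
  qed
qed

text \<open>An idempotent is the sum of the rank-one operators formed by a basis of its range and
  the coordinate forms composed with \<open>e\<close>, so its trace counts the basis.\<close>

lemma tr_idempotent:
  assumes e: "e \<in> frank" "e * e = e" "e \<noteq> 0" shows "\<exists>r>0. tr e = complex_of_real r"
proof -
  have eh: "e \<in> E.homog" using e frank_homog by blast
  have sub: "subspace (range (app e))" unfolding subspace_def
  proof (intro conjI ballI allI)
    show "0 \<in> range (app e)" by (rule image_eqI[of _ _ 0]) simp_all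
    show "x + y \<in> range (app e)" if "x \<in> range (app e)" "y \<in> range (app e)" for x y
      using that by (auto simp: app_add[symmetric])
    show "scale c x \<in> range (app e)" if x: "x \<in> range (app e)" for c x
    proof -
      obtain y where "x = app e y" using x by blast
      then have "scale c x = app e (scale c y)" using eh unfolding homog_iff by simp
      then show ?thesis by (rule image_eqI) simp
    qed
  qed
  obtain C where C: "finite C" "C \<subseteq> range (app e)" "independent C" "span C = range (app e)"
    using fdim_basis_subspace[OF frank_range[OF e(1)] sub] by blast
  define \<phi> where "\<phi> c x = representation C (app e x) c" for c x
  have ex: "app e x \<in> span C" for x using C(4) by blast
  have lf: "lform (\<phi> c)" for c unfolding form_on_def \<phi>_def
    using eh unfolding homog_iff by (simp add: app_add representation_add[OF C(3) ex ex] representation_scale[OF C(3) ex])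
  have fixc: "app e c = c" if "c \<in> C" for c
  proof -
    have "c \<in> range (app e)" using that C(2) by blast
    then obtain x where "c = app e x" by blast
    then show ?thesis using e(2) by (metis app_ring(6))
  qed
  have "e = (\<Sum>c\<in>C. rank1 (\<phi> c) c)"
  proof (rule aend_eqI)
    fix x :: 'b
    have s: "app (\<Sum>c\<in>X. h c) x = (\<Sum>c\<in>X. app (h c) x)" for X h
      by (induction X rule: infinite_finite_induct) simp_all
    have "app e x = (\<Sum>c | representation C (app e x) c \<noteq> 0. scale (representation C (app e x) c) c)"
      using sum_nonzero_representation_eq[OF C(3) ex] by simp
    also have "\<dots> = (\<Sum>c\<in>C. scale (representation C (app e x) c) c)"
      using C(1) representation_ne_zero by (intro sum.mono_neutral_left) auto
    finally show "app e x = app (\<Sum>c\<in>C. rank1 (\<phi> c) c) x" unfolding s by (simp add: app_rank1 lf \<phi>_def)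
  qed
  moreover have "tr (\<Sum>c\<in>X. rank1 (\<phi> c) c) = (\<Sum>c\<in>X. \<phi> c c)" for X
  proof (induction X rule: infinite_finite_induct)
    case (insert c X)
    have "(\<Sum>c\<in>X. rank1 (\<phi> c) c) \<in> frank" using lf rank1_frank by (intro E.subspace_sum[OF subspace_frank]) auto
    then show ?case using insert tr_lin rank1_trace(2)[OF lf] rank1_frank[OF lf] unfolding E.form_on_def by simp
  qed (simp_all add: E.form_on_zero[OF subspace_frank tr_lin])
  ultimately have "tr e = (\<Sum>c\<in>C. \<phi> c c)" by simp
  also have "\<dots> = (\<Sum>c\<in>C. 1)"
    using fixc representation_basis[OF C(3)] by (intro sum.cong) (simp_all add: \<phi>_def)
  finally have "tr e = complex_of_real (real (card C))" by simp
  moreover have "C \<noteq> {}"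
  proof
    assume "C = {}"
    then have "app e x = 0" for x using ex[of x] by simp
    then have "e = 0" by (intro aend_eqI) simp
    then show False using e by simp
  qed
  then have "real (card C) > 0" using C(1) by (simp add: card_gt_0_iff)
  ultimately show ?thesis by blast
qed

lemma pos_trace_alg_frank: "pos_trace_alg (smul scale) frank tr"
proof unfold_locales
  show "a * b \<in> frank" if "a \<in> frank" "b \<in> frank" for a b using frank_ideal frank_homog that by blast
  show "tr (a * b) = tr (b * a)" if "a \<in> frank" "b \<in> frank" for a b using tr_cyclic frank_homog that by blast
qed (use subspace_frank frank_homog frank_fdim tr_lin tr_nilpotent_zero tr_idempotent in auto)

end

section \<open>The quotient by the trace radical\<close>

context talg
begin

text \<open>\<open>\<pi>\<close> kills a basis of the radical and fixes the vectors completing it to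
  a basis of \<open>alg G\<close>. Its range is a complement of the radical and stands for the
  quotient.\<close>

lemma quotient_projection:
  assumes "G \<subseteq> F"
  obtains \<pi> where "lin_on UNIV \<pi>" "\<And>x. \<pi> x \<in> alg G" "\<And>n. n \<in> trad G \<Longrightarrow> \<pi> n = 0" "\<And>y. y \<in> alg G \<Longrightarrow> \<pi> y - y \<in> trad G"
proof -
  interpret P: vector_space_pair scale scale by unfold_locales
  have N: "subspace (trad G)" "trad G \<subseteq> alg G" using subspace_trad[OF assms] by (auto simp: trad_def)
  obtain X where X: "X \<subseteq> trad G" "independent X" "trad G \<subseteq> span X"
    by (rule basis_exists[of "trad G"]) (rule that)
  have "X \<subseteq> alg G" using X(1) N(2) by (rule subset_trans)
  then obtain Y where Y: "X \<subseteq> Y" "Y \<subseteq> alg G" "independent Y" "alg G \<subseteq> span Y"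
    by (rule maximal_independent_subset_extend[OF _ X(2)]) (rule that)
  obtain g where g: "Vector_Spaces.linear scale scale g" "\<forall>x\<in>Y. g x = (if x \<in> X then 0 else x)"
    "range g = span ((\<lambda>x. if x \<in> X then 0 else x) ` Y)"
    using P.linear_independent_extend_subspace[OF Y(3), of "\<lambda>x. if x \<in> X then 0 else x"] by (elim exE conjE)
  have gl: "g (x + y) = g x + g y" "g (scale c x) = scale c (g x)" for x y c
    using g(1) by (simp_all add: Vector_Spaces.linear_iff)
  have g0: "g 0 = 0" using gl(2)[of 0 0] by simp
  show ?thesis
  proof (rule that)
    show "lin_on UNIV g" unfolding lin_on_def using gl by blast
    have "(\<lambda>x. if x \<in> X then 0 else x) ` Y \<subseteq> alg G" using Y(2) alg.zero by auto
    then have "range g \<subseteq> alg G" unfolding g(3) by (rule span_minimal[OF _ subspace_alg])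
    then show "g x \<in> alg G" for x by blast
    show "g n = 0" if "n \<in> trad G" for n
    proof -
      have "span X \<subseteq> {x. g x = 0}" using g(2) X Y(1)
        by (intro span_minimal) (auto simp: subspace_def gl g0)
      then show ?thesis using that X(3) by blast
    qed
    show "g y - y \<in> trad G" if "y \<in> alg G" for y
    proof -
      have "span Y \<subseteq> {y. g y - y \<in> trad G}"
      proof (rule span_minimal)
        show "subspace {y. g y - y \<in> trad G}"
        proof (rule subspaceI)
          show "0 \<in> {y. g y - y \<in> trad G}" using subspace_0[OF N(1)] by (simp add: g0)
          show "x + y \<in> {y. g y - y \<in> trad G}" if "x \<in> {y. g y - y \<in> trad G}" "y \<in> {y. g y - y \<in> trad G}" for x y
            using subspace_add[OF N(1), of "g x - x" "g y - y"] that by (simp add: gl algebra_simps)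
          show "scale c x \<in> {y. g y - y \<in> trad G}" if "x \<in> {y. g y - y \<in> trad G}" for c x
            using subspace_scale[OF N(1), of "g x - x" c] that by (simp add: gl scale_right_diff_distrib)
        qed
        show "Y \<subseteq> {y. g y - y \<in> trad G}"
        proof
          fix y assume y: "y \<in> Y"
          show "y \<in> {y. g y - y \<in> trad G}"
          proof (cases "y \<in> X")
            case True
            then have "g y - y = - y" "y \<in> trad G" using g(2) y X(1) by auto
            then show ?thesis using subspace_neg[OF N(1)] by simp
          next
            case False
            then have "g y - y = 0" using g(2) y by simp
            then show ?thesis using subspace_0[OF N(1)] by simp
          qed
        qed
      qed
      then show ?thesis using that Y(4) by blast
    qed
  qed
qed

text \<open>The quotient of \<open>alg G\<close> by its trace radical, realised in the endomorphism ring of a linear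
  complement of the radical.\<close>
lemma quotient_map:
  assumes G: "G \<subseteq> F"
  obtains \<Phi> :: "'b \<Rightarrow> 'b aend" where
    "\<And>a b. a \<in> alg G \<Longrightarrow> b \<in> alg G \<Longrightarrow> \<Phi> (a + b) = \<Phi> a + \<Phi> b"
    "\<And>a c. a \<in> alg G \<Longrightarrow> \<Phi> (scale c a) = smul scale c (\<Phi> a)"
    "\<And>a b. a \<in> alg G \<Longrightarrow> b \<in> alg G \<Longrightarrow> \<Phi> (a * b) = \<Phi> a * \<Phi> b"
    "\<And>a. a \<in> alg G \<Longrightarrow> \<Phi> a = 0 \<longleftrightarrow> a \<in> trad G"
    "\<And>a. a \<in> alg G \<Longrightarrow> \<Phi> a \<in> calg.homog (smul scale)"
proof -
  interpret E: calg "smul scale" by (rule calg_smul)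
  obtain \<pi> where \<pi>: "lin_on UNIV \<pi>" "\<And>x. \<pi> x \<in> alg G" "\<And>n. n \<in> trad G \<Longrightarrow> \<pi> n = 0" "\<And>y. y \<in> alg G \<Longrightarrow> \<pi> y - y \<in> trad G"
    by (rule quotient_projection[OF G]) (rule that)
  have \<pi>a: "\<pi> (x + y) = \<pi> x + \<pi> y" and \<pi>s: "\<pi> (scale c x) = scale c (\<pi> x)" for x y c
    using \<pi>(1) unfolding lin_on_def by auto
  have \<pi>d: "\<pi> (x - y) = \<pi> x - \<pi> y" for x y using \<pi>a[of "x - y" y] by simp
  have AF: "alg G \<subseteq> F" by (rule alg_F[OF G])
  have Ah: "a \<in> homog" if "a \<in> alg G" for a using that AF F_homog by blast
  \<comment> \<open>Left multiplication on the complement, followed by the projection back onto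
    it.\<close>
  define \<Phi> where "\<Phi> a = Aend (\<lambda>x. \<pi> (a * \<pi> x))" for a
  have app\<Phi>: "app (\<Phi> a) x = \<pi> (a * \<pi> x)" for a x
    unfolding \<Phi>_def by (subst app_Aend) (simp_all add: \<pi>a distrib_left)
  have mod: "\<pi> (a * \<pi> y) = \<pi> (a * y)" if a: "a \<in> alg G" and y: "y \<in> alg G" for a y
  proof -
    have "a * (\<pi> y - y) \<in> trad G" by (rule trad_mult_left[OF G \<pi>(4)[OF y] a])
    then have "\<pi> (a * (\<pi> y - y)) = 0" by (rule \<pi>(3))
    then show ?thesis by (simp add: right_diff_distrib \<pi>d)
  qed
  show ?thesis
  proof (rule that[of \<Phi>])
    fix a b c assume a: "a \<in> alg G"
    show "\<Phi> (scale c a) = smul scale c (\<Phi> a)"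
      by (rule aend_eqI) (simp add: app\<Phi> app_smul scale_mult_left \<pi>s)
    show "\<Phi> a \<in> E.homog" unfolding homog_iff using Ah[OF a] by (simp add: app\<Phi> \<pi>s homogD)
    show "\<Phi> a = 0 \<longleftrightarrow> a \<in> trad G"
    proof
      assume "a \<in> trad G"
      then have "\<pi> (a * \<pi> x) = 0" for x using \<pi>(3) trad_mult_right \<pi>(2) by blast
      then show "\<Phi> a = 0" by (intro aend_eqI) (simp add: app\<Phi>)
    next
      assume 0: "\<Phi> a = 0"
      \<comment> \<open>Without a unit in \<open>alg G\<close> the hypothesis gives only that every
        \<open>a * d\<close> is in the radical. That is enough: such products are nilpotent and have
        trace zero.\<close>
      have "\<tau> (a * d) = 0" if d: "d \<in> alg G" for d
      proof -
        have "\<pi> (a * d) = 0" using 0 mod[OF a d] app\<Phi>[of a d] by simp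
        then have "- (a * d) \<in> trad G" using \<pi>(4)[OF alg_mult[OF a d]] by simp
        then have "a * d \<in> trad G" using subspace_neg[OF subspace_trad[OF G]] by fastforce
        then obtain n where "(a * d) ^ n = 0" using trad_nilpotent[OF G] by blast
        then show ?thesis using tr_nil AF alg_mult[OF a d] by blast
      qed
      then show "a \<in> trad G" unfolding trad_def using a by blast
    qed
    assume b: "b \<in> alg G"
    show "\<Phi> (a + b) = \<Phi> a + \<Phi> b" by (rule aend_eqI) (simp add: app\<Phi> distrib_right \<pi>a)
    show "\<Phi> (a * b) = \<Phi> a * \<Phi> b"
    proof (rule aend_eqI)
      fix x
      have "\<pi> (a * \<pi> (b * \<pi> x)) = \<pi> (a * (b * \<pi> x))" using mod[OF a alg_mult[OF b \<pi>(2)]] .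
      moreover have "\<pi> (\<pi> (b * \<pi> x)) = \<pi> (b * \<pi> x)"
        using \<pi>(3)[OF \<pi>(4)[OF alg_mult[OF b \<pi>(2)[of x]]]] \<pi>d by simp
      ultimately show "app (\<Phi> (a * b)) x = app (\<Phi> a * \<Phi> b) x" by (simp add: app\<Phi> mult.assoc)
    qed
  qed
qed

lemma finite_lder_support:
  assumes "finite S" "S \<subseteq> lder G" shows "\<exists>T. finite T \<and> T \<subseteq> G \<and> S \<subseteq> lder T"
  using assms
proof (induction S rule: finite_induct)
  case empty then show ?case by (intro exI[of _ "{}"]) auto
next
  case (insert s S)
  then obtain T where T: "finite T" "T \<subseteq> G" "S \<subseteq> lder T" by auto
  have "lder G \<subseteq> {x. \<exists>T. finite T \<and> T \<subseteq> G \<and> x \<in> lder T}" unfolding lder_def[of G]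
  proof (rule span_minimal)
    show "subspace {x. \<exists>T. finite T \<and> T \<subseteq> G \<and> x \<in> lder T}"
    proof (rule subspaceI)
      show "0 \<in> {x. \<exists>T. finite T \<and> T \<subseteq> G \<and> x \<in> lder T}"
        unfolding lder_def by (auto intro!: exI[of _ "{}"] simp: span_zero)
    next
      fix x y assume "x \<in> {x. \<exists>T. finite T \<and> T \<subseteq> G \<and> x \<in> lder T}" "y \<in> {x. \<exists>T. finite T \<and> T \<subseteq> G \<and> x \<in> lder T}"
      then obtain T U where TU: "finite T" "T \<subseteq> G" "x \<in> lder T" "finite U" "U \<subseteq> G" "y \<in> lder U" by blast
      then have "x \<in> lder (T \<union> U)" "y \<in> lder (T \<union> U)" using lder_mono[of T "T \<union> U"] lder_mono[of U "T \<union> U"] by auto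
      then have "x + y \<in> lder (T \<union> U)" unfolding lder_def by (rule span_add)
      then show "x + y \<in> {x. \<exists>T. finite T \<and> T \<subseteq> G \<and> x \<in> lder T}"
        using TU by (intro CollectI exI[of _ "T \<union> U"]) auto
    next
      fix c x assume "x \<in> {x. \<exists>T. finite T \<and> T \<subseteq> G \<and> x \<in> lder T}"
      then show "scale c x \<in> {x. \<exists>T. finite T \<and> T \<subseteq> G \<and> x \<in> lder T}"
        unfolding lder_def using span_scale by blast
    qed
    show "{commutator x y | x y. x \<in> G \<and> y \<in> G} \<subseteq> {x. \<exists>T. finite T \<and> T \<subseteq> G \<and> x \<in> lder T}"
    proof clarify
      fix x y assume "x \<in> G" "y \<in> G"
      then show "\<exists>T. finite T \<and> T \<subseteq> G \<and> commutator x y \<in> lder T"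
        by (intro exI[of _ "{x, y}"]) (auto intro: commutator_in_lder)
    qed
  qed
  moreover have "s \<in> lder G" using insert.prems by simp
  ultimately have "s \<in> {x. \<exists>T. finite T \<and> T \<subseteq> G \<and> x \<in> lder T}" by (rule subsetD)
  then obtain U where U: "finite U" "U \<subseteq> G" "s \<in> lder U" by (elim CollectE exE conjE)
  have "lder T \<subseteq> lder (T \<union> U)" "lder U \<subseteq> lder (T \<union> U)" by (simp_all add: lder_mono)
  then have "insert s S \<subseteq> lder (T \<union> U)" using T(3) U(3) by (simp add: subset_iff)
  then show ?case using T(1,2) U(1,2) by (intro exI[of _ "T \<union> U"]) simp
qed

text \<open>The quotient map is injective on \<open>M\<close> and maps it onto the derived algebra
  of the image of \<open>G\<close>. Finite-dimensional pieces found in the quotient are therefore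
  pulled back to \<open>M\<close> without loss.\<close>

theorem locally_semisimple_complement:
  assumes G: "G \<subseteq> F" "lsub G"
    and star: "\<And>a. a \<in> alg G \<Longrightarrow> star a \<in> alg G"
      "\<And>a b. a \<in> alg G \<Longrightarrow> b \<in> alg G \<Longrightarrow> star (a + b) = star a + star b"
      "\<And>a c. a \<in> alg G \<Longrightarrow> star (scale c a) = scale c (star a)"
      "\<And>a b. a \<in> alg G \<Longrightarrow> b \<in> alg G \<Longrightarrow> star (a * b) = star b * star a"
      "\<And>a. a \<in> alg G \<Longrightarrow> star (star a) = a"
      "\<And>a. a \<in> alg G \<Longrightarrow> \<tau> (star a) = \<tau> a"
      "\<And>x. x \<in> G \<Longrightarrow> star x = - x"
    and rad: "\<And>x. x \<in> lder G \<Longrightarrow> (\<And>y. y \<in> G \<Longrightarrow> \<tau> (x * y) = 0) \<Longrightarrow> x \<in> trad G"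
    and M: "lsub M" "M \<subseteq> lder G" "M \<inter> trad G = {0}" "\<And>x. x \<in> lder G \<Longrightarrow> \<exists>y\<in>M. x - y \<in> trad G"
    and S: "finite S" "S \<subseteq> M"
  shows "\<exists>K. lsub K \<and> fdim K \<and> K \<subseteq> M \<and> S \<subseteq> K \<and>
    (\<forall>I. lideal K I \<and> (\<forall>x\<in>I. \<forall>y\<in>I. commutator x y = 0) \<longrightarrow> I = {0})"
proof -
  interpret E: calg "smul scale" by (rule calg_smul)
  obtain \<Phi> :: "'b \<Rightarrow> 'b aend" where \<Phi>:
    "\<And>a b. a \<in> alg G \<Longrightarrow> b \<in> alg G \<Longrightarrow> \<Phi> (a + b) = \<Phi> a + \<Phi> b"
    "\<And>a c. a \<in> alg G \<Longrightarrow> \<Phi> (scale c a) = smul scale c (\<Phi> a)"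
    "\<And>a b. a \<in> alg G \<Longrightarrow> b \<in> alg G \<Longrightarrow> \<Phi> (a * b) = \<Phi> a * \<Phi> b"
    "\<And>a. a \<in> alg G \<Longrightarrow> \<Phi> a = 0 \<longleftrightarrow> a \<in> trad G"
    "\<And>a. a \<in> alg G \<Longrightarrow> \<Phi> a \<in> E.homog"
    by (rule quotient_map[OF G(1)]) (rule that)
  let ?A = "alg G"
  have GA: "G \<subseteq> ?A" by (auto intro: alg.base)
  have AF: "?A \<subseteq> F" by (rule alg_F[OF G(1)])
  note sA = subspace_alg[of G]
  have A: "a + b \<in> ?A" "a - b \<in> ?A" "scale c a \<in> ?A" "a * b \<in> ?A" if "a \<in> ?A" "b \<in> ?A" for a b c
    using that subspace_add[OF sA] subspace_diff[OF sA] subspace_scale[OF sA] alg_mult by auto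
  have A0: "0 \<in> ?A" by (rule alg.zero)
  have \<Phi>0: "\<Phi> 0 = 0" using \<Phi>(4)[OF A0] subspace_0[OF subspace_trad[OF G(1)]] by simp
  have \<Phi>d: "\<Phi> (a - b) = \<Phi> a - \<Phi> b" if "a \<in> ?A" "b \<in> ?A" for a b
    using \<Phi>(1)[of "a - b" b] A(2)[OF that] that by simp
  have \<Phi>c: "\<Phi> (commutator a b) = commutator (\<Phi> a) (\<Phi> b)" if "a \<in> ?A" "b \<in> ?A" for a b
    unfolding commutator_def using that A \<Phi>d \<Phi>(3) by simp
  have eq: "\<Phi> a = \<Phi> b \<longleftrightarrow> a - b \<in> trad G" if "a \<in> ?A" "b \<in> ?A" for a b
    using \<Phi>(4)[OF A(2)[OF that]] \<Phi>d[OF that] by simp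
  have Ninf: "\<tau> n = 0" if "n \<in> trad G" for n
    using trad_nilpotent[OF G(1) that] tr_nil[of n] that AF unfolding trad_def by blast
  \<comment> \<open>Trace and involution descend by choosing preimages. They do not depend on the
    choice because the radical consists of nilpotent elements, which have trace zero, and is stable
    under \<open>star\<close>.\<close>
  define \<tau>B where "\<tau>B x = \<tau> (SOME a. a \<in> ?A \<and> \<Phi> a = x)" for x
  define stB where "stB x = \<Phi> (star (SOME a. a \<in> ?A \<and> \<Phi> a = x))" for x
  have some: "(SOME b. b \<in> ?A \<and> \<Phi> b = \<Phi> a) \<in> ?A \<and> a - (SOME b. b \<in> ?A \<and> \<Phi> b = \<Phi> a) \<in> trad G" if a: "a \<in> ?A" for a
  proof -
    have "(SOME b. b \<in> ?A \<and> \<Phi> b = \<Phi> a) \<in> ?A \<and> \<Phi> (SOME b. b \<in> ?A \<and> \<Phi> b = \<Phi> a) = \<Phi> a"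
      by (rule someI[of _ a]) (simp add: a)
    then show ?thesis using eq[OF a] by metis
  qed
  have \<tau>B: "\<tau>B (\<Phi> a) = \<tau> a" if a: "a \<in> ?A" for a
  proof -
    let ?b = "SOME b. b \<in> ?A \<and> \<Phi> b = \<Phi> a"
    have "\<tau> (a - ?b) = 0" using Ninf some[OF a] by blast
    moreover have "a \<in> F" "?b \<in> F" using a some[OF a] AF by auto
    ultimately show ?thesis unfolding \<tau>B_def by (simp add: tr_diff)
  qed
  have star0: "star 0 = 0" using star(3)[OF A0, of 0] by simp
  have stard: "star (a - b) = star a - star b" if "a \<in> ?A" "b \<in> ?A" for a b
    using star(2)[of "a - b" b] A(2)[OF that] that by simp
  have starN: "star n \<in> trad G" if n: "n \<in> trad G" for n
  proof -
    have nA: "n \<in> ?A" using n unfolding trad_def by blast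
    have "\<tau> (star n * b) = 0" if b: "b \<in> ?A" for b
    proof -
      have "\<tau> (star n * b) = \<tau> (star (star b * n))" using star(4,5) star(1) b nA by simp
      also have "\<dots> = \<tau> (star b * n)" using star(1,6) b nA A(4) by simp
      also have "\<dots> = 0" using trad_tr[OF G(1) n star(1)[OF b]] .
      finally show ?thesis .
    qed
    then show ?thesis unfolding trad_def using star(1)[OF nA] by blast
  qed
  have stB: "stB (\<Phi> a) = \<Phi> (star a)" if a: "a \<in> ?A" for a
  proof -
    let ?b = "SOME b. b \<in> ?A \<and> \<Phi> b = \<Phi> a"
    have b: "?b \<in> ?A" "a - ?b \<in> trad G" using some[OF a] by auto
    have "star a - star ?b \<in> trad G" using starN[OF b(2)] stard[OF a b(1)] by simp
    then have "\<Phi> (star a) = \<Phi> (star ?b)" using eq[OF star(1)[OF a] star(1)[OF b(1)]] by simp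
    then show ?thesis unfolding stB_def by simp
  qed
  let ?B = "\<Phi> ` ?A"
  have \<Phi>lspan: "\<Phi> x \<in> E.span (\<Phi> ` X)" if "X \<subseteq> ?A" "x \<in> span X" for X x
  proof -
    have "span X \<subseteq> {x \<in> ?A. \<Phi> x \<in> E.span (\<Phi> ` X)}"
    proof (rule span_minimal)
      show "X \<subseteq> {x \<in> ?A. \<Phi> x \<in> E.span (\<Phi> ` X)}" using that(1) by (auto intro: E.span_base)
      show "subspace {x \<in> ?A. \<Phi> x \<in> E.span (\<Phi> ` X)}" unfolding subspace_def
        by (auto simp: A0 \<Phi>0 A \<Phi> E.span_zero E.span_add E.span_scale)
    qed
    then show ?thesis using that(2) by blast
  qed
  have im_sub: "E.subspace (\<Phi> ` Z)" if Z: "subspace Z" "Z \<subseteq> ?A" for Z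
  proof (rule E.subspaceI)
    show "0 \<in> \<Phi> ` Z" using subspace_0[OF Z(1)] by (intro image_eqI[of _ _ 0]) (simp_all add: \<Phi>0)
  next
    fix x y assume "x \<in> \<Phi> ` Z" "y \<in> \<Phi> ` Z"
    then obtain a b where ab: "x = \<Phi> a" "a \<in> Z" "y = \<Phi> b" "b \<in> Z" by (elim imageE)
    then have "x + y = \<Phi> (a + b)" using \<Phi>(1)[of a b] Z(2) by (simp add: subset_iff)
    then show "x + y \<in> \<Phi> ` Z" by (rule image_eqI) (rule subspace_add[OF Z(1) ab(2,4)])
  next
    fix c x assume "x \<in> \<Phi> ` Z"
    then obtain a where a: "x = \<Phi> a" "a \<in> Z" by (elim imageE)
    then have "smul scale c x = \<Phi> (scale c a)" using \<Phi>(2)[of a c] Z(2) by (simp add: subset_iff)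
    then show "smul scale c x \<in> \<Phi> ` Z" by (rule image_eqI) (rule subspace_scale[OF Z(1) a(2)])
  qed
  have \<Phi>pow: "\<Phi> (a ^ Suc n) = \<Phi> a ^ Suc n" if a: "a \<in> ?A" for a n
    by (induction n) (simp_all add: \<Phi>(3)[OF a] alg_power[OF a, simplified])
  have lder\<Phi>: "E.lder (\<Phi> ` X) = \<Phi> ` lder X" if X: "X \<subseteq> ?A" for X
  proof
    have cA: "{commutator x y | x y. x \<in> X \<and> y \<in> X} \<subseteq> ?A" using X alg_commutator by blast
    then have lA: "lder X \<subseteq> ?A" unfolding lder_def by (rule span_minimal[OF _ sA])
    have "{commutator x y | x y. x \<in> \<Phi> ` X \<and> y \<in> \<Phi> ` X} \<subseteq> \<Phi> ` lder X"
    proof clarify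
      fix x y assume xy: "x \<in> X" "y \<in> X"
      then have "commutator (\<Phi> x) (\<Phi> y) = \<Phi> (commutator x y)" using \<Phi>c X by (simp add: subset_iff)
      then show "commutator (\<Phi> x) (\<Phi> y) \<in> \<Phi> ` lder X" using commutator_in_lder xy by blast
    qed
    moreover have "E.subspace (\<Phi> ` lder X)" using lA by (intro im_sub) (simp_all add: lder_def)
    ultimately show "E.lder (\<Phi> ` X) \<subseteq> \<Phi> ` lder X" unfolding E.lder_def by (rule E.span_minimal)
    show "\<Phi> ` lder X \<subseteq> E.lder (\<Phi> ` X)"
    proof (rule image_subsetI)
      fix x assume "x \<in> lder X"
      then have "\<Phi> x \<in> E.span (\<Phi> ` {commutator x y | x y. x \<in> X \<and> y \<in> X})"
        using \<Phi>lspan[OF cA] unfolding lder_def by blast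
      also have "\<dots> \<subseteq> E.lder (\<Phi> ` X)" unfolding E.lder_def
      proof (rule E.span_mono, clarify)
        fix x y assume xy: "x \<in> X" "y \<in> X"
        then have "\<Phi> (commutator x y) = commutator (\<Phi> x) (\<Phi> y)" using \<Phi>c X by (simp add: subset_iff)
        then show "\<exists>x' y'. \<Phi> (commutator x y) = commutator x' y' \<and> x' \<in> \<Phi> ` X \<and> y' \<in> \<Phi> ` X" using xy by blast
      qed
      finally show "\<Phi> x \<in> E.lder (\<Phi> ` X)" .
    qed
  qed
  have algB: "?B = E.alg (\<Phi> ` G)"
  proof
    have "?A \<subseteq> {a \<in> ?A. \<Phi> a \<in> E.alg (\<Phi> ` G)}"
    proof (rule alg_least)
      show "subspace {a \<in> ?A. \<Phi> a \<in> E.alg (\<Phi> ` G)}" unfolding subspace_def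
        by (auto simp: A0 \<Phi>0 A \<Phi> intro: E.alg.intros)
      show "G \<subseteq> {a \<in> ?A. \<Phi> a \<in> E.alg (\<Phi> ` G)}" using GA by (auto intro: E.alg.base)
      show "x * a \<in> {a \<in> ?A. \<Phi> a \<in> E.alg (\<Phi> ` G)}" if "x \<in> G" "a \<in> {a \<in> ?A. \<Phi> a \<in> E.alg (\<Phi> ` G)}" for x a
      proof -
        have xa: "x \<in> ?A" "a \<in> ?A" "\<Phi> a \<in> E.alg (\<Phi> ` G)" using that GA by auto
        have "\<Phi> x * \<Phi> a \<in> E.alg (\<Phi> ` G)" using that(1) xa(3) by (intro E.alg.mult) simp_all
        then show ?thesis using \<Phi>(3)[OF xa(1,2)] A(4)[OF xa(1,2)] by simp
      qed
    qed
    then show "?B \<subseteq> E.alg (\<Phi> ` G)" by blast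
    show "E.alg (\<Phi> ` G) \<subseteq> ?B"
    proof (rule E.alg_subset_subalgebra[OF im_sub[OF sA subset_refl]])
      show "\<Phi> ` G \<subseteq> ?B" using GA by blast
      show "a * b \<in> ?B" if "a \<in> ?B" "b \<in> ?B" for a b using that \<Phi>(3) A(4) by auto (metis image_eqI)
    qed
  qed
  interpret Q: skew_generated "smul scale" ?B \<tau>B "\<Phi> ` G" stB
  proof unfold_locales
    show "E.subspace ?B" by (rule im_sub[OF sA subset_refl])
    show "?B \<subseteq> E.homog" using \<Phi>(5) by blast
    show "E.form_on ?B \<tau>B" unfolding E.form_on_def
    proof (intro conjI ballI allI; clarify)
      fix a b assume ab: "a \<in> ?A" "b \<in> ?A"
      have "\<tau>B (\<Phi> a + \<Phi> b) = \<tau> (a + b)" using \<tau>B[OF A(1)[OF ab]] \<Phi>(1)[OF ab] by simp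
      then show "\<tau>B (\<Phi> a + \<Phi> b) = \<tau>B (\<Phi> a) + \<tau>B (\<Phi> b)" using ab \<tau>B AF by (simp add: tr_add subset_iff)
    next
      fix c a assume a: "a \<in> ?A"
      have "\<tau>B (smul scale c (\<Phi> a)) = \<tau> (scale c a)" using \<tau>B[OF A(3)[OF a a]] \<Phi>(2)[OF a] by simp
      then show "\<tau>B (smul scale c (\<Phi> a)) = c * \<tau>B (\<Phi> a)" using a \<tau>B AF by (simp add: tr_scale subset_iff)
    qed
    fix x y assume "x \<in> ?B"
    then obtain a where a: "a \<in> ?A" "x = \<Phi> a" by blast
    note aF = subsetD[OF AF a(1)]
    { fix n assume "x ^ n = 0"
      \<comment> \<open>Positive exponents only: the quotient map is multiplicative on
        \<open>alg G\<close>, which need not contain 1.\<close>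
      then have "x ^ Suc n = 0" by simp
      then have "a ^ Suc n \<in> trad G" using \<Phi>pow[OF a(1)] \<Phi>(4)[OF alg_power[OF a(1)]] a(2) by simp
      then obtain k where "(a ^ Suc n) ^ k = 0" using trad_nilpotent[OF G(1)] by blast
      from tr_zero_of_power_nilpotent[OF aF this] show "\<tau>B x = 0" using \<tau>B[OF a(1)] a(2) by simp }
    { assume h: "\<And>k. \<tau>B (x ^ Suc k) = 0"
      have "\<tau> (a ^ Suc k) = 0" for k using h[of k] \<tau>B[OF alg_power[OF a(1)], of k] \<Phi>pow[OF a(1)] a(2) by metis
      then obtain n where n: "a ^ n = 0" using nil_tr[OF aF] by blast
      then have "a ^ Suc n = 0" by simp
      then show "\<exists>n. x ^ n = 0" using \<Phi>pow[OF a(1), of n] a(2) \<Phi>0 by (metis (no_types)) }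
    { assume h: "\<And>b. b \<in> ?B \<Longrightarrow> \<tau>B (x * b) = 0"
      have "\<tau> (a * b) = 0" if "b \<in> ?A" for b
        using h[of "\<Phi> b"] that \<tau>B[OF A(4)[OF a(1) that]] \<Phi>(3)[OF a(1) that] a(2) by simp
      then have "a \<in> trad G" unfolding trad_def using a(1) by blast
      then show "x = 0" using \<Phi>(4) a by simp }
    note sa = star(1)[OF a(1)]
    show "stB x \<in> ?B" using a stB sa by simp
    show "stB (stB x) = x" using a stB sa star(5) by simp
    show "\<tau>B (stB x) = \<tau>B x" using a stB sa star(6) \<tau>B by simp
    show "stB (smul scale c x) = smul scale c (stB x)" for c
    proof -
      have "stB (\<Phi> (scale c a)) = smul scale c (\<Phi> (star a))"
        using stB[OF A(3)[OF a(1) a(1)]] star(3)[OF a(1)] \<Phi>(2)[OF sa] by simp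
      then show ?thesis using \<Phi>(2)[OF a(1)] stB[OF a(1)] a(2) by simp
    qed
    assume "y \<in> ?B"
    then obtain b where b: "b \<in> ?A" "y = \<Phi> b" by blast
    note bF = subsetD[OF AF b(1)]
    show "x * y \<in> ?B" using a b \<Phi>(3) A(4) by (metis image_eqI)
    show "\<tau>B (x * y) = \<tau>B (y * x)"
      using tr_comm[OF aF bF] \<tau>B[OF A(4)[OF a(1) b(1)]] \<tau>B[OF A(4)[OF b(1) a(1)]] \<Phi>(3) a b by simp
    show "stB (x + y) = stB x + stB y" using a b stB stB[OF A(1)[OF a(1) b(1)]] \<Phi>(1) star(1,2) by simp
    show "stB (x * y) = stB y * stB x" using a b stB stB[OF A(4)[OF a(1) b(1)]] \<Phi>(3) star(1,4) by simp
    show "E.fdim {x * z * y | z. z \<in> ?B}"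
    proof -
      obtain X where X: "finite X" "X \<subseteq> {a * z * b | z. z \<in> ?A}" "{a * z * b | z. z \<in> ?A} \<subseteq> span X"
        using fdim_basis[OF fdim_subset[OF F_fdim[OF aF bF]], of "{a * z * b | z. z \<in> ?A}"] AF by blast
      have XA: "X \<subseteq> ?A" using X(2) a(1) b(1) A(4) by blast
      have "{x * z * y | z. z \<in> ?B} \<subseteq> E.span (\<Phi> ` X)"
      proof clarify
        fix z assume z: "z \<in> ?A"
        have "x * \<Phi> z * y = \<Phi> (a * z * b)" using a b z \<Phi>(3) A(4) by simp
        then show "x * \<Phi> z * y \<in> E.span (\<Phi> ` X)" using \<Phi>lspan[OF XA] X(3) z by auto
      qed
      then show ?thesis unfolding E.fdim_def using X(1) by blast
    qed
  next
    show "?B = E.alg (\<Phi> ` G)" by (rule algB)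
    have cG: "\<And>x y. x \<in> G \<Longrightarrow> y \<in> G \<Longrightarrow> commutator x y \<in> G" and sG: "subspace G" using G(2) unfolding lsub_def by blast+
    show "E.lsub (\<Phi> ` G)" unfolding E.lsub_def
    proof (intro conjI ballI)
      show "E.subspace (\<Phi> ` G)" by (rule im_sub[OF sG GA])
      fix x y assume "x \<in> \<Phi> ` G" "y \<in> \<Phi> ` G"
      then obtain a b where "a \<in> G" "b \<in> G" "x = \<Phi> a" "y = \<Phi> b" by blast
      then show "commutator x y \<in> \<Phi> ` G" using \<Phi>c[of a b] cG GA by (metis image_eqI subsetD)
    qed
    fix x
    { assume "x \<in> \<Phi> ` G"
      then obtain a where a: "a \<in> G" "x = \<Phi> a" by blast
      have "\<Phi> (- a) = - \<Phi> a" using \<Phi>d[OF A0, of a] \<Phi>0 a GA by auto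
      then show "stB x = - x" using a stB[of a] star(7)[OF a(1)] GA by auto }
    { assume h: "x \<in> E.lder (\<Phi> ` G)" "\<And>y. y \<in> \<Phi> ` G \<Longrightarrow> \<tau>B (x * y) = 0"
      obtain a where a: "a \<in> lder G" "x = \<Phi> a" using h(1) lder\<Phi>[OF GA] by blast
      have aA: "a \<in> ?A" using a(1) lder_subset[OF G(2)] GA by blast
      have "\<tau> (a * y) = 0" if "y \<in> G" for y
        using h(2)[of "\<Phi> y"] that \<tau>B[OF A(4)[OF aA, of y]] \<Phi>(3)[OF aA, of y] GA a(2) by (simp add: subset_iff)
      then have "a \<in> trad G" by (rule rad[OF a(1)])
      then show "x = 0" using \<Phi>(4)[OF aA] a(2) by simp }
  qed
  have lGA: "lder G \<subseteq> ?A" using lder_subset[OF G(2)] GA by blast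
  have MA: "M \<subseteq> ?A" using M(2) lGA by blast
  have sM: "subspace M" and cM: "\<And>x y. x \<in> M \<Longrightarrow> y \<in> M \<Longrightarrow> commutator x y \<in> M" using M(1) unfolding lsub_def by blast+
  \<comment> \<open>Semisimplicity is known for \<open>E.lder K1\<close> and not for
    \<open>K1\<close>, so \<open>K1\<close> is built around elements of \<open>G\<close> whose
    brackets already span over \<open>S\<close>.\<close>
  obtain S1 where S1: "finite S1" "S1 \<subseteq> G" "S \<subseteq> lder S1"
    using finite_lder_support[OF S(1) subset_trans[OF S(2) M(2)]] by (elim exE conjE)
  obtain K1 where K1: "E.lsub K1" "E.fdim K1" "K1 \<subseteq> \<Phi> ` G" "\<Phi> ` S1 \<subseteq> K1"
    and K1_ideal: "\<forall>I. E.lideal (E.lder K1) I \<and> (\<forall>x\<in>I. \<forall>y\<in>I. commutator x y = 0) \<longrightarrow> I = {0}"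
    using Q.locally_semisimple_core[OF finite_imageI[OF S1(1)] image_mono[OF S1(2)]] by (elim exE conjE)
  let ?L = "E.lder K1"
  have lL: "E.lsub ?L" by (rule E.lsub_lder[OF K1(1)])
  have sL: "E.subspace ?L" and cL: "\<And>x y. x \<in> ?L \<Longrightarrow> y \<in> ?L \<Longrightarrow> commutator x y \<in> ?L" using lL unfolding E.lsub_def by blast+
  define K where "K = {y \<in> M. \<Phi> y \<in> ?L}"
  have KM: "K \<subseteq> M" unfolding K_def by blast
  have KA: "K \<subseteq> ?A" using KM MA by blast
  have inj: "x = 0" if "x \<in> M" "\<Phi> x = 0" for x
    using that \<Phi>(4)[of x] MA M(3) by blast
  have surj: "\<exists>y\<in>K. z = \<Phi> y" if z: "z \<in> ?L" for z
  proof -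
    have "z \<in> E.lder (\<Phi> ` G)" using z E.lder_mono[OF K1(3)] by blast
    then obtain x where x: "x \<in> lder G" "z = \<Phi> x" using lder\<Phi>[OF GA] by blast
    obtain y where y: "y \<in> M" "x - y \<in> trad G" using M(4)[OF x(1)] by blast
    have "\<Phi> x = \<Phi> y" using eq[of x y] x(1) lGA y MA by blast
    then show ?thesis using x(2) y(1) z unfolding K_def by auto
  qed
  have lK: "lsub K" unfolding lsub_def
  proof (intro conjI ballI)
    show "subspace K" unfolding K_def
    proof (rule subspaceI)
      show "0 \<in> {y \<in> M. \<Phi> y \<in> ?L}" using subspace_0[OF sM] E.subspace_0[OF sL] by (simp add: \<Phi>0)
    next
      fix x y assume "x \<in> {y \<in> M. \<Phi> y \<in> ?L}" "y \<in> {y \<in> M. \<Phi> y \<in> ?L}"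
      then have xy: "x \<in> M" "y \<in> M" "\<Phi> x \<in> ?L" "\<Phi> y \<in> ?L" by simp_all
      then have "\<Phi> (x + y) = \<Phi> x + \<Phi> y" using \<Phi>(1) MA by (simp add: subset_iff)
      then show "x + y \<in> {y \<in> M. \<Phi> y \<in> ?L}" using subspace_add[OF sM xy(1,2)] E.subspace_add[OF sL xy(3,4)] by simp
    next
      fix c x assume "x \<in> {y \<in> M. \<Phi> y \<in> ?L}"
      then have x: "x \<in> M" "\<Phi> x \<in> ?L" by simp_all
      then have "\<Phi> (scale c x) = smul scale c (\<Phi> x)" using \<Phi>(2) MA by (simp add: subset_iff)
      then show "scale c x \<in> {y \<in> M. \<Phi> y \<in> ?L}" using subspace_scale[OF sM x(1)] E.subspace_scale[OF sL x(2)] by simp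
    qed
    fix x y assume "x \<in> K" "y \<in> K"
    then have xy: "x \<in> M" "y \<in> M" "\<Phi> x \<in> ?L" "\<Phi> y \<in> ?L" unfolding K_def by simp_all
    then have "\<Phi> (commutator x y) = commutator (\<Phi> x) (\<Phi> y)" using \<Phi>c MA by (simp add: subset_iff)
    then show "commutator x y \<in> K" using cM[OF xy(1,2)] cL[OF xy(3,4)] unfolding K_def by simp
  qed
  then have sK: "subspace K" unfolding lsub_def by blast
  have "fdim K"
  proof -
    have "\<Phi> ` K \<subseteq> ?L" unfolding K_def by (rule image_subsetI) simp
    then have "\<Phi> ` K \<subseteq> K1" using E.lder_subset[OF K1(1)] by (rule subset_trans)
    then have "E.fdim (\<Phi> ` K)" by (rule E.fdim_subset[OF K1(2)])
    from E.fdim_basis[OF this]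
    obtain Y where Y: "finite Y" "Y \<subseteq> \<Phi> ` K" "\<Phi> ` K \<subseteq> E.span Y" by (elim exE conjE)
    obtain X where X: "X \<subseteq> K" "finite X" "Y = \<Phi> ` X" using finite_subset_image[OF Y(1,2)] by (elim exE conjE)
    have XA: "X \<subseteq> ?A" using X(1) KA by blast
    have spA: "span X \<subseteq> K" using X(1) sK by (rule span_minimal)
    have "E.span (\<Phi> ` X) \<subseteq> \<Phi> ` span X"
    proof (rule E.span_minimal)
      show "\<Phi> ` X \<subseteq> \<Phi> ` span X" using span_superset by blast
      show "E.subspace (\<Phi> ` span X)" using spA KA by (intro im_sub) auto
    qed
    have "K \<subseteq> span X"
    proof
      fix y assume y: "y \<in> K"
      then obtain x where x: "x \<in> span X" "\<Phi> y = \<Phi> x" using Y(3) X(3) \<open>E.span (\<Phi> ` X) \<subseteq> \<Phi> ` span X\<close> by blast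
      have yA: "y \<in> ?A" and xA: "x \<in> ?A" using y x(1) spA KA by auto
      have "\<Phi> (y - x) = 0" using \<Phi>d[OF yA xA] x(2) by simp
      moreover have "y - x \<in> M" using y x(1) spA KM subspace_diff[OF sM] by blast
      ultimately show "y \<in> span X" using inj[of "y - x"] x(1) by simp
    qed
    then show ?thesis unfolding fdim_def using X(2) by blast
  qed
  moreover have "S \<subseteq> K"
  proof
    fix s assume s: "s \<in> S"
    have "S1 \<subseteq> ?A" using S1(2) GA by blast
    then have "\<Phi> s \<in> E.lder (\<Phi> ` S1)" using lder\<Phi> s S1(3) by blast
    then have "\<Phi> s \<in> ?L" using E.lder_mono[OF K1(4)] by blast
    then show "s \<in> K" unfolding K_def using s S(2) by blast
  qed
  moreover have "I = {0}" if I: "lideal K I" "\<forall>x\<in>I. \<forall>y\<in>I. commutator x y = 0" for I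
  proof -
    have IK: "I \<subseteq> K" and sI: "subspace I" and cI: "\<And>x y. x \<in> K \<Longrightarrow> y \<in> I \<Longrightarrow> commutator x y \<in> I"
      using I(1) unfolding lideal_def by auto
    have IA: "I \<subseteq> ?A" using IK KA by blast
    have "E.lideal ?L (\<Phi> ` I)" unfolding E.lideal_def
    proof (intro conjI ballI)
      show "E.subspace (\<Phi> ` I)" by (rule im_sub[OF sI IA])
      show "\<Phi> ` I \<subseteq> ?L" using IK unfolding K_def by blast
      fix x y assume "x \<in> ?L" "y \<in> \<Phi> ` I"
      then obtain a b where ab: "a \<in> K" "x = \<Phi> a" "b \<in> I" "y = \<Phi> b" using surj by blast
      then have "commutator x y = \<Phi> (commutator a b)" using \<Phi>c KA IA by (simp add: subset_iff)
      then show "commutator x y \<in> \<Phi> ` I" using cI ab by blast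
    qed
    moreover have "\<forall>x\<in>\<Phi> ` I. \<forall>y\<in>\<Phi> ` I. commutator x y = 0"
    proof (intro ballI)
      fix x y assume "x \<in> \<Phi> ` I" "y \<in> \<Phi> ` I"
      then obtain a b where ab: "a \<in> I" "x = \<Phi> a" "b \<in> I" "y = \<Phi> b" by blast
      then have "commutator x y = \<Phi> (commutator a b)" using \<Phi>c IA by (simp add: subset_iff)
      then show "commutator x y = 0" using I(2) ab \<Phi>0 by simp
    qed
    ultimately have "\<Phi> ` I = {0}" using K1_ideal by simp
    then have "x = 0" if "x \<in> I" for x using inj that IK KM by blast
    then show ?thesis using subspace_0[OF sI] by blast
  qed
  ultimately show ?thesis using lK KM by blast
qed

end

section \<open>Levi components\<close>

context cvs
begin

text \<open>Every finite subset of \<open>C\<close> spans a space containing only finitely many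
  members of an independent set. The finite subsets of \<open>C\<close> are countably many, so a
  basis of \<open>M\<close> is countable.\<close>

lemma countable_spanning_subset:
  assumes "subspace M" "M \<subseteq> span C" "countable C"
  shows "\<exists>Y. countable Y \<and> Y \<subseteq> M \<and> M \<subseteq> span Y"
proof -
  obtain Y where Y: "Y \<subseteq> M" "independent Y" "M \<subseteq> span Y" by (rule basis_exists[of M]) (rule that)
  have "Y \<subseteq> (\<Union>T\<in>{T. finite T \<and> T \<subseteq> C}. Y \<inter> span T)"
  proof
    fix y assume y: "y \<in> Y"
    then have "y \<in> span C" using Y(1) assms(2) by blast
    then obtain T r where T: "finite T" "T \<subseteq> C" "y = (\<Sum>a\<in>T. scale (r a) a)"
      unfolding span_explicit by blast
    then have "y \<in> span T" by (auto intro: span_sum span_scale span_base)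
    then show "y \<in> (\<Union>T\<in>{T. finite T \<and> T \<subseteq> C}. Y \<inter> span T)" using y T(1,2) by blast
  qed
  moreover have "countable (\<Union>T\<in>{T. finite T \<and> T \<subseteq> C}. Y \<inter> span T)"
  proof (rule countable_UN)
    show "countable {T. finite T \<and> T \<subseteq> C}" by (rule countable_Collect_finite_subset[OF assms(3)])
    fix T assume "T \<in> {T. finite T \<and> T \<subseteq> C}"
    then have "finite T" by simp
    moreover have "independent (Y \<inter> span T)" by (rule independent_mono[OF Y(2)]) simp
    ultimately have "finite (Y \<inter> span T)" using independent_span_bound[of T "Y \<inter> span T"] by simp
    then show "countable (Y \<inter> span T)" by (rule countable_finite)
  qed
  ultimately have "countable Y" by (rule countable_subset)
  then show ?thesis using Y by blast
qed

end

section \<open>Radicals and Levi components inside an associative algebra\<close>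

context calg
begin

lemma alg_finite_support: "a \<in> alg G \<Longrightarrow> \<exists>T. finite T \<and> T \<subseteq> G \<and> a \<in> alg T"
proof (induction rule: alg.induct)
  case (base x)
  then show ?case by (intro exI[of _ "{x}"]) (simp add: alg.base)
next
  case zero
  show ?case by (intro exI[of _ "{}"]) (simp add: alg.zero)
next
  case (add a b)
  then obtain T U where TU: "finite T" "T \<subseteq> G" "a \<in> alg T" "finite U" "U \<subseteq> G" "b \<in> alg U" by (elim exE conjE)
  then have "a \<in> alg (T \<union> U)" "b \<in> alg (T \<union> U)"
    using subsetD[OF alg_mono[of T "T \<union> U"]] subsetD[OF alg_mono[of U "T \<union> U"]] by simp_all
  then have "a + b \<in> alg (T \<union> U)" by (rule alg.add)
  then show ?case using TU by (intro exI[of _ "T \<union> U"]) simp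
next
  case (scale a c)
  then obtain T where "finite T" "T \<subseteq> G" "a \<in> alg T" by (elim exE conjE)
  then show ?case by (intro exI[of _ T]) (simp add: alg.scale)
next
  case (mult x a)
  then obtain T where T: "finite T" "T \<subseteq> G" "a \<in> alg T" by (elim exE conjE)
  then have "a \<in> alg (insert x T)" using subsetD[OF alg_mono[of T "insert x T"]] by blast
  then have "x * a \<in> alg (insert x T)" by (intro alg.mult) simp_all
  then show ?case using T mult by (intro exI[of _ "insert x T"]) simp
qed

text \<open>Phrased with finite-dimensional subalgebras instead of finitely generated ones, the form
  in which the finite-dimensional results are applied.\<close>

definition lsolv :: "'b set \<Rightarrow> bool" where
  "lsolv R \<longleftrightarrow> (\<forall>H. lsub H \<and> fdim H \<and> H \<subseteq> R \<longrightarrow> (\<exists>n. ders H n = {0}))"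

definition radical :: "'b set \<Rightarrow> 'b set \<Rightarrow> bool" where
  "radical G R \<longleftrightarrow> lideal G R \<and> lsolv R \<and> (\<forall>I. lideal G I \<and> lsolv I \<longrightarrow> I \<subseteq> R)"

definition fdss :: "'b set \<Rightarrow> bool" where
  "fdss K \<longleftrightarrow> lsub K \<and> fdim K \<and> (\<forall>I n. lideal K I \<and> ders I n = {0} \<longrightarrow> I = {0})"

definition levi :: "'b set \<Rightarrow> 'b set \<Rightarrow> 'b set \<Rightarrow> bool" where
  "levi G R M \<longleftrightarrow> lsub M \<and> {r + m | r m. r \<in> R \<inter> lder G \<and> m \<in> M} = lder G \<and> R \<inter> lder G \<inter> M = {0}"

lemma radical_unique: "radical G R \<Longrightarrow> radical G R' \<Longrightarrow> R = R'"
  unfolding radical_def by (intro subset_antisym) blast+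

text \<open>If \<open>lder I\<close> vanishes by the induction hypothesis, then \<open>I\<close> is
  abelian; so excluding abelian ideals excludes solvable ones.\<close>

lemma no_solvable_ideal:
  assumes "K \<subseteq> homog" "\<forall>I. lideal K I \<and> (\<forall>x\<in>I. \<forall>y\<in>I. commutator x y = 0) \<longrightarrow> I = {0}"
  shows "lideal K I \<Longrightarrow> ders I n = {0} \<Longrightarrow> I = {0}"
proof (induction n arbitrary: I)
  case 0 then show ?case by simp
next
  case (Suc n)
  have "lder I = {0}"
    using Suc.IH[OF lideal_lder[OF assms(1) Suc.prems(1)]] Suc.prems(2) unfolding ders_Suc' by simp
  then have "\<forall>x\<in>I. \<forall>y\<in>I. commutator x y = 0" using commutator_in_lder[of _ I] by auto
  then show ?case using assms(2) Suc.prems(1) by simp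
qed

lemma lsub_lideal: "lideal G I \<Longrightarrow> lsub I"
  unfolding lideal_def lsub_def by blast

context
  fixes G R M assumes R: "radical G R" and M: "levi G R M"
begin

lemma lideal_radical: "lideal G R"
  using R unfolding radical_def by simp

lemma levi_lsub: "lsub M" and levi_inter: "R \<inter> lder G \<inter> M = {0}"
  using M unfolding levi_def by simp_all

lemma levi_subset: "M \<subseteq> lder G"
proof
  fix m assume m: "m \<in> M"
  have "0 \<in> R \<inter> lder G" using levi_inter by blast
  then have "0 + m \<in> {r + m | r m. r \<in> R \<inter> lder G \<and> m \<in> M}" using m by blast
  then show "m \<in> lder G" using M unfolding levi_def by (simp only: add_0_left)
qed

lemma levi_decompose: assumes "x \<in> lder G" shows "\<exists>y\<in>M. x - y \<in> R \<inter> lder G"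
proof -
  have "x \<in> {r + m | r m. r \<in> R \<inter> lder G \<and> m \<in> M}" using M assms unfolding levi_def by simp
  then obtain r m where "x = r + m" "r \<in> R \<inter> lder G" "m \<in> M" by blast
  then show ?thesis by (intro bexI[of _ m]) simp_all
qed

lemma levi_projection_unique:
  assumes "y \<in> M" "y' \<in> M" "x - y \<in> R \<inter> lder G" "x - y' \<in> R \<inter> lder G" shows "y = y'"
proof -
  have "subspace (R \<inter> lder G)" using lideal_radical unfolding lideal_def lder_def by (simp add: subspace_inter)
  from subspace_diff[OF this assms(4,3)] have "y - y' \<in> R \<inter> lder G" by simp
  moreover have "y - y' \<in> M" using levi_lsub assms(1,2) subspace_diff unfolding lsub_def by blast
  ultimately have "y - y' = 0" using levi_inter by blast
  then show ?thesis by simp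
qed

end

lemma levi_isomorphism:
  assumes G: "lsub G" "G \<subseteq> homog" and R: "radical G R" and M: "levi G R M1" "levi G R M2"
  shows "\<exists>\<phi>. bij_betw \<phi> M1 M2 \<and>
    (\<forall>x\<in>M1. \<forall>y\<in>M1. \<phi> (x + y) = \<phi> x + \<phi> y \<and> \<phi> (commutator x y) = commutator (\<phi> x) (\<phi> y)) \<and>
    (\<forall>c. \<forall>x\<in>M1. \<phi> (scale c x) = scale c (\<phi> x))"
proof -
  let ?N = "R \<inter> lder G"
  note M1 = levi_lsub[OF R M(1)] levi_subset[OF R M(1)] levi_decompose[OF R M(1)] levi_projection_unique[OF R M(1)]
  note M2 = levi_lsub[OF R M(2)] levi_subset[OF R M(2)] levi_decompose[OF R M(2)] levi_projection_unique[OF R M(2)]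
  have lR: "lideal G R" by (rule lideal_radical[OF R M(1)])
  have sN: "subspace ?N" using lR unfolding lideal_def lder_def by (simp add: subspace_inter)
  have LG: "lder G \<subseteq> G" by (rule lder_subset[OF G(1)])
  have N: "commutator n y \<in> ?N" "commutator y n \<in> ?N" if "n \<in> ?N" "y \<in> G" for n y
    using that LG lideal_commutator'[OF lR, of n y] commutator_in_lder[of n G y] commutator_in_lder[of y G n] lR
    unfolding lideal_def by auto
  have "\<forall>x\<in>M1. \<exists>y. y \<in> M2 \<and> x - y \<in> ?N" using M1(2) M2(3) by blast
  from bchoice[OF this] obtain \<phi> where \<phi>: "\<forall>x\<in>M1. \<phi> x \<in> M2 \<and> x - \<phi> x \<in> ?N" by (elim exE)
  have \<phi>M: "\<phi> x \<in> M2" and \<phi>N: "x - \<phi> x \<in> ?N" if "x \<in> M1" for x using \<phi> that by simp_all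
  have s1: "subspace M1" and c1: "\<And>x y. x \<in> M1 \<Longrightarrow> y \<in> M1 \<Longrightarrow> commutator x y \<in> M1"
    and s2: "subspace M2" and c2: "\<And>x y. x \<in> M2 \<Longrightarrow> y \<in> M2 \<Longrightarrow> commutator x y \<in> M2"
    using M1(1) M2(1) unfolding lsub_def by simp_all
  have eqI: "\<phi> x = y" if "x \<in> M1" "y \<in> M2" "x - y \<in> ?N" for x y
    using M2(4)[OF \<phi>M[OF that(1)] that(2) \<phi>N[OF that(1)] that(3)] .
  have "bij_betw \<phi> M1 M2" unfolding bij_betw_def
  proof
    show "inj_on \<phi> M1"
    proof (rule inj_onI)
      fix x y assume xy: "x \<in> M1" "y \<in> M1" "\<phi> x = \<phi> y"
      have "\<phi> x - x \<in> ?N" "\<phi> x - y \<in> ?N" using subspace_neg[OF sN \<phi>N[OF xy(1)]] subspace_neg[OF sN \<phi>N[OF xy(2)]] xy(3) by simp_all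
      then show "x = y" by (rule M1(4)[OF xy(1,2)])
    qed
    show "\<phi> ` M1 = M2"
    proof
      show "\<phi> ` M1 \<subseteq> M2" using \<phi>M by (rule image_subsetI)
      show "M2 \<subseteq> \<phi> ` M1"
      proof
        fix y assume y: "y \<in> M2"
        then obtain x where x: "x \<in> M1" "y - x \<in> ?N" using M1(3)[OF subsetD[OF M2(2) y]] by (elim bexE)
        have "x - y \<in> ?N" using subspace_neg[OF sN x(2)] by simp
        then have "y = \<phi> x" using eqI[OF x(1) y] by simp
        then show "y \<in> \<phi> ` M1" using x(1) by (rule image_eqI)
      qed
    qed
  qed
  moreover have "\<phi> (x + y) = \<phi> x + \<phi> y" if xy: "x \<in> M1" "y \<in> M1" for x y
  proof (rule eqI)
    show "x + y - (\<phi> x + \<phi> y) \<in> ?N" using subspace_add[OF sN \<phi>N[OF xy(1)] \<phi>N[OF xy(2)]] by (simp add: algebra_simps)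
  qed (simp_all add: subspace_add[OF s1] subspace_add[OF s2] xy \<phi>M)
  moreover have "\<phi> (scale c x) = scale c (\<phi> x)" if x: "x \<in> M1" for c x
  proof (rule eqI)
    show "scale c x - scale c (\<phi> x) \<in> ?N"
      using subspace_scale[OF sN \<phi>N[OF x], of c] by (simp only: scale_right_diff_distrib)
  qed (simp_all add: subspace_scale[OF s1] subspace_scale[OF s2] x \<phi>M)
  moreover have "\<phi> (commutator x y) = commutator (\<phi> x) (\<phi> y)" if xy: "x \<in> M1" "y \<in> M1" for x y
  proof (rule eqI)
    have "\<phi> x \<in> G" "y \<in> G" using xy \<phi>M M1(2) M2(2) LG by blast+
    then have "commutator (x - \<phi> x) y + commutator (\<phi> x) (y - \<phi> y) \<in> ?N"
      using subspace_add[OF sN N(1)[OF \<phi>N[OF xy(1)]] N(2)[OF \<phi>N[OF xy(2)]]] by simp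
    \<comment> \<open>The error of the bracket is split so that each summand has one factor in the
      ideal \<open>?N\<close> and the other in \<open>G\<close>.\<close>
    moreover have "commutator (x - \<phi> x) y + commutator (\<phi> x) (y - \<phi> y) = commutator x y - commutator (\<phi> x) (\<phi> y)"
      by (simp add: commutator_def algebra_simps)
    ultimately show "commutator x y - commutator (\<phi> x) (\<phi> y) \<in> ?N" by simp
  qed (simp_all add: c1 c2 xy \<phi>M)
  ultimately show ?thesis by (intro exI[of _ \<phi>]) simp
qed

end

locale skew_adjoint_algebra = pos_trace_alg scale F \<tau>
  for scale :: "complex \<Rightarrow> 'b::{ring,monoid_mult} \<Rightarrow> 'b" and F \<tau> +
  fixes G R :: "'b set" and star :: "'b \<Rightarrow> 'b"
  assumes G_F: "G \<subseteq> F" and lsub_G: "lsub G" and radical_R: "radical G R"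
    and star: "\<And>a. a \<in> alg G \<Longrightarrow> star a \<in> alg G"
      "\<And>a b. a \<in> alg G \<Longrightarrow> b \<in> alg G \<Longrightarrow> star (a + b) = star a + star b"
      "\<And>a c. a \<in> alg G \<Longrightarrow> star (scale c a) = scale c (star a)"
      "\<And>a b. a \<in> alg G \<Longrightarrow> b \<in> alg G \<Longrightarrow> star (a * b) = star b * star a"
      "\<And>a. a \<in> alg G \<Longrightarrow> star (star a) = a"
      "\<And>a. a \<in> alg G \<Longrightarrow> \<tau> (star a) = \<tau> a"
      "\<And>x. x \<in> G \<Longrightarrow> star x = - x"
begin

lemma G_homog: "G \<subseteq> homog" using G_F F_homog by (rule subset_trans)

lemma local_subalgebra:
  assumes "finite T" "T \<subseteq> G"
  shows "lsub (alg T \<inter> G)" "fdim (alg T \<inter> G)" "T \<subseteq> alg T \<inter> G" "alg T \<inter> G \<subseteq> F"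
proof -
  show "lsub (alg T \<inter> G)"
    using lsub_G alg_commutator[of _ T] subspace_inter[OF subspace_alg, of G T] unfolding lsub_def by simp
  show "fdim (alg T \<inter> G)"
    using fdim_subset[OF fdim_alg[OF _ fdim_finite[OF assms(1)]]] assms(2) G_F by blast
  show "T \<subseteq> alg T \<inter> G" using assms(2) by (auto intro: alg.base)
  show "alg T \<inter> G \<subseteq> F" using G_F by blast
qed

text \<open>The kernel of the trace form on \<open>G\<close> is an ideal by invariance. The form
  vanishes on each of its finite-dimensional subalgebras, so these are solvable by
  \<open>cartan_solvable\<close>, and the kernel lies in the largest locally solvable ideal.\<close>

lemma trace_kernel_radical:
  assumes "x \<in> G" "\<And>y. y \<in> G \<Longrightarrow> \<tau> (x * y) = 0" shows "x \<in> R"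
proof -
  define T where "T = {x \<in> G. \<forall>y\<in>G. \<tau> (x * y) = 0}"
  have sG: "subspace G" and cG: "\<And>x y. x \<in> G \<Longrightarrow> y \<in> G \<Longrightarrow> commutator x y \<in> G"
    using lsub_G unfolding lsub_def by simp_all
  have F: "x \<in> G \<Longrightarrow> x \<in> F" for x using G_F by (rule subsetD)
  have "lideal G T" unfolding lideal_def
  proof (intro conjI ballI)
    show "subspace T"
    proof (rule subspaceI)
      show "0 \<in> T" using subspace_0[OF sG] unfolding T_def by (simp add: tr_zero)
      show "x + y \<in> T" if "x \<in> T" "y \<in> T" for x y
        using that subspace_add[OF sG] unfolding T_def by (simp add: distrib_right tr_add F F_mult)
      show "scale c x \<in> T" if "x \<in> T" for c x
        using that subspace_scale[OF sG] unfolding T_def by (simp add: scale_mult_left tr_scale F F_mult)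
    qed
    show "T \<subseteq> G" unfolding T_def by simp
    fix z x assume zx: "z \<in> G" "x \<in> T"
    then have x: "x \<in> G" "\<And>y. y \<in> G \<Longrightarrow> \<tau> (x * y) = 0" unfolding T_def by simp_all
    have "\<tau> (commutator z x * y) = 0" if "y \<in> G" for y
      using tr_invariant'[OF F[OF zx(1)] F[OF x(1)] F[OF that]] x(2)[OF cG[OF that zx(1)]] by simp
    then show "commutator z x \<in> T" unfolding T_def using cG[OF zx(1) x(1)] by simp
  qed
  moreover have "lsolv T" unfolding lsolv_def
  proof (intro allI impI, elim conjE)
    fix H assume H: "lsub H" "fdim H" "H \<subseteq> T"
    have HG: "H \<subseteq> G" using H(3) unfolding T_def by blast
    show "\<exists>n. ders H n = {0}"
    proof (rule cartan_solvable[OF subset_trans[OF HG G_F] H(1,2)])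
      show "\<tau> (a * b) = 0" if "a \<in> H" "b \<in> H" for a b
        using subsetD[OF H(3) that(1)] subsetD[OF HG that(2)] unfolding T_def by simp
    qed
  qed
  ultimately have "T \<subseteq> R" using radical_R unfolding radical_def by simp
  moreover have "x \<in> T" unfolding T_def using assms by simp
  ultimately show ?thesis by (rule subsetD)
qed

text \<open>Orthogonality of \<open>x\<close> to one \<open>b\<close> at a time: finitely many
  elements of \<open>G\<close> suffice both to generate \<open>b\<close> and to write
  \<open>x\<close> as a sum of brackets. The subalgebra \<open>h\<close> around them is
  finite-dimensional, and \<open>R \<inter> h\<close> is a solvable ideal of it.\<close>

lemma radical_derived_trad: "R \<inter> lder G \<subseteq> trad G"
proof
  fix x assume x: "x \<in> R \<inter> lder G"
  have lR: "lideal G R" and sR: "lsolv R" using radical_R unfolding radical_def by simp_all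
  have xG: "x \<in> G" using x lder_subset[OF lsub_G] by blast
  have "\<tau> (x * b) = 0" if b: "b \<in> alg G" for b
  proof -
    obtain T where T: "finite T" "T \<subseteq> G" "b \<in> alg T" using alg_finite_support[OF b] by (elim exE conjE)
    obtain U where U: "finite U" "U \<subseteq> G" "{x} \<subseteq> lder U"
      using finite_lder_support[of "{x}" G] x by auto
    define h where "h = alg (T \<union> U) \<inter> G"
    have h: "lsub h" "fdim h" "T \<union> U \<subseteq> h" "h \<subseteq> F"
      unfolding h_def using local_subalgebra[of "T \<union> U"] T(1,2) U(1,2) by simp_all
    have hG: "h \<subseteq> G" unfolding h_def by simp
    have I: "lideal h (R \<inter> h)"
      using lR h(1) subspace_inter[of R h] subsetD[OF hG] unfolding lideal_def lsub_def by simp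
    have "fdim (R \<inter> h)" using h(2) by (rule fdim_subset) simp
    then obtain n where n: "ders (R \<inter> h) n = {0}" using sR lsub_lideal[OF I] unfolding lsolv_def by blast
    have "U \<subseteq> h" "T \<subseteq> h" using h(3) by simp_all
    then have xh: "x \<in> lder h" and bh: "b \<in> alg h" using U(3) lder_mono[of U h] T(3) alg_mono[of T h] by auto
    then have "x \<in> R \<inter> h \<inter> lder h" using x lder_subset[OF h(1)] by blast
    then have "x \<in> trad h" using solvable_ideal_trad(1)[OF h(4,1,2) I n] by blast
    then show ?thesis using bh unfolding trad_def by simp
  qed
  then show "x \<in> trad G" unfolding trad_def using xG by (simp add: alg.base)
qed

text \<open>The two preceding inclusions identify \<open>R \<inter> lder G\<close> with
  \<open>trad G \<inter> lder G\<close>, so a Levi component is a complement modulo the trace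
  radical.\<close>

lemma levi_finite:
  assumes M: "levi G R M" and S: "finite S" "S \<subseteq> M"
  shows "\<exists>K. fdss K \<and> K \<subseteq> M \<and> S \<subseteq> K"
proof -
  note M_lder = levi_subset[OF radical_R M]
  have "\<exists>K. lsub K \<and> fdim K \<and> K \<subseteq> M \<and> S \<subseteq> K \<and>
    (\<forall>I. lideal K I \<and> (\<forall>x\<in>I. \<forall>y\<in>I. commutator x y = 0) \<longrightarrow> I = {0})"
  proof (rule locally_semisimple_complement[where G = G and star = star])
    show "x \<in> trad G" if "x \<in> lder G" "\<And>y. y \<in> G \<Longrightarrow> \<tau> (x * y) = 0" for x
    proof -
      have "x \<in> R" using trace_kernel_radical[OF _ that(2)] that(1) lder_subset[OF lsub_G] by blast
      then show ?thesis using radical_derived_trad that(1) by blast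
    qed
    show "M \<inter> trad G = {0}"
    proof
      show "M \<inter> trad G \<subseteq> {0}"
      proof
        fix x assume x: "x \<in> M \<inter> trad G"
        then have xL: "x \<in> lder G" using M_lder by blast
        then have xG: "x \<in> G" using lder_subset[OF lsub_G] by blast
        have "\<tau> (x * y) = 0" if "y \<in> G" for y using x alg.base[OF that] unfolding trad_def by simp
        then have "x \<in> R" using xG by (intro trace_kernel_radical)
        then have "x \<in> R \<inter> lder G \<inter> M" using x xL by simp
        then show "x \<in> {0}" unfolding levi_inter[OF radical_R M] .
      qed
      show "{0} \<subseteq> M \<inter> trad G" using subspace_0[OF subspace_trad[OF G_F]] levi_inter[OF radical_R M] by blast
    qed
    show "\<exists>y\<in>M. x - y \<in> trad G" if "x \<in> lder G" for x
      using levi_decompose[OF radical_R M that] radical_derived_trad by blast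
  qed (simp_all only: G_F lsub_G star M_lder levi_lsub[OF radical_R M] S)
  then obtain K where K: "lsub K" "fdim K" "K \<subseteq> M" "S \<subseteq> K"
    and I: "\<forall>I. lideal K I \<and> (\<forall>x\<in>I. \<forall>y\<in>I. commutator x y = 0) \<longrightarrow> I = {0}" by (elim exE conjE)
  have "K \<subseteq> homog" using K(3) M_lder lder_subset[OF lsub_G] G_homog by blast
  then have "fdss K" unfolding fdss_def using K(1,2) no_solvable_ideal[OF _ I] by blast
  then show ?thesis using K by blast
qed

lemma levi_exhaustion:
  assumes M: "levi G R M" and C: "countable C" "M \<subseteq> span C"
  shows "\<exists>K :: nat \<Rightarrow> 'b set. (\<forall>n. K n \<subseteq> K (Suc n)) \<and> (\<forall>n. fdss (K n)) \<and> M = \<Union>(range K)"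
proof -
  have sM: "subspace M" using levi_lsub[OF radical_R M] unfolding lsub_def by simp
  obtain Y where Y: "countable Y" "Y \<subseteq> M" "M \<subseteq> span Y"
    using countable_spanning_subset[OF sM C(2,1)] by (elim exE conjE)
  \<comment> \<open>The zero vector makes the enumerated set nonempty; it lies in \<open>M\<close>
    anyway.\<close>
  define y where "y = from_nat_into (insert 0 Y)"
  have ry: "range y = insert 0 Y" unfolding y_def using Y(1) by (intro range_from_nat_into) simp_all
  have "insert 0 Y \<subseteq> M" using Y(2) subspace_0[OF sM] by simp
  then have yM: "y n \<in> M" for n unfolding ry[symmetric] by (rule subsetD) simp
  \<comment> \<open>A finite spanning set of \<open>K\<close> is passed on together with the next
    vector, which makes the sequence increasing.\<close>
  have step: "\<exists>K'. (fdss K' \<and> K' \<subseteq> M \<and> y (Suc n) \<in> K') \<and> K \<subseteq> K'" if K: "fdss K \<and> K \<subseteq> M \<and> y n \<in> K" for K n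
  proof -
    have "fdim K" using K unfolding fdss_def by simp
    from fdim_basis[OF this] obtain X where X: "finite X" "X \<subseteq> K" "K \<subseteq> span X" by (elim exE conjE)
    have "insert (y (Suc n)) X \<subseteq> M" "finite (insert (y (Suc n)) X)" using yM X(1,2) K by auto
    from levi_finite[OF M this(2,1)] obtain K' where K': "fdss K'" "K' \<subseteq> M" "insert (y (Suc n)) X \<subseteq> K'" by (elim exE conjE)
    have "span X \<subseteq> K'" using K' unfolding fdss_def lsub_def by (intro span_minimal) simp_all
    then show ?thesis using K' X(3) by (intro exI[of _ K']) auto
  qed
  have "\<exists>K. fdss K \<and> K \<subseteq> M \<and> y 0 \<in> K" using levi_finite[OF M, of "{y 0}"] yM by simp
  then have "\<exists>K. \<forall>n. (fdss (K n) \<and> K n \<subseteq> M \<and> y n \<in> K n) \<and> K n \<subseteq> K (Suc n)"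
    using step by (rule dependent_nat_choice)
  then obtain K where K_all: "\<forall>n. (fdss (K n) \<and> K n \<subseteq> M \<and> y n \<in> K n) \<and> K n \<subseteq> K (Suc n)" by (elim exE)
  then have K: "\<And>n. fdss (K n) \<and> K n \<subseteq> M \<and> y n \<in> K n" "\<And>n. K n \<subseteq> K (Suc n)" by simp_all
  have mono: "K m \<subseteq> K n" if "m \<le> n" for m n using K(2) that by (rule lift_Suc_mono_le)
  have sK: "subspace (K n)" for n using K(1)[of n] unfolding fdss_def lsub_def by simp
  have "subspace (\<Union>(range K))"
  proof (rule subspaceI)
    show "0 \<in> \<Union>(range K)" using subspace_0[OF sK] by blast
  next
    fix a b assume "a \<in> \<Union>(range K)" "b \<in> \<Union>(range K)"
    then obtain m n where mn: "a \<in> K m" "b \<in> K n" by blast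
    then have "a \<in> K (max m n)" "b \<in> K (max m n)" using mono[of m "max m n"] mono[of n "max m n"] by auto
    from subspace_add[OF sK this] show "a + b \<in> \<Union>(range K)" by blast
  next
    fix c a assume "a \<in> \<Union>(range K)"
    then show "scale c a \<in> \<Union>(range K)" using subspace_scale[OF sK] by blast
  qed
  moreover have "Y \<subseteq> \<Union>(range K)"
  proof
    fix z assume "z \<in> Y"
    then have "z \<in> range y" unfolding ry by simp
    then show "z \<in> \<Union>(range K)" using K(1) by blast
  qed
  ultimately have "span Y \<subseteq> \<Union>(range K)" by (intro span_minimal)
  then have "M = \<Union>(range K)" using Y(3) K(1) by blast
  then show ?thesis using K by blast
qed

text \<open>An element of \<open>N\<close> differs from its Levi part by an element of
  \<open>R\<close> that lies in some \<open>K n\<close>; there \<open>R\<close> cuts out a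
  finite-dimensional solvable ideal, which is zero.\<close>

lemma levi_maximal:
  assumes M: "levi G R M" and N: "lsub N" "N \<subseteq> G" "M \<subseteq> N"
    and K: "\<And>n :: nat. fdss (K n)" "N = \<Union>(range K)"
  shows "N = M"
proof
  have lR: "lideal G R" and sR: "lsolv R" using radical_R unfolding radical_def by simp_all
  have sN: "subspace N" using N(1) unfolding lsub_def by simp
  have KG: "K n \<subseteq> G" for n using K(2) N(2) by blast
  have perfect: "K n \<subseteq> lder G" for n
  proof -
    have "lder (K n) = K n"
      using K(1)[of n] subset_trans[OF KG G_F] unfolding fdss_def by (intro semisimple_perfect) blast+
    then show ?thesis using lder_mono[OF KG[of n]] by simp
  qed
  have inter: "R \<inter> K n = {0}" for n
  proof -
    have Kn: "lsub (K n)" "fdim (K n)" "\<And>I j. lideal (K n) I \<Longrightarrow> ders I j = {0} \<Longrightarrow> I = {0}"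
      using K(1)[of n] unfolding fdss_def by blast+
    have cR: "commutator x y \<in> R" if "x \<in> K n" "y \<in> R" for x y
      using lR that KG[of n] unfolding lideal_def by blast
    have I: "lideal (K n) (R \<inter> K n)"
      using lR Kn(1) cR subspace_inter[of R "K n"] unfolding lideal_def lsub_def by simp
    have "fdim (R \<inter> K n)" using Kn(2) by (rule fdim_subset) simp
    then obtain j where "ders (R \<inter> K n) j = {0}" using sR lsub_lideal[OF I] unfolding lsolv_def by blast
    then show ?thesis using Kn(3)[OF I] by simp
  qed
  show "N \<subseteq> M"
  proof
    fix x assume x: "x \<in> N"
    then have "x \<in> lder G" using K(2) perfect by blast
    then obtain y where y: "y \<in> M" "x - y \<in> R \<inter> lder G" using levi_decompose[OF radical_R M] by blast
    have "x - y \<in> N" using subspace_diff[OF sN x] y(1) N(3) by blast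
    then obtain n where "x - y \<in> K n" using K(2) by blast
    then have "x - y \<in> R \<inter> K n" using y(2) by simp
    then have "x - y = 0" unfolding inter by simp
    then show "x \<in> M" using y(1) by simp
  qed
qed (rule N(3))

end

section \<open>Subalgebras of gl(V,W)\<close>

locale gl_subalgebra = V: vector_space scV + W: vector_space scW
  for scV :: "complex \<Rightarrow> 'v::ab_group_add \<Rightarrow> 'v" and scW :: "complex \<Rightarrow> 'w::ab_group_add \<Rightarrow> 'w" +
  fixes p :: "'v \<Rightarrow> 'w \<Rightarrow> complex" and g :: "('v \<Rightarrow> 'v) set"
  assumes pairing: "nondeg_pairing scV scW p" and g_subalg: "lie_subalg scV g" and g_gl: "g \<subseteq> glVV scV p"
begin

lemma p_add: "p (v + v') w = p v w + p v' w" "p v (w + w') = p v w + p v w'"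
  and p_scale: "p (scV c v) w = c * p v w" "p v (scW c w) = c * p v w"
  using pairing unfolding nondeg_pairing_def by blast+

lemma p_zero: "p 0 w = 0" "p v 0 = 0"
  using p_add(1)[of 0 0 w] p_add(2)[of v 0 0] by simp_all

lemma p_neg: "p (- v) w = - p v w" "p v (- w) = - p v w"
  using p_add(1)[of v "- v" w] p_add(2)[of v w "- w"] by (simp_all add: p_zero eq_neg_iff_add_eq_0 add.commute)

lemma p_diff: "p (v - v') w = p v w - p v' w" "p v (w - w') = p v w - p v w'"
  using p_add(1)[of v "- v'" w] p_add(2)[of v w "- w'"] by (simp_all add: p_neg)

lemma p_eqI: "(\<And>w. p v w = p v' w) \<Longrightarrow> v = v'" "(\<And>v. p v w = p v w') \<Longrightarrow> w = w'"
proof -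
  have nd: "(\<And>w. p v w = 0) \<Longrightarrow> v = 0" "(\<And>v. p v w = 0) \<Longrightarrow> w = 0" for v w
    using pairing unfolding nondeg_pairing_def by blast+
  show "v = v'" if "\<And>w. p v w = p v' w" using nd(1)[of "v - v'"] that by (simp add: p_diff)
  show "w = w'" if "\<And>v. p v w = p v w'" using nd(2)[of "w - w'"] that by (simp add: p_diff)
qed

lemma p_sum: "p (\<Sum>i\<in>I. f i) w = (\<Sum>i\<in>I. p (f i) w)" "p v (\<Sum>i\<in>I. h i) = (\<Sum>i\<in>I. p v (h i))"
  by (induction I rule: infinite_finite_induct) (simp_all add: p_zero p_add)

text \<open>Nondegeneracy of the pairing makes the transpose unique, so the choice depends only on
  the operator and not on a tensor representing it.\<close>

definition transp :: "('v \<Rightarrow> 'v) \<Rightarrow> 'w \<Rightarrow> 'w" where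
  "transp x = (SOME f. \<forall>v w. p (x v) w = p v (f w))"

lemma glVV_transp:
  assumes "x = (\<lambda>v. \<Sum>i<n::nat. scV (p v (ws i)) (vs i))"
  shows "p (x v) w = p v (\<Sum>i<n. scW (p (vs i) w) (ws i))"
  unfolding assms by (simp add: p_sum p_scale mult.commute)

lemma p_transp: assumes "x \<in> glVV scV p" shows "p (x v) w = p v (transp x w)"
proof -
  obtain n vs ws where "x = (\<lambda>v. \<Sum>i<n::nat. scV (p v (ws i)) (vs i))"
    using assms unfolding glVV_def by blast
  from glVV_transp[OF this] have "\<exists>f. \<forall>v w. p (x v) w = p v (f w)"
    by (intro exI[of _ "\<lambda>w. \<Sum>i<n. scW (p (vs i) w) (ws i)"] allI)
  then have "\<forall>v w. p (x v) w = p v (transp x w)" unfolding transp_def by (rule someI_ex)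
  then show ?thesis by simp
qed

lemma transp_unique: "x \<in> glVV scV p \<Longrightarrow> (\<And>v w. p (x v) w = p v (f w)) \<Longrightarrow> transp x w = f w"
  by (rule p_eqI(2)) (simp add: p_transp[symmetric])

lemma glVV_linear:
  assumes "x \<in> glVV scV p"
  shows "x (v + v') = x v + x v'" "x (scV c v) = scV c (x v)"
  by (rule p_eqI(1), simp add: p_transp[OF assms] p_add p_scale)+

lemma transp_linear:
  assumes "x \<in> glVV scV p"
  shows "transp x (w + w') = transp x w + transp x w'" "transp x (scW c w) = scW c (transp x w)"
  by (rule p_eqI(2), simp add: p_transp[OF assms, symmetric] p_add p_scale)+

section \<open>The quadratic space on pairs and its adjoints\<close>

definition sc2 :: "complex \<Rightarrow> 'v \<times> 'w \<Rightarrow> 'v \<times> 'w" where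
  "sc2 c u = (scV c (fst u), scW c (snd u))"

lemma cvs_sc2: "cvs sc2"
  by unfold_locales (simp_all add: sc2_def prod_eq_iff V.scale_right_distrib V.scale_left_distrib
      W.scale_right_distrib W.scale_left_distrib)

interpretation U: cvs sc2 by (rule cvs_sc2)
interpretation T: pos_trace_alg "smul sc2" U.frank U.tr by (rule U.pos_trace_alg_frank)

definition q :: "'v \<times> 'w \<Rightarrow> 'v \<times> 'w \<Rightarrow> complex" where
  "q u u' = p (fst u) (snd u') + p (fst u') (snd u)"

lemma q_simps: "q (u + u') t = q u t + q u' t" "q t (u + u') = q t u + q t u'"
  "q (sc2 c u) t = c * q u t" "q t (sc2 c u) = c * q t u" "q (- u) t = - q u t" "q t (- u) = - q t u"
  unfolding q_def sc2_def by (simp_all add: p_add p_scale p_neg algebra_simps)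

lemma q_commute: "q u t = q t u"
  unfolding q_def by simp

lemma q_eqI: assumes "\<And>t. q t u = q t u'" shows "u = u'"
proof (rule prod_eqI)
  show "fst u = fst u'" using assms[of "(0, w)" for w] by (intro p_eqI(1)) (simp add: q_def p_zero)
  show "snd u = snd u'" using assms[of "(v, 0)" for v] by (intro p_eqI(2)) (simp add: q_def p_zero)
qed

lemma q_form: "U.lform (q u)"
  unfolding U.form_on_def by (simp add: q_simps)

text \<open>A relation, since an arbitrary endomorphism need have no adjoint; where one exists,
  nondegeneracy of \<open>q\<close> makes it unique.\<close>

definition adj :: "('v \<times> 'w) aend \<Rightarrow> ('v \<times> 'w) aend \<Rightarrow> bool" where
  "adj a b \<longleftrightarrow> (\<forall>u t. q (app a u) t = q u (app b t))"

lemma adjI: "(\<And>u t. q (app a u) t = q u (app b t)) \<Longrightarrow> adj a b"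
  and adjD: "adj a b \<Longrightarrow> q (app a u) t = q u (app b t)"
  unfolding adj_def by blast+

lemma adj_unique: "adj a b \<Longrightarrow> adj a b' \<Longrightarrow> b = b'"
  by (intro aend_eqI q_eqI) (simp only: adjD[symmetric])

lemma adj_sym: "adj a b \<Longrightarrow> adj b a"
  by (rule adjI) (metis adjD q_commute)

lemma adj_add: "adj a b \<Longrightarrow> adj a' b' \<Longrightarrow> adj (a + a') (b + b')"
  by (rule adjI) (simp add: q_simps adjD)

lemma adj_scale: "adj a b \<Longrightarrow> adj (smul sc2 c a) (smul sc2 c b)"
  by (rule adjI) (simp add: q_simps adjD U.app_smul)

lemma adj_mult: "adj a b \<Longrightarrow> adj a' b' \<Longrightarrow> adj (a * a') (b' * b)"
  by (rule adjI) (simp add: adjD)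

text \<open>\<open>U.frank\<close> admits all linear forms on the pairs, and such operators need not
  have an adjoint. Those built from forms \<open>q u\<close> do: \<open>U.rank1 (q u) t\<close> and
  \<open>U.rank1 (q t) u\<close> are adjoint to each other and have equal trace by symmetry of
  \<open>q\<close>.\<close>

definition qrank :: "('v \<times> 'w) aend set" where
  "qrank = T.span {U.rank1 (q u) t | u t. True}"

lemma subspace_qrank: "T.subspace qrank"
  unfolding qrank_def by (rule T.subspace_span)

lemma rank1_qrank: "U.rank1 (q u) t \<in> qrank"
  unfolding qrank_def by (rule T.span_base) blast

lemma qrank_frank: "qrank \<subseteq> U.frank"
  unfolding qrank_def using U.rank1_frank[OF q_form] by (intro T.span_minimal U.subspace_frank) blast

lemma qrank_mult: assumes "a \<in> qrank" "b \<in> qrank" shows "a * b \<in> qrank"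
proof -
  have a: "a \<in> T.homog" using assms(1) qrank_frank T.F_homog by blast
  have "a * b \<in> T.span ((\<lambda>b. a * b) ` {U.rank1 (q u) t | u t. True})"
    using assms(2) unfolding qrank_def by (rule T.span_mult_left[OF a])
  also have "\<dots> \<subseteq> qrank"
  proof (rule T.span_minimal[OF _ subspace_qrank], clarify)
    fix u t show "a * U.rank1 (q u) t \<in> qrank" unfolding U.rank1_mult_left[OF q_form a] by (rule rank1_qrank)
  qed
  finally show ?thesis .
qed

lemma qrank_adjoint: assumes "a \<in> qrank" shows "\<exists>b\<in>qrank. adj a b \<and> U.tr b = U.tr a"
proof -
  have F: "a \<in> qrank \<Longrightarrow> a \<in> U.frank" for a using qrank_frank by blast
  have "qrank \<subseteq> {a \<in> qrank. \<exists>b\<in>qrank. adj a b \<and> U.tr b = U.tr a}" (is "_ \<subseteq> ?A")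
  proof (subst qrank_def, rule T.span_minimal)
    show "T.subspace ?A"
    proof (rule T.subspaceI)
      have "adj 0 0" unfolding adj_def using q_simps(3)[of 0] q_simps(4)[of _ 0] by (simp add: sc2_def flip: zero_prod_def)
      then show "0 \<in> ?A" using T.subspace_0[OF subspace_qrank] by (auto intro!: bexI[of _ 0])
    next
      fix a a' assume "a \<in> ?A" "a' \<in> ?A"
      then obtain b b' where "a \<in> qrank" "a' \<in> qrank" "b \<in> qrank" "b' \<in> qrank" "adj a b" "adj a' b'" "U.tr b = U.tr a" "U.tr b' = U.tr a'"
        by blast
      then show "a + a' \<in> ?A"
        by (auto intro!: bexI[of _ "b + b'"] simp: T.subspace_add[OF subspace_qrank] adj_add T.tr_add F)
    next
      fix c a assume "a \<in> ?A"
      then obtain b where "a \<in> qrank" "b \<in> qrank" "adj a b" "U.tr b = U.tr a" by blast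
      then show "smul sc2 c a \<in> ?A"
        by (auto intro!: bexI[of _ "smul sc2 c b"] simp: T.subspace_scale[OF subspace_qrank] adj_scale T.tr_scale F)
    qed
    show "{U.rank1 (q u) t | u t. True} \<subseteq> ?A"
    proof clarify
      fix u t
      have "adj (U.rank1 (q u) t) (U.rank1 (q t) u)"
        unfolding adj_def by (simp add: U.app_rank1 q_form q_simps q_commute[of u] mult.commute)
      moreover have "U.tr (U.rank1 (q t) u) = U.tr (U.rank1 (q u) t)"
        by (simp add: U.rank1_trace(2)[OF q_form] q_commute[of u])
      ultimately show "U.rank1 (q u) t \<in> qrank \<and> (\<exists>b\<in>qrank. adj (U.rank1 (q u) t) b \<and> U.tr b = U.tr (U.rank1 (q u) t))"
        using rank1_qrank by blast
    qed
  qed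
  then show ?thesis using assms by blast
qed

definition star :: "('v \<times> 'w) aend \<Rightarrow> ('v \<times> 'w) aend" where
  "star a = (SOME b. b \<in> qrank \<and> adj a b \<and> U.tr b = U.tr a)"

lemma star: assumes "a \<in> qrank" shows "star a \<in> qrank" "adj a (star a)" "U.tr (star a) = U.tr a"
proof -
  have "\<exists>b. b \<in> qrank \<and> adj a b \<and> U.tr b = U.tr a" using qrank_adjoint[OF assms] by blast
  then have "star a \<in> qrank \<and> adj a (star a) \<and> U.tr (star a) = U.tr a" unfolding star_def by (rule someI_ex)
  then show "star a \<in> qrank" "adj a (star a)" "U.tr (star a) = U.tr a" by simp_all
qed

lemma star_eqI: "a \<in> qrank \<Longrightarrow> adj a b \<Longrightarrow> star a = b"
  by (rule adj_unique[OF star(2)])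

text \<open>The countable dimension of both spaces enters here: rank-one operators built from basis
  vectors form a countable spanning set, which later permits an exhaustion by a sequence.\<close>

lemma countable_qrank:
  assumes "count_inf_dim scV" "count_inf_dim scW"
  shows "\<exists>C. countable C \<and> qrank \<subseteq> T.span C"
proof -
  obtain BV where BV: "countable BV" "V.span BV = UNIV" using assms(1) unfolding count_inf_dim_def by blast
  obtain BW where BW: "countable BW" "W.span BW = UNIV" using assms(2) unfolding count_inf_dim_def by blast
  define B where "B = (\<lambda>v. (v, 0)) ` BV \<union> (\<lambda>w. (0, w)) ` BW"
  have "V.span BV \<subseteq> {v. (v, 0) \<in> U.span B}"
  proof (rule V.span_minimal)
    show "BV \<subseteq> {v. (v, 0) \<in> U.span B}" unfolding B_def by (auto intro: U.span_base)
    show "V.subspace {v. (v, 0) \<in> U.span B}" unfolding V.subspace_def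
      using U.span_zero[of B] U.span_add[of "(_, 0)" B "(_, 0)"] U.span_scale[of "(_, 0)" B]
      by (auto simp: sc2_def zero_prod_def)
  qed
  moreover have "W.span BW \<subseteq> {w. (0, w) \<in> U.span B}"
  proof (rule W.span_minimal)
    show "BW \<subseteq> {w. (0, w) \<in> U.span B}" unfolding B_def by (auto intro: U.span_base)
    show "W.subspace {w. (0, w) \<in> U.span B}" unfolding W.subspace_def
      using U.span_zero[of B] U.span_add[of "(0, _)" B "(0, _)"] U.span_scale[of "(0, _)" B]
      by (auto simp: sc2_def zero_prod_def)
  qed
  ultimately have "(v, 0) + (0, w) \<in> U.span B" for v w unfolding BV(2) BW(2) by (intro U.span_add) auto
  then have B: "u \<in> U.span B" for u by (cases u) simp
  define C where "C = (\<lambda>(u, t). U.rank1 (q u) t) ` (B \<times> B)"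
  have r1: "U.rank1 \<phi> (s + t) = U.rank1 \<phi> s + U.rank1 \<phi> t" "U.rank1 \<phi> (sc2 c t) = smul sc2 c (U.rank1 \<phi> t)" "U.rank1 \<phi> 0 = 0"
    if "U.lform \<phi>" for \<phi> s t c
    using that by (auto intro!: aend_eqI simp: U.app_rank1 U.scale_right_distrib U.app_smul mult.commute)
  have r2: "U.rank1 (q (s + t)) u = U.rank1 (q s) u + U.rank1 (q t) u" "U.rank1 (q (sc2 c t)) u = smul sc2 c (U.rank1 (q t) u)"
    "U.rank1 (q 0) u = 0" for s t u c
    using q_simps(3)[of 0] by (auto intro!: aend_eqI simp: U.app_rank1 q_form U.scale_left_distrib U.app_smul q_simps)
  have 1: "U.rank1 (q u) t \<in> T.span C" if u: "u \<in> B" for u t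
  proof -
    have "U.span B \<subseteq> {t. U.rank1 (q u) t \<in> T.span C}"
    proof (rule U.span_minimal)
      show "B \<subseteq> {t. U.rank1 (q u) t \<in> T.span C}" unfolding C_def using u by (auto intro!: T.span_base)
      show "U.subspace {t. U.rank1 (q u) t \<in> T.span C}" unfolding U.subspace_def
        by (auto simp: r1 q_form T.span_zero T.span_add T.span_scale)
    qed
    then show ?thesis using B by blast
  qed
  have "U.rank1 (q u) t \<in> T.span C" for u t
  proof -
    have "U.span B \<subseteq> {u. U.rank1 (q u) t \<in> T.span C}"
    proof (rule U.span_minimal)
      show "B \<subseteq> {u. U.rank1 (q u) t \<in> T.span C}" using 1 by blast
      show "U.subspace {u. U.rank1 (q u) t \<in> T.span C}" unfolding U.subspace_def
        by (auto simp: r2 T.span_zero T.span_add T.span_scale)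
    qed
    then show ?thesis using B by blast
  qed
  then have "qrank \<subseteq> T.span C" unfolding qrank_def by (intro T.span_minimal T.subspace_span) blast
  moreover have "countable C" unfolding C_def B_def using BV BW by simp
  ultimately show ?thesis by blast
qed

text \<open>The operator \<open>x \<oplus> - x\<^sup>T\<close> on \<open>V \<times> W\<close>; it is skew for the symmetric form \<open>q\<close>, so that
  the associative algebra generated by the image of \<open>g\<close> is stable under adjoints.\<close>
definition \<psi> :: "('v \<Rightarrow> 'v) \<Rightarrow> ('v \<times> 'w) aend" where
  "\<psi> x = Aend (\<lambda>u. (x (fst u), - transp x (snd u)))"

lemma app_psi: "x \<in> glVV scV p \<Longrightarrow> app (\<psi> x) u = (x (fst u), - transp x (snd u))"
  unfolding \<psi>_def by (subst app_Aend) (simp_all add: glVV_linear transp_linear)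

lemma psi_qrank: assumes "x \<in> glVV scV p" shows "\<psi> x \<in> qrank"
proof -
  obtain n vs ws where x: "x = (\<lambda>v. \<Sum>i<n::nat. scV (p v (ws i)) (vs i))"
    using assms unfolding glVV_def by blast
  have tx: "transp x w = (\<Sum>i<n. scW (p (vs i) w) (ws i))" for w
    by (rule transp_unique[OF assms glVV_transp[OF x]])
  \<comment> \<open>A tensor \<open>v_i\<close> with \<open>w_i\<close> acts on pairs as the
    corresponding element of the exterior square acts on a quadratic space.\<close>
  let ?r = "\<lambda>i. U.rank1 (q (0, ws i)) (vs i, 0) - U.rank1 (q (vs i, 0)) (0, ws i)"
  have s: "app (\<Sum>i<k. h i) u = (\<Sum>i<k. app (h i) u)" for k :: nat and h u
    by (induction k) simp_all
  have s1: "fst (\<Sum>i<k. h i) = (\<Sum>i<k. fst (h i))" "snd (\<Sum>i<k. h i) = (\<Sum>i<k. snd (h i))" for k :: nat and h :: "nat \<Rightarrow> 'v \<times> 'w"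
    by (induction k) simp_all
  have "\<psi> x = (\<Sum>i<n. ?r i)"
  proof (rule aend_eqI)
    fix u
    have "app (\<psi> x) u = (\<Sum>i<n. scV (p (fst u) (ws i)) (vs i), - (\<Sum>i<n. scW (p (vs i) (snd u)) (ws i)))"
      unfolding app_psi[OF assms] tx by (simp add: x)
    then show "app (\<psi> x) u = app (\<Sum>i<n. ?r i) u"
      by (simp add: s prod_eq_iff s1 U.app_rank1 q_form sc2_def q_def p_zero sum_negf)
  qed
  also have "\<dots> \<in> qrank"
    using T.subspace_diff[OF subspace_qrank] rank1_qrank by (intro T.subspace_sum[OF subspace_qrank]) blast
  finally show ?thesis .
qed

section \<open>Transfer of Lie-theoretic notions along the embedding\<close>

lemma g_closed: "opzero \<in> g" "x \<in> g \<Longrightarrow> y \<in> g \<Longrightarrow> opadd x y \<in> g" "x \<in> g \<Longrightarrow> opsc scV c x \<in> g"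
  "x \<in> g \<Longrightarrow> y \<in> g \<Longrightarrow> lbr x y \<in> g"
  using g_subalg unfolding lie_subalg_def lsubspace_def by simp_all

lemma g_glVV: "x \<in> g \<Longrightarrow> x \<in> glVV scV p"
  using g_gl by (rule subsetD)

lemma psi_add: "x \<in> g \<Longrightarrow> y \<in> g \<Longrightarrow> \<psi> (opadd x y) = \<psi> x + \<psi> y"
proof (rule aend_eqI)
  fix u assume xy: "x \<in> g" "y \<in> g"
  have "transp (opadd x y) w = transp x w + transp y w" for w
    by (rule transp_unique[OF g_glVV[OF g_closed(2)[OF xy]]]) (simp add: opadd_def p_add p_transp[OF g_glVV] xy)
  then show "app (\<psi> (opadd x y)) u = app (\<psi> x + \<psi> y) u"
    using xy g_closed(2)[OF xy] by (simp add: app_psi g_glVV opadd_def)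
qed

lemma psi_scale: "x \<in> g \<Longrightarrow> \<psi> (opsc scV c x) = smul sc2 c (\<psi> x)"
proof (rule aend_eqI)
  fix u assume x: "x \<in> g"
  have "transp (opsc scV c x) w = scW c (transp x w)" for w
    by (rule transp_unique[OF g_glVV[OF g_closed(3)[OF x]]]) (simp add: opsc_def p_scale p_transp[OF g_glVV] x)
  then show "app (\<psi> (opsc scV c x)) u = app (smul sc2 c (\<psi> x)) u"
    using x g_closed(3)[OF x] by (simp add: app_psi g_glVV opsc_def U.app_smul sc2_def)
qed

lemma psi_lbr: "x \<in> g \<Longrightarrow> y \<in> g \<Longrightarrow> \<psi> (lbr x y) = commutator (\<psi> x) (\<psi> y)"
proof (rule aend_eqI)
  fix u assume xy: "x \<in> g" "y \<in> g"
  have neg: "transp z (- w) = - transp z w" if "z \<in> g" for z w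
    by (rule p_eqI(2)) (simp add: p_transp[OF g_glVV[OF that], symmetric] p_neg)
  have "transp (lbr x y) w = transp y (transp x w) - transp x (transp y w)" for w
    by (rule transp_unique[OF g_glVV[OF g_closed(4)[OF xy]]]) (simp add: lbr_def p_diff p_transp[OF g_glVV] xy)
  then show "app (\<psi> (lbr x y)) u = app (commutator (\<psi> x) (\<psi> y)) u"
    using xy g_closed(4)[OF xy] by (simp add: app_psi g_glVV lbr_def commutator_def neg)
qed

lemma inj_psi: "inj_on \<psi> g"
proof (rule inj_onI, rule ext)
  fix x y v assume xy: "x \<in> g" "y \<in> g" "\<psi> x = \<psi> y"
  then have "app (\<psi> x) (v, 0) = app (\<psi> y) (v, 0)" by simp
  then show "x v = y v" using xy(1,2) by (simp add: app_psi g_glVV)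
qed

lemma psi_zero: "\<psi> opzero = 0"
proof -
  have "opadd opzero opzero = opzero" unfolding opadd_def opzero_def by simp
  from psi_add[OF g_closed(1,1), unfolded this] have "\<psi> opzero + \<psi> opzero = \<psi> opzero" by (rule sym)
  then show ?thesis by (simp only: add_cancel_left_left)
qed

lemma psi_g_frank: "\<psi> ` g \<subseteq> U.frank"
  using psi_qrank g_glVV qrank_frank by (intro image_subsetI) blast

lemma psi_adjoint: "x \<in> g \<Longrightarrow> adj (\<psi> x) (- \<psi> x)"
  unfolding adj_def by (simp add: app_psi g_glVV q_def p_neg p_transp[OF g_glVV])

lemma alg_qrank: "T.alg (\<psi> ` g) \<subseteq> qrank"
  using psi_qrank g_glVV by (intro T.alg_subset_subalgebra[OF subspace_qrank]) (auto intro: qrank_mult)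

lemma star_alg: assumes "a \<in> T.alg (\<psi> ` g)" shows "star a \<in> T.alg (\<psi> ` g)"
proof -
  let ?A = "T.alg (\<psi> ` g)"
  have Q: "a \<in> ?A \<Longrightarrow> a \<in> qrank" for a using alg_qrank by blast
  note sA = T.subspace_alg[of "\<psi> ` g"]
  have "?A \<subseteq> {a \<in> ?A. star a \<in> ?A}"
  proof (rule T.alg_least)
    show "T.subspace {a \<in> ?A. star a \<in> ?A}"
    proof (rule T.subspaceI)
      have "adj 0 0" using adj_scale[OF star(2)[OF Q[OF T.alg.zero]], of 0] by simp
      then have "star 0 = 0" by (rule star_eqI[OF Q[OF T.alg.zero]])
      then show "0 \<in> {a \<in> ?A. star a \<in> ?A}" by (simp add: T.alg.zero)
    next
      fix a b assume "a \<in> {a \<in> ?A. star a \<in> ?A}" "b \<in> {a \<in> ?A. star a \<in> ?A}"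
      then have ab: "a \<in> ?A" "b \<in> ?A" "star a \<in> ?A" "star b \<in> ?A" by simp_all
      have "star (a + b) = star a + star b"
        by (rule star_eqI[OF Q[OF T.subspace_add[OF sA ab(1,2)]] adj_add]) (simp_all add: star Q ab)
      then show "a + b \<in> {a \<in> ?A. star a \<in> ?A}" using T.subspace_add[OF sA] ab by simp
    next
      fix c a assume "a \<in> {a \<in> ?A. star a \<in> ?A}"
      then have a: "a \<in> ?A" "star a \<in> ?A" by simp_all
      have "star (smul sc2 c a) = smul sc2 c (star a)"
        by (rule star_eqI[OF Q[OF T.subspace_scale[OF sA a(1)]] adj_scale]) (simp add: star Q a)
      then show "smul sc2 c a \<in> {a \<in> ?A. star a \<in> ?A}" using T.subspace_scale[OF sA] a by simp
    qed
    show "\<psi> ` g \<subseteq> {a \<in> ?A. star a \<in> ?A}"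
    proof (rule image_subsetI)
      fix x assume x: "x \<in> g"
      have xA: "\<psi> x \<in> ?A" using x by (intro T.alg.base) simp
      then show "\<psi> x \<in> {a \<in> ?A. star a \<in> ?A}"
        using star_eqI[OF Q[OF xA] psi_adjoint[OF x]] T.subspace_neg[OF sA xA] by simp
    qed
    fix x a assume "x \<in> \<psi> ` g" "a \<in> {a \<in> ?A. star a \<in> ?A}"
    then obtain y where y: "y \<in> g" "x = \<psi> y" and a: "a \<in> ?A" "star a \<in> ?A" by blast
    have xA: "x \<in> ?A" using y by (auto intro: T.alg.base)
    have "adj (x * a) (star a * - x)" using adj_mult[OF psi_adjoint[OF y(1)] star(2)[OF Q[OF a(1)]]] y(2) by simp
    then have "star (x * a) = star a * - x" by (rule star_eqI[OF Q[OF T.alg_mult[OF xA a(1)]]])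
    also have "\<dots> \<in> ?A" by (rule T.alg_mult[OF a(2) T.subspace_neg[OF sA xA]])
    finally show "x * a \<in> {a \<in> ?A. star a \<in> ?A}" using T.alg_mult[OF xA a(1)] by simp
  qed
  then show ?thesis using assms by blast
qed

lemma psi_mem: "A \<subseteq> g \<Longrightarrow> x \<in> g \<Longrightarrow> \<psi> x \<in> \<psi> ` A \<longleftrightarrow> x \<in> A"
  by (rule inj_on_image_mem_iff[OF inj_psi])

lemma psi_image_eq: "A \<subseteq> g \<Longrightarrow> B \<subseteq> g \<Longrightarrow> \<psi> ` A = \<psi> ` B \<longleftrightarrow> A = B"
  by (rule inj_on_image_eq_iff[OF inj_psi])

lemma psi_preimage: "J \<subseteq> \<psi> ` g \<Longrightarrow> \<psi> ` {x \<in> g. \<psi> x \<in> J} = J"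
  by blast

lemma subspace_psi: assumes "A \<subseteq> g" shows "T.subspace (\<psi> ` A) \<longleftrightarrow> lsubspace scV A"
proof -
  have A: "x \<in> g" if "x \<in> A" for x using assms that by (rule subsetD)
  have "0 \<in> \<psi> ` A \<longleftrightarrow> opzero \<in> A" using psi_mem[OF assms g_closed(1)] by (simp add: psi_zero)
  moreover have "\<psi> x + \<psi> y \<in> \<psi> ` A \<longleftrightarrow> opadd x y \<in> A" if "x \<in> A" "y \<in> A" for x y
    using psi_mem[OF assms g_closed(2)[OF A[OF that(1)] A[OF that(2)]]] that by (simp add: psi_add A)
  moreover have "smul sc2 c (\<psi> x) \<in> \<psi> ` A \<longleftrightarrow> opsc scV c x \<in> A" if "x \<in> A" for x c
    using psi_mem[OF assms g_closed(3)[OF A[OF that]]] that by (simp add: psi_scale A)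
  ultimately show ?thesis unfolding T.subspace_def lsubspace_def ball_simps by simp
qed

lemma lsub_psi: assumes "A \<subseteq> g" shows "T.lsub (\<psi> ` A) \<longleftrightarrow> lie_subalg scV A"
proof -
  have A: "x \<in> g" if "x \<in> A" for x using assms that by (rule subsetD)
  have "commutator (\<psi> x) (\<psi> y) \<in> \<psi> ` A \<longleftrightarrow> lbr x y \<in> A" if "x \<in> A" "y \<in> A" for x y
    using psi_mem[OF assms g_closed(4)[OF A[OF that(1)] A[OF that(2)]]] that by (simp add: psi_lbr A)
  then show ?thesis unfolding T.lsub_def lie_subalg_def ball_simps subspace_psi[OF assms] by simp
qed

lemma lideal_psi:
  assumes "A \<subseteq> g" "I \<subseteq> g" shows "T.lideal (\<psi> ` A) (\<psi> ` I) \<longleftrightarrow> lie_ideal scV A I"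
proof -
  have A: "x \<in> g" if "x \<in> A" for x using assms(1) that by (rule subsetD)
  have I: "x \<in> g" if "x \<in> I" for x using assms(2) that by (rule subsetD)
  have "commutator (\<psi> x) (\<psi> y) \<in> \<psi> ` I \<longleftrightarrow> lbr x y \<in> I" if "x \<in> A" "y \<in> I" for x y
    using psi_mem[OF assms(2) g_closed(4)[OF A[OF that(1)] I[OF that(2)]]] that by (simp add: psi_lbr A I)
  moreover have "\<psi> ` I \<subseteq> \<psi> ` A \<longleftrightarrow> I \<subseteq> A"
    unfolding image_subset_iff subset_iff using psi_mem[OF assms(1)] I by blast
  ultimately show ?thesis unfolding T.lideal_def lie_ideal_def ball_simps subspace_psi[OF assms(2)] by simp
qed

lemma lsubspace_g: "lsubspace scV g"
  using g_subalg unfolding lie_subalg_def by simp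

lemma lsubspace_lspan: "lsubspace scV (lspan scV S)"
  unfolding lspan_def lsubspace_def by blast

lemma lspan_superset: "S \<subseteq> lspan scV S"
  unfolding lspan_def by blast

lemma lspan_minimal: "lsubspace scV A \<Longrightarrow> S \<subseteq> A \<Longrightarrow> lspan scV S \<subseteq> A"
  unfolding lspan_def by blast

lemma lspan_psi: assumes "S \<subseteq> g" shows "lspan scV S \<subseteq> g" "\<psi> ` lspan scV S = T.span (\<psi> ` S)"
proof -
  show g: "lspan scV S \<subseteq> g" by (rule lspan_minimal[OF lsubspace_g assms])
  let ?A = "{x \<in> g. \<psi> x \<in> T.span (\<psi> ` S)}"
  have "T.span (\<psi> ` S) \<subseteq> \<psi> ` g"
    by (rule T.span_minimal) (use assms subspace_psi lsubspace_g in auto)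
  then have im: "\<psi> ` ?A = T.span (\<psi> ` S)" by (rule psi_preimage)
  have "T.subspace (\<psi> ` ?A)" unfolding im by (rule T.subspace_span)
  then have "lsubspace scV ?A" using subspace_psi[of ?A] by simp
  moreover have "S \<subseteq> ?A" using assms T.span_base[of _ "\<psi> ` S"] by blast
  ultimately have "lspan scV S \<subseteq> ?A" by (rule lspan_minimal)
  then have "\<psi> ` lspan scV S \<subseteq> T.span (\<psi> ` S)" by blast
  moreover have "T.span (\<psi> ` S) \<subseteq> \<psi> ` lspan scV S"
    by (rule T.span_minimal) (use lspan_superset subspace_psi[OF g] lsubspace_lspan in auto)
  ultimately show "\<psi> ` lspan scV S = T.span (\<psi> ` S)" by (rule subset_antisym)
qed

lemma brk_psi: assumes "A \<subseteq> g" shows "brk scV A A \<subseteq> g" "\<psi> ` brk scV A A = T.lder (\<psi> ` A)"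
proof -
  have A: "x \<in> g" if "x \<in> A" for x using assms that by (rule subsetD)
  have sub: "{lbr a b | a b. a \<in> A \<and> b \<in> A} \<subseteq> g" using g_closed(4) A by blast
  show "brk scV A A \<subseteq> g" unfolding brk_def by (rule lspan_psi(1)[OF sub])
  have "\<psi> ` {lbr a b | a b. a \<in> A \<and> b \<in> A} = {commutator x y | x y. x \<in> \<psi> ` A \<and> y \<in> \<psi> ` A}"
  proof
    show "\<psi> ` {lbr a b | a b. a \<in> A \<and> b \<in> A} \<subseteq> {commutator x y | x y. x \<in> \<psi> ` A \<and> y \<in> \<psi> ` A}"
    proof clarify
      fix a b assume ab: "a \<in> A" "b \<in> A"
      then show "\<exists>x y. \<psi> (lbr a b) = commutator x y \<and> x \<in> \<psi> ` A \<and> y \<in> \<psi> ` A"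
        using psi_lbr[OF A[OF ab(1)] A[OF ab(2)]] by blast
    qed
    show "{commutator x y | x y. x \<in> \<psi> ` A \<and> y \<in> \<psi> ` A} \<subseteq> \<psi> ` {lbr a b | a b. a \<in> A \<and> b \<in> A}"
    proof clarify
      fix a b assume ab: "a \<in> A" "b \<in> A"
      have "commutator (\<psi> a) (\<psi> b) = \<psi> (lbr a b)" using psi_lbr[OF A[OF ab(1)] A[OF ab(2)]] by simp
      then show "commutator (\<psi> a) (\<psi> b) \<in> \<psi> ` {lbr a b | a b. a \<in> A \<and> b \<in> A}" using ab by (intro image_eqI) auto
    qed
  qed
  then show "\<psi> ` brk scV A A = T.lder (\<psi> ` A)" unfolding brk_def T.lder_def lspan_psi(2)[OF sub] by simp
qed

lemma derived_psi: assumes "A \<subseteq> g" shows "derived scV A n \<subseteq> g \<and> \<psi> ` derived scV A n = T.ders (\<psi> ` A) n"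
proof (induction n)
  case 0 then show ?case using assms by simp
next
  case (Suc n)
  then have "derived scV A n \<subseteq> g" by simp
  from brk_psi[OF this] show ?case using Suc by simp
qed

lemma solvable_psi: assumes "A \<subseteq> g" shows "solvable scV A \<longleftrightarrow> (\<exists>n. T.ders (\<psi> ` A) n = {0})"
proof -
  have "derived scV A n = {opzero} \<longleftrightarrow> T.ders (\<psi> ` A) n = {0}" for n
    using psi_image_eq[of "derived scV A n" "{opzero}"] derived_psi[OF assms, of n] g_closed(1) by (simp add: psi_zero)
  then show ?thesis unfolding solvable_def by simp
qed

lemma fin_dim_psi:
  assumes "A \<subseteq> g" "lsubspace scV A" shows "fin_dim scV A \<longleftrightarrow> T.fdim (\<psi> ` A)"
proof
  assume "fin_dim scV A"
  then obtain S where S: "finite S" "A = lspan scV S" unfolding fin_dim_def by (elim exE conjE)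
  have "S \<subseteq> g" using lspan_superset[of S] assms(1) S(2) by simp
  then have "\<psi> ` A = T.span (\<psi> ` S)" unfolding S(2) by (rule lspan_psi(2))
  then show "T.fdim (\<psi> ` A)" unfolding T.fdim_def using S(1) by (intro exI[of _ "\<psi> ` S"]) simp
next
  assume "T.fdim (\<psi> ` A)"
  from T.fdim_basis_subspace[OF this] obtain X where X: "finite X" "X \<subseteq> \<psi> ` A" "T.span X = \<psi> ` A"
    using subspace_psi[OF assms(1)] assms(2) by blast
  obtain S where S: "S \<subseteq> A" "finite S" "X = \<psi> ` S" using finite_subset_image[OF X(1,2)] by (elim exE conjE)
  have Sg: "S \<subseteq> g" using S(1) assms(1) by (rule subset_trans)
  have "\<psi> ` A = \<psi> ` lspan scV S" using lspan_psi(2)[OF Sg] X(3) S(3) by simp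
  then have "A = lspan scV S" using psi_image_eq[OF assms(1) lspan_psi(1)[OF Sg]] by simp
  then show "fin_dim scV A" unfolding fin_dim_def using S(2) by (intro exI[of _ S]) simp
qed

lemma fdss_psi: assumes "A \<subseteq> g" shows "fd_semisimple scV A \<longleftrightarrow> T.fdss (\<psi> ` A)"
proof -
  have eq: "lie_ideal scV A I \<and> solvable scV I \<longleftrightarrow> T.lideal (\<psi> ` A) (\<psi> ` I) \<and> (\<exists>n. T.ders (\<psi> ` I) n = {0})"
    "I = {opzero} \<longleftrightarrow> \<psi> ` I = {0}" if "I \<subseteq> g" for I
    using lideal_psi[OF assms that] solvable_psi[OF that] psi_image_eq[OF that, of "{opzero}"] g_closed(1)
    by (simp_all add: psi_zero)
  have "(\<forall>I. lie_ideal scV A I \<and> solvable scV I \<longrightarrow> I = {opzero}) \<longleftrightarrow>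
    (\<forall>J n. T.lideal (\<psi> ` A) J \<and> T.ders J n = {0} \<longrightarrow> J = {0})" (is "?L \<longleftrightarrow> ?R")
  proof
    assume L: ?L
    show ?R
    proof (intro allI impI)
      fix J n assume J: "T.lideal (\<psi> ` A) J \<and> T.ders J n = {0}"
      then have "J \<subseteq> \<psi> ` g" using assms unfolding T.lideal_def by blast
      then have im: "\<psi> ` {x \<in> g. \<psi> x \<in> J} = J" by (rule psi_preimage)
      have "lie_ideal scV A {x \<in> g. \<psi> x \<in> J} \<and> solvable scV {x \<in> g. \<psi> x \<in> J}"
        using J by (subst eq(1)) (simp_all only: im, auto)
      then have "{x \<in> g. \<psi> x \<in> J} = {opzero}" using L by (elim allE impE)
      then show "J = {0}" using eq(2)[of "{x \<in> g. \<psi> x \<in> J}"] unfolding im by simp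
    qed
  next
    assume R: ?R
    show ?L
    proof (intro allI impI)
      fix I assume I: "lie_ideal scV A I \<and> solvable scV I"
      then have Ig: "I \<subseteq> g" using assms unfolding lie_ideal_def by blast
      then obtain n where "T.lideal (\<psi> ` A) (\<psi> ` I)" "T.ders (\<psi> ` I) n = {0}"
        using I unfolding eq(1)[OF Ig] by (elim exE conjE)
      then have "\<psi> ` I = {0}" using R[rule_format, of "\<psi> ` I" n] by blast
      then show "I = {opzero}" using eq(2)[OF Ig] by simp
    qed
  qed
  then show ?thesis
    unfolding fd_semisimple_def T.fdss_def lsub_psi[OF assms] using fin_dim_psi[OF assms] unfolding lie_subalg_def by blast
qed

lemma gen_subalg_minimal: "lie_subalg scV A \<Longrightarrow> S \<subseteq> A \<Longrightarrow> gen_subalg scV S \<subseteq> A"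
  unfolding gen_subalg_def by blast

lemma gen_subalg_superset: "S \<subseteq> gen_subalg scV S"
  unfolding gen_subalg_def by blast

lemma lie_subalg_gen: "lie_subalg scV (gen_subalg scV S)"
  unfolding gen_subalg_def lie_subalg_def lsubspace_def by blast

text \<open>The Lie subalgebra generated by finitely many elements embeds into the associative
  algebra generated by their images, which is finite-dimensional by
  \<open>T.fdim_alg\<close>.\<close>

lemma gen_subalg_fdim: assumes "finite S" "S \<subseteq> g" shows "gen_subalg scV S \<subseteq> g" "T.fdim (\<psi> ` gen_subalg scV S)"
proof -
  let ?A = "{x \<in> g. \<psi> x \<in> T.alg (\<psi> ` S)}"
  have "\<psi> ` ?A = \<psi> ` g \<inter> T.alg (\<psi> ` S)" by blast
  moreover have "T.lsub (\<psi> ` g)" using lsub_psi[of g] g_subalg by simp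
  then have "T.lsub (\<psi> ` g \<inter> T.alg (\<psi> ` S))"
    unfolding T.lsub_def using T.subspace_inter[OF _ T.subspace_alg, of "\<psi> ` g" "\<psi> ` S"]
    by (metis Int_iff T.alg_commutator)
  ultimately have "lie_subalg scV ?A" using lsub_psi[of ?A] by simp
  moreover have "S \<subseteq> ?A" using assms(2) by (auto intro: T.alg.base)
  ultimately have sub: "gen_subalg scV S \<subseteq> ?A" by (rule gen_subalg_minimal)
  then show "gen_subalg scV S \<subseteq> g" by blast
  have "\<psi> ` S \<subseteq> U.frank" using assms(2) psi_g_frank by blast
  then have "T.fdim (T.alg (\<psi> ` S))" by (rule T.fdim_alg) (simp add: T.fdim_finite assms(1))
  then show "T.fdim (\<psi> ` gen_subalg scV S)" by (rule T.fdim_subset) (use sub in blast)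
qed

text \<open>The two notions of local solvability agree because a finite-dimensional subalgebra is
  generated by a basis, and a finitely generated one is finite-dimensional.\<close>

lemma lsolv_psi:
  assumes "R \<subseteq> g" "lie_subalg scV R" shows "loc_solvable scV R \<longleftrightarrow> T.lsolv (\<psi> ` R)"
proof
  assume L: "loc_solvable scV R"
  show "T.lsolv (\<psi> ` R)" unfolding T.lsolv_def
  proof (intro allI impI, elim conjE)
    fix H assume H: "T.lsub H" "T.fdim H" "H \<subseteq> \<psi> ` R"
    have sH: "T.subspace H" using H(1) unfolding T.lsub_def by simp
    obtain X where X: "finite X" "X \<subseteq> H" "T.span X = H" using T.fdim_basis_subspace[OF H(2) sH] by (elim exE conjE)
    have "X \<subseteq> \<psi> ` R" using X(2) H(3) by (rule subset_trans)
    from finite_subset_image[OF X(1) this] obtain S where S: "S \<subseteq> R" "finite S" "X = \<psi> ` S" by (elim exE conjE)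
    have Sg: "S \<subseteq> g" using S(1) assms(1) by (rule subset_trans)
    note gen = gen_subalg_fdim(1)[OF S(2) Sg]
    have "H \<subseteq> \<psi> ` gen_subalg scV S" unfolding X(3)[symmetric] S(3)
      by (rule T.span_minimal[OF image_mono[OF gen_subalg_superset]])
        (use lie_subalg_gen[of S] subspace_psi[OF gen] in \<open>simp add: lie_subalg_def\<close>)
    moreover have "\<psi> ` gen_subalg scV S \<subseteq> H"
    proof -
      have "H \<subseteq> \<psi> ` g" using H(3) assms(1) by blast
      then have im: "\<psi> ` {x \<in> g. \<psi> x \<in> H} = H" by (rule psi_preimage)
      then have "lie_subalg scV {x \<in> g. \<psi> x \<in> H}" using lsub_psi[of "{x \<in> g. \<psi> x \<in> H}"] H(1) by simp
      moreover have "S \<subseteq> {x \<in> g. \<psi> x \<in> H}" using Sg X(2) S(3) by blast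
      ultimately have "gen_subalg scV S \<subseteq> {x \<in> g. \<psi> x \<in> H}" by (rule gen_subalg_minimal)
      then show ?thesis by blast
    qed
    ultimately have "H = \<psi> ` gen_subalg scV S" by (rule subset_antisym)
    moreover have "solvable scV (gen_subalg scV S)" using L S(1,2) unfolding loc_solvable_def by simp
    ultimately show "\<exists>n. T.ders H n = {0}" using solvable_psi[OF gen] by simp
  qed
next
  assume R: "T.lsolv (\<psi> ` R)"
  show "loc_solvable scV R" unfolding loc_solvable_def
  proof (intro allI impI, elim conjE)
    fix S assume S: "finite S" "S \<subseteq> R"
    have Sg: "S \<subseteq> g" using S(2) assms(1) by (rule subset_trans)
    note gen = gen_subalg_fdim[OF S(1) Sg]
    have "T.lsub (\<psi> ` gen_subalg scV S)" using lsub_psi[OF gen(1)] lie_subalg_gen by simp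
    moreover have "\<psi> ` gen_subalg scV S \<subseteq> \<psi> ` R" by (rule image_mono[OF gen_subalg_minimal[OF assms(2) S(2)]])
    ultimately show "solvable scV (gen_subalg scV S)"
      using R gen(2) solvable_psi[OF gen(1)] unfolding T.lsolv_def by simp
  qed
qed

text \<open>Maximality is tested against ideals of the image of \<open>g\<close>; each is the image
  of its preimage in \<open>g\<close>, to which the maximality of \<open>R\<close> applies.\<close>

lemma radical_psi: assumes "loc_solv_radical scV g R" shows "T.radical (\<psi> ` g) (\<psi> ` R)"
proof -
  have R: "lie_ideal scV g R" "loc_solvable scV R" "\<And>I. lie_ideal scV g I \<Longrightarrow> loc_solvable scV I \<Longrightarrow> I \<subseteq> R"
    using assms unfolding loc_solv_radical_def by simp_all
  have sub: "lie_ideal scV g I \<Longrightarrow> I \<subseteq> g" for I unfolding lie_ideal_def by simp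
  have alg: "lie_ideal scV g I \<Longrightarrow> lie_subalg scV I" for I unfolding lie_ideal_def lie_subalg_def by blast
  show ?thesis unfolding T.radical_def
  proof (intro conjI allI impI; (elim conjE)?)
    show "T.lideal (\<psi> ` g) (\<psi> ` R)" using lideal_psi[OF subset_refl sub[OF R(1)]] R(1) by simp
    show "T.lsolv (\<psi> ` R)" using lsolv_psi[OF sub alg] R(1,2) by simp
    fix J assume J: "T.lideal (\<psi> ` g) J" "T.lsolv J"
    let ?I = "{x \<in> g. \<psi> x \<in> J}"
    have "J \<subseteq> \<psi> ` g" using J(1) unfolding T.lideal_def by simp
    then have im: "\<psi> ` ?I = J" by (rule psi_preimage)
    have I: "lie_ideal scV g ?I" using lideal_psi[of g ?I, unfolded im] J(1) by simp
    have "loc_solvable scV ?I" using lsolv_psi[OF sub[OF I] alg[OF I], unfolded im] J(2) by simp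
    then have "?I \<subseteq> R" by (rule R(3)[OF I])
    then show "J \<subseteq> \<psi> ` R" using im by blast
  qed
qed

lemma levi_psi:
  assumes "levi_component scV g M"
  shows "\<exists>R. T.radical (\<psi> ` g) R \<and> T.levi (\<psi> ` g) R (\<psi> ` M)" "M \<subseteq> g" "lie_subalg scV M"
proof -
  show M: "M \<subseteq> g" "lie_subalg scV M" using assms unfolding levi_component_def by simp_all
  obtain R where R: "loc_solv_radical scV g R" "{opadd r m | r m. r \<in> R \<inter> brk scV g g \<and> m \<in> M} = brk scV g g"
    "R \<inter> brk scV g g \<inter> M = {opzero}"
    using assms unfolding levi_component_def by (elim exE conjE)
  have Rg: "R \<subseteq> g" using R(1) unfolding loc_solv_radical_def lie_ideal_def by simp
  note b = brk_psi[OF subset_refl]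
  have int: "\<psi> ` (R \<inter> brk scV g g) = \<psi> ` R \<inter> T.lder (\<psi> ` g)"
    using inj_on_image_Int[OF inj_psi Rg b(1)] b(2) by simp
  have RB: "R \<inter> brk scV g g \<subseteq> g" using Rg by (rule le_infI1)
  have "\<psi> ` (R \<inter> brk scV g g \<inter> M) = \<psi> ` R \<inter> T.lder (\<psi> ` g) \<inter> \<psi> ` M"
    unfolding inj_on_image_Int[OF inj_psi RB M(1)] int by (rule refl)
  then have i2: "\<psi> ` R \<inter> T.lder (\<psi> ` g) \<inter> \<psi> ` M = {0}" using R(3) by (simp add: psi_zero)
  have "\<psi> ` {opadd r m | r m. r \<in> R \<inter> brk scV g g \<and> m \<in> M} =
    {r + m | r m. r \<in> \<psi> ` (R \<inter> brk scV g g) \<and> m \<in> \<psi> ` M}" (is "_ ` ?X = ?Y")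
  proof
    show "\<psi> ` ?X \<subseteq> ?Y"
    proof (rule image_subsetI)
      fix x assume "x \<in> ?X"
      then obtain r m where rm: "x = opadd r m" "r \<in> R \<inter> brk scV g g" "m \<in> M" by blast
      have "\<psi> x = \<psi> r + \<psi> m" unfolding rm(1) by (rule psi_add[OF subsetD[OF RB rm(2)] subsetD[OF M(1) rm(3)]])
      then show "\<psi> x \<in> ?Y" using rm(2,3) by blast
    qed
    show "?Y \<subseteq> \<psi> ` ?X"
    proof
      fix y assume "y \<in> ?Y"
      then obtain r m where rm: "y = \<psi> r + \<psi> m" "r \<in> R \<inter> brk scV g g" "m \<in> M" by blast
      have "y = \<psi> (opadd r m)"
        unfolding rm(1) by (rule psi_add[OF subsetD[OF RB rm(2)] subsetD[OF M(1) rm(3)], symmetric])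
      then show "y \<in> \<psi> ` ?X" using rm(2,3) by (intro image_eqI) auto
    qed
  qed
  then have "{r + m | r m. r \<in> \<psi> ` R \<inter> T.lder (\<psi> ` g) \<and> m \<in> \<psi> ` M} = T.lder (\<psi> ` g)"
    unfolding int R(2) b(2) by (rule sym)
  then have "T.levi (\<psi> ` g) (\<psi> ` R) (\<psi> ` M)" 
    unfolding T.levi_def using iffD2[OF lsub_psi[OF M(1)] M(2)] i2 by (intro conjI)
  then show "\<exists>R. T.radical (\<psi> ` g) R \<and> T.levi (\<psi> ` g) R (\<psi> ` M)"
    using radical_psi[OF R(1)] by (intro exI[of _ "\<psi> ` R"] conjI)
qed

lemma skew_adjoint_psi:
  assumes "T.radical (\<psi> ` g) R" shows "skew_adjoint_algebra (smul sc2) U.frank U.tr (\<psi> ` g) R star"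
proof unfold_locales
  let ?A = "T.alg (\<psi> ` g)"
  have Q: "a \<in> ?A \<Longrightarrow> a \<in> qrank" for a using alg_qrank by blast
  note sA = T.subspace_alg[of "\<psi> ` g"]
  show "\<psi> ` g \<subseteq> U.frank" by (rule psi_g_frank)
  show "T.lsub (\<psi> ` g)" using lsub_psi[of g] g_subalg by simp
  show "T.radical (\<psi> ` g) R" by (rule assms)
  fix a assume a: "a \<in> ?A"
  show sa: "star a \<in> ?A" by (rule star_alg[OF a])
  show "star (smul sc2 c a) = smul sc2 c (star a)" for c
    by (rule star_eqI[OF Q[OF T.subspace_scale[OF sA a]] adj_scale[OF star(2)[OF Q[OF a]]]])
  show "star (star a) = a" by (rule star_eqI[OF Q[OF sa] adj_sym[OF star(2)[OF Q[OF a]]]])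
  show "U.tr (star a) = U.tr a" by (rule star(3)[OF Q[OF a]])
  fix b assume b: "b \<in> ?A"
  show "star (a + b) = star a + star b"
    by (rule star_eqI[OF Q[OF T.subspace_add[OF sA a b]] adj_add[OF star(2)[OF Q[OF a]] star(2)[OF Q[OF b]]]])
  show "star (a * b) = star b * star a"
    by (rule star_eqI[OF Q[OF T.alg_mult[OF a b]] adj_mult[OF star(2)[OF Q[OF a]] star(2)[OF Q[OF b]]]])
next
  fix x assume "x \<in> \<psi> ` g"
  then obtain y where y: "y \<in> g" "x = \<psi> y" by blast
  show "star x = - x" unfolding y(2) by (rule star_eqI[OF psi_qrank[OF g_glVV[OF y(1)]] psi_adjoint[OF y(1)]])
qed

lemma levi_max_loc_semisimple:
  assumes "count_inf_dim scV" "count_inf_dim scW" and M: "levi_component scV g M"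
  shows "max_loc_semisimple scV g M"
proof -
  obtain R where R: "T.radical (\<psi> ` g) R" "T.levi (\<psi> ` g) R (\<psi> ` M)"
    using levi_psi(1)[OF M] by (elim exE conjE)
  note Mg = levi_psi(2,3)[OF M]
  interpret S: skew_adjoint_algebra "smul sc2" U.frank U.tr "\<psi> ` g" R star by (rule skew_adjoint_psi[OF R(1)])
  obtain C where C: "countable C" "qrank \<subseteq> T.span C" using countable_qrank[OF assms(1,2)] by (elim exE conjE)
  have "\<psi> ` M \<subseteq> qrank" using psi_qrank g_glVV Mg(1) by blast
  then have "\<psi> ` M \<subseteq> T.span C" using C(2) by (rule subset_trans)
  from S.levi_exhaustion[OF R(2) C(1) this]
  obtain K :: "nat \<Rightarrow> ('v \<times> 'w) aend set" where K: "\<forall>n. K n \<subseteq> K (Suc n)" "\<forall>n. T.fdss (K n)" "\<psi> ` M = \<Union>(range K)"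
    by (elim exE conjE)
  \<comment> \<open>The exhaustion found among operators on pairs, pulled back to
    \<open>g\<close>.\<close>
  define H where "H n = {x \<in> g. \<psi> x \<in> K n}" for n
  have Hg: "H n \<subseteq> g" for n unfolding H_def by simp
  have Kg: "K n \<subseteq> \<psi> ` g" for n using K(3) Mg(1) by blast
  have im: "\<psi> ` H n = K n" for n unfolding H_def by (rule psi_preimage[OF Kg])
  have "\<forall>n. H n \<subseteq> H (Suc n)" unfolding H_def using K(1) by blast
  moreover have "\<forall>n. fd_semisimple scV (H n)" using fdss_psi[OF Hg] im K(2) by simp
  moreover have "M = \<Union>(range H)"
  proof -
    have "\<psi> ` \<Union>(range H) = \<psi> ` M" unfolding K(3) image_Union using im by (simp add: image_image)
    moreover have "\<Union>(range H) \<subseteq> g" using Hg by blast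
    ultimately have "\<Union>(range H) = M" using psi_image_eq[OF _ Mg(1)] by simp
    then show ?thesis by (rule sym)
  qed
  ultimately have "loc_semisimple scV M" unfolding loc_semisimple_def by (intro exI[of _ H]) simp
  moreover have "N = M" if N: "N \<subseteq> g" "lie_subalg scV N" "loc_semisimple scV N" "M \<subseteq> N" for N
  proof -
    obtain E :: "nat \<Rightarrow> ('v \<Rightarrow> 'v) set" where E: "\<forall>n. fd_semisimple scV (E n)" "N = \<Union>(range E)"
      using N(3) unfolding loc_semisimple_def by (elim exE conjE)
    have Eg: "E n \<subseteq> g" for n using E(2) N(1) by blast
    have "\<psi> ` N = \<psi> ` M"
    proof (rule S.levi_maximal[OF R(2), where K = "\<lambda>n. \<psi> ` E n"])
      show "T.lsub (\<psi> ` N)" using lsub_psi[OF N(1)] N(2) by simp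
      show "\<psi> ` N \<subseteq> \<psi> ` g" by (rule image_mono[OF N(1)])
      show "\<psi> ` M \<subseteq> \<psi> ` N" by (rule image_mono[OF N(4)])
      show "T.fdss (\<psi> ` E n)" for n using fdss_psi[OF Eg] E(1) by simp
      show "\<psi> ` N = (\<Union>n. \<psi> ` E n)" unfolding E(2) by blast
    qed
    then show ?thesis using psi_image_eq[OF N(1) Mg(1)] by simp
  qed
  ultimately show ?thesis unfolding max_loc_semisimple_def using Mg by blast
qed

lemma levi_isomorphic:
  assumes M: "levi_component scV g M1" "levi_component scV g M2"
  shows "lie_isomorphic scV M1 M2"
proof -
  obtain R R' where R: "T.radical (\<psi> ` g) R" "T.levi (\<psi> ` g) R (\<psi> ` M1)"
    and R': "T.radical (\<psi> ` g) R'" "T.levi (\<psi> ` g) R' (\<psi> ` M2)"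
    using levi_psi(1)[OF M(1)] levi_psi(1)[OF M(2)] by (elim exE conjE)
  have "T.levi (\<psi> ` g) R (\<psi> ` M2)" using R'(2) T.radical_unique[OF R(1) R'(1)] by simp
  moreover have "T.lsub (\<psi> ` g)" using lsub_psi[of g] g_subalg by simp
  moreover have "\<psi> ` g \<subseteq> T.homog" using psi_g_frank T.F_homog by (rule subset_trans)
  ultimately have "\<exists>\<phi>. bij_betw \<phi> (\<psi> ` M1) (\<psi> ` M2) \<and>
    (\<forall>x\<in>\<psi> ` M1. \<forall>y\<in>\<psi> ` M1. \<phi> (x + y) = \<phi> x + \<phi> y \<and> \<phi> (commutator x y) = commutator (\<phi> x) (\<phi> y)) \<and>
    (\<forall>c. \<forall>x\<in>\<psi> ` M1. \<phi> (smul sc2 c x) = smul sc2 c (\<phi> x))"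
    using R(1,2) by (intro T.levi_isomorphism)
  then obtain \<phi> where \<phi>: "bij_betw \<phi> (\<psi> ` M1) (\<psi> ` M2)"
    "\<forall>x\<in>\<psi> ` M1. \<forall>y\<in>\<psi> ` M1. \<phi> (x + y) = \<phi> x + \<phi> y \<and> \<phi> (commutator x y) = commutator (\<phi> x) (\<phi> y)"
    "\<forall>c. \<forall>x\<in>\<psi> ` M1. \<phi> (smul sc2 c x) = smul sc2 c (\<phi> x)"
    by (elim exE conjE)
  define f where "f x = inv_into M2 \<psi> (\<phi> (\<psi> x))" for x
  note g1 = levi_psi(2,3)[OF M(1)] and g2 = levi_psi(2,3)[OF M(2)]
  have b1: "bij_betw \<psi> M1 (\<psi> ` M1)" and b2: "bij_betw \<psi> M2 (\<psi> ` M2)"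
    using inj_on_subset[OF inj_psi g1(1)] inj_on_subset[OF inj_psi g2(1)] by (simp_all add: bij_betw_def)
  have "bij_betw (inv_into M2 \<psi> \<circ> (\<phi> \<circ> \<psi>)) M1 M2"
    by (rule bij_betw_trans[OF bij_betw_trans[OF b1 \<phi>(1)] bij_betw_inv_into[OF b2]])
  then have bij: "bij_betw f M1 M2" unfolding f_def comp_def .
  have f: "f x \<in> M2" "\<psi> (f x) = \<phi> (\<psi> x)" if x: "x \<in> M1" for x
  proof -
    show "f x \<in> M2" using bij_betw_apply[OF bij x] .
    have "\<phi> (\<psi> x) \<in> \<psi> ` M2" using bij_betw_apply[OF \<phi>(1)] x by blast
    then show "\<psi> (f x) = \<phi> (\<psi> x)" unfolding f_def by (rule f_inv_into_f)
  qed
  have m1: "x \<in> M1 \<Longrightarrow> x \<in> g" for x using g1(1) by (rule subsetD)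
  have m2: "x \<in> M2 \<Longrightarrow> x \<in> g" for x using g2(1) by (rule subsetD)
  have c: "x \<in> N \<Longrightarrow> y \<in> N \<Longrightarrow> opadd x y \<in> N" "x \<in> N \<Longrightarrow> opsc scV k x \<in> N" "x \<in> N \<Longrightarrow> y \<in> N \<Longrightarrow> lbr x y \<in> N"
    if "lie_subalg scV N" for N x y k using that unfolding lie_subalg_def lsubspace_def by simp_all
  have eqI: "u = v" if "u \<in> M2" "v \<in> M2" "\<psi> u = \<psi> v" for u v
    using inj_onD[OF inj_psi, of u v] m2 that by simp
  have "f (opadd x y) = opadd (f x) (f y)" if xy: "x \<in> M1" "y \<in> M1" for x y
    by (rule eqI) (simp_all add: f xy c[OF g1(2)] c[OF g2(2)] psi_add m1 m2 \<phi>(2))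
  moreover have "f (lbr x y) = lbr (f x) (f y)" if xy: "x \<in> M1" "y \<in> M1" for x y
    by (rule eqI) (simp_all add: f xy c[OF g1(2)] c[OF g2(2)] psi_lbr m1 m2 \<phi>(2))
  moreover have "f (opsc scV k x) = opsc scV k (f x)" if x: "x \<in> M1" for x k
    by (rule eqI) (simp_all add: f x c[OF g1(2)] c[OF g2(2)] psi_scale m1 m2 \<phi>(3))
  ultimately show ?thesis unfolding lie_isomorphic_def using bij by (intro exI[of _ f]) simp
qed

end

theorem theorem4p3:
  fixes scV :: "complex \<Rightarrow> 'v::ab_group_add \<Rightarrow> 'v"
    and scW :: "complex \<Rightarrow> 'w::ab_group_add \<Rightarrow> 'w"
    and p :: "'v \<Rightarrow> 'w \<Rightarrow> complex"
    and g :: "('v \<Rightarrow> 'v) set"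
  assumes "vector_space scV" and "vector_space scW"
    and "count_inf_dim scV" and "count_inf_dim scW"
    and "nondeg_pairing scV scW p"
    and "lie_subalg scV g" and "g \<subseteq> glVV scV p"
  shows "(\<forall>M. levi_component scV g M \<longrightarrow> max_loc_semisimple scV g M) \<and>
         (\<forall>M1 M2. levi_component scV g M1 \<and> levi_component scV g M2 \<longrightarrow>
            lie_isomorphic scV M1 M2)"
proof -
  interpret gl_subalgebra scV scW p g
    using assms by (intro gl_subalgebra.intro gl_subalgebra_axioms.intro)
  show ?thesis using levi_max_loc_semisimple[OF assms(3,4)] levi_isomorphic by blast
qed

end
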